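(* Let $G$ be a finite group and $p$ a fixed prime divisor of $|G|$. Then every non-nilpotent subgroup of $G$ is a TI-subgroup of $G$ or subnormal in $G$ or has $p'$-order if and only if one of the following statements holds: (1) every non-nilpotent subgroup of $G$ of order divisible by $p$ is subnormal in $G$; (2) $p>2$ and $G=(Z_q)^r\rtimes(Z_p\rtimes H)$ is a Frobenius group with kernel $(Z_q)^r$ and complement $Z_p\rtimes H$, where $q$ is a prime with $q\neq p$ and $r>1$, $Z_p$ is a Sylow $p$-subgroup of $G$, $H$ is either a cyclic group or a direct product of the quaternion group $Q_8$ and a cyclic group of odd order such that $[Z_p,H]\neq 1$, and $Z_p$ acts irreducibly (by conjugation) on $(Z_q)^r$.
   Context: All groups are finite. A subgroup $H$ of a group $G$ is a TI-subgroup of $G$ if for every $g\in G$, $H^g\cap H=1$ or $H^g\cap H=H$. A subgroup has $p'$-order if its order is not divisible by $p$. $Z_n$ denotes the cyclic group of order $n$, $(Z_q)^r$ the elementary abelian group of order $q^r$, and $Q_8$ the quaternion group of order $8$. *)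

theory Defs
  imports "HOL-Algebra.Algebra" "HOL-Computational_Algebra.Primes"
begin

definition conj_set :: "('a, 'b) monoid_scheme \<Rightarrow> 'a set \<Rightarrow> 'a \<Rightarrow> 'a set" where
  "conj_set G H g = (\<lambda>h. inv\<^bsub>G\<^esub> g \<otimes>\<^bsub>G\<^esub> h \<otimes>\<^bsub>G\<^esub> g) ` H"

definition TI_subgroup :: "('a, 'b) monoid_scheme \<Rightarrow> 'a set \<Rightarrow> bool" where
  "TI_subgroup G H \<longleftrightarrow> subgroup H G \<and>
     (\<forall>g \<in> carrier G. conj_set G H g \<inter> H = {\<one>\<^bsub>G\<^esub>} \<or> conj_set G H g \<inter> H = H)"

definition commutator_subgroup :: "('a, 'b) monoid_scheme \<Rightarrow> 'a set \<Rightarrow> 'a set \<Rightarrow> 'a set" where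
  "commutator_subgroup G A B =
     generate G (\<Union>a \<in> A. \<Union>b \<in> B. {a \<otimes>\<^bsub>G\<^esub> b \<otimes>\<^bsub>G\<^esub> inv\<^bsub>G\<^esub> a \<otimes>\<^bsub>G\<^esub> inv\<^bsub>G\<^esub> b})"

definition nilpotent_group :: "('a, 'b) monoid_scheme \<Rightarrow> bool" where
  "nilpotent_group G \<longleftrightarrow>
     (\<exists>n. compow n (\<lambda>S. commutator_subgroup G S (carrier G)) (carrier G) = {\<one>\<^bsub>G\<^esub>})"

inductive subnormal :: "('a, 'b) monoid_scheme \<Rightarrow> 'a set \<Rightarrow> bool" for G where
  top: "subnormal G (carrier G)"
| step: "subnormal G K \<Longrightarrow> H \<lhd> G\<lparr>carrier := K\<rparr> \<Longrightarrow> subnormal G H"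

definition sylow_subgroup :: "('a, 'b) monoid_scheme \<Rightarrow> nat \<Rightarrow> 'a set \<Rightarrow> bool" where
  "sylow_subgroup G p P \<longleftrightarrow> subgroup P G \<and> card P = p ^ multiplicity p (order G)"

definition frobenius_group_with :: "('a, 'b) monoid_scheme \<Rightarrow> 'a set \<Rightarrow> 'a set \<Rightarrow> bool" where
  "frobenius_group_with G K C \<longleftrightarrow>
     subgroup C G \<and> C \<noteq> {\<one>\<^bsub>G\<^esub>} \<and> C \<noteq> carrier G \<and>
     (\<forall>g \<in> carrier G - C. C \<inter> conj_set G C g = {\<one>\<^bsub>G\<^esub>}) \<and>
     K = (carrier G - (\<Union>g \<in> carrier G. conj_set G C g)) \<union> {\<one>\<^bsub>G\<^esub>}"

definition int_semidirect :: "('a, 'b) monoid_scheme \<Rightarrow> 'a set \<Rightarrow> 'a set \<Rightarrow> 'a set \<Rightarrow> bool" where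
  "int_semidirect G N A Y \<longleftrightarrow>
     subgroup Y G \<and> subgroup A G \<and> N \<lhd> G\<lparr>carrier := Y\<rparr> \<and> A \<subseteq> Y \<and>
     N \<inter> A = {\<one>\<^bsub>G\<^esub>} \<and> N <#>\<^bsub>G\<^esub> A = Y"

definition int_direct :: "('a, 'b) monoid_scheme \<Rightarrow> 'a set \<Rightarrow> 'a set \<Rightarrow> 'a set \<Rightarrow> bool" where
  "int_direct G A B Y \<longleftrightarrow>
     subgroup Y G \<and> A \<lhd> G\<lparr>carrier := Y\<rparr> \<and> B \<lhd> G\<lparr>carrier := Y\<rparr> \<and>
     A \<inter> B = {\<one>\<^bsub>G\<^esub>} \<and> A <#>\<^bsub>G\<^esub> B = Y"

text \<open>The quaternion group Q_8 = {\<plusminus>1, \<plusminus>i, \<plusminus>j, \<plusminus>k}: element (s, u) is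
  (-1)^s times the unit u, with u = 0,1,2,3 standing for 1, i, j, k.\<close>
definition q8_unit_mult :: "nat \<Rightarrow> nat \<Rightarrow> bool \<times> nat" where
  "q8_unit_mult a b =
     (if a = 0 then (False, b)
      else if b = 0 then (False, a)
      else if a = b then (True, 0)
      else ((a, b) \<notin> {(1, 2), (2, 3), (3, 1)}, 6 - a - b))"

definition Q8_group :: "(bool \<times> nat) monoid" where
  "Q8_group = \<lparr>carrier = UNIV \<times> {..<4},
     monoid.mult = (\<lambda>(s, a) (t, b). (case q8_unit_mult a b of (u, c) \<Rightarrow> ((s \<noteq> t) \<noteq> u, c))),
     one = (False, 0)\<rparr>"

abbreviation elem_abelian_group :: "nat \<Rightarrow> nat \<Rightarrow> (nat \<Rightarrow> int) monoid" where
  "elem_abelian_group q r \<equiv> product_group {..<r} (\<lambda>_. integer_mod_group q)"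

definition acts_irreducibly :: "('a, 'b) monoid_scheme \<Rightarrow> 'a set \<Rightarrow> 'a set \<Rightarrow> bool" where
  "acts_irreducibly G A K \<longleftrightarrow> K \<noteq> {\<one>\<^bsub>G\<^esub>} \<and>
     (\<forall>N. subgroup N G \<and> N \<subseteq> K \<and> (\<forall>a \<in> A. conj_set G N a = N) \<longrightarrow>
          N = {\<one>\<^bsub>G\<^esub>} \<or> N = K)"

end

theory Submission
  imports Defs "HOL-Combinatorics.Perm" "HOL-Number_Theory.Cong"
begin

text \<open>
  Assume that every non-nilpotent subgroup of order divisible by \<open>p\<close> is TI or subnormal, and that some
  such subgroup is not subnormal. A maximal one, \<open>M\<close>, is a self-normalizing TI-subgroup, so that
  \<open>M\<close> is a Frobenius complement, and by counting a maximal subgroup. Transfer shows that a perfect group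
  does not satisfy the hypothesis; hence \<open>M\<close> is soluble and Frobenius' theorem follows by transfer as well.
  The kernel \<open>K\<close> is a minimal normal subgroup and elementary abelian. Since \<open>M\<close> acts without fixed
  points on \<open>K\<close>, it has no subgroup of type \<open>(a, a)\<close>; as \<open>K \<bullet> T\<close> is subnormal for every
  \<open>T \<subseteq> M\<close> of order divisible by \<open>p\<close>, so is \<open>T\<close> in \<open>M\<close>, which makes the subgroup \<open>P\<close> of order \<open>p\<close>
  normal and Sylow. A complement \<open>H\<close> of \<open>P\<close> in \<open>M\<close> is generated by elements that do not
  centralize \<open>P\<close>, each of which generates a normal subgroup of \<open>H\<close>; this forces \<open>H\<close> to be cyclic or the product of \<open>Q\<^sub>8\<close> and a
  cyclic group of odd order. Conversely, a subgroup of order divisible by \<open>p\<close> contains, up to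
  conjugation, \<open>P\<close>, so by irreducibility it either contains \<open>K\<close> or meets it trivially.

  The group theory is done for finite subgroups of a group type, which avoids
  carriers; Cayley's embedding reaches an arbitrary \<open>G\<close>.\<close>

section \<open>Finite subgroups of a group\<close>

text \<open>Two classical theorems are avoided: Frobenius' theorem for arbitrary complements, which
  needs characters, and Thompson's theorem on the kernel. The first is proved only for a soluble
  complement, whose solubility is not given in advance; it comes from an induction on the order,
  since \<open>M\<close> inherits the hypothesis. The obstacle there is that the hypothesis says
  nothing about subgroups of order prime to \<open>p\<close>. For a perfect subgroup of such order,
  a group \<open>P\<close> of order \<open>p\<close> acts on it, a perfect \<open>Z\<close>
  centralized by \<open>P\<close> is found, and \<open>T \<bullet> P\<close> is tested in place of
  \<open>T \<subseteq> Z\<close>. Thompson's theorem is replaced by a \<open>P\<close>-invariant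
  Sylow \<open>r\<close>-subgroup \<open>R\<close> of \<open>K\<close>: if \<open>K\<close> is not
  an \<open>r\<close>-group, the TI alternative makes \<open>R\<close> a Frobenius complement of
  \<open>K\<close>, whose kernel contradicts the minimality of \<open>K\<close>. The bounds
  \<open>p > 2\<close> and \<open>r > 1\<close> both reflect that some element of \<open>M\<close>
  does not commute with \<open>P\<close>: a group of order 2 has no non-trivial automorphism, and
  the automorphisms of a group of prime order commute.\<close>

class group_mult = monoid_mult + inverse +
  assumes left_inv [simp]: "inverse x * x = 1"

hide_const (open) Perm.order Perm.orbit Divisibility.prime
no_notation var (\<open>X\<index>\<close>)
notation inverse (\<open>_\<^sup>-\<close> [1000] 1000)

section \<open>Calculation with inverses, conjugates and commutators\<close>

lemma inv_mult_cancel [simp]: "x\<^sup>- * (x * y) = y" for x :: "'g::group_mult"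
  by (simp flip: mult.assoc)

lemma right_inv [simp]: "x * x\<^sup>- = 1" for x :: "'g::group_mult"
proof -
  have "x * x\<^sup>- = x\<^sup>-\<^sup>- * (x\<^sup>- * (x * x\<^sup>-))" by (rule inv_mult_cancel [symmetric])
  also have "\<dots> = 1" by simp
  finally show ?thesis .
qed

lemma mult_inv_cancel [simp]: "x * (x\<^sup>- * y) = y" for x :: "'g::group_mult"
  by (simp flip: mult.assoc)

lemma mult_left_cancel_group [simp]: "x * y = x * z \<longleftrightarrow> y = z" for x :: "'g::group_mult"
  by (metis inv_mult_cancel)

lemma mult_right_cancel_group [simp]: "y * x = z * x \<longleftrightarrow> y = z" for x :: "'g::group_mult"
  by (metis mult.assoc mult_1_right right_inv)

lemma mult_eq_self_iff [simp]: "x * y = x \<longleftrightarrow> y = 1" "y * x = x \<longleftrightarrow> y = 1" for x :: "'g::group_mult"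
  by (metis mult_left_cancel_group mult_1_right, metis mult_right_cancel_group mult_1_left)

lemma inv_eqI: "x * y = 1 \<Longrightarrow> y = x\<^sup>-" for x :: "'g::group_mult"
  by (metis inv_mult_cancel mult_1_right)

lemma inverse_inv [simp]: "x\<^sup>-\<^sup>- = x" for x :: "'g::group_mult"
  by (metis inv_eqI left_inv)

lemma inverse_1 [simp]: "(1::'g::group_mult)\<^sup>- = 1"
  by (metis inv_eqI mult_1_left)

lemma inverse_mult: "(x * y)\<^sup>- = y\<^sup>- * x\<^sup>-" for x :: "'g::group_mult"
  by (rule inv_eqI [symmetric]) (simp add: mult.assoc)

lemma inv_eq_iff [simp]: "x\<^sup>- = y\<^sup>- \<longleftrightarrow> x = y" for x :: "'g::group_mult"
  by (metis inverse_inv)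

lemma inv_power: "(x ^ n)\<^sup>- = x\<^sup>- ^ n" for x :: "'g::group_mult"
  by (induction n) (simp_all add: inverse_mult flip: power_Suc2)

lemmas gsimps = mult.assoc inverse_mult

text \<open>A left action: \<open>cj g (cj h x)\<close> is \<open>cj (g * h) x\<close>. The
  operation \<open>conj_set\<close> conjugates by the inverse, which makes no difference once all
  \<open>g\<close> are considered.\<close>

definition cj :: "'g::group_mult \<Rightarrow> 'g \<Rightarrow> 'g" where
  "cj g x = g * x * g\<^sup>-"

lemma cj_mult: "cj g (x * y) = cj g x * cj g y"
  by (simp add: cj_def gsimps)

lemma cj_cj [simp]: "cj g (cj h x) = cj (g * h) x"
  by (simp add: cj_def gsimps)

lemma cj_one [simp]: "cj 1 x = x" "cj g 1 = 1"
  by (simp_all add: cj_def)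

lemma cj_inv: "cj g (x\<^sup>-) = (cj g x)\<^sup>-"
  by (simp add: cj_def gsimps)

lemma cj_power: "cj g (x ^ n) = cj g x ^ n"
  by (induction n) (simp_all add: cj_mult)

lemma cj_eq_iff [simp]: "cj g x = cj g y \<longleftrightarrow> x = y"
  by (simp add: cj_def)

lemma cj_eq_one_iff [simp]: "cj g x = 1 \<longleftrightarrow> x = 1"
  by (metis cj_eq_iff cj_one(2))

lemma inj_cj: "inj_on (cj g) A"
  by (simp add: inj_on_def)

lemma cj_image_cj [simp]: "cj g ` cj h ` A = cj (g * h) ` A"
  by (simp add: image_image)

lemma cj_image_one [simp]: "cj 1 ` A = A"
  by simp

lemma card_cj [simp]: "card (cj g ` A) = card A"
  by (simp add: card_image inj_cj)

lemma cj_eq_self_iff: "cj g x = x \<longleftrightarrow> g * x = x * g"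
proof -
  have "cj g x = x \<longleftrightarrow> cj g x * g = x * g" by simp
  then show ?thesis by (simp add: cj_def mult.assoc)
qed

lemma mem_cj_image: "x \<in> cj g ` A \<longleftrightarrow> cj (g\<^sup>-) x \<in> A"
proof
  assume "cj (g\<^sup>-) x \<in> A"
  then have "cj g (cj (g\<^sup>-) x) \<in> cj g ` A" by blast
  then show "x \<in> cj g ` A" by simp
qed auto

definition cm :: "'g::group_mult \<Rightarrow> 'g \<Rightarrow> 'g" where
  "cm x y = x * y * x\<^sup>- * y\<^sup>-"

lemma cm_eq_one_iff: "cm x y = 1 \<longleftrightarrow> x * y = y * x"
proof -
  have "cm x y = 1 \<longleftrightarrow> cm x y * (y * x) = 1 * (y * x)" by (metis mult_right_cancel_group)
  then show ?thesis by (simp add: cm_def mult.assoc)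
qed

lemma cm_cj: "cm x y = x * cj y (x\<^sup>-)" "cm x y = cj x y * y\<^sup>-"
  by (simp_all add: cm_def cj_def mult.assoc)

lemma cj_cm: "cj g (cm x y) = cm (cj g x) (cj g y)"
  by (simp add: cm_def cj_mult cj_inv)

lemma inv_cm: "(cm x y)\<^sup>- = cm y x"
  by (simp add: cm_def gsimps)

lemma cm_mult_left: "cm (x * y) z = cj x (cm y z) * cm x z"
  by (simp add: cm_def cj_def gsimps)

lemma cm_one [simp]: "cm 1 x = 1" "cm x 1 = 1"
  by (simp_all add: cm_def)

text \<open>Closure under inverses follows from finiteness (\<open>sg_inv\<close>), which reduces
  every later subgroup check to closure under products. Finiteness is part of the notion because the
  ambient type may be infinite.\<close>

definition sg :: "'g::group_mult set \<Rightarrow> bool" where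
  "sg H \<longleftrightarrow> finite H \<and> 1 \<in> H \<and> (\<forall>x\<in>H. \<forall>y\<in>H. x * y \<in> H)"

lemma sg_finite: "sg H \<Longrightarrow> finite H" and sg_one: "sg H \<Longrightarrow> 1 \<in> H"
  and sg_mult: "sg H \<Longrightarrow> x \<in> H \<Longrightarrow> y \<in> H \<Longrightarrow> x * y \<in> H"
  by (simp_all add: sg_def)

lemma sg_power: "sg H \<Longrightarrow> x \<in> H \<Longrightarrow> x ^ n \<in> H"
  by (induction n) (simp_all add: sg_def)

lemma ex_power_eq_one: assumes "sg H" "x \<in> H" shows "\<exists>n>0. x ^ n = 1"
proof -
  have "range (\<lambda>n::nat. x ^ n) \<subseteq> H" using assms sg_power by blast
  then have "finite (range (\<lambda>n::nat. x ^ n))" using assms sg_finite finite_subset by blast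
  then have "\<not> inj (\<lambda>n::nat. x ^ n)" using finite_imageD by blast
  then obtain i j :: nat where "x ^ i = x ^ j" "i < j" by (metis injI linorder_neqE_nat)
  then have "x ^ i * x ^ (j - i) = x ^ i * 1" by (metis le_add_diff_inverse less_imp_le mult_1_right power_add)
  then show ?thesis using \<open>i < j\<close> by (intro exI[of _ "j - i"]) simp
qed

lemma sg_inv: assumes "sg H" "x \<in> H" shows "x\<^sup>- \<in> H"
proof -
  obtain n where "n > 0" "x ^ n = 1" using ex_power_eq_one[OF assms] by blast
  then have "x * x ^ (n - 1) = 1" by (simp add: power_eq_if)
  then show ?thesis using inv_eqI sg_power[OF assms] by metis
qed

lemma sg_inv_iff: "sg H \<Longrightarrow> x\<^sup>- \<in> H \<longleftrightarrow> x \<in> H"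
  by (metis inverse_inv sg_inv)

lemma sg_mult_iff: "sg H \<Longrightarrow> x \<in> H \<Longrightarrow> x * y \<in> H \<longleftrightarrow> y \<in> H"
  "sg H \<Longrightarrow> x \<in> H \<Longrightarrow> y * x \<in> H \<longleftrightarrow> y \<in> H"
proof -
  show "sg H \<Longrightarrow> x \<in> H \<Longrightarrow> x * y \<in> H \<longleftrightarrow> y \<in> H"
    by (metis inv_mult_cancel sg_inv sg_mult)
  assume H: "sg H" "x \<in> H"
  have "(y * x) * x\<^sup>- = y" by (simp add: mult.assoc)
  then show "y * x \<in> H \<longleftrightarrow> y \<in> H" using H by (metis sg_inv sg_mult)
qed

lemma sg_cj: "sg H \<Longrightarrow> g \<in> H \<Longrightarrow> x \<in> H \<Longrightarrow> cj g x \<in> H"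
  by (simp add: cj_def sg_mult sg_inv)

lemma sg_cm: "sg H \<Longrightarrow> g \<in> H \<Longrightarrow> x \<in> H \<Longrightarrow> cm g x \<in> H"
  by (simp add: cm_def sg_mult sg_inv)

lemmas sg_closed = sg_one sg_mult sg_power sg_inv sg_cj sg_cm

lemma sg_card_pos: "sg H \<Longrightarrow> card H > 0"
  by (metis card_gt_0_iff empty_iff sg_def)

lemma sg_trivial [simp]: "sg {1}"
  by (simp add: sg_def)

lemma sg_cj_image: "sg H \<Longrightarrow> sg (cj g ` H)"
  by (auto simp: sg_def image_iff simp flip: cj_mult)

lemma sg_Int: "sg A \<Longrightarrow> sg B \<Longrightarrow> sg (A \<inter> B)"
  by (simp add: sg_def)

lemma sg_eq_one_iff: "sg H \<Longrightarrow> card H = 1 \<longleftrightarrow> H = {1}"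
  by (metis One_nat_def card_1_singletonE card.empty card_insert_if empty_iff finite.emptyI sg_one singletonD)

lemma sg_ne_one: "sg H \<Longrightarrow> H \<noteq> {1} \<Longrightarrow> \<exists>x\<in>H. x \<noteq> 1"
  using sg_one by fastforce

lemma cj_image_self: assumes "sg H" "g \<in> H" shows "cj g ` H = H"
  using assms by (metis card_cj card_subset_eq image_subsetI sg_cj sg_finite)

lemma cj_image_eqI: "finite H \<Longrightarrow> (\<And>h. h \<in> H \<Longrightarrow> cj g h \<in> H) \<Longrightarrow> cj g ` H = H"
  by (metis card_cj card_subset_eq image_subsetI)

text \<open>The common counting principle: it yields Lagrange's theorem for both kinds of cosets,
  the product formula \<open>card_setmul\<close>, orbit-stabilizer, and the number of conjugates of
  a Frobenius complement.\<close>

lemma card_eq_fiber_mult: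
  assumes "finite A" "\<And>b. b \<in> f ` A \<Longrightarrow> card {a\<in>A. f a = b} = k"
  shows "card A = k * card (f ` A)"
proof -
  have "card A = (\<Sum>b\<in>f ` A. \<Sum>a\<in>{a\<in>A. f a = b}. 1)"
    using sum.image_gen[OF assms(1), of "\<lambda>_. 1::nat" f] by simp
  also have "\<dots> = (\<Sum>b\<in>f ` A. k)" by (rule sum.cong) (auto simp: assms(2))
  finally show ?thesis by simp
qed

section \<open>Cosets and products of subgroups\<close>

definition lcos :: "'g::group_mult \<Rightarrow> 'g set \<Rightarrow> 'g set" where
  "lcos x H = (\<lambda>h. x * h) ` H"

lemma mem_lcos: "y \<in> lcos x H \<longleftrightarrow> x\<^sup>- * y \<in> H"
  unfolding lcos_def by (metis (no_types, lifting) image_iff inv_mult_cancel mult_inv_cancel)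

lemma lcos_eq_iff: assumes "sg H" shows "lcos x H = lcos y H \<longleftrightarrow> x\<^sup>- * y \<in> H"
proof
  assume "lcos x H = lcos y H"
  then show "x\<^sup>- * y \<in> H" by (metis assms left_inv mem_lcos sg_one)
next
  assume *: "x\<^sup>- * y \<in> H"
  have "x\<^sup>- * z = (x\<^sup>- * y) * (y\<^sup>- * z)" for z by (simp add: gsimps)
  then have "x\<^sup>- * z \<in> H \<longleftrightarrow> y\<^sup>- * z \<in> H" for z using * assms sg_mult_iff(1) by metis
  then show "lcos x H = lcos y H" by (auto simp: mem_lcos)
qed

lemma card_lcos [simp]: "card (lcos x H) = card H"
  unfolding lcos_def by (rule card_image) (simp add: inj_on_def)

lemma card_lcosets:
  assumes "sg H" "sg X" "H \<subseteq> X"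
  shows "card X = card H * card ((\<lambda>x. lcos x H) ` X)"
proof (rule card_eq_fiber_mult)
  show "finite X" using assms sg_finite by blast
  fix b assume "b \<in> (\<lambda>x. lcos x H) ` X"
  then obtain x where x: "x \<in> X" "b = lcos x H" by blast
  have "{a \<in> X. lcos a H = b} = lcos x H"
  proof -
    have "a \<in> X" if "x\<^sup>- * a \<in> H" for a
      using that x assms by (meson sg_inv sg_mult_iff(1) subsetD)
    then show ?thesis using assms x
      by (auto simp: mem_lcos lcos_eq_iff) (metis lcos_eq_iff)+
  qed
  then show "card {a \<in> X. lcos a H = b} = card H" by simp
qed

lemma sg_card_dvd: "sg H \<Longrightarrow> sg X \<Longrightarrow> H \<subseteq> X \<Longrightarrow> card H dvd card X"
  using card_lcosets by (metis dvd_triv_left)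

definition setmul :: "'g::group_mult set \<Rightarrow> 'g set \<Rightarrow> 'g set" (infixl \<open>\<bullet>\<close> 70) where
  "A \<bullet> B = {a * b | a b. a \<in> A \<and> b \<in> B}"

lemma setmulI: "a \<in> A \<Longrightarrow> b \<in> B \<Longrightarrow> a * b \<in> A \<bullet> B"
  by (auto simp: setmul_def)

lemma setmulE: "x \<in> A \<bullet> B \<Longrightarrow> (\<And>a b. a \<in> A \<Longrightarrow> b \<in> B \<Longrightarrow> x = a * b \<Longrightarrow> P) \<Longrightarrow> P"
  by (auto simp: setmul_def)

lemma setmul_left: "sg B \<Longrightarrow> A \<subseteq> A \<bullet> B" and setmul_right: "sg A \<Longrightarrow> B \<subseteq> A \<bullet> B"
  by (auto simp: setmul_def) (metis mult_1_right sg_one, metis mult_1_left sg_one)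

lemma setmul_least: "sg X \<Longrightarrow> A \<subseteq> X \<Longrightarrow> B \<subseteq> X \<Longrightarrow> A \<bullet> B \<subseteq> X"
  by (auto simp: setmul_def sg_mult subset_iff)

lemma setmul_mono: "A \<subseteq> A' \<Longrightarrow> B \<subseteq> B' \<Longrightarrow> A \<bullet> B \<subseteq> A' \<bullet> B'"
  by (auto simp: setmul_def)

lemma finite_setmul: "finite A \<Longrightarrow> finite B \<Longrightarrow> finite (A \<bullet> B)"
proof -
  assume "finite A" "finite B"
  moreover have "A \<bullet> B = (\<lambda>(a,b). a * b) ` (A \<times> B)" by (auto simp: setmul_def)
  ultimately show ?thesis by simp
qed

lemma sg_setmul:
  assumes "sg A" "sg B" "\<And>a b. a \<in> A \<Longrightarrow> b \<in> B \<Longrightarrow> cj b a \<in> A"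
  shows "sg (A \<bullet> B)"
  unfolding sg_def
proof (intro conjI ballI)
  show "finite (A \<bullet> B)" using assms finite_setmul sg_finite by blast
  show "1 \<in> A \<bullet> B" using setmulI[of 1 A 1 B] assms sg_one by force
  fix x y assume "x \<in> A \<bullet> B" "y \<in> A \<bullet> B"
  then obtain a b c d where *: "a \<in> A" "b \<in> B" "c \<in> A" "d \<in> B" "x = a * b" "y = c * d"
    by (auto elim!: setmulE)
  then have "x * y = (a * cj b c) * (b * d)" by (simp add: cj_def mult.assoc)
  then show "x * y \<in> A \<bullet> B" using * assms by (metis setmulI sg_mult)
qed

lemma card_setmul:
  assumes "sg A" "sg B"
  shows "card A * card B = card (A \<inter> B) * card (A \<bullet> B)"
proof -
  let ?f = "\<lambda>(a,b). a * b"
  have "card (A \<times> B) = card (A \<inter> B) * card (?f ` (A \<times> B))"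
  proof (rule card_eq_fiber_mult)
    show "finite (A \<times> B)" using assms sg_finite by blast
    fix y assume "y \<in> ?f ` (A \<times> B)"
    then obtain a b where ab: "a \<in> A" "b \<in> B" "y = a * b" by auto
    \<comment> \<open>All factorizations of \<open>a * b\<close> arise from this one by moving an
      element of \<open>A \<inter> B\<close> across, so each fibre is a copy of the
      intersection.\<close>
    let ?g = "\<lambda>d. (a * d, d\<^sup>- * b)"
    have "bij_betw ?g (A \<inter> B) {x \<in> A \<times> B. ?f x = y}"
      unfolding bij_betw_def
    proof
      show "inj_on ?g (A \<inter> B)" by (auto simp: inj_on_def)
      have "?g ` (A \<inter> B) \<subseteq> {x \<in> A \<times> B. ?f x = y}"
        using ab assms by (auto simp: sg_mult sg_inv mult.assoc)
      moreover have "(c, d) \<in> ?g ` (A \<inter> B)" if "c \<in> A" "d \<in> B" "c * d = y" for c d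
      proof -
        have "c = a * (b * d\<^sup>-)" using that ab by (metis mult.assoc mult_1_right right_inv)
        then have e: "a\<^sup>- * c = b * d\<^sup>-" by simp
        then have "(a\<^sup>- * c) \<in> A \<inter> B" using that ab assms by (metis IntI sg_inv sg_mult)
        moreover have "(c, d) = ?g (a\<^sup>- * c)" using that ab by (metis e inverse_inv inverse_mult left_inv mult.assoc mult_1_left mult_1_right mult_inv_cancel)
        ultimately show ?thesis by blast
      qed
      ultimately show "?g ` (A \<inter> B) = {x \<in> A \<times> B. ?f x = y}" by auto
    qed
    then show "card {x \<in> A \<times> B. ?f x = y} = card (A \<inter> B)" using bij_betw_same_card by fastforce
  qed
  moreover have "?f ` (A \<times> B) = A \<bullet> B" by (auto simp: setmul_def)
  ultimately show ?thesis by (simp add: card_cartesian_product)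
qed

text \<open>The same set as a HOL-Algebra structure. Through it Sylow's existence theorem, factor
  groups and finite products over abelian groups become available for subsets of the group
  type.\<close>

definition rec :: "'g::group_mult set \<Rightarrow> 'g monoid" where
  "rec X = \<lparr>carrier = X, monoid.mult = (*), one = 1\<rparr>"

lemma rec_simps [simp]: "carrier (rec X) = X" "monoid.mult (rec X) = (*)" "one (rec X) = 1"
  "(rec X)\<lparr>carrier := Y\<rparr> = rec Y" "order (rec X) = card X"
  by (simp_all add: rec_def Coset.order_def)

lemma group_rec: "sg X \<Longrightarrow> group (rec X)"
  by (rule groupI) (auto simp: sg_mult sg_one mult.assoc intro: sg_inv left_inv)

lemma inv_rec [simp]: "sg X \<Longrightarrow> x \<in> X \<Longrightarrow> inv\<^bsub>rec X\<^esub> x = x\<^sup>-"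
  by (rule group.inv_equality[OF group_rec]) (simp_all add: sg_inv)

lemma pow_rec [simp]: "x [^]\<^bsub>rec X\<^esub> (n::nat) = x ^ n"
  by (induction n) (simp_all add: nat_pow_def flip: power_Suc2)

lemma subgroup_rec: "sg X \<Longrightarrow> subgroup H (rec X) \<longleftrightarrow> sg H \<and> H \<subseteq> X"
proof -
  assume X: "sg X"
  show ?thesis
  proof (cases "H \<subseteq> X")
    case True
    then have "inv\<^bsub>rec X\<^esub> x = x\<^sup>-" if "x \<in> H" for x using that X by auto
    then have "subgroup H (rec X) \<longleftrightarrow> 1 \<in> H \<and> (\<forall>x\<in>H. \<forall>y\<in>H. x * y \<in> H) \<and> (\<forall>x\<in>H. x\<^sup>- \<in> H)"
      using True by (auto simp: subgroup_def)
    then show ?thesis using True X sg_inv finite_subset unfolding sg_def by metis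
  qed (auto simp: subgroup_def)
qed

lemma power_card_eq_one: "sg X \<Longrightarrow> x \<in> X \<Longrightarrow> x ^ card X = 1"
  using group.pow_order_eq_1[OF group_rec, of X x] by simp

subsection \<open>Cyclic subgroups and orders of elements\<close>

definition cyc :: "'g::group_mult \<Rightarrow> 'g set" where
  "cyc x = range (\<lambda>n::nat. x ^ n)"

lemma cyc_power [simp]: "x ^ n \<in> cyc x" and cyc_self [simp]: "x \<in> cyc x" and cyc_one [simp]: "1 \<in> cyc x"
  unfolding cyc_def by (blast, metis power_one_right rangeI, metis power_0 rangeI)

lemma mem_cyc: "y \<in> cyc x \<longleftrightarrow> (\<exists>n. y = x ^ n)"
  by (auto simp: cyc_def)

lemma cyc_least: "sg X \<Longrightarrow> x \<in> X \<Longrightarrow> cyc x \<subseteq> X"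
  by (auto simp: cyc_def sg_power)

lemma sg_cyc: "sg X \<Longrightarrow> x \<in> X \<Longrightarrow> sg (cyc x)"
proof -
  assume "sg X" "x \<in> X"
  then have "finite (cyc x)" using cyc_least sg_finite finite_subset by blast
  then show ?thesis unfolding sg_def by (auto simp: mem_cyc) (metis power_0, metis power_add)
qed

lemma cyc_commute: "y \<in> cyc x \<Longrightarrow> z \<in> cyc x \<Longrightarrow> y * z = z * y"
  by (auto simp: mem_cyc simp flip: power_add) (metis add.commute)

lemma cyc_trivial [simp]: "cyc 1 = {1}"
  by (auto simp: cyc_def)

lemma cj_cyc: "cj g ` cyc x = cyc (cj g x)"
  by (auto simp: cyc_def image_image cj_power)

definition od :: "'g::group_mult \<Rightarrow> nat" where
  "od x = card (cyc x)"

lemma power_eq_one_iff: assumes "sg X" "x \<in> X" shows "x ^ n = 1 \<longleftrightarrow> od x dvd n"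
proof -
  \<comment> \<open>\<open>od\<close> counts the powers of \<open>x\<close>. The least positive
    exponent \<open>d\<close> is only auxiliary: \<open>cyc x\<close> turns out to have exactly
    \<open>d\<close> elements.\<close>
  define d where "d = (LEAST n. n > 0 \<and> x ^ n = 1)"
  have d: "d > 0" "x ^ d = 1"
    using LeastI_ex[OF ex_power_eq_one[OF assms]] unfolding d_def by auto
  have min: "d \<le> n" if "n > 0" "x ^ n = 1" for n
    unfolding d_def by (rule Least_le) (use that in blast)
  have red: "x ^ n = x ^ (n mod d)" for n
  proof -
    have "x ^ n = x ^ (d * (n div d) + n mod d)" by simp
    also have "\<dots> = x ^ (n mod d)" by (simp only: power_add power_mult d) simp
    finally show ?thesis .
  qed
  have dvd: "x ^ n = 1 \<longleftrightarrow> d dvd n" for n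
    by (metis red d(1) dvd_eq_mod_eq_0 min mod_less_divisor not_gr_zero not_le power_0)
  have inj: "i = j" if "x ^ i = x ^ j" "i \<le> j" "j < d" for i j
  proof -
    have "x ^ i * x ^ (j - i) = x ^ i * 1" using that by (metis le_add_diff_inverse mult_1_right power_add)
    then have "d dvd j - i" using dvd by simp
    then show ?thesis using that by (metis dvd_imp_le le_antisym less_imp_diff_less not_le zero_less_diff leI)
  qed
  have "inj_on (\<lambda>n. x ^ n) {..<d}"
    by (rule inj_onI) (metis inj lessThan_iff linear)
  moreover have "cyc x = (\<lambda>n. x ^ n) ` {..<d}"
    using red d(1) by (fastforce simp: cyc_def)
  ultimately have "od x = d" by (simp add: od_def card_image)
  then show ?thesis using dvd by simp
qed

lemma od_dvd_card: "sg X \<Longrightarrow> x \<in> X \<Longrightarrow> od x dvd card X"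
  using power_eq_one_iff power_card_eq_one by blast

lemma od_pos: "sg X \<Longrightarrow> x \<in> X \<Longrightarrow> od x > 0"
  by (metis od_def sg_card_pos sg_cyc)

lemma power_od: "sg X \<Longrightarrow> x \<in> X \<Longrightarrow> x ^ od x = 1"
  by (simp add: power_eq_one_iff)

lemma od_eq_one_iff: "sg X \<Longrightarrow> x \<in> X \<Longrightarrow> od x = 1 \<longleftrightarrow> x = 1"
  by (metis power_eq_one_iff nat_dvd_1_iff_1 power_one_right)

text \<open>Bezout's identity writes \<open>c\<close> as a quotient of a power of
  \<open>c ^ n\<close> and a power of \<open>c ^ m\<close>. A subgroup \<open>N\<close> in place of
  \<open>{1}\<close> permits arguments modulo \<open>N\<close>.\<close>

lemma mem_of_coprime_powers:
  assumes "sg N" "sg X" "c \<in> X" "c ^ n \<in> N" "c ^ m \<in> N" "coprime n m"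
  shows "c \<in> N"
proof -
  have *: "c \<in> N" if "c ^ n \<in> N" "c ^ m \<in> N" "coprime n m" "n \<noteq> 0" for n m
  proof -
    obtain a b where "n * a = m * b + gcd n m" using bezout_nat[OF \<open>n \<noteq> 0\<close>] by blast
    then have "(c ^ n) ^ a = (c ^ m) ^ b * c"
      using that by (metis coprime_iff_gcd_eq_1 power_add power_mult power_one_right)
    then show ?thesis by (metis assms(1) sg_mult_iff(1) sg_power that(1,2))
  qed
  \<comment> \<open>The identity over the naturals needs a non-zero first exponent; for
    \<open>n = 0\<close> coprimality makes \<open>m\<close> equal to 1.\<close>
  show ?thesis
  proof (cases "n = 0")
    case True
    then show ?thesis using assms by simp
  next
    case False
    then show ?thesis using * assms by blast
  qed
qed

lemma eq_one_of_coprime_powers: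
  assumes "sg X" "c \<in> X" "c ^ n = 1" "c ^ m = 1" "coprime n m"
  shows "c = 1"
  using mem_of_coprime_powers[of "{1}" X c n m] assms by simp

text \<open>Stated through some exponent rather than through \<open>od\<close>, so that powers and
  conjugates can be treated without naming a finite subgroup that contains the element.\<close>

definition pel :: "nat \<Rightarrow> 'g::group_mult \<Rightarrow> bool" where
  "pel p x \<longleftrightarrow> (\<exists>n. x ^ (p ^ n) = 1)"

definition p'el :: "nat \<Rightarrow> 'g::group_mult \<Rightarrow> bool" where
  "p'el p x \<longleftrightarrow> (\<exists>m. coprime p m \<and> x ^ m = 1)"

lemma pel_power: "pel p x \<Longrightarrow> pel p (x ^ k)" and p'el_power: "p'el p x \<Longrightarrow> p'el p (x ^ k)"
  unfolding pel_def p'el_def by (metis mult.commute power_mult power_one)+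

lemma p'el_cj: "p'el p x \<Longrightarrow> p'el p (cj g x)"
  unfolding p'el_def by (metis cj_one(2) cj_power)

text \<open>Both factors are powers of \<open>x\<close>; hence they commute and lie in every
  subgroup that contains \<open>x\<close>.\<close>

lemma pel_p'el_decompose:
  assumes "sg X" "x \<in> X" "prime p"
  shows "\<exists>i j. x = x ^ i * x ^ j \<and> pel p (x ^ i) \<and> p'el p (x ^ j)"
proof -
  have "card X \<noteq> 0" "\<not> is_unit p" using assms sg_card_pos by (auto simp: not_prime_unit)
  then obtain m where m: "card X = p ^ multiplicity p (card X) * m" "\<not> p dvd m"
    using multiplicity_decompose' by blast
  define q where "q = p ^ multiplicity p (card X)"
  have one: "x ^ (q * m) = 1" using m power_card_eq_one assms unfolding q_def by metis
  have cop: "coprime q m" using m(2) assms(3) unfolding q_def by (simp add: prime_imp_coprime)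
  have "q \<noteq> 0" using assms(3) unfolding q_def by auto
  then obtain a b where ab: "q * a = m * b + 1"
    using bezout_nat cop by (metis coprime_iff_gcd_eq_1)
  \<comment> \<open>the \<open>p\<close>-part is \<open>x\<close> to the power \<open>- m b\<close>, made nonnegative modulo \<open>q m\<close>\<close>
  have "m \<noteq> 0" using m(2) by (metis dvd_0_right)
  define i where "i = m * (b * (q - 1))"
  have "x ^ (i + q * a) = x ^ (m * b * q + 1)"
    using ab \<open>q \<noteq> 0\<close> unfolding i_def by (cases q) (simp_all add: algebra_simps)
  also have "\<dots> = x" by (metis mult.assoc mult.commute one power_add power_mult power_one power_one_right mult_1_left)
  finally have "x = x ^ i * x ^ (q * a)" by (simp add: power_add)
  moreover have "pel p (x ^ i)" unfolding pel_def i_def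
    by (rule exI[of _ "multiplicity p (card X)"])
       (metis q_def mult.assoc mult.commute one power_mult power_one)
  moreover have "p'el p (x ^ (q * a))" unfolding p'el_def
    by (rule exI[of _ m]) (metis assms(3) m(2) mult.assoc mult.commute one power_mult power_one prime_imp_coprime)
  ultimately show ?thesis by blast
qed

lemma od_pel: assumes "sg X" "x \<in> X" "prime p" "pel p x" shows "\<exists>n. od x = p ^ n"
  using assms unfolding pel_def by (metis divides_primepow_nat power_eq_one_iff)

lemma pel_p'el_one: "sg X \<Longrightarrow> x \<in> X \<Longrightarrow> prime p \<Longrightarrow> pel p x \<Longrightarrow> p'el p x \<Longrightarrow> x = 1"
  unfolding pel_def p'el_def using eq_one_of_coprime_powers by (metis coprime_power_left_iff)

subsection \<open>Normal subgroups, normalizers, centralizers, commutator subgroups\<close>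

definition nml :: "'g::group_mult set \<Rightarrow> 'g set \<Rightarrow> bool" where
  "nml N X \<longleftrightarrow> sg N \<and> sg X \<and> N \<subseteq> X \<and> (\<forall>x\<in>X. \<forall>n\<in>N. cj x n \<in> N)"

lemma nmlD: "nml N X \<Longrightarrow> sg N" "nml N X \<Longrightarrow> sg X" "nml N X \<Longrightarrow> N \<subseteq> X"
  "nml N X \<Longrightarrow> x \<in> X \<Longrightarrow> n \<in> N \<Longrightarrow> cj x n \<in> N"
  by (auto simp: nml_def)

lemma nml_image: "nml N X \<Longrightarrow> x \<in> X \<Longrightarrow> cj x ` N = N"
  by (rule cj_image_eqI) (auto simp: nml_def sg_def)

lemma nml_refl: "sg X \<Longrightarrow> nml X X"
  by (simp add: nml_def sg_cj)

lemma nml_one: "sg X \<Longrightarrow> nml {1} X"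
  by (simp add: nml_def sg_one)

lemma nml_Int: "nml N X \<Longrightarrow> nml M X \<Longrightarrow> nml (N \<inter> M) X"
  by (auto simp: nml_def sg_Int)

lemma nml_Int_sg: "nml N X \<Longrightarrow> sg Y \<Longrightarrow> Y \<subseteq> X \<Longrightarrow> nml (N \<inter> Y) Y"
  by (auto simp: nml_def sg_Int sg_cj)

lemma nml_sub: "nml N X \<Longrightarrow> sg Y \<Longrightarrow> N \<subseteq> Y \<Longrightarrow> Y \<subseteq> X \<Longrightarrow> nml N Y"
  by (auto simp: nml_def)

lemma sg_nml_setmul: "nml N X \<Longrightarrow> sg A \<Longrightarrow> A \<subseteq> X \<Longrightarrow> sg (N \<bullet> A)"
  by (rule sg_setmul) (auto simp: nml_def)

lemma nml_setmul_nml: assumes "nml N X" "nml M X" shows "nml (N \<bullet> M) X"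
  unfolding nml_def
proof (intro conjI ballI)
  show "sg (N \<bullet> M)" using assms sg_nml_setmul by (auto simp: nml_def)
  show "N \<bullet> M \<subseteq> X" using assms by (intro setmul_least) (auto simp: nml_def)
  show "cj x n \<in> N \<bullet> M" if "x \<in> X" "n \<in> N \<bullet> M" for x n
    using that assms by (auto elim!: setmulE simp: cj_mult nml_def intro!: setmulI)
qed (use assms in \<open>auto simp: nml_def\<close>)

definition nrm :: "'g::group_mult set \<Rightarrow> 'g set \<Rightarrow> 'g set" where
  "nrm X H = {x \<in> X. cj x ` H = H}"

lemma sg_nrm: "sg X \<Longrightarrow> sg (nrm X H)"
  unfolding sg_def nrm_def by (auto simp flip: cj_image_cj)

lemma nrm_sub: "nrm X H \<subseteq> X"
  by (auto simp: nrm_def)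

lemma nml_nrm: "sg X \<Longrightarrow> sg H \<Longrightarrow> H \<subseteq> X \<Longrightarrow> nml H (nrm X H)"
  unfolding nml_def using sg_nrm[of X H] cj_image_self[of H] by (auto simp: nrm_def)

lemma nml_iff_nrm: "sg X \<Longrightarrow> sg H \<Longrightarrow> H \<subseteq> X \<Longrightarrow> nml H X \<longleftrightarrow> nrm X H = X"
  using nml_nrm[of X H] nml_image[of H X] by (auto simp: nrm_def)

definition cent :: "'g::group_mult set \<Rightarrow> 'g set \<Rightarrow> 'g set" where
  "cent X S = {x \<in> X. \<forall>s\<in>S. x * s = s * x}"

lemma sg_cent: "sg X \<Longrightarrow> sg (cent X S)"
  unfolding sg_def cent_def by (auto simp: mult.assoc) (metis mult.assoc)

lemma cent_sub: "cent X S \<subseteq> X"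
  by (auto simp: cent_def)

definition gen :: "'g::group_mult set \<Rightarrow> 'g set" where
  "gen S = \<Inter>{H. sg H \<and> S \<subseteq> H}"

lemma gen_least: "sg H \<Longrightarrow> S \<subseteq> H \<Longrightarrow> gen S \<subseteq> H" and gen_incl: "S \<subseteq> gen S"
  by (auto simp: gen_def)

lemma gen_mono: "S \<subseteq> T \<Longrightarrow> gen S \<subseteq> gen T"
  by (auto simp: gen_def)

lemma sg_gen: assumes "sg H" "S \<subseteq> H" shows "sg (gen S)"
  unfolding sg_def
proof (intro conjI)
  show "finite (gen S)" using gen_least[OF assms] assms sg_finite finite_subset by blast
qed (auto simp: gen_def sg_one sg_mult)

lemma gen_cj: assumes "sg H" "S \<subseteq> H" "\<And>s. s \<in> S \<Longrightarrow> cj x s \<in> gen S" "y \<in> gen S" shows "cj x y \<in> gen S"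
proof -
  have "sg {y \<in> gen S. cj x y \<in> gen S}"
    using sg_gen[OF assms(1,2)] by (auto simp: sg_def cj_mult)
  moreover have "S \<subseteq> {y \<in> gen S. cj x y \<in> gen S}" using assms(3) gen_incl by blast
  ultimately show ?thesis using gen_least assms(4) by blast
qed

definition comm :: "'g::group_mult set \<Rightarrow> 'g set \<Rightarrow> 'g set" where
  "comm A B = gen {cm a b | a b. a \<in> A \<and> b \<in> B}"

lemma comm_least: "sg N \<Longrightarrow> (\<And>a b. a \<in> A \<Longrightarrow> b \<in> B \<Longrightarrow> cm a b \<in> N) \<Longrightarrow> comm A B \<subseteq> N"
  unfolding comm_def by (rule gen_least) auto

lemma comm_mono: "A \<subseteq> A' \<Longrightarrow> B \<subseteq> B' \<Longrightarrow> comm A B \<subseteq> comm A' B'"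
  unfolding comm_def by (rule gen_mono) auto

lemma comm_mem: "a \<in> A \<Longrightarrow> b \<in> B \<Longrightarrow> cm a b \<in> comm A B"
  unfolding comm_def by (rule subsetD[OF gen_incl]) blast

lemma sg_comm: "sg X \<Longrightarrow> A \<subseteq> X \<Longrightarrow> B \<subseteq> X \<Longrightarrow> sg (comm A B)"
  unfolding comm_def by (rule sg_gen[of X]) (auto simp: sg_cm subset_iff)

lemma comm_sub: "sg X \<Longrightarrow> A \<subseteq> X \<Longrightarrow> B \<subseteq> X \<Longrightarrow> comm A B \<subseteq> X"
  by (rule comm_least) (auto simp: sg_cm subset_iff)

lemma nml_comm: assumes "nml N X" "nml M X" shows "nml (comm N M) X"
  unfolding nml_def
proof (intro conjI ballI)
  fix x n assume x: "x \<in> X" and n: "n \<in> comm N M"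
  have sub: "{cm a b | a b. a \<in> N \<and> b \<in> M} \<subseteq> X" using assms by (auto simp: nml_def sg_cm subset_iff)
  have "cj x s \<in> gen {cm a b | a b. a \<in> N \<and> b \<in> M}" if "s \<in> {cm a b | a b. a \<in> N \<and> b \<in> M}" for s
    using that assms x gen_incl[of "{cm a b | a b. a \<in> N \<and> b \<in> M}"] by (fastforce simp: cj_cm nml_def)
  then show "cj x n \<in> comm N M"
    using gen_cj[OF nmlD(2)[OF assms(1)] sub] n unfolding comm_def by blast
qed (use assms comm_sub[of X N M] sg_comm[of X N M] in \<open>auto simp: nml_def\<close>)

lemma comm_nml_sub: "nml N X \<Longrightarrow> comm N X \<subseteq> N"
  by (rule comm_least) (auto simp: nml_def cm_cj(1) sg_mult sg_inv)

text \<open>Modulo \<open>N\<close> the commutator of \<open>n * y\<close> and \<open>m * z\<close>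
  is \<open>cm y z\<close>. The use is with minimal supplements: if a perfect group is
  \<open>N \<bullet> Z\<close> with \<open>Z\<close> minimal, then \<open>Z\<close> is
  perfect.\<close>

lemma comm_setmul_sub:
  assumes "nml N (N \<bullet> Z)" "sg Z"
  shows "comm (N \<bullet> Z) (N \<bullet> Z) \<subseteq> N \<bullet> comm Z Z"
proof (rule comm_least)
  have Z: "Z \<subseteq> N \<bullet> Z" using setmul_right assms nmlD(1) by metis
  then have C: "comm Z Z \<subseteq> N \<bullet> Z" "sg (comm Z Z)"
    using assms comm_sub[OF nmlD(2) Z Z] sg_comm[OF nmlD(2) Z Z] by auto
  then show "sg (N \<bullet> comm Z Z)" using assms sg_nml_setmul by metis
  fix a b assume "a \<in> N \<bullet> Z" "b \<in> N \<bullet> Z"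
  then obtain n y m z where *: "n \<in> N" "y \<in> Z" "m \<in> N" "z \<in> Z" "a = n * y" "b = m * z"
    by (auto elim!: setmulE)
  have N: "cj t k \<in> N" if "t \<in> Z" "k \<in> N" for t k using that assms Z nmlD(4) by blast
  have "cm a b = (n * cj y m * cj (cj y z) (n\<^sup>-) * cj (cm y z) (m\<^sup>-)) * cm y z"
    using * by (simp add: cm_def cj_def gsimps)
  moreover have "n * cj y m * cj (cj y z) (n\<^sup>-) * cj (cm y z) (m\<^sup>-) \<in> N"
    using * assms by (auto simp: nml_def intro!: sg_mult[of N] sg_inv[of N] N sg_cj[of Z] sg_cm[of Z])
  ultimately show "cm a b \<in> N \<bullet> comm Z Z" using * comm_mem setmulI by metis
qed

section \<open>Fixed points of p-groups and Sylow subgroups\<close>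

text \<open>The induction removes one non-trivial orbit at a time; by orbit-stabilizer its size
  divides a power of \<open>p\<close> and is not 1. The points have an arbitrary type because later
  actions are on cosets, on Sylow subgroups and on elements.\<close>

lemma card_mod_fixed_points:
  fixes A :: "'g::group_mult set" and act :: "'g \<Rightarrow> 'b \<Rightarrow> 'b"
  assumes p: "prime p" and A: "sg A" "card A = p ^ n"
  assumes "finite \<Omega>" "\<And>a w. a \<in> A \<Longrightarrow> w \<in> \<Omega> \<Longrightarrow> act a w \<in> \<Omega>"
    and "\<And>w. w \<in> \<Omega> \<Longrightarrow> act 1 w = w"
    and "\<And>a b w. a \<in> A \<Longrightarrow> b \<in> A \<Longrightarrow> w \<in> \<Omega> \<Longrightarrow> act (a * b) w = act a (act b w)"
  shows "card \<Omega> mod p = card {w\<in>\<Omega>. \<forall>a\<in>A. act a w = w} mod p"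
  using assms(4-)
proof (induction "card \<Omega>" arbitrary: \<Omega> rule: less_induct)
  case less
  note cl = less.prems(2) and one = less.prems(3) and mult = less.prems(4)
  show ?case
  proof (cases "\<forall>w\<in>\<Omega>. \<forall>a\<in>A. act a w = w")
    case True
    then have "{w\<in>\<Omega>. \<forall>a\<in>A. act a w = w} = \<Omega>" by blast
    then show ?thesis by simp
  next
    case False
    then obtain w0 c where w0: "w0 \<in> \<Omega>" "c \<in> A" "act c w0 \<noteq> w0" by blast
    define Orb where "Orb = (\<lambda>a. act a w0) ` A"
    have ret: "act (a\<^sup>-) (act a w) = w" if "a \<in> A" "w \<in> \<Omega>" for a w
      using that mult[of "a\<^sup>-" a w] one sg_inv[OF A(1)] by auto
    have sub: "Orb \<subseteq> \<Omega>" using cl w0 by (auto simp: Orb_def)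
    have w0O: "w0 \<in> Orb" unfolding Orb_def using one[OF w0(1)] sg_one[OF A(1)] by (metis imageI)
    have "card A = card {a\<in>A. act a w0 = w0} * card Orb"
      unfolding Orb_def
    proof (rule card_eq_fiber_mult)
      show "finite A" using A sg_finite by blast
      fix b assume "b \<in> (\<lambda>a. act a w0) ` A"
      then obtain c where c: "c \<in> A" "b = act c w0" by blast
      have "bij_betw (\<lambda>s. c * s) {a\<in>A. act a w0 = w0} {a\<in>A. act a w0 = b}"
        unfolding bij_betw_def
      proof
        show "(\<lambda>s. c * s) ` {a\<in>A. act a w0 = w0} = {a\<in>A. act a w0 = b}"
        proof (intro subset_antisym subsetI)
          fix a assume "a \<in> {a\<in>A. act a w0 = b}"
          then have a: "a \<in> A" "act a w0 = b" by auto
          then have "act (c\<^sup>- * a) w0 = w0" using c mult[of "c\<^sup>-" a w0] ret[of c w0] w0 A sg_inv by auto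
          then have "c\<^sup>- * a \<in> {a\<in>A. act a w0 = w0}" using a c A by (auto intro: sg_mult sg_inv)
          moreover have "a = c * (c\<^sup>- * a)" by simp
          ultimately show "a \<in> (\<lambda>s. c * s) ` {a\<in>A. act a w0 = w0}" by blast
        qed (use c mult[of c] w0 A in \<open>auto intro: sg_mult\<close>)
      qed (simp add: inj_on_def)
      then show "card {a\<in>A. act a w0 = b} = card {a\<in>A. act a w0 = w0}"
        using bij_betw_same_card by fastforce
    qed
    then have "card Orb dvd p ^ n" using A by (metis dvd_triv_right)
    moreover have fO: "finite Orb" using A sg_finite by (auto simp: Orb_def)
    moreover have "card Orb \<noteq> 1"
    proof
      assume "card Orb = 1"
      then obtain z where "Orb = {z}" using card_1_singletonE by blast
      moreover have "act c w0 \<in> Orb" using w0 by (auto simp: Orb_def)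
      ultimately show False using w0O w0(3) by auto
    qed
    ultimately have pO: "p dvd card Orb"
      using p by (metis divides_primepow_nat dvd_power gr0I power_0)
    have cl': "act a w \<in> \<Omega> - Orb" if "a \<in> A" "w \<in> \<Omega> - Orb" for a w
    proof -
      have "w \<in> Orb" if ao: "act a w \<in> Orb" "w \<in> \<Omega>"
      proof -
        obtain d where d: "d \<in> A" "act a w = act d w0" using ao by (auto simp: Orb_def)
        then have "w = act (a\<^sup>- * d) w0" using ret[of a w] mult[of "a\<^sup>-" d w0] \<open>a \<in> A\<close> ao w0 sg_inv[OF A(1)] by auto
        then show ?thesis using d \<open>a \<in> A\<close> A by (auto simp: Orb_def intro: sg_mult sg_inv)
      qed
      then show ?thesis using that cl by blast
    qed
    have "card (\<Omega> - Orb) < card \<Omega>"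
      using w0O w0(1) less.prems(1) by (metis Diff_iff card_seteq finite_Diff linorder_not_le Diff_subset)
    then have IH: "card (\<Omega> - Orb) mod p = card {w\<in>\<Omega> - Orb. \<forall>a\<in>A. act a w = w} mod p"
      by (rule less.hyps) (use less.prems cl' in auto)
    have "{w\<in>\<Omega> - Orb. \<forall>a\<in>A. act a w = w} = {w\<in>\<Omega>. \<forall>a\<in>A. act a w = w}"
    proof -
      have False if w: "w \<in> Orb" "\<forall>a\<in>A. act a w = w" for w
      proof -
        obtain d where d: "d \<in> A" "w = act d w0" using w by (auto simp: Orb_def)
        then have "w = w0" using ret[of d w0] w0(1) w(2) sg_inv[OF A(1)] by metis
        then show False using w w0 by blast
      qed
      then show ?thesis by blast
    qed
    moreover have "card \<Omega> = card (\<Omega> - Orb) + card Orb"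
      using sub fO less.prems(1) by (metis card_Diff_subset card_mono le_add_diff_inverse2)
    ultimately show ?thesis using IH pO by (auto simp: dvd_def)
  qed
qed

lemma ex_fixed_point:
  fixes A :: "'g::group_mult set" and act :: "'g \<Rightarrow> 'b \<Rightarrow> 'b"
  assumes "prime p" "sg A" "card A = p ^ n" "finite \<Omega>" "\<And>a w. a \<in> A \<Longrightarrow> w \<in> \<Omega> \<Longrightarrow> act a w \<in> \<Omega>"
    and "\<And>w. w \<in> \<Omega> \<Longrightarrow> act 1 w = w"
    and "\<And>a b w. a \<in> A \<Longrightarrow> b \<in> A \<Longrightarrow> w \<in> \<Omega> \<Longrightarrow> act (a * b) w = act a (act b w)"
    and "\<not> p dvd card \<Omega>"
  shows "\<exists>w\<in>\<Omega>. \<forall>a\<in>A. act a w = w"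
proof (rule ccontr)
  assume "\<not> ?thesis"
  then have "{w\<in>\<Omega>. \<forall>a\<in>A. act a w = w} = {}" by blast
  then have "card {w\<in>\<Omega>. \<forall>a\<in>A. act a w = w} = 0" by (simp only: card.empty)
  then show False using card_mod_fixed_points[OF assms(1-7)] assms(8) by (simp only: dvd_eq_mod_eq_0) simp
qed

section \<open>Sylow theory\<close>

definition pgrp :: "nat \<Rightarrow> 'g::group_mult set \<Rightarrow> bool" where
  "pgrp p X \<longleftrightarrow> sg X \<and> (\<exists>n. card X = p ^ n)"

lemma pgrp_sg: "pgrp p X \<Longrightarrow> sg X"
  by (simp add: pgrp_def)

lemma pgrp_sub: assumes "pgrp p X" "sg Y" "Y \<subseteq> X" "prime p" shows "pgrp p Y"
  using assms unfolding pgrp_def by (metis divides_primepow_nat sg_card_dvd)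

lemma pgrp_pel: assumes "pgrp p X" "x \<in> X" shows "pel p x"
  using assms unfolding pgrp_def pel_def by (metis power_card_eq_one)

lemma pgrp_cyc: assumes "sg X" "x \<in> X" "prime p" "pel p x" shows "pgrp p (cyc x)"
  unfolding pgrp_def using od_pel[OF assms] sg_cyc[OF assms(1,2)] by (simp add: od_def)

lemma pgrp_cj: "pgrp p X \<Longrightarrow> pgrp p (cj g ` X)"
  by (simp add: pgrp_def sg_cj_image)

lemma pgrp_card_coprime: "prime p \<Longrightarrow> pgrp p X \<Longrightarrow> \<not> p dvd m \<Longrightarrow> coprime (card X) m"
  by (metis coprime_power_left_iff pgrp_def prime_imp_coprime)

lemma ex_subgroup_card_power:
  assumes "sg X" "prime p" "p ^ n dvd card X"
  shows "\<exists>S. sg S \<and> S \<subseteq> X \<and> card S = p ^ n"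
proof -
  obtain m where "order (rec X) = p ^ n * m" using assms(3) by auto
  then have "\<exists>H. subgroup H (rec X) \<and> card H = p ^ n"
    by (intro sylow_thm[OF assms(2) group_rec[OF assms(1)]]) (use sg_finite[OF assms(1)] in auto)
  then show ?thesis using subgroup_rec[OF assms(1)] by blast
qed

lemma cauchy: assumes "sg X" "prime p" "p dvd card X" shows "\<exists>x\<in>X. od x = p"
proof -
  obtain S where S: "sg S" "S \<subseteq> X" "card S = p" using ex_subgroup_card_power[of X p 1] assms by auto
  then have "S \<noteq> {1}" using assms(2) by (auto simp: prime_nat_iff)
  then obtain x where "x \<in> S" "x \<noteq> 1" using sg_ne_one S by blast
  then have "od x = p" using S od_dvd_card od_eq_one_iff assms(2) by (metis prime_nat_iff)
  then show ?thesis using S \<open>x \<in> S\<close> by blast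
qed

lemma cyc_of_prime_card: assumes "sg X" "prime p" "card X = p" "x \<in> X" "x \<noteq> 1" shows "cyc x = X"
proof -
  have "od x = p" using assms od_dvd_card od_eq_one_iff by (metis prime_nat_iff)
  then show ?thesis using cyc_least[OF assms(1,4)] assms(3) sg_finite[OF assms(1)] card_subset_eq
    by (metis od_def)
qed

definition syl :: "nat \<Rightarrow> 'g::group_mult set \<Rightarrow> 'g set \<Rightarrow> bool" where
  "syl p X S \<longleftrightarrow> sg S \<and> S \<subseteq> X \<and> card S = p ^ multiplicity p (card X)"

lemma sylD: "syl p X S \<Longrightarrow> sg S" "syl p X S \<Longrightarrow> S \<subseteq> X" "syl p X S \<Longrightarrow> pgrp p S"
  by (auto simp: syl_def pgrp_def)

lemma ex_syl: "sg X \<Longrightarrow> prime p \<Longrightarrow> \<exists>S. syl p X S"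
  unfolding syl_def by (rule ex_subgroup_card_power) (simp_all add: multiplicity_dvd)

lemma syl_cj: "sg X \<Longrightarrow> syl p X S \<Longrightarrow> x \<in> X \<Longrightarrow> syl p X (cj x ` S)"
  unfolding syl_def by (auto simp: sg_cj_image sg_cj subset_iff)

lemma syl_cj_eq: "syl p X S \<Longrightarrow> cj x ` X = X \<Longrightarrow> syl p X (cj x ` S)"
  unfolding syl_def by (auto simp: sg_cj_image)

lemma syl_index: assumes "sg X" "prime p" "syl p X S" "card X = card S * k" shows "\<not> p dvd k"
proof
  assume "p dvd k"
  then have "p ^ Suc (multiplicity p (card X)) dvd card X"
    using assms(3,4) unfolding syl_def by (metis mult_dvd_mono dvd_refl mult.commute power_Suc)
  then show False using sg_card_pos[OF assms(1)] assms(2)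
    by (metis less_numeral_extra(3) not_prime_unit power_dvd_iff_le_multiplicity not_less_eq_eq order_refl)
qed

text \<open>\<open>A\<close> acts by left multiplication on the left cosets of \<open>S\<close>,
  whose number is prime to \<open>p\<close>; a fixed coset of \<open>x\<close> says that
  \<open>A\<close> lies in the conjugate of \<open>S\<close> by \<open>x\<close>.\<close>

lemma pgrp_sub_cj_syl:
  assumes X: "sg X" "prime p" and S: "syl p X S" and A: "pgrp p A" "A \<subseteq> X"
  shows "\<exists>x\<in>X. A \<subseteq> cj x ` S"
proof -
  let ?\<Omega> = "(\<lambda>x. lcos x S) ` X"
  have "\<exists>w\<in>?\<Omega>. \<forall>a\<in>A. (\<lambda>y. a * y) ` w = w"
  proof (rule ex_fixed_point)
    show "\<not> p dvd card ?\<Omega>"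
      using syl_index[OF X S] card_lcosets[OF sylD(1)[OF S] X(1) sylD(2)[OF S]] by blast
    show "finite ?\<Omega>" using X sg_finite by blast
    show "sg A" "card A = p ^ (SOME n. card A = p ^ n)"
      using A(1) unfolding pgrp_def by (auto intro: someI_ex)
    show "(\<lambda>y. a * y) ` w \<in> ?\<Omega>" if aw: "a \<in> A" "w \<in> ?\<Omega>" for a w
    proof -
      obtain x where x: "x \<in> X" "w = lcos x S" using aw by blast
      then have "(\<lambda>y. a * y) ` w = lcos (a * x) S" by (simp add: lcos_def image_image mult.assoc)
      moreover have "a * x \<in> X" using x aw A X by (auto intro: sg_mult)
      ultimately show ?thesis by blast
    qed
  qed (use X in \<open>auto simp: image_image mult.assoc\<close>)
  then obtain x where x: "x \<in> X" "\<And>a. a \<in> A \<Longrightarrow> (\<lambda>y. a * y) ` lcos x S = lcos x S" by blast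
  have "a \<in> cj x ` S" if "a \<in> A" for a
  proof -
    have "x \<in> lcos x S" using sg_one[OF sylD(1)[OF S]] by (simp add: mem_lcos)
    then have "a * x \<in> lcos x S" using x(2)[OF that] by blast
    then show ?thesis unfolding mem_cj_image by (simp add: cj_def mem_lcos mult.assoc)
  qed
  then show ?thesis using x by blast
qed

lemma syl_conjugate:
  assumes "sg X" "prime p" "syl p X S" "syl p X T"
  shows "\<exists>x\<in>X. T = cj x ` S"
proof -
  obtain x where x: "x \<in> X" "T \<subseteq> cj x ` S" using pgrp_sub_cj_syl[OF assms(1,2,3)] sylD[OF assms(4)] by blast
  then have "T = cj x ` S" using assms(3,4) by (metis card_cj card_subset_eq finite_imageI sg_finite syl_def)
  then show ?thesis using x by blast
qed

lemma pgrp_sub_syl: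
  assumes "sg X" "prime p" "pgrp p A" "A \<subseteq> X"
  shows "\<exists>S. syl p X S \<and> A \<subseteq> S"
  using ex_syl[OF assms(1,2)] pgrp_sub_cj_syl[OF assms(1,2) _ assms(3,4)] syl_cj[OF assms(1)] by blast

lemma pgrp_sub_card: assumes "sg X" "prime p" "pgrp p A" "A \<subseteq> X" "syl p X S" "S \<subseteq> A" shows "A = S"
proof -
  obtain T where "syl p X T" "A \<subseteq> T" using pgrp_sub_syl assms(1-4) by blast
  then have "card A \<le> card S" using assms(5) by (metis card_mono sg_finite syl_def)
  then show ?thesis using assms by (metis card_seteq pgrp_sg sg_finite)
qed

text \<open>A Sylow subgroup of \<open>N\<close> lies in a conjugate of \<open>S\<close>.
  Conjugating back stays inside the normal subgroup \<open>N\<close>, so a Sylow subgroup of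
  \<open>N\<close> is contained in the \<open>p\<close>-group \<open>S \<inter> N\<close> and fills
  it.\<close>

lemma syl_Int:
  assumes "prime p" "nml N X" "syl p X S"
  shows "syl p N (S \<inter> N)"
proof -
  note N = nmlD(1-3)[OF assms(2)]
  obtain T where T: "syl p N T" using ex_syl N(1) assms(1) by blast
  then obtain x where x: "x \<in> X" "T \<subseteq> cj x ` S"
    using pgrp_sub_cj_syl[OF N(2) assms(1,3), of T] sylD[OF T] N by blast
  have "cj (x\<^sup>-) t \<in> S \<inter> N" if "t \<in> T" for t
    using that x sylD[OF T] nmlD(4)[OF assms(2)] N sg_inv by (auto simp: mem_cj_image dest!: subsetD)
  then have *: "cj (x\<^sup>-) ` T \<subseteq> S \<inter> N" by blast
  have "pgrp p (S \<inter> N)" using pgrp_sub[OF sylD(3)[OF assms(3)]] sg_Int sylD(1)[OF assms(3)] N assms(1) by blast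
  moreover have "syl p N (cj (x\<^sup>-) ` T)"
    using syl_cj_eq[OF T] nml_image[OF assms(2)] sg_inv[OF N(2)] x by blast
  ultimately show ?thesis using pgrp_sub_card[OF N(1) assms(1), of "S \<inter> N" "cj (x\<^sup>-) ` T"] * by force
qed

text \<open>Each Sylow subgroup brings its full prime power into \<open>card B\<close>, so
  \<open>card X\<close> divides \<open>card B\<close>.\<close>

lemma sg_eq_of_sylows:
  assumes "sg B" "sg X" "B \<subseteq> X" "\<And>p. prime p \<Longrightarrow> \<exists>S. syl p X S \<and> S \<subseteq> B"
  shows "B = X"
proof -
  have "multiplicity p (card X) \<le> multiplicity p (card B)" if p: "prime p" for p
  proof -
    obtain S where "syl p X S" "S \<subseteq> B" using assms(4) p by blast
    then have "p ^ multiplicity p (card X) dvd card B" using sg_card_dvd assms(1) by (metis syl_def)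
    then show ?thesis using sg_card_pos[OF assms(1)] p
      by (intro multiplicity_geI) (auto simp: not_prime_unit)
  qed
  then have "card X dvd card B" using sg_card_pos[OF assms(2)] by (intro multiplicity_le_imp_dvd) auto
  then show ?thesis using assms sg_card_pos sg_finite by (metis card_seteq dvd_imp_le)
qed

text \<open>The number of Sylow \<open>r\<close>-subgroups is the index of a normalizer in
  \<open>L\<close>, hence prime to \<open>p\<close>, and the \<open>p\<close>-group \<open>A\<close>
  that permutes them fixes one.\<close>

lemma ex_invariant_syl:
  assumes pr: "prime p" "prime r" and A: "pgrp p A" and L: "sg L" "\<not> p dvd card L"
    and inv: "\<And>a. a \<in> A \<Longrightarrow> cj a ` L = L"
  shows "\<exists>R. syl r L R \<and> (\<forall>a\<in>A. cj a ` R = R)"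
proof -
  let ?\<Omega> = "{R. syl r L R}"
  obtain R0 where R0: "syl r L R0" using ex_syl L pr by blast
  have img: "?\<Omega> = (\<lambda>x. cj x ` R0) ` L"
    using syl_conjugate[OF L(1) pr(2) R0] syl_cj[OF L(1) R0] by blast
  have "card L = card (nrm L R0) * card ((\<lambda>x. cj x ` R0) ` L)"
  proof (rule card_eq_fiber_mult)
    show "finite L" using L sg_finite by blast
    fix b assume "b \<in> (\<lambda>x. cj x ` R0) ` L"
    then obtain c where c: "c \<in> L" "b = cj c ` R0" by blast
    have "{a \<in> L. cj a ` R0 = b} = lcos c (nrm L R0)"
    proof (intro Set.set_eqI iffI)
      fix a assume "a \<in> {a \<in> L. cj a ` R0 = b}"
      then have "a \<in> L" "cj (c\<^sup>-) ` cj a ` R0 = R0" using c by auto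
      then show "a \<in> lcos c (nrm L R0)" using c L by (auto simp: mem_lcos nrm_def sg_mult sg_inv)
    next
      fix a assume "a \<in> lcos c (nrm L R0)"
      then obtain d where d: "d \<in> L" "cj d ` R0 = R0" "a = c * d" by (auto simp: lcos_def nrm_def)
      then have "cj a ` R0 = b" using c by (metis cj_image_cj)
      then show "a \<in> {a \<in> L. cj a ` R0 = b}" using d c L sg_mult by auto
    qed
    then show "card {a \<in> L. cj a ` R0 = b} = card (nrm L R0)" by simp
  qed
  then have "card ?\<Omega> dvd card L" using img by simp
  then have nd: "\<not> p dvd card ?\<Omega>" using L(2) dvd_trans by blast
  have "\<exists>w\<in>?\<Omega>. \<forall>a\<in>A. cj a ` w = w"
  proof (rule ex_fixed_point[OF pr(1) _ _ _ _ _ _ nd])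
    show "sg A" "card A = p ^ (SOME n. card A = p ^ n)"
      using A(1) unfolding pgrp_def by (auto intro: someI_ex)
    show "finite ?\<Omega>" unfolding img using L sg_finite by blast
    show "cj a ` w \<in> ?\<Omega>" if "a \<in> A" "w \<in> ?\<Omega>" for a w
      using that inv syl_cj_eq by blast
  qed auto
  then show ?thesis by blast
qed

section \<open>Nilpotent groups\<close>

primrec lcs :: "'g::group_mult set \<Rightarrow> nat \<Rightarrow> 'g set" where
  "lcs X 0 = X"
| "lcs X (Suc n) = comm (lcs X n) X"

definition nilp :: "'g::group_mult set \<Rightarrow> bool" where
  "nilp X \<longleftrightarrow> (\<exists>n. lcs X n = {1})"

lemma nml_lcs: "sg X \<Longrightarrow> nml (lcs X n) X"
  by (induction n) (simp_all add: nml_refl nml_comm)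

lemma lcs_cm: "sg X \<Longrightarrow> w \<in> lcs X n \<Longrightarrow> x \<in> X \<Longrightarrow> cm w x \<in> lcs X (Suc n)"
  by (simp add: comm_mem)

lemma nilp_mono: assumes "nilp X" "sg X" "sg T" "T \<subseteq> X" shows "nilp T"
proof -
  have "lcs T n \<subseteq> lcs X n" for n by (induction n) (simp_all add: assms comm_mono)
  then show ?thesis using assms unfolding nilp_def
    by (metis nml_lcs nmlD(1) sg_one subset_singletonD empty_iff)
qed

text \<open>Take the first term of the lower central series whose intersection with \<open>W\<close>
  falls into \<open>V\<close>; the term before it supplies the element. Since \<open>V\<close> is
  any subgroup, the case \<open>W = X\<close> gives the growth of normalizers.\<close>

lemma nilp_ex_central_mod:
  assumes "nilp X" "sg X" "nml W X" "sg V" "\<not> W \<subseteq> V"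
  shows "\<exists>w\<in>W - V. \<forall>x\<in>X. cm w x \<in> V"
proof -
  define P where "P n \<longleftrightarrow> W \<inter> lcs X n \<subseteq> V" for n
  obtain n where "lcs X n = {1}" using assms(1) nilp_def by blast
  then have "P n" using assms(4) sg_one by (auto simp: P_def)
  then have "P (LEAST n. P n)" by (rule LeastI)
  moreover have "\<not> P 0" using assms nmlD(3)[OF assms(3)] by (auto simp: P_def)
  ultimately obtain m where m: "P (Suc m)" "\<not> P m"
    by (metis not_less_Least old.nat.exhaust lessI)
  then obtain w where w: "w \<in> W" "w \<in> lcs X m" "w \<notin> V" by (auto simp: P_def)
  have "cm w x \<in> V" if "x \<in> X" for x
  proof -
    have "cm w x \<in> W" using that w assms(3) unfolding cm_cj(1) by (meson nmlD sg_inv sg_mult)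
    moreover have "cm w x \<in> lcs X (Suc m)" using lcs_cm that w assms(2) by blast
    ultimately show ?thesis using m(1) by (auto simp: P_def)
  qed
  then show ?thesis using w by blast
qed

text \<open>If the lower central series does not reach 1, it becomes stationary at some non-trivial
  \<open>W\<close> with \<open>comm W X = W\<close>. Below \<open>W\<close> a maximal normal
  subgroup \<open>V\<close> is chosen; the elements of \<open>W\<close> central modulo
  \<open>V\<close> then form all of \<open>W\<close>, so that \<open>comm W X\<close> would lie in
  \<open>V\<close>.\<close>

lemma nilpI:
  assumes X: "sg X"
    and ex: "\<And>V W. nml V X \<Longrightarrow> nml W X \<Longrightarrow> V \<subset> W \<Longrightarrow> \<exists>w\<in>W - V. \<forall>x\<in>X. cm w x \<in> V"
  shows "nilp X"
proof (rule ccontr)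
  assume nn: "\<not> nilp X"
  have "\<exists>W. nml W X \<and> W \<noteq> {1} \<and> comm W X = W"
  proof (rule ccontr)
    assume no: "\<not> ?thesis"
    have "card (lcs X n) + n \<le> card X" for n
    proof (induction n)
      case (Suc n)
      have "lcs X (Suc n) \<subset> lcs X n"
        using no nml_lcs[OF X, of n] comm_nml_sub[of "lcs X n" X] nn by (auto simp: nilp_def)
      then have "card (lcs X (Suc n)) < card (lcs X n)"
        using nml_lcs[OF X] nmlD(1) sg_finite by (metis psubset_card_mono)
      then show ?case using Suc by linarith
    qed simp
    from this[of "Suc (card X)"] show False by simp
  qed
  then obtain W where W: "nml W X" "W \<noteq> {1}" "comm W X = W" by blast
  let ?S = "{V. nml V X \<and> V \<subset> W}"
  have "finite ?S" using sg_finite[OF nmlD(1)[OF W(1)]] by (auto intro: finite_subset[of _ "Pow W"])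
  moreover have "{1} \<in> ?S" using nml_one X W(2) sg_one nmlD(1)[OF W(1)] by auto
  ultimately obtain V where V: "V \<in> ?S" "\<And>U. U \<in> ?S \<Longrightarrow> V \<subseteq> U \<Longrightarrow> U = V"
    using finite_has_maximal2[of ?S "{1}"] by (metis (no_types, lifting))
  then obtain w where w: "w \<in> W - V" "\<forall>x\<in>X. cm w x \<in> V" using ex[of V W] W by blast
  \<comment> \<open>\<open>D\<close> is the preimage of the centralizer of \<open>X\<close> in
    \<open>W\<close> modulo \<open>V\<close>. It is normal and larger than \<open>V\<close>, so
    maximality of \<open>V\<close> makes it \<open>W\<close>.\<close>
  define D where "D = {w\<in>W. \<forall>x\<in>X. cm w x \<in> V}"
  have nV: "nml V X" using V by blast
  have sD: "sg D" unfolding sg_def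
  proof (intro conjI ballI)
    show "finite D" using sg_finite[OF nmlD(1)[OF W(1)]] by (auto simp: D_def)
    show "1 \<in> D" using sg_one nmlD(1) W(1) nV by (auto simp: D_def)
    fix a b assume "a \<in> D" "b \<in> D"
    then show "a * b \<in> D" using W(1) nV unfolding D_def nml_def
      by (auto simp: cm_mult_left intro!: sg_mult)
  qed
  have "nml D X" unfolding nml_def
  proof (intro conjI ballI)
    fix y d assume y: "y \<in> X" and d: "d \<in> D"
    have "cm (cj y d) x \<in> V" if "x \<in> X" for x
    proof -
      have "cm (cj y d) x = cj y (cm d (cj (y\<^sup>-) x))" by (simp add: cj_cm)
      moreover have "cj (y\<^sup>-) x \<in> X" using y that X sg_cj sg_inv by blast
      ultimately show ?thesis using d y nV by (auto simp: D_def nml_def)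
    qed
    then show "cj y d \<in> D" using d y W(1) by (auto simp: D_def nml_def)
  qed (use sD X W(1) in \<open>auto simp: D_def nml_def\<close>)
  moreover have "V \<subseteq> D"
  proof
    fix v assume v: "v \<in> V"
    then have "cm v x \<in> V" if "x \<in> X" for x using comm_nml_sub[OF nV] comm_mem[OF v that] by auto
    then show "v \<in> D" using v V by (auto simp: D_def)
  qed
  moreover have "D \<noteq> V" using w by (auto simp: D_def)
  ultimately have "D = W" using V(2)[of D] by (auto simp: D_def)
  then have "comm W X \<subseteq> V" using nV by (intro comm_least) (auto simp: D_def nml_def)
  then show False using W(3) V by blast
qed

lemma cm_power_mod:
  assumes N: "nml N X" and xy: "x \<in> X" "y \<in> X" and c: "cm x (cm x y) \<in> N"
  shows "\<exists>a\<in>N. cm (x ^ k) y = a * cm x y ^ k"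
proof (induction k)
  case 0
  then show ?case using sg_one[OF nmlD(1)[OF N]] by force
next
  case (Suc k)
  let ?c = "cm x y"
  have cX: "?c \<in> X" using sg_cm[OF nmlD(2)[OF N] xy] .
  have 1: "cm x (?c ^ i) \<in> N" for i
  proof (induction i)
    case 0
    then show ?case using sg_one[OF nmlD(1)[OF N]] by simp
  next
    case (Suc i)
    have "cm x (?c ^ Suc i) = cm x ?c * cj ?c (cm x (?c ^ i))" by (simp add: cm_def cj_def gsimps)
    then show ?case using Suc c nmlD(4)[OF N cX] sg_mult[OF nmlD(1)[OF N]] by metis
  qed
  obtain a where a: "a \<in> N" "cm (x ^ k) y = a * ?c ^ k" using Suc by blast
  have "cm (x ^ Suc k) y = cj x (cm (x ^ k) y) * ?c" by (simp add: cm_mult_left)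
  also have "\<dots> = cj x a * cm x (?c ^ k) * ?c ^ Suc k"
    unfolding a cj_mult cm_cj(2)[of x "?c ^ k"] by (simp add: mult.assoc power_commutes[symmetric])
  finally show ?case using 1 a nmlD(1,4)[OF N] xy(1) sg_mult by metis
qed

text \<open>The commutator commutes with \<open>x\<close> and \<open>y\<close> modulo
  \<open>N\<close>, so modulo \<open>N\<close> its powers with exponents \<open>n\<close> and
  \<open>m\<close> are commutators with \<open>x ^ n\<close> and \<open>y ^ m\<close>, which are
  trivial.\<close>

lemma cm_coprime_mem:
  assumes N: "nml N X" and xy: "x \<in> X" "y \<in> X" and c: "cm x (cm x y) \<in> N" "cm y (cm x y) \<in> N"
    and nm: "x ^ n = 1" "y ^ m = 1" "coprime n m"
  shows "cm x y \<in> N"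
proof -
  note sN = nmlD(1)[OF N] and X = nmlD(2)[OF N]
  have pw: "cm x y ^ n \<in> N" if "x \<in> X" "y \<in> X" "cm x (cm x y) \<in> N" "x ^ n = 1" for x y n
    using cm_power_mod[OF N that(1-3), of n] that(4) sg_inv[OF sN] inv_eqI by (metis cm_one(1))
  have "cm x y ^ n \<in> N" using pw xy c nm by blast
  moreover have "cm y (cm y x) \<in> N"
  proof -
    have "cm y (cm y x) = cj (cm y x) ((cm y (cm x y))\<^sup>-)"
      by (simp add: inv_cm[of x y, symmetric] cm_def cj_def gsimps)
    then show ?thesis using c(2) nmlD(4)[OF N] sg_cm[OF X xy(2,1)] sg_inv[OF sN] by metis
  qed
  then have "cm y x ^ m \<in> N" using pw xy nm by blast
  then have "cm x y ^ m \<in> N" by (metis inv_cm inv_power sN sg_inv)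
  ultimately show ?thesis using mem_of_coprime_powers[OF sN X sg_cm[OF X xy] _ _ nm(3)] by blast
qed

text \<open>Descent along the lower central series: once \<open>cm x y\<close> lies in a term, its
  commutators lie in the next one, and \<open>cm_coprime_mem\<close> puts \<open>cm x y\<close>
  itself there.\<close>

lemma nilp_coprime_commute:
  assumes "nilp X" "sg X" "x \<in> X" "y \<in> X" "x ^ n = 1" "y ^ m = 1" "coprime n m"
  shows "x * y = y * x"
proof -
  have "cm x y \<in> lcs X i" for i
  proof (induction i)
    case 0
    then show ?case using assms sg_cm by simp
  next
    case (Suc i)
    note N = nml_lcs[OF assms(2), of "Suc i"]
    have "cm t (cm x y) \<in> lcs X (Suc i)" if "t \<in> X" for t
      using lcs_cm[OF assms(2) Suc that] sg_inv[OF nmlD(1)[OF N]] inv_cm by metis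
    then show ?case using cm_coprime_mem[OF N assms(3,4) _ _ assms(5-7)] assms(3,4) by blast
  qed
  then have "cm x y = 1" using assms(1) unfolding nilp_def by (metis singletonD)
  then show ?thesis by (simp add: cm_eq_one_iff)
qed

lemma nilp_pel_p'el_commute:
  assumes "nilp X" "sg X" "x \<in> X" "y \<in> X" "pel p x" "p'el p y"
  shows "x * y = y * x"
  using assms nilp_coprime_commute unfolding pel_def p'el_def by (metis coprime_power_left_iff)

text \<open>Let \<open>r\<close> divide the index of \<open>V\<close> in \<open>W\<close>. The Sylow
  subgroup \<open>R\<close> fixes a non-trivial coset in the \<open>r\<close>-part of that section,
  and elements of other prime power orders commute with its representative because normal Sylow
  subgroups for different primes centralize each other. So \<open>nilpI\<close> applies.\<close>

lemma nilp_of_sylows_nml: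
  assumes X: "sg X" and S: "\<And>r R. prime r \<Longrightarrow> syl r X R \<Longrightarrow> nml R X"
  shows "nilp X"
proof (rule nilpI[OF X])
  fix V W assume VW: "nml V X" "nml W X" "V \<subset> W"
  note sV = nmlD(1)[OF VW(1)] and sW = nmlD(1)[OF VW(2)]
  obtain k where k: "card W = card V * k" using sg_card_dvd[OF sV sW] VW(3) by auto
  have "k \<noteq> 1" using k VW(3) psubset_card_mono[OF sg_finite[OF sW] VW(3)] by simp
  then obtain r where r: "prime r" "r dvd k" using prime_factor_nat by blast
  obtain R where R: "syl r X R" using ex_syl X r by blast
  have nR: "nml R X" using S r R by blast
  have RW: "syl r W (R \<inter> W)" using syl_Int[OF r(1) VW(2) R] .
  let ?Y = "R \<inter> W"
  have nY: "nml ?Y X" using nml_Int nR VW by blast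
  have "\<not> ?Y \<subseteq> V"
  proof
    assume "?Y \<subseteq> V"
    then have "card ?Y dvd card V" using sg_card_dvd nmlD(1)[OF nY] sV by blast
    then obtain j where "card V = card ?Y * j" by blast
    then show False using syl_index[OF sW r(1) RW, of "j * k"] k r(2) by simp
  qed
  define U where "U = V \<inter> ?Y"
  have nU: "nml U X" unfolding U_def using nml_Int VW nY by blast
  have UY: "U \<noteq> ?Y" using \<open>\<not> ?Y \<subseteq> V\<close> by (auto simp: U_def)
  \<comment> \<open>\<open>R\<close> fixes a nontrivial coset of \<open>U\<close> in \<open>R \<inter> W\<close>\<close>
  let ?\<Omega> = "(\<lambda>y. lcos y U) ` ?Y"
  have sU: "sg U" "U \<subseteq> ?Y" "sg ?Y" using nmlD(1) nU nY by (auto simp: U_def)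
  have inv: "cj a ` lcos y U = lcos (cj a y) U" if "a \<in> X" for a y
  proof -
    have "cj a ` lcos y U = lcos (cj a y) (cj a ` U)" by (simp add: lcos_def image_image cj_mult)
    then show ?thesis using nml_image[OF nU that] by simp
  qed
  have cardO: "card ?Y = card U * card ?\<Omega>" using card_lcosets sU by blast
  then have "card ?\<Omega> \<noteq> 1" using UY sU sg_finite card_subset_eq by (metis mult.right_neutral)
  moreover have "\<exists>n. card ?\<Omega> = r ^ n" using cardO RW r(1)
    by (metis divides_primepow_nat dvd_triv_right syl_def)
  ultimately have rO: "r dvd card ?\<Omega>" by (metis dvd_power gr0I power_0)
  have fO: "finite ?\<Omega>" using sg_finite[OF sU(3)] by blast
  let ?F = "{w\<in>?\<Omega>. \<forall>a\<in>R. cj a ` w = w}"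
  obtain n where "card R = r ^ n" using sylD(3)[OF R] pgrp_def by blast
  have RX: "R \<subseteq> X" using sylD(2)[OF R] .
  have "card ?\<Omega> mod r = card ?F mod r"
  proof (rule card_mod_fixed_points[OF r(1) sylD(1)[OF R] \<open>card R = r ^ n\<close> fO])
    show "cj a ` w \<in> ?\<Omega>" if aw: "a \<in> R" "w \<in> ?\<Omega>" for a w
    proof -
      obtain y where y: "y \<in> ?Y" "w = lcos y U" using aw by blast
      have "a \<in> X" using aw RX by blast
      then show ?thesis using inv[of a y] y nmlD(4)[OF nY] by blast
    qed
  qed auto
  then have "r dvd card ?F" using rO by (simp add: dvd_eq_mod_eq_0)
  moreover have LU: "lcos 1 U = U" by (simp add: lcos_def)
  have "U \<in> ?F"
  proof -
    have "U \<in> ?\<Omega>" using LU sg_one[OF sU(3)] by (metis (no_types, lifting) imageI)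
    then show ?thesis using nml_image[OF nU] RX by blast
  qed
  ultimately have "card ?F \<noteq> 1" "finite ?F" using r(1) fO by (auto simp: prime_nat_iff)
  then obtain w where w: "w \<in> ?F" "w \<noteq> U" using \<open>U \<in> ?F\<close>
    by (metis (no_types, lifting) card_1_singleton_iff is_singletonI' is_singleton_def empty_iff One_nat_def)
  then obtain y where y: "y \<in> ?Y" "w = lcos y U" by blast
  have yU: "y \<notin> U" using w y LU lcos_eq_iff[OF sU(1)] by (metis inverse_1 mult_1_left)
  have cmR: "cm y a \<in> U" if "a \<in> R" for a
  proof -
    have "lcos (cj a y) U = lcos y U" using w(1) y inv[of a y] that RX by blast
    then have "(cj a y)\<^sup>- * y \<in> U" using lcos_eq_iff[OF sU(1)] by blast
    then have "y\<^sup>- * cj a y \<in> U" by (metis gsimps(2) inverse_inv sU(1) sg_inv)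
    then have "(y\<^sup>- * cj a y)\<^sup>- \<in> U" using sU sg_inv by blast
    then have "cj y ((y\<^sup>- * cj a y)\<^sup>-) \<in> U" using nmlD(4)[OF nU] y nmlD(3)[OF nY] by blast
    then show ?thesis by (simp add: cm_def cj_def gsimps)
  qed
  have "cm y x \<in> V" if x: "x \<in> X" for x
  proof -
    obtain i j where ij: "x = x ^ i * x ^ j" "pel r (x ^ i)" "p'el r (x ^ j)"
      using pel_p'el_decompose[OF X x r(1)] by blast
    have "pgrp r (cyc (x ^ i))" using pgrp_cyc X x sg_power r(1) ij by blast
    then obtain z where "z \<in> X" "cyc (x ^ i) \<subseteq> cj z ` R"
      using pgrp_sub_cj_syl[OF X r(1) R] cyc_least[OF X] sg_power[OF X x] by blast
    then have xi: "x ^ i \<in> R" using nml_image[OF nR] cyc_self by blast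
    have "y * x ^ j = x ^ j * y"
    proof -
      obtain m where m: "coprime r m" "(x ^ j) ^ m = 1" using ij(3) p'el_def by blast
      have "cm y (x ^ j) \<in> R" using y nmlD(1,4)[OF nR] sg_power[OF X x] unfolding cm_cj(1)
        by (meson IntD1 sg_inv sg_mult)
      have "cj (x ^ j) y = y"
      proof -
        \<comment> \<open>every \<open>r'\<close>-element lies in the normal Sylow subgroups for the other primes\<close>
        have comm: "y * z = z * y" if z: "z \<in> X" "pel q z" "prime q" "q \<noteq> r" for z q
        proof -
          obtain Q where Q: "syl q X Q" using ex_syl X z by blast
          have nQ: "nml Q X" using S Q z by blast
          obtain t where "t \<in> X" "cyc z \<subseteq> cj t ` Q"
            using pgrp_sub_cj_syl[OF X z(3) Q, of "cyc z"] cyc_least[OF X] pgrp_cyc[OF X] z by blast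
          then have zQ: "z \<in> Q" using nml_image[OF nQ] cyc_self by blast
          have "cm y z \<in> R" using y zQ nmlD(1,4)[OF nR] z unfolding cm_cj(1)
            by (meson IntD1 sg_inv sg_mult)
          moreover have "cm y z \<in> Q" using y zQ nmlD(1,4)[OF nQ] RX unfolding cm_cj(2)
            by (meson IntD1 sg_inv sg_mult subsetD)
          moreover have "coprime r q" using z r by (metis primes_coprime)
          moreover obtain n m where "cm y z ^ (r ^ n) = 1" "cm y z ^ (q ^ m) = 1"
            using calculation(1,2) pgrp_pel[OF sylD(3)[OF R]] pgrp_pel[OF sylD(3)[OF Q]] unfolding pel_def by blast
          ultimately have "cm y z = 1"
            using eq_one_of_coprime_powers[OF sylD(1)[OF R], of "cm y z" "r ^ n" "q ^ m"] by auto
          then show ?thesis by (simp add: cm_eq_one_iff)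
        qed
        \<comment> \<open>It is enough to test elements of prime power order: the centralizer of
          \<open>y\<close> in \<open>cyc (x ^ j)\<close> contains all Sylow subgroups of this cyclic
          group.\<close>
        have "x ^ j \<in> cent (cyc (x ^ j)) {y}"
        proof -
          have sc: "sg (cyc (x ^ j))" using sg_cyc X sg_power x by blast
          have "cent (cyc (x ^ j)) {y} = cyc (x ^ j)"
          proof (rule sg_eq_of_sylows[OF sg_cent[OF sc] sc cent_sub])
            fix q :: nat assume q: "prime q"
            obtain Q where Q: "syl q (cyc (x ^ j)) Q" using ex_syl[OF sc q] by blast
            have "z \<in> cent (cyc (x ^ j)) {y}" if "z \<in> Q" for z
            proof (cases "q = r")
              case True
              have zc: "z \<in> cyc (x ^ j)" using sylD(2)[OF Q] that by blast
              then have "p'el r z" using p'el_power[OF ij(3)] by (auto simp: mem_cyc)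
              then have "z = 1" using pgrp_pel[OF sylD(3)[OF Q] that] True pel_p'el_one[OF sc zc r(1)] by blast
              then show ?thesis by (simp add: cent_def)
            next
              case False
              have zc: "z \<in> cyc (x ^ j)" using sylD(2)[OF Q] that by blast
              then have "z \<in> X" using cyc_least[OF X sg_power[OF X x]] by blast
              then have "y * z = z * y" using comm pgrp_pel[OF sylD(3)[OF Q] that] q False by blast
              then show ?thesis using zc by (simp add: cent_def)
            qed
            then show "\<exists>S. syl q (cyc (x ^ j)) S \<and> S \<subseteq> cent (cyc (x ^ j)) {y}" using Q by blast
          qed
          then show ?thesis by simp
        qed
        then show ?thesis by (simp add: cent_def cj_eq_self_iff)
      qed
      then show ?thesis by (simp add: cj_eq_self_iff)
    qed
    then have "cm y x = cm y (x ^ i)"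
      using ij(1) by (metis (no_types, lifting) cj_cj cj_eq_self_iff cj_inv cm_cj(1))
    then show ?thesis using cmR xi by (auto simp: U_def)
  qed
  moreover have "y \<in> W - V" using y yU by (auto simp: U_def)
  ultimately show "\<exists>w\<in>W - V. \<forall>x\<in>X. cm w x \<in> V" by blast
qed

lemma nilp_pgrp: assumes "prime p" "pgrp p X" shows "nilp X"
proof (rule nilp_of_sylows_nml)
  show X: "sg X" using assms pgrp_def by blast
  fix r R assume r: "prime r" and R: "syl r X R"
  show "nml R X"
  proof (cases "r = p")
    case True
    then have "syl p X X" using R by (metis (no_types, lifting) X assms(1,2) card_cj nml_image nml_refl
          pgrp_def pgrp_sub_card pgrp_sub_syl subset_refl sylD(2) subset_antisym)
    then have "R = X" using R True by (metis X card_subset_eq sg_finite syl_def)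
    then show ?thesis using X nml_refl by blast
  next
    case False
    obtain n where "card X = p ^ n" using assms pgrp_def by blast
    then have "multiplicity r (card X) = 0"
      using False r assms(1) by (metis multiplicity_distinct_prime_power)
    then have "R = {1}" using R sg_eq_one_iff by (metis power_0 syl_def)
    then show ?thesis using X nml_one by blast
  qed
qed

text \<open>An element that is central modulo \<open>V\<close> normalizes \<open>V\<close>, since
  its commutators with \<open>V\<close> fall into \<open>V\<close>.\<close>

lemma nilp_normalizer_grows:
  assumes "nilp X" "sg X" "sg V" "V \<subseteq> X" "V \<noteq> X"
  shows "\<exists>w\<in>X - V. cj w ` V = V"
proof -
  obtain w where w: "w \<in> X - V" "\<forall>x\<in>X. cm w x \<in> V"
    using nilp_ex_central_mod[OF assms(1,2) nml_refl[OF assms(2)] assms(3)] assms by blast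
  have "cj w v \<in> V" if "v \<in> V" for v
  proof -
    have "cj w v = cm w v * v" by (simp add: cm_cj(2) mult.assoc)
    moreover have "cm w v \<in> V" using w that assms(4) by blast
    ultimately show ?thesis using that sg_mult[OF assms(3)] by simp
  qed
  then show ?thesis using w cj_image_eqI sg_finite assms(3) by blast
qed

text \<open>The normalizer of a Sylow subgroup is its own normalizer, because \<open>S\<close> is
  the only conjugate of \<open>S\<close> inside it; in a nilpotent group only the whole group has
  this property.\<close>

lemma nilp_syl_nml:
  assumes "nilp X" "sg X" "prime p" "syl p X S"
  shows "nml S X"
proof (rule ccontr)
  assume "\<not> nml S X"
  then have "nrm X S \<noteq> X" using nml_iff_nrm assms(2) sylD[OF assms(4)] by blast
  then obtain w where w: "w \<in> X - nrm X S" "cj w ` nrm X S = nrm X S"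
    using nilp_normalizer_grows[OF assms(1,2) sg_nrm[OF assms(2)] nrm_sub] by blast
  have nS: "nml S (nrm X S)" using nml_nrm assms(2) sylD[OF assms(4)] by blast
  have 1: "pgrp p (cj w ` S)" "cj w ` S \<subseteq> nrm X S"
    using pgrp_cj sylD(3)[OF assms(4)] w nmlD(3)[OF nS] by blast+
  have "syl p (nrm X S) S"
  proof -
    obtain T where T: "syl p (nrm X S) T" "S \<subseteq> T"
      using pgrp_sub_syl[OF sg_nrm[OF assms(2)] assms(3) sylD(3)[OF assms(4)] nmlD(3)[OF nS]] by blast
    then have "T = S" using pgrp_sub_card[OF assms(2,3) sylD(3)[OF T(1)] _ assms(4)] sylD(2)[OF T(1)] nrm_sub by blast
    then show ?thesis using T by blast
  qed
  then obtain z where z: "z \<in> nrm X S" "cj w ` S \<subseteq> cj z ` S"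
    using pgrp_sub_cj_syl[OF sg_nrm[OF assms(2)] assms(3) _ 1] by blast
  then have "cj w ` S \<subseteq> S" by (auto simp: nrm_def)
  then have "cj w ` S = S" using sylD(1)[OF assms(4)] by (metis card_cj card_subset_eq sg_finite)
  then show False using w by (auto simp: nrm_def)
qed

section \<open>Extremal subgroups and abelian quotients\<close>

lemma ex_maximal_set:
  assumes "finite U" "P A" "\<And>A. P A \<Longrightarrow> A \<subseteq> U"
  shows "\<exists>M. P M \<and> A \<subseteq> M \<and> (\<forall>B. P B \<longrightarrow> M \<subseteq> B \<longrightarrow> B = M)"
proof -
  have "finite {B. P B}" using assms(1,3) by (auto intro: finite_subset[of _ "Pow U"])
  then show ?thesis using finite_has_maximal2[of "{B. P B}" A] assms(2) by auto
qed

lemma ex_minimal_set: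
  assumes "P (A :: 'a set)" "finite A"
  shows "\<exists>M. P M \<and> M \<subseteq> A \<and> (\<forall>B. P B \<longrightarrow> B \<subseteq> M \<longrightarrow> B = M)"
proof -
  have "finite {B. P B \<and> B \<subseteq> A}" using assms(2) by (auto intro: finite_subset[of _ "Pow A"])
  then obtain M where "M \<in> {B. P B \<and> B \<subseteq> A}" "\<forall>B\<in>{B. P B \<and> B \<subseteq> A}. B \<subseteq> M \<longrightarrow> M = B"
    using finite_has_minimal2[of "{B. P B \<and> B \<subseteq> A}" A] assms by blast
  then show ?thesis by (intro exI[of _ M]) blast
qed

lemma comm_cyc: "comm (cyc x) (cyc x) = {1}"
proof
  show "comm (cyc x) (cyc x) \<subseteq> {1}" by (rule comm_least) (auto simp: cm_eq_one_iff intro: cyc_commute)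
  show "{1} \<subseteq> comm (cyc x) (cyc x)" using comm_mem[of 1 "cyc x" 1 "cyc x"] by simp
qed

lemma setmul_trivial [simp]: "N \<bullet> {1} = N"
  by (auto simp: setmul_def)

lemma comm_sub_of_cyclic_quotient:
  assumes "nml N X" "x \<in> X" "X = N \<bullet> cyc x"
  shows "comm X X \<subseteq> N"
  using comm_setmul_sub[of N "cyc x"] assms sg_cyc nmlD(2) by (metis comm_cyc setmul_trivial)

text \<open>For a maximal proper normal \<open>W\<close> above \<open>V\<close>, an element
  \<open>w\<close> central modulo \<open>W\<close> makes \<open>W \<bullet> cyc w\<close> normal,
  hence everything, and the quotient by \<open>W\<close> is cyclic. This provides non-trivial
  abelian quotients that kill a prescribed \<open>V\<close>.\<close>

lemma nilp_ex_nml_derived: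
  assumes "nilp X" "sg X" "nml V X" "V \<noteq> X"
  shows "\<exists>W. nml W X \<and> V \<subseteq> W \<and> W \<noteq> X \<and> comm X X \<subseteq> W"
proof -
  obtain W where W: "nml W X \<and> W \<noteq> X" "V \<subseteq> W" "\<And>B. nml B X \<and> B \<noteq> X \<Longrightarrow> W \<subseteq> B \<Longrightarrow> B = W"
    using ex_maximal_set[of X "\<lambda>W. nml W X \<and> W \<noteq> X" V] assms(3,4) sg_finite[OF assms(2)] nmlD(3)[of _ X] by auto
  obtain w where w: "w \<in> X - W" "\<forall>x\<in>X. cm w x \<in> W"
    using nilp_ex_central_mod[OF assms(1,2) nml_refl[OF assms(2)], of W] W(1) nmlD(1,3)[of W X] by blast
  let ?C = "W \<bullet> cyc w"
  have sC: "sg (cyc w)" "cyc w \<subseteq> X" using sg_cyc cyc_least assms(2) w by blast+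
  have "nml ?C X" unfolding nml_def
  proof (intro conjI ballI)
    show "sg ?C" using sg_nml_setmul W(1) sC by blast
    show "?C \<subseteq> X" using setmul_least assms(2) W(1) nmlD(3) sC by blast
    fix x n assume x: "x \<in> X" and n: "n \<in> ?C"
    have one: "cj x w \<in> ?C"
    proof -
      have "cj x w = (cm w x)\<^sup>- * w" unfolding inv_cm by (simp add: cm_cj(2)[of x w] mult.assoc)
      then show ?thesis using w x W(1) nmlD(1) sg_inv by (metis cyc_self setmulI)
    qed
    have sg: "sg ?C" using sg_nml_setmul W(1) sC by blast
    obtain a i where ai: "a \<in> W" "n = a * w ^ i" using n by (auto elim!: setmulE simp: mem_cyc)
    have "cj x a \<in> ?C" using ai x W(1) nmlD(4) setmul_left[OF sC(1), of W] by blast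
    moreover have "cj x (w ^ i) \<in> ?C" using one sg_power[OF sg] by (simp add: cj_power)
    ultimately show "cj x n \<in> ?C" using ai sg_mult[OF sg] by (simp add: cj_mult)
  qed (use assms in auto)
  moreover have "W \<subseteq> ?C" using setmul_left sC by blast
  moreover have "?C \<noteq> W"
  proof
    assume "?C = W"
    then have "w \<in> W" using setmul_right[of W "cyc w"] W(1) nmlD(1) cyc_self by blast
    then show False using w by blast
  qed
  ultimately have "?C = X" using W(3) by blast
  then have "comm X X \<subseteq> W" using comm_sub_of_cyclic_quotient W(1) w by (metis DiffD1)
  then show ?thesis using W by blast
qed

lemma nilp_perfect: assumes "nilp X" "sg X" "comm X X = X" shows "X = {1}"
  using nilp_ex_nml_derived[OF assms(1,2) nml_one[OF assms(2)]] assms(3) nmlD(3) by blast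

lemma nilp_center: assumes "nilp X" "sg X" "X \<noteq> {1}" shows "\<exists>w\<in>X. w \<noteq> 1 \<and> (\<forall>x\<in>X. w * x = x * w)"
proof -
  have "\<not> X \<subseteq> {1}" using assms sg_one by blast
  then obtain w where w: "w \<in> X - {1}" "\<forall>x\<in>X. cm w x \<in> {1}"
    using nilp_ex_central_mod[OF assms(1,2) nml_refl[OF assms(2)] sg_trivial] by metis
  then have "\<forall>x\<in>X. w * x = x * w" by (simp add: cm_eq_one_iff)
  then show ?thesis using w by blast
qed

section \<open>Subnormal subgroups\<close>

inductive sn :: "'g::group_mult set \<Rightarrow> 'g set \<Rightarrow> bool" for X where
  top: "sg X \<Longrightarrow> sn X X"
| step: "sn X Y \<Longrightarrow> nml T Y \<Longrightarrow> sn X T"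

lemma sn_sg: "sn X T \<Longrightarrow> sg X" "sn X T \<Longrightarrow> sg T" "sn X T \<Longrightarrow> T \<subseteq> X"
  by (induction rule: sn.induct) (auto simp: nml_def)

lemma sn_nml: "nml T X \<Longrightarrow> sn X T"
  using sn.step[OF sn.top] nmlD(2) by blast

lemma sn_Int: "sn X T \<Longrightarrow> sg Y \<Longrightarrow> Y \<subseteq> X \<Longrightarrow> sn Y (T \<inter> Y)"
proof (induction rule: sn.induct)
  case top
  then show ?case using sn.top[of Y] by (simp add: Int_absorb1)
next
  case (step Z T)
  have "nml (T \<inter> Y) (Z \<inter> Y)"
    using step.hyps(2) step.prems sn_sg(2)[OF step.hyps(1)] by (auto simp: nml_def sg_Int sg_cj)
  then show ?case using step sn.step by blast
qed

lemma sn_restrict: "sn X T \<Longrightarrow> sg Y \<Longrightarrow> Y \<subseteq> X \<Longrightarrow> T \<subseteq> Y \<Longrightarrow> sn Y T"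
  using sn_Int by (metis Int_absorb2)

lemma sn_proper: "sn X T \<Longrightarrow> T \<noteq> X \<Longrightarrow> \<exists>N. nml N X \<and> N \<noteq> X \<and> T \<subseteq> N"
proof (induction rule: sn.induct)
  case (step Y T)
  then show ?case using nmlD(3)[OF step.hyps(2)] by (cases "Y = X") blast+
qed simp

text \<open>Induction through a proper normal \<open>N\<close> above \<open>T\<close>: as
  \<open>S \<inter> N\<close> is Sylow in \<open>N\<close>, it already contains \<open>T\<close>.
  The claim holds for every Sylow \<open>S\<close>, which is what puts \<open>T\<close> into
  \<open>core p X\<close>.\<close>

lemma sn_pgrp_sub_syl:
  assumes "prime p" "sn X T" "pgrp p T" "syl p X S"
  shows "T \<subseteq> S"
  using assms(2-)
proof (induction "card X" arbitrary: X S rule: less_induct)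
  case less
  show ?case
  proof (cases "T = X")
    case True
    then show ?thesis using pgrp_sub_card[OF sn_sg(1)[OF less.prems(1)] assms(1) less.prems(2) _ less.prems(3)]
      sylD(2)[OF less.prems(3)] by blast
  next
    case False
    then obtain N where N: "nml N X" "N \<noteq> X" "T \<subseteq> N" using sn_proper[OF less.prems(1)] by blast
    then have "card N < card X" by (metis nmlD(2,3) psubsetI psubset_card_mono sg_finite)
    moreover have "sn N T" using sn_restrict[OF less.prems(1) nmlD(1,3)[OF N(1)] N(3)] .
    ultimately have "T \<subseteq> S \<inter> N" using less.hyps less.prems(2) syl_Int[OF assms(1) N(1) less.prems(3)] by blast
    then show ?thesis by blast
  qed
qed

text \<open>By the preceding lemma \<open>R\<close> lies in each of its conjugates, and they have
  the same order.\<close>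

lemma sn_syl_nml:
  assumes "prime p" "sg X" "sn X R" "syl p X R"
  shows "nml R X"
proof -
  have "cj x ` R = R" if "x \<in> X" for x
    using sn_pgrp_sub_syl[OF assms(1,3) sylD(3)[OF assms(4)] syl_cj[OF assms(2,4) that]] sylD(1)[OF assms(4)]
    by (metis card_cj card_subset_eq finite_imageI sg_finite)
  then show ?thesis unfolding nml_def using assms sylD[OF assms(4)] by blast
qed

section \<open>Transfer\<close>

lemma normal_rec: "sg X \<Longrightarrow> N \<lhd> rec X \<longleftrightarrow> nml N X"
proof -
  assume X: "sg X"
  have "(\<forall>x\<in>X. \<forall>h\<in>N. x * h * inv\<^bsub>rec X\<^esub> x \<in> N) \<longleftrightarrow> (\<forall>x\<in>X. \<forall>h\<in>N. cj x h \<in> N)"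
    using X by (simp add: cj_def)
  then show ?thesis unfolding group.normal_inv_iff[OF group_rec[OF X]] subgroup_rec[OF X] nml_def
    using X by auto
qed

text \<open>Packages the factor group of \<open>M\<close> by \<open>D\<close> as the abelian target
  of a transfer; the fourth part says that the kernel is exactly \<open>D\<close>.\<close>

lemma abelian_quotient:
  assumes D: "nml D M" and cD: "comm M M \<subseteq> D"
  defines "\<phi> \<equiv> \<lambda>m. D #>\<^bsub>rec M\<^esub> m" and "A \<equiv> rec M Mod D"
  shows "comm_group A" "\<And>m. m \<in> M \<Longrightarrow> \<phi> m \<in> carrier A"
    "\<And>m n. m \<in> M \<Longrightarrow> n \<in> M \<Longrightarrow> \<phi> (m * n) = \<phi> m \<otimes>\<^bsub>A\<^esub> \<phi> n"
    "\<And>m. m \<in> M \<Longrightarrow> \<phi> m = \<one>\<^bsub>A\<^esub> \<longleftrightarrow> m \<in> D" "carrier A = \<phi> ` M"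
proof -
  note M = nmlD(2)[OF D]
  interpret M: group "rec M" using group_rec[OF M] .
  interpret N: normal D "rec M" using normal_rec[OF M] D by blast
  show car: "carrier A = \<phi> ` M"
    by (auto simp: A_def \<phi>_def FactGroup_def RCOSETS_def)
  then show cl: "\<phi> m \<in> carrier A" if "m \<in> M" for m using that by blast
  show hom: "\<phi> (m * n) = \<phi> m \<otimes>\<^bsub>A\<^esub> \<phi> n" if "m \<in> M" "n \<in> M" for m n
    using N.rcos_sum[of m n] that by (simp add: A_def \<phi>_def FactGroup_def)
  have eq: "\<phi> m = D \<longleftrightarrow> m \<in> D" if "m \<in> M" for m
    unfolding \<phi>_def using that N.subgroup_axioms M.coset_join1[of D m] M.coset_join2[of m D] by auto
  then show one: "\<phi> m = \<one>\<^bsub>A\<^esub> \<longleftrightarrow> m \<in> D" if "m \<in> M" for m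
    using that by (simp add: A_def FactGroup_def)
  have "group A" unfolding A_def by (rule N.factorgroup_is_group)
  then show "comm_group A"
  proof (rule group.group_comm_groupI)
    fix a b assume "a \<in> carrier A" "b \<in> carrier A"
    then obtain m n where mn: "m \<in> M" "n \<in> M" "a = \<phi> m" "b = \<phi> n" unfolding car by (elim imageE)
    have "m * n = cm m n * (n * m)" by (simp add: cm_def mult.assoc)
    moreover have "cm m n \<in> D" using subsetD[OF cD comm_mem[OF mn(1,2)]] .
    moreover have nm: "n * m \<in> M" "cm m n \<in> M" using mn sg_mult[OF M] sg_cm[OF M] by auto
    ultimately have "\<phi> (m * n) = \<one>\<^bsub>A\<^esub> \<otimes>\<^bsub>A\<^esub> \<phi> (n * m)"
      using hom[of "cm m n" "n * m"] one[of "cm m n"] by simp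
    also have "\<dots> = \<phi> (n * m)" using \<open>group A\<close> cl[OF nm(1)] by (simp add: group.is_monoid monoid.l_one)
    finally show "a \<otimes>\<^bsub>A\<^esub> b = b \<otimes>\<^bsub>A\<^esub> a" using mn hom by simp
  qed
qed

text \<open>In the transfer the group acts by right multiplication, so right cosets take the place
  of \<open>lcos\<close>.\<close>

definition rcos :: "'g::group_mult set \<Rightarrow> 'g \<Rightarrow> 'g set" where
  "rcos H x = (\<lambda>h. h * x) ` H"

lemma mem_rcos: "y \<in> rcos H x \<longleftrightarrow> y * x\<^sup>- \<in> H"
proof -
  have "y = h * x \<longleftrightarrow> y * x\<^sup>- = h" for h by (metis inverse_inv mult.assoc mult_1_right right_inv)
  then show ?thesis unfolding rcos_def by (simp add: image_iff)
qed

lemma rcos_eq_iff: assumes "sg H" shows "rcos H x = rcos H y \<longleftrightarrow> x * y\<^sup>- \<in> H"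
proof
  assume "rcos H x = rcos H y"
  then show "x * y\<^sup>- \<in> H" by (metis assms mem_rcos right_inv sg_one)
next
  assume *: "x * y\<^sup>- \<in> H"
  have "z * y\<^sup>- = (z * x\<^sup>-) * (x * y\<^sup>-)" for z by (simp add: gsimps)
  then have "z * x\<^sup>- \<in> H \<longleftrightarrow> z * y\<^sup>- \<in> H" for z using * assms sg_mult_iff(2) by metis
  then show "rcos H x = rcos H y" by (auto simp: mem_rcos)
qed

lemma card_rcosets:
  assumes "sg H" "sg X" "H \<subseteq> X"
  shows "card X = card H * card (rcos H ` X)"
proof (rule card_eq_fiber_mult)
  show "finite X" using assms sg_finite by blast
  fix b assume "b \<in> rcos H ` X"
  then obtain x where x: "x \<in> X" "b = rcos H x" by blast
  have "a \<in> X" if "a * x\<^sup>- \<in> H" for a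
    using that x assms by (meson sg_inv sg_mult_iff(2) subsetD)
  then have "{a \<in> X. rcos H a = b} = rcos H x"
    unfolding x rcos_eq_iff[OF assms(1)] by (auto simp: mem_rcos)
  moreover have "card (rcos H x) = card H"
    unfolding rcos_def by (rule card_image) (simp add: inj_on_def)
  ultimately show "card {a \<in> X. rcos H a = b} = card H" by simp
qed

text \<open>\<open>V\<close> below is the transfer of the homomorphism \<open>\<phi>\<close> from
  the subgroup \<open>H\<close> to all of \<open>X\<close>.\<close>

locale transfer = comm_group A for A :: "('b, 'c) monoid_scheme" (structure) +
  fixes X H :: "'g::group_mult set" and \<phi> :: "'g \<Rightarrow> 'b"
  assumes X: "sg X" and H: "sg H" and HX: "H \<subseteq> X"
    and phi_cl: "\<And>h. h \<in> H \<Longrightarrow> \<phi> h \<in> carrier A"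
    and phi_mult: "\<And>h k. h \<in> H \<Longrightarrow> k \<in> H \<Longrightarrow> \<phi> (h * k) = \<phi> h \<otimes> \<phi> k"
begin

lemma cancel_inv: "a \<in> carrier A \<Longrightarrow> b \<in> carrier A \<Longrightarrow> a \<otimes> (inv a \<otimes> b) = b"
  by (simp flip: m_assoc)

text \<open>An extension of \<open>\<phi>\<close> to the whole type that is equivariant under left
  multiplication by \<open>H\<close> (\<open>psi_mult\<close>). It records the \<open>H\<close>-part
  of \<open>g\<close> relative to a chosen coset representative, so that no explicit transversal has
  to be carried along.\<close>

definition \<psi> :: "'g \<Rightarrow> 'b" where
  "\<psi> g = \<phi> (g * (SOME y. y \<in> rcos H g)\<^sup>-)"

lemma rep_rcos: "(SOME y. y \<in> rcos H g) \<in> rcos H g"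
  by (rule someI[of _ g]) (use H sg_one in \<open>simp add: mem_rcos\<close>)

lemma rep_in: "g * (SOME y. y \<in> rcos H g)\<^sup>- \<in> H"
  using rep_rcos[of g] sg_inv[OF H] unfolding mem_rcos by (metis inverse_inv inverse_mult)

lemma psi_cl: "\<psi> g \<in> carrier A"
  unfolding \<psi>_def using rep_in phi_cl by blast

lemma psi_mult: "h \<in> H \<Longrightarrow> \<psi> (h * g) = \<phi> h \<otimes> \<psi> g"
proof -
  assume h: "h \<in> H"
  then have "rcos H (h * g) = rcos H g" by (simp add: rcos_eq_iff[OF H] mult.assoc)
  then show ?thesis unfolding \<psi>_def using phi_mult[OF h rep_in[of g]] by (simp add: mult.assoc)
qed

definition rp :: "'g set \<Rightarrow> 'g" where "rp C = (SOME g. g \<in> C)"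

lemma rp_rcos: "\<exists>h\<in>H. rp (rcos H g) = h * g"
  using rep_rcos[of g] unfolding rp_def rcos_def by blast

definition ratio :: "'g \<Rightarrow> 'g set \<Rightarrow> 'b" where
  "ratio x C = \<psi> (rp C * x) \<otimes> inv (\<psi> (rp C))"

lemma ratio_cl: "ratio x C \<in> carrier A"
  by (simp add: ratio_def psi_cl)

text \<open>Changing the representative multiplies both values of \<open>\<psi>\<close> by the same
  \<open>\<phi> h\<close>, which cancels in the abelian group \<open>A\<close>. So the ratio belongs
  to the coset.\<close>

lemma ratio_rcos: "ratio x (rcos H g) = \<psi> (g * x) \<otimes> inv (\<psi> g)"
proof -
  obtain h where h: "h \<in> H" "rp (rcos H g) = h * g" using rp_rcos by blast
  have "ratio x (rcos H g) = (\<phi> h \<otimes> \<psi> (g * x)) \<otimes> inv (\<phi> h \<otimes> \<psi> g)"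
    using psi_mult[OF h(1)] by (simp add: ratio_def h mult.assoc)
  also have "\<dots> = (\<phi> h \<otimes> inv (\<phi> h)) \<otimes> (\<psi> (g * x) \<otimes> inv (\<psi> g))"
    using phi_cl[OF h(1)] psi_cl by (simp add: inv_mult m_ac cancel_inv)
  finally show ?thesis using phi_cl[OF h(1)] psi_cl by simp
qed

definition V :: "'g \<Rightarrow> 'b" where
  "V x = finprod A (ratio x) (rcos H ` X)"

lemma V_cl: "V x \<in> carrier A"
  unfolding V_def by (rule finprod_closed) (simp add: ratio_cl)

definition sh :: "'g \<Rightarrow> 'g set \<Rightarrow> 'g set" where "sh x C = (\<lambda>y. y * x) ` C"

lemma sh_rcos: "sh x (rcos H g) = rcos H (g * x)"
  by (simp add: sh_def rcos_def image_image mult.assoc)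

lemma inj_sh: "inj_on (sh x) S"
  unfolding sh_def by (rule inj_onI) (simp add: inj_image_eq_iff inj_on_def)

lemma sh_image: assumes "\<And>g. g \<in> Y \<Longrightarrow> g * x \<in> Y" "finite Y"
  shows "sh x ` rcos H ` Y = rcos H ` Y"
proof -
  have "sh x ` rcos H ` Y \<subseteq> rcos H ` Y" using assms(1) by (auto simp: sh_rcos)
  moreover have "card (sh x ` rcos H ` Y) = card (rcos H ` Y)" by (rule card_image[OF inj_sh])
  ultimately show ?thesis using assms(2) by (metis card_subset_eq finite_imageI)
qed

text \<open>The ratios telescope: right multiplication by \<open>x\<close> permutes the cosets, and
  after reindexing \<open>V y\<close> along it the factors \<open>\<psi> (g * x)\<close>
  cancel.\<close>

lemma V_mult: assumes "x \<in> X" "y \<in> X" shows "V (x * y) = V x \<otimes> V y"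
proof -
  let ?\<Omega> = "rcos H ` X"
  have sh: "sh x ` ?\<Omega> = ?\<Omega>" by (rule sh_image) (use assms X sg_mult sg_finite in auto)
  have "V y = finprod A (ratio y) (sh x ` ?\<Omega>)" by (simp add: V_def sh)
  also have "\<dots> = finprod A (\<lambda>C. ratio y (sh x C)) ?\<Omega>"
    by (rule finprod_reindex) (auto simp: ratio_cl inj_sh)
  finally have "V x \<otimes> V y = finprod A (\<lambda>C. ratio x C \<otimes> ratio y (sh x C)) ?\<Omega>"
    unfolding V_def by (subst finprod_multf) (auto simp: ratio_cl)
  also have "\<dots> = V (x * y)" unfolding V_def
  proof (rule finprod_cong')
    fix C assume "C \<in> ?\<Omega>"
    then obtain g where g: "C = rcos H g" by blast
    have "ratio x C \<otimes> ratio y (sh x C)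
        = \<psi> (g * x) \<otimes> inv \<psi> g \<otimes> (\<psi> (g * (x * y)) \<otimes> inv \<psi> (g * x))"
      by (simp add: g sh_rcos ratio_rcos mult.assoc)
    also have "\<dots> = (\<psi> (g * x) \<otimes> inv \<psi> (g * x)) \<otimes> (\<psi> (g * (x * y)) \<otimes> inv \<psi> g)"
      using psi_cl by (simp add: m_ac cancel_inv)
    also have "\<dots> = ratio (x * y) C" using psi_cl by (simp add: g ratio_rcos)
    finally show "ratio x C \<otimes> ratio y (sh x C) = ratio (x * y) C" .
  qed (auto simp: ratio_cl)
  finally show ?thesis by simp
qed

text \<open>On the cosets outside \<open>N\<close> the section \<open>\<psi>\<close> can be replaced by one that is invariant under \<open>x\<close>,
  so these cosets do not contribute.\<close>

lemma ex_invariant_section: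
  assumes x: "x \<in> H" and N: "sg N" "H \<subseteq> N" "N \<subseteq> X"
    and out: "\<And>t k. t \<in> X - N \<Longrightarrow> cj t (x ^ k) \<in> H \<Longrightarrow> \<phi> (cj t (x ^ k)) = \<one>"
  shows "\<exists>\<psi>'. (\<forall>g\<in>X - N. \<psi>' g \<in> carrier A \<and> (\<forall>h\<in>H. \<psi>' (h * g) = \<phi> h \<otimes> \<psi>' g) \<and> \<psi>' (g * x) = \<psi>' g)"
proof -
  \<comment> \<open>\<open>DC g\<close> is the double coset of \<open>g\<close> for \<open>H\<close>
    and the powers of \<open>x\<close>. Writing \<open>g = h * \<tau> g * x ^ i\<close> and taking
    \<open>\<phi> h\<close> is invariant under \<open>x\<close> by construction; the assumption
    \<open>out\<close> is what makes this value independent of the chosen \<open>h\<close>.\<close>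
  define DC where "DC g = {h * g * x ^ i | h i. h \<in> H}" for g
  define \<tau> where "\<tau> g = (SOME t. t \<in> DC g)" for g
  define \<psi>' where "\<psi>' g = \<phi> (SOME h. h \<in> H \<and> (\<exists>i. g = h * \<tau> g * x ^ i))" for g
  obtain m where m: "m > 0" "x ^ m = 1" using ex_power_eq_one[OF H x] by blast
  have xinv: "\<exists>k. (x ^ i)\<^sup>- = x ^ k" for i
    using sg_inv[OF sg_cyc[OF H x], of "x ^ i"] by (auto simp: mem_cyc)
  have self: "g \<in> DC g" for g unfolding DC_def using sg_one[OF H] by (metis (mono_tags, lifting) CollectI mult_1_left mult_1_right power_0)
  have DCsub: "DC (h * g * x ^ i) \<subseteq> DC g" if "h \<in> H" for h g i
  proof
    fix y assume "y \<in> DC (h * g * x ^ i)"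
    then obtain k j where "k \<in> H" "y = k * (h * g * x ^ i) * x ^ j" unfolding DC_def by blast
    then have "y = (k * h) * g * x ^ (i + j)" "k * h \<in> H" using that H sg_mult by (auto simp: mult.assoc power_add)
    then show "y \<in> DC g" unfolding DC_def by blast
  qed
  have DCeq: "DC (h * g * x ^ i) = DC g" if h: "h \<in> H" for h g i
  proof
    obtain k where "(x ^ i)\<^sup>- = x ^ k" using xinv by blast
    then have "g = h\<^sup>- * (h * g * x ^ i) * x ^ k" by (metis inv_mult_cancel mult.assoc mult_1_right right_inv)
    then show "DC g \<subseteq> DC (h * g * x ^ i)" using DCsub[of "h\<^sup>-" "h * g * x ^ i" k] h H sg_inv by metis
  qed (rule DCsub[OF h])
  have \<tau>DC: "\<tau> g \<in> DC g" for g unfolding \<tau>_def by (rule someI[of _ g, OF self])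
  have \<tau>eq: "\<tau> (h * g * x ^ i) = \<tau> g" if "h \<in> H" for h g i unfolding \<tau>_def DCeq[OF that] ..
  have ex: "\<exists>h. h \<in> H \<and> (\<exists>i. g = h * \<tau> g * x ^ i)" for g
  proof -
    obtain h i where hi: "h \<in> H" "\<tau> g = h * g * x ^ i" using \<tau>DC[of g] unfolding DC_def by blast
    obtain k where "(x ^ i)\<^sup>- = x ^ k" using xinv by blast
    then have "g = h\<^sup>- * \<tau> g * x ^ k" using hi by (metis inv_mult_cancel mult.assoc mult_1_right right_inv)
    then show ?thesis using hi H sg_inv by metis
  qed
  have \<tau>out: "\<tau> g \<in> X - N" if g: "g \<in> X - N" for g
  proof -
    obtain h i where hi: "h \<in> H" "\<tau> g = h * g * x ^ i" using \<tau>DC[of g] unfolding DC_def by blast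
    have "h * g * x ^ i \<in> Y \<longleftrightarrow> g \<in> Y" if "sg Y" "H \<subseteq> Y" for Y
      using that hi(1) x sg_power[OF that(1)] by (metis sg_mult_iff subsetD)
    then show ?thesis using hi(2) g N X HX by auto
  qed
  have val: "\<psi>' g = \<phi> h" if g: "g \<in> X - N" and h: "h \<in> H" and gi: "g = h * \<tau> g * x ^ i" for g h i
  proof -
    define k where "k = (SOME h. h \<in> H \<and> (\<exists>i. g = h * \<tau> g * x ^ i))"
    have "k \<in> H \<and> (\<exists>i. g = k * \<tau> g * x ^ i)" unfolding k_def by (rule someI_ex[OF ex])
    then obtain j where k: "k \<in> H" "g = k * \<tau> g * x ^ j" by blast
    obtain l where l: "(x ^ j)\<^sup>- = x ^ l" using xinv by blast
    have "h * \<tau> g * x ^ i * (x ^ j)\<^sup>- = k * \<tau> g"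
      using gi k(2) by (metis mult.assoc mult_1_right right_inv)
    then have "h * \<tau> g * x ^ (i + l) = k * \<tau> g" by (simp add: l power_add mult.assoc)
    then have e: "cj (\<tau> g) (x ^ (i + l)) = h\<^sup>- * k"
    proof -
      have "h\<^sup>- * (h * \<tau> g * x ^ (i + l)) * (\<tau> g)\<^sup>- = h\<^sup>- * (k * \<tau> g) * (\<tau> g)\<^sup>-"
        using \<open>h * \<tau> g * x ^ (i + l) = k * \<tau> g\<close> by simp
      then show ?thesis unfolding cj_def by (simp add: mult.assoc)
    qed
    have hk: "h\<^sup>- * k \<in> H" using h k H by (simp add: sg_mult sg_inv)
    then have "\<phi> (h\<^sup>- * k) = \<one>" using out[OF \<tau>out[OF g], of "i + l"] e by simp
    then have "\<phi> (h * (h\<^sup>- * k)) = \<phi> h" using phi_mult[OF h hk] phi_cl[OF h] by simp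
    then show ?thesis unfolding \<psi>'_def k_def[symmetric] by simp
  qed
  have "\<psi>' g \<in> carrier A \<and> (\<forall>h\<in>H. \<psi>' (h * g) = \<phi> h \<otimes> \<psi>' g) \<and> \<psi>' (g * x) = \<psi>' g" if g: "g \<in> X - N" for g
  proof -
    obtain k i where k: "k \<in> H" "g = k * \<tau> g * x ^ i" using ex by blast
    have v: "\<psi>' g = \<phi> k" using val[OF g k] .
    have "\<psi>' (h * g) = \<phi> h \<otimes> \<psi>' g" if h: "h \<in> H" for h
    proof -
      have "\<tau> (h * g) = \<tau> g" using \<tau>eq[OF h, of g 0] by simp
      moreover have "h * g \<in> X - N" using g h H N HX X sg_mult_iff(1) by (metis Diff_iff subsetD)
      moreover have "h * g = (h * k) * \<tau> g * x ^ i" using k(2) by (metis mult.assoc)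
      ultimately show ?thesis using val[of "h * g" "h * k" i] phi_mult[OF h k(1)] v sg_mult[OF H h k(1)] by simp
    qed
    moreover have "\<psi>' (g * x) = \<psi>' g"
    proof -
      have "\<tau> (g * x) = \<tau> g" using \<tau>eq[OF sg_one[OF H], of g 1] by simp
      moreover have "g * x \<in> X - N" using g x N HX X sg_mult_iff(2) by (metis Diff_iff subsetD)
      moreover have "g * x = k * \<tau> g * x ^ Suc i" using k(2) by (metis mult.assoc power_Suc2)
      ultimately show ?thesis using val[of "g * x" k "Suc i"] v k by simp
    qed
    ultimately show ?thesis using v phi_cl k by simp
  qed
  then show ?thesis by blast
qed

text \<open>Inside \<open>N\<close>, \<open>g * x\<close> equals \<open>cj g x * g\<close>, so every
  coset contributes \<open>\<phi> x\<close>; outside \<open>N\<close> the contributions cancel. In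
  the two applications \<open>N\<close> is the Frobenius complement itself and the normalizer of a
  Sylow subgroup.\<close>

lemma V_eval:
  assumes x: "x \<in> H" and N: "sg N" "H \<subseteq> N" "N \<subseteq> X"
    and inn: "\<And>t. t \<in> N \<Longrightarrow> cj t x \<in> H" "\<And>t. t \<in> N \<Longrightarrow> \<phi> (cj t x) = \<phi> x"
    and out: "\<And>t k. t \<in> X - N \<Longrightarrow> cj t (x ^ k) \<in> H \<Longrightarrow> \<phi> (cj t (x ^ k)) = \<one>"
  shows "V x = \<phi> x [^] (card N div card H)"
proof -
  obtain \<psi>' where \<psi>': "\<And>g. g \<in> X - N \<Longrightarrow> \<psi>' g \<in> carrier A"
    "\<And>g h. g \<in> X - N \<Longrightarrow> h \<in> H \<Longrightarrow> \<psi>' (h * g) = \<phi> h \<otimes> \<psi>' g"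
    "\<And>g. g \<in> X - N \<Longrightarrow> \<psi>' (g * x) = \<psi>' g"
    using ex_invariant_section[OF x N out] by blast
  let ?\<Omega>0 = "rcos H ` N" and ?\<Omega>1 = "rcos H ` (X - N)"
  have fin: "finite ?\<Omega>0" "finite ?\<Omega>1" using N X sg_finite by blast+
  have "rcos H a \<noteq> rcos H b" if ab: "a \<in> N" "b \<in> X - N" for a b
  proof
    assume "rcos H a = rcos H b"
    then have "a * b\<^sup>- \<in> N" using rcos_eq_iff[OF H] N(2) by blast
    then show False using ab N(1) by (metis DiffD2 sg_inv_iff sg_mult_iff(1))
  qed
  then have dis: "?\<Omega>0 \<inter> ?\<Omega>1 = {}" by blast
  have "rcos H ` X = ?\<Omega>0 \<union> ?\<Omega>1" using N by blast
  then have "V x = finprod A (ratio x) ?\<Omega>0 \<otimes> finprod A (ratio x) ?\<Omega>1"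
    unfolding V_def using finprod_Un_disjoint[OF fin dis] ratio_cl by auto
  moreover have "finprod A (ratio x) ?\<Omega>0 = \<phi> x [^] (card N div card H)"
  proof -
    have "ratio x C = \<phi> x" if C: "C \<in> ?\<Omega>0" for C
    proof -
      obtain g where g: "g \<in> N" "C = rcos H g" using C by blast
      have "g * x = cj g x * g" by (simp add: cj_def mult.assoc)
      then have "ratio x C = \<phi> x \<otimes> \<psi> g \<otimes> inv \<psi> g"
        using psi_mult[of "cj g x" g] inn g by (simp add: ratio_rcos)
      then show ?thesis using psi_cl phi_cl x by (simp add: m_assoc)
    qed
    then have "finprod A (ratio x) ?\<Omega>0 = finprod A (\<lambda>_. \<phi> x) ?\<Omega>0"
      by (intro finprod_cong') (auto simp: phi_cl x)
    also have "\<dots> = \<phi> x [^] card ?\<Omega>0" by (rule finprod_const) (use fin phi_cl x in auto)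
    also have "card ?\<Omega>0 = card N div card H"
      using card_rcosets[OF H N(1,2)] sg_card_pos[OF H] by (simp add: nonzero_mult_div_cancel_left)
    finally show ?thesis .
  qed
  moreover have "finprod A (ratio x) ?\<Omega>1 = \<one>"
  proof -
    \<comment> \<open>\<open>\<delta>\<close> compares \<open>\<psi>\<close> with the invariant
      section. Multiplying \<open>ratio x C\<close> by \<open>\<delta> C\<close> gives
      \<open>\<delta>\<close> at the shifted coset, and the shift permutes the cosets outside
      \<open>N\<close>; so the product of the ratios cancels to 1.\<close>
    define \<delta> where "\<delta> C = \<psi> (rp C) \<otimes> inv \<psi>' (rp C)" for C
    have hX: "h * g \<in> X - N" if "h \<in> H" "g \<in> X - N" for h g
      using that H N HX X sg_mult_iff(1) by (metis Diff_iff subsetD)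
    have \<delta>: "\<delta> (rcos H g) = \<psi> g \<otimes> inv \<psi>' g" if g: "g \<in> X - N" for g
    proof -
      obtain h where h: "h \<in> H" "rp (rcos H g) = h * g" using rp_rcos by blast
      have "\<delta> (rcos H g) = (\<phi> h \<otimes> \<psi> g) \<otimes> inv (\<phi> h \<otimes> \<psi>' g)"
        using psi_mult[OF h(1)] \<psi>'(2)[OF g h(1)] by (simp add: \<delta>_def h)
      also have "\<dots> = (\<phi> h \<otimes> inv (\<phi> h)) \<otimes> (\<psi> g \<otimes> inv (\<psi>' g))"
        using phi_cl[OF h(1)] psi_cl \<psi>'(1)[OF g] by (simp add: inv_mult m_ac cancel_inv)
      finally show ?thesis using phi_cl[OF h(1)] psi_cl \<psi>'(1)[OF g] by simp
    qed
    have gx: "g * x \<in> X - N" if "g \<in> X - N" for g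
      using that x N HX X sg_mult_iff(2) by (metis Diff_iff subsetD)
    have \<delta>cl: "\<delta> C \<in> carrier A" if "C \<in> ?\<Omega>1" for C
      using that \<delta> psi_cl \<psi>'(1) by auto
    have sh: "sh x ` ?\<Omega>1 = ?\<Omega>1" by (rule sh_image) (use gx X sg_finite in auto)
    have "finprod A (ratio x) ?\<Omega>1 \<otimes> finprod A \<delta> ?\<Omega>1 = finprod A (\<lambda>C. ratio x C \<otimes> \<delta> C) ?\<Omega>1"
      by (subst finprod_multf) (auto simp: ratio_cl \<delta>cl)
    also have "\<dots> = finprod A (\<lambda>C. \<delta> (sh x C)) ?\<Omega>1"
    proof (rule finprod_cong')
      fix C assume "C \<in> ?\<Omega>1"
      then obtain g where g: "g \<in> X - N" "C = rcos H g" by blast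
      have "ratio x C \<otimes> \<delta> C = \<psi> (g * x) \<otimes> inv \<psi> g \<otimes> (\<psi> g \<otimes> inv \<psi>' g)"
        using g \<delta> by (simp add: ratio_rcos)
      also have "\<dots> = (\<psi> g \<otimes> inv \<psi> g) \<otimes> (\<psi> (g * x) \<otimes> inv \<psi>' g)"
        using psi_cl \<psi>'(1)[OF g(1)] by (simp add: m_ac cancel_inv)
      also have "\<dots> = \<delta> (sh x C)"
        using g \<delta>[OF gx[OF g(1)]] \<psi>'(3)[OF g(1)] psi_cl \<psi>'(1)[OF g(1)] by (simp add: sh_rcos)
      finally show "ratio x C \<otimes> \<delta> C = \<delta> (sh x C)" .
    next
      show "(\<lambda>C. \<delta> (sh x C)) \<in> ?\<Omega>1 \<rightarrow> carrier A" using gx \<delta>cl by (auto simp: sh_rcos)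
    qed simp
    also have "\<dots> = finprod A \<delta> (sh x ` ?\<Omega>1)"
      by (rule finprod_reindex[symmetric]) (use sh \<delta>cl inj_sh in auto)
    also have "\<dots> = finprod A \<delta> ?\<Omega>1" by (simp only: sh)
    finally have e: "finprod A (ratio x) ?\<Omega>1 \<otimes> finprod A \<delta> ?\<Omega>1 = finprod A \<delta> ?\<Omega>1" .
    have "finprod A \<delta> ?\<Omega>1 \<in> carrier A" "finprod A (ratio x) ?\<Omega>1 \<in> carrier A"
      by (intro finprod_closed funcsetI \<delta>cl, assumption) (intro finprod_closed funcsetI ratio_cl)
    then show ?thesis using e r_cancel_one by blast
  qed
  ultimately show ?thesis using phi_cl x by simp
qed

lemma V_kernel: "nml {x\<in>X. V x = \<one>} X" "comm X X \<subseteq> {x\<in>X. V x = \<one>}"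
proof -
  let ?N = "{x\<in>X. V x = \<one>}"
  have one: "V 1 = \<one>" using V_mult[of 1 1] sg_one[OF X] V_cl[of 1] by simp
  have inv: "V (x\<^sup>-) = inv (V x)" if "x \<in> X" for x
    using V_mult[of "x\<^sup>-" x] that sg_inv[OF X] one V_cl by (metis inv_equality left_inv)
  have N: "sg ?N" unfolding sg_def using X sg_finite sg_one sg_mult one V_mult by auto
  have cj: "V (cj x n) = V n" if "x \<in> X" "n \<in> X" for x n
    unfolding cj_def using that V_mult sg_mult[OF X] sg_inv[OF X] inv V_cl by (simp add: m_ac cancel_inv)
  then show "nml ?N X" unfolding nml_def using N X sg_cj by auto
  show "comm X X \<subseteq> ?N"
  proof (rule comm_least[OF N])
    fix a b assume ab: "a \<in> X" "b \<in> X"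
    then have "V (cm a b) = V b \<otimes> inv (V b)"
      unfolding cm_cj(2) using V_mult sg_cj[OF X] sg_inv[OF X] inv cj by simp
    then show "cm a b \<in> ?N" using ab X sg_cm V_cl by simp
  qed
qed

end

section \<open>Frobenius groups\<close>

text \<open>A Frobenius pair: \<open>M\<close> is a proper, non-trivial, malnormal subgroup of
  \<open>X\<close>, that is, a Frobenius complement.\<close>

definition FP :: "'g::group_mult set \<Rightarrow> 'g set \<Rightarrow> bool" where
  "FP X M \<longleftrightarrow> sg X \<and> sg M \<and> M \<subseteq> X \<and> M \<noteq> X \<and> M \<noteq> {1} \<and> (\<forall>g\<in>X - M. M \<inter> cj g ` M = {1})"

definition kern :: "'g::group_mult set \<Rightarrow> 'g set \<Rightarrow> 'g set" where
  "kern X M = insert 1 (X - (\<Union>g\<in>X. cj g ` M))"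

lemma FPD: "FP X M \<Longrightarrow> sg X" "FP X M \<Longrightarrow> sg M" "FP X M \<Longrightarrow> M \<subseteq> X" "FP X M \<Longrightarrow> M \<noteq> X" "FP X M \<Longrightarrow> M \<noteq> {1}"
  by (auto simp: FP_def)

lemma FP_mem: "FP X M \<Longrightarrow> g \<in> X \<Longrightarrow> x \<in> M \<Longrightarrow> x \<noteq> 1 \<Longrightarrow> cj g x \<in> M \<Longrightarrow> g \<in> M"
  unfolding FP_def using imageI[of x M "cj g"] cj_eq_one_iff[of g x] by blast

lemma FP_conj_mem:
  assumes "FP X M" "g \<in> X" "c \<in> X" "x \<noteq> 1" "x \<in> cj g ` M" "x \<in> cj c ` M"
  shows "c\<^sup>- * g \<in> M"
proof -
  have "cj (g\<^sup>-) x \<in> M" "cj (c\<^sup>-) x \<in> M" using assms(5,6) by (simp_all add: mem_cj_image)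
  moreover have "cj (c\<^sup>- * g) (cj (g\<^sup>-) x) = cj (c\<^sup>-) x" by (simp add: mult.assoc)
  ultimately show ?thesis using FP_mem[OF assms(1)] assms FPD(1) sg_mult sg_inv cj_eq_one_iff by metis
qed

lemma cj_image_mem_eq: assumes "sg M" "c\<^sup>- * g \<in> M" shows "cj g ` M = cj c ` M"
proof -
  have "cj (c * (c\<^sup>- * g)) ` M = cj c ` cj (c\<^sup>- * g) ` M" by (simp only: cj_image_cj)
  then show ?thesis using cj_image_self[OF assms] by simp
qed

lemma FP_conj_eq_iff:
  assumes "FP X M" "g \<in> X" "c \<in> X"
  shows "cj g ` M - {1} = cj c ` M - {1} \<longleftrightarrow> c\<^sup>- * g \<in> M"
proof
  assume *: "cj g ` M - {1} = cj c ` M - {1}"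
  obtain x where "x \<in> M" "x \<noteq> 1" using sg_ne_one FPD[OF assms(1)] by blast
  then have "cj g x \<in> cj g ` M - {1}" by simp
  then show "c\<^sup>- * g \<in> M" using * FP_conj_mem[OF assms(1-3), of "cj g x"] by blast
qed (simp add: cj_image_mem_eq[OF FPD(2)[OF assms(1)]])

lemma FP_card_union:
  assumes "FP X M"
  shows "\<exists>k. k * card M = card X \<and> card (\<Union>g\<in>X. cj g ` M - {1}) = k * (card M - 1)"
proof -
  \<comment> \<open>With the identity removed, different conjugates of \<open>M\<close> are
    disjoint, so their union can be counted by multiplication.\<close>
  let ?f = "\<lambda>g. cj g ` M - {1}"
  let ?F = "?f ` X"
  note sg = FPD(1,2,3)[OF assms]
  have "card X = card M * card ?F"
  proof (rule card_eq_fiber_mult)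
    show "finite X" using sg sg_finite by blast
    fix b assume "b \<in> ?F"
    then obtain c where c: "c \<in> X" "b = ?f c" by blast
    have "{a \<in> X. ?f a = b} = lcos c M"
    proof -
      have "a \<in> X" if "c\<^sup>- * a \<in> M" for a
        using that sg c(1) by (meson sg_inv sg_mult_iff(1) subsetD)
      then have "a \<in> X \<and> ?f a = ?f c \<longleftrightarrow> a \<in> lcos c M" for a
        using FP_conj_eq_iff[OF assms _ c(1), of a] mem_lcos[of a c M] by metis
      then show ?thesis unfolding c(2) by (simp only: Collect_mem_eq)
    qed
    then show "card {a \<in> X. ?f a = b} = card M" by simp
  qed
  moreover have "card (\<Union> ?F) = card ?F * (card M - 1)"
  proof -
    have "card b = card M - 1" if b: "b \<in> ?F" for b
    proof -
      obtain g where g: "b = cj g ` M - {1}" using b by blast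
      have "1 \<in> cj g ` M" using sg_one[OF sg(2)] by (simp add: mem_cj_image)
      then show ?thesis unfolding g by (simp add: card_Diff_singleton)
    qed
    moreover have "pairwise disjnt ?F"
    proof (rule pairwiseI)
      fix a b assume "a \<in> ?F" "b \<in> ?F" "a \<noteq> b"
      then obtain g c where gc: "g \<in> X" "c \<in> X" "a = ?f g" "b = ?f c" by blast
      have "x \<notin> b" if "x \<in> a" for x
        using that gc \<open>a \<noteq> b\<close> FP_conj_mem[OF assms gc(1,2), of x] FP_conj_eq_iff[OF assms gc(1,2)] by auto
      then show "disjnt a b" by (auto simp: disjnt_def)
    qed
    moreover have "finite b" if "b \<in> ?F" for b using that sg sg_finite by auto
    moreover have "card (\<Union> ?F) = sum card ?F" by (rule card_Union_disjoint) (use calculation in auto)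
    ultimately show ?thesis by simp
  qed
  ultimately show ?thesis by (metis mult.commute)
qed

lemma FP_card_kern: assumes "FP X M" shows "card (kern X M) * card M = card X"
proof -
  let ?U = "\<Union>g\<in>X. cj g ` M - {1}"
  obtain k where k: "k * card M = card X" "card ?U = k * (card M - 1)" using FP_card_union[OF assms] by blast
  note sg = FPD(1,2,3)[OF assms]
  have sub: "?U \<subseteq> X" using sg sg_cj by (auto dest!: subsetD)
  have "kern X M = X - ?U" unfolding kern_def using sg_one[OF sg(1)] by auto
  then have "card (kern X M) = card X - card ?U"
    using card_Diff_subset[OF finite_subset[OF sub sg_finite[OF sg(1)]] sub] by simp
  also have "\<dots> = k * card M - k * (card M - 1)" using k by simp
  also have "\<dots> = k" using sg_card_pos[OF sg(2)] by (cases "card M") simp_all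
  finally show ?thesis using k by simp
qed

lemma FP_sub: assumes "FP X M" "sg L" "M \<subseteq> L" "L \<subseteq> X" "L \<noteq> M" shows "FP L M"
  using assms unfolding FP_def by blast

lemma FP_conj: assumes "FP X M" "g \<in> X" "sg L" "cj g ` M \<subseteq> L" "L \<subseteq> X" "L \<noteq> cj g ` M" shows "FP L (cj g ` M)"
  unfolding FP_def
proof (intro conjI ballI)
  show "cj g ` M \<noteq> {1}" using FPD(5)[OF assms(1)] by (metis cj_image_cj cj_image_one cj_one(2) image_empty image_insert left_inv)
  show "sg (cj g ` M)" using sg_cj_image FPD(2)[OF assms(1)] by blast
  fix y assume y: "y \<in> L - cj g ` M"
  have "x = 1" if x: "x \<in> cj g ` M" "x \<in> cj y ` cj g ` M" for x
  proof (rule ccontr)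
    assume "x \<noteq> 1"
    then have "g\<^sup>- * (y * g) \<in> M"
      using FP_conj_mem[OF assms(1), of "y * g" g x] x assms(2,5) y FPD(1)[OF assms(1)] sg_mult by auto
    then have "y \<in> cj g ` M" unfolding mem_cj_image by (simp add: cj_def mult.assoc)
    then show False using y by blast
  qed
  moreover have "1 \<in> cj g ` M" "1 \<in> cj y ` cj g ` M"
    using sg_one[OF FPD(2)[OF assms(1)]] by (simp_all add: mem_cj_image)
  ultimately show "cj g ` M \<inter> cj y ` cj g ` M = {1}" by blast
qed (use assms in auto)

lemma FP_complements_conj:
  assumes "FP X M" "sg L" "M \<subseteq> L" "L \<subseteq> X" "g \<in> X" "cj g ` M \<subseteq> L"
  shows "\<exists>l\<in>L. cj g ` M = cj l ` M"
proof (rule ccontr)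
  assume no: "\<not> ?thesis"
  have "L \<noteq> M"
  proof
    assume "L = M"
    then have "cj g ` M = cj 1 ` M" using assms(6) by (metis card_cj card_subset_eq cj_image_one sg_finite assms(2))
    then show False using no sg_one[OF assms(2)] by blast
  qed
  then have 1: "FP L M" using FP_sub assms by blast
  have "L \<noteq> cj g ` M"
    using \<open>L \<noteq> M\<close> assms(2,3) by (metis card_cj card_subset_eq sg_finite)
  then have 2: "FP L (cj g ` M)" using FP_conj assms by blast
  let ?U = "\<Union>a\<in>L. cj a ` M - {1}" and ?W = "\<Union>a\<in>L. cj a ` cj g ` M - {1}"
  obtain k where k: "k * card M = card L" "card ?U = k * (card M - 1)" using FP_card_union[OF 1] by blast
  obtain j where j: "j * card M = card L" "card ?W = j * (card M - 1)" using FP_card_union[OF 2] by auto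
  have M: "card M > 0" "card M \<noteq> 1" using FPD[OF assms(1)] sg_card_pos sg_eq_one_iff by blast+
  then have "j = k" using k j by (metis mult_cancel2 less_numeral_extra(3))
  have "?U \<inter> ?W = {}"
  proof -
    have False if x: "x \<noteq> 1" "a \<in> L" "b \<in> L" "x \<in> cj a ` M" "x \<in> cj (b * g) ` M" for x a b
    proof -
      have "a\<^sup>- * (b * g) \<in> M"
        by (rule FP_conj_mem[OF assms(1), of "b * g" a x])
           (use x assms sg_mult[OF FPD(1)[OF assms(1)]] in auto)
      moreover have "(b\<^sup>- * a)\<^sup>- * g = a\<^sup>- * (b * g)" by (simp add: gsimps)
      ultimately have "cj g ` M = cj (b\<^sup>- * a) ` M" using cj_image_mem_eq FPD(2)[OF assms(1)] by metis
      then show False using no x sg_mult sg_inv assms(2) by blast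
    qed
    then show ?thesis by auto
  qed
  moreover have "cj a ` T - {1} \<subseteq> L - {1}" if "a \<in> L" "T \<subseteq> L" for a T
    using that assms(2) sg_cj by blast
  then have sub: "?U \<subseteq> L - {1}" "?W \<subseteq> L - {1}" using assms(3,6) by blast+
  moreover have fL: "finite (L - {1})" using assms(2) sg_finite by blast
  ultimately have "card ?U + card ?W \<le> card (L - {1})"
    using sub by (metis (no_types, lifting) Un_least card_Un_disjoint card_mono finite_subset)
  also have "\<dots> < card L" using assms(2) sg_one sg_finite by (metis card_Diff1_less)
  finally have "2 * (k * (card M - 1)) < k * card M" using k j \<open>j = k\<close> by simp
  then show False using M by (cases "card M") auto
qed

text \<open>A Frattini argument: a proper subnormal \<open>L\<close> lies in a proper normal
  \<open>N\<close>, which contains all conjugates of \<open>M\<close>. These are conjugate already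
  in \<open>N\<close>, so \<open>X\<close> equals \<open>N \<bullet> M\<close>, which is
  \<open>N\<close>.\<close>

lemma FP_sn_eq: assumes "FP X M" "sn X L" "M \<subseteq> L" shows "L = X"
proof (rule ccontr)
  assume "L \<noteq> X"
  then obtain N where N: "nml N X" "N \<noteq> X" "L \<subseteq> N" using sn_proper assms(2) by metis
  have "g \<in> N" if g: "g \<in> X" for g
  proof -
    have "cj g ` M \<subseteq> N" using nmlD(4)[OF N(1) g] N(3) assms(3) by blast
    then obtain l where l: "l \<in> N" "cj g ` M = cj l ` M"
      using FP_complements_conj[OF assms(1) nmlD(1)[OF N(1)] _ nmlD(3)[OF N(1)] g] N(3) assms(3) by blast
    then have "l\<^sup>- * g \<in> M" using FP_conj_eq_iff[OF assms(1) g, of l] nmlD(3)[OF N(1)] by auto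
    then have "l\<^sup>- * g \<in> N" using N(3) assms(3) by blast
    then show ?thesis using l nmlD(1)[OF N(1)] sg_inv sg_mult_iff(1) by metis
  qed
  then show False using N nmlD(3) by blast
qed

text \<open>Elements of \<open>Y\<close> keep a non-identity element of \<open>T\<close> inside
  \<open>M\<close>, so malnormality forces \<open>Y \<subseteq> M\<close>. The inclusion climbs the
  subnormal chain up to \<open>X\<close>, which is not contained in \<open>M\<close>.\<close>

lemma FP_no_sn: "sn X T \<Longrightarrow> FP X M \<Longrightarrow> T \<subseteq> M \<Longrightarrow> T = {1}"
proof (induction rule: sn.induct)
  case top
  then show ?case using FPD(3,4) by blast
next
  case (step Y T)
  show ?case
  proof (rule ccontr)
    assume "T \<noteq> {1}"
    then obtain t where t: "t \<in> T" "t \<noteq> 1" using sg_ne_one nmlD(1)[OF step.hyps(2)] by blast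
    have "y \<in> M" if "y \<in> Y" for y
      using FP_mem[OF step.prems(1), of y t] t that step.prems(2) nmlD(4)[OF step.hyps(2) that]
        sn_sg(3)[OF step.hyps(1)] by blast
    then have "Y = {1}" using step by blast
    then show False using t nmlD(3)[OF step.hyps(2)] by blast
  qed
qed

text \<open>The transfer of \<open>M\<close> onto its abelian factor group by \<open>D\<close>
  restricts to the projection itself, since a conjugate of an element of \<open>M\<close> by
  something outside \<open>M\<close> returns to \<open>M\<close> only for the identity. Its kernel
  is \<open>N\<close>.\<close>

lemma FP_abelian_extension:
  assumes FP: "FP X M" and D: "nml D M" "comm M M \<subseteq> D"
  shows "\<exists>N. nml N X \<and> N \<inter> M = D \<and> N \<bullet> M = X"
proof -
  define \<phi> where "\<phi> = (\<lambda>m. D #>\<^bsub>rec M\<^esub> m)"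
  define A where "A = rec M Mod D"
  note Q = abelian_quotient[OF D, folded \<phi>_def A_def]
  interpret A: comm_group A using Q(1) .
  interpret transfer A X M \<phi>
    by unfold_locales (use FPD[OF FP] Q in auto)
  note M = FPD(2)[OF FP]
  have inv: "\<phi> (m\<^sup>-) = inv\<^bsub>A\<^esub> \<phi> m" if "m \<in> M" for m
    using Q(3)[of "m\<^sup>-" m] Q(2)[of m] Q(2)[of "m\<^sup>-"] Q(4)[of 1] that sg_inv[OF M] sg_one[OF M]
      sg_one[OF nmlD(1)[OF D(1)]] A.inv_equality[of "\<phi> (m\<^sup>-)" "\<phi> m"] by simp
  have ev: "V x = \<phi> x" if x: "x \<in> M" for x
  proof -
    have "V x = \<phi> x [^]\<^bsub>A\<^esub> (card M div card M)"
    proof (rule V_eval[OF x M subset_refl FPD(3)[OF FP]])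
      show "cj t x \<in> M" if "t \<in> M" for t using that x sg_cj M by blast
      show "\<phi> (cj t x) = \<phi> x" if t: "t \<in> M" for t
      proof -
        have "\<phi> (cj t x) = \<phi> t \<otimes>\<^bsub>A\<^esub> \<phi> x \<otimes>\<^bsub>A\<^esub> inv\<^bsub>A\<^esub> \<phi> t"
          unfolding cj_def using Q(3) t x sg_mult[OF M] sg_inv[OF M] inv by simp
        also have "\<dots> = \<phi> x" using Q(2)[OF t] Q(2)[OF x] by (metis A.inv_closed A.inv_solve_right A.m_comm A.m_closed)
        finally show ?thesis .
      qed
      show "\<phi> (cj t (x ^ k)) = \<one>\<^bsub>A\<^esub>" if t: "t \<in> X - M" and m: "cj t (x ^ k) \<in> M" for t k
      proof -
        have "x ^ k = 1" using FP_mem[OF FP, of t "x ^ k"] t m x sg_power[OF M] by blast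
        then show ?thesis using Q(4)[of 1] sg_one[OF M] sg_one[OF nmlD(1)[OF D(1)]] by simp
      qed
    qed
    then show ?thesis using sg_card_pos[OF M] Q(2)[OF x] by simp
  qed
  let ?N = "{x\<in>X. V x = \<one>\<^bsub>A\<^esub>}"
  have "x \<in> ?N \<longleftrightarrow> x \<in> D" if "x \<in> M" for x using ev[OF that] Q(4)[OF that] that FPD(3)[OF FP] by auto
  then have "?N \<inter> M = D" using nmlD(3)[OF D(1)] by blast
  moreover have "x \<in> ?N \<bullet> M" if x: "x \<in> X" for x
  proof -
    obtain m where m: "m \<in> M" "V x = \<phi> m" using V_cl[of x] Q(5) by blast
    have mX: "m \<in> X" "m\<^sup>- \<in> X" "m\<^sup>- \<in> M" using m FPD[OF FP] sg_inv[OF M] by auto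
    have "V (x * m\<^sup>-) = \<phi> m \<otimes>\<^bsub>A\<^esub> inv\<^bsub>A\<^esub> \<phi> m" using V_mult[OF x mX(2)] ev[OF mX(3)] inv m by simp
    then have "x * m\<^sup>- \<in> ?N" using Q(2)[OF m(1)] x mX FPD(1)[OF FP] sg_mult by simp
    moreover have "x = (x * m\<^sup>-) * m" by (simp add: mult.assoc)
    ultimately show ?thesis using m setmulI by metis
  qed
  moreover have "?N \<bullet> M \<subseteq> X" by (rule setmul_least) (use FPD[OF FP] in auto)
  ultimately show ?thesis using V_kernel(1) by blast
qed

text \<open>For finite groups this is solubility, because the derived series becomes stationary at a
  perfect subgroup. In this form it passes to subgroups immediately.\<close>

definition solv :: "'g::group_mult set \<Rightarrow> bool" where
  "solv X \<longleftrightarrow> (\<forall>Y. sg Y \<and> Y \<subseteq> X \<and> comm Y Y = Y \<longrightarrow> Y = {1})"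

lemma solv_mono: "solv X \<Longrightarrow> Y \<subseteq> X \<Longrightarrow> solv Y"
  by (auto simp: solv_def)

lemma kern_cj: assumes "sg X" "M \<subseteq> X" "x \<in> X" "y \<in> kern X M" shows "cj x y \<in> kern X M"
proof (cases "y = 1")
  case False
  then have y: "y \<in> X" "\<And>g. g \<in> X \<Longrightarrow> y \<notin> cj g ` M" using assms(4) by (auto simp: kern_def)
  have "cj x y \<notin> cj g ` M" if g: "g \<in> X" for g
  proof
    assume "cj x y \<in> cj g ` M"
    then have "y \<in> cj (x\<^sup>- * g) ` M" by (simp add: mem_cj_image gsimps)
    then show False using y(2) g assms sg_mult sg_inv by blast
  qed
  then show ?thesis using y sg_cj[OF assms(1,3)] by (auto simp: kern_def)
qed (simp add: kern_def)

lemma kern_sub: "sg X \<Longrightarrow> kern X M \<subseteq> X"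
  by (auto simp: kern_def sg_one)

lemma kern_Int: "sg X \<Longrightarrow> sg M \<Longrightarrow> kern X M \<inter> M = {1}"
proof -
  assume "sg X" "sg M"
  then have "M \<subseteq> (\<Union>g\<in>X. cj g ` M)" using UN_upper[OF sg_one, of X "\<lambda>g. cj g ` M"] by simp
  then show ?thesis using sg_one[OF \<open>sg M\<close>] by (auto simp: kern_def)
qed

text \<open>Frobenius' theorem; a soluble complement admits a proof by transfer into its abelianization, without characters.\<close>

theorem FP_nml_kern:
  assumes "FP X M" "solv M"
  shows "nml (kern X M) X"
  using assms
proof (induction "card M" arbitrary: X M rule: less_induct)
  case less
  note FP = less.prems(1)
  note sg = FPD[OF FP]
  let ?D = "comm M M"
  have D: "nml ?D M" using nml_comm nml_refl sg(2) by blast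
  have DM: "?D \<noteq> M" using less.prems(2) sg by (auto simp: solv_def)
  \<comment> \<open>By orders, \<open>card N\<close> is \<open>card ?D * card (kern X M)\<close>. If
    \<open>?D\<close> is trivial, \<open>N\<close> is the kernel. Otherwise \<open>?D\<close> is a
    smaller complement in \<open>N\<close>, smaller than \<open>M\<close> because \<open>M\<close>
    is soluble, and the kernel of \<open>N\<close> turns out to be that of \<open>X\<close>.\<close>
  obtain N where N: "nml N X" "N \<inter> M = ?D" "N \<bullet> M = X" using FP_abelian_extension[OF FP D] by blast
  have c: "card N * card M = card ?D * card X" using card_setmul[OF nmlD(1)[OF N(1)] sg(2)] N by simp
  have fK: "finite (kern X M)" using kern_sub sg(1) sg_finite finite_subset by metis
  have "sg (kern X M)"
  proof (cases "?D = {1}")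
    case True
    have "N \<subseteq> kern X M"
    proof
      fix x assume x: "x \<in> N"
      have "x = 1" if "g \<in> X" "x \<in> cj g ` M" for g
      proof -
        have "cj (g\<^sup>-) x \<in> N \<inter> M" using that x nmlD(4)[OF N(1)] sg_inv[OF sg(1)] by (auto simp: mem_cj_image)
        then show ?thesis using N(2) True by simp
      qed
      then show "x \<in> kern X M" using x nmlD(3)[OF N(1)] by (auto simp: kern_def)
    qed
    moreover have "card N * card M = card (kern X M) * card M" using c True FP_card_kern[OF FP] by simp
    then have "card N = card (kern X M)" using sg_card_pos[OF sg(2)] by simp
    ultimately have "N = kern X M" using card_subset_eq fK by blast
    then show ?thesis using nmlD(1)[OF N(1)] by simp
  next
    case False
    have "card ?D < card M" using DM nmlD(3)[OF D] sg_finite[OF sg(2)] by (metis psubsetI psubset_card_mono)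
    have DN: "?D \<noteq> N"
    proof
      assume e: "?D = N"
      have "card X = card M" using c sg_card_pos[OF nmlD(1)[OF N(1)]] unfolding e by simp
      then show False using sg sg_finite card_subset_eq by metis
    qed
    have FN: "FP N ?D" unfolding FP_def
    proof (intro conjI ballI)
      fix g assume g: "g \<in> N - ?D"
      then have "g \<in> X - M" using N(2) nmlD(3)[OF N(1)] by blast
      then have "M \<inter> cj g ` M = {1}" using FP unfolding FP_def by blast
      moreover have "?D \<inter> cj g ` ?D \<subseteq> M \<inter> cj g ` M" using nmlD(3)[OF D] by blast
      moreover have "1 \<in> ?D \<inter> cj g ` ?D" using sg_one[OF nmlD(1)[OF D]] by (simp add: mem_cj_image)
      ultimately show "?D \<inter> cj g ` ?D = {1}" by blast
    qed (use nmlD[OF D] nmlD[OF N(1)] N(2) DN False in auto)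
    have nK: "nml (kern N ?D) N"
      using less.hyps[OF \<open>card ?D < card M\<close> FN] solv_mono[OF less.prems(2)] nmlD(3)[OF D] by blast
    have "kern N ?D \<subseteq> kern X M"
    proof
      fix x assume x: "x \<in> kern N ?D"
      have xN: "x \<in> N" using x nmlD(3)[OF nK] by blast
      have "x = 1" if g: "g \<in> X" "x \<in> cj g ` M" for g
      proof -
        \<comment> \<open>As \<open>X\<close> is \<open>N \<bullet> M\<close>, every conjugate of
          \<open>M\<close> is a conjugate by an element of \<open>N\<close>, and it meets
          \<open>N\<close> in the corresponding conjugate of \<open>?D\<close>.\<close>
        obtain n m where nm: "n \<in> N" "m \<in> M" "g = n * m" using N(3) g(1) by (auto elim!: setmulE)
        have "cj g ` M = cj n ` M" using nm cj_image_mem_eq[OF sg(2), of n g] by simp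
        then have "cj (n\<^sup>-) x \<in> M" using g(2) by (simp add: mem_cj_image)
        moreover have "cj (n\<^sup>-) x \<in> N" using xN nm nmlD(1)[OF N(1)] sg_cj sg_inv by blast
        ultimately have "x \<in> cj n ` ?D" using N(2) by (auto simp: mem_cj_image)
        then show ?thesis using x nm(1) by (auto simp: kern_def)
      qed
      then show "x \<in> kern X M" using xN nmlD(3)[OF N(1)] by (auto simp: kern_def)
    qed
    moreover have "card (kern N ?D) = card (kern X M)"
    proof -
      have "card (kern N ?D) * card ?D * card M = card ?D * (card (kern X M) * card M)"
        using c FP_card_kern[OF FN] FP_card_kern[OF FP] by simp
      then show ?thesis using sg_card_pos[OF sg(2)] sg_card_pos[OF nmlD(1)[OF D]] by simp
    qed
    ultimately have "kern N ?D = kern X M" using card_subset_eq fK by blast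
    then show ?thesis using nmlD(1)[OF nK] by simp
  qed
  then show ?case unfolding nml_def using sg kern_cj kern_sub by blast
qed

lemma FP_kern_setmul: assumes "FP X M" "sg (kern X M)" shows "kern X M \<bullet> M = X"
proof -
  note sg = FPD[OF assms(1)]
  have "card (kern X M \<bullet> M) = card X"
    using card_setmul[OF assms(2) sg(2)] kern_Int[OF sg(1,2)] FP_card_kern[OF assms(1)] by simp
  moreover have "kern X M \<bullet> M \<subseteq> X" using setmul_least kern_sub sg by blast
  ultimately show ?thesis using card_subset_eq sg_finite[OF sg(1)] by blast
qed

section \<open>Solubility\<close>

lemma syl_sub: assumes "sg X" "prime p" "syl p X S" "sg Y" "S \<subseteq> Y" "Y \<subseteq> X" shows "syl p Y S"
proof -
  obtain T where T: "syl p Y T" "S \<subseteq> T"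
    using pgrp_sub_syl[OF assms(4,2) sylD(3)[OF assms(3)] assms(5)] by blast
  then have "T = S"
    using pgrp_sub_card[OF assms(1,2) sylD(3)[OF T(1)] _ assms(3) T(2)] sylD(2)[OF T(1)] assms(6) by blast
  then show ?thesis using T by blast
qed

lemma cyc_normalizes: assumes "cj x ` N = N" "y \<in> cyc x" "n \<in> N" shows "cj y n \<in> N"
proof -
  have "cj (x ^ i) ` N = N" for i
  proof (induction i)
    case (Suc i)
    have "cj (x ^ Suc i) ` N = cj x ` cj (x ^ i) ` N" by (simp only: cj_image_cj power_Suc)
    then show ?case using Suc assms(1) by simp
  qed simp
  then show ?thesis using assms(2,3) by (auto simp: mem_cyc)
qed

lemma nml_setmul_self: assumes "sg N" "sg B" "\<And>b n. b \<in> B \<Longrightarrow> n \<in> N \<Longrightarrow> cj b n \<in> N" shows "nml N (N \<bullet> B)"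
  unfolding nml_def
proof (intro conjI ballI)
  show "sg (N \<bullet> B)" by (rule sg_setmul) (use assms in auto)
  show "N \<subseteq> N \<bullet> B" using setmul_left assms(2) by blast
  fix x n assume "x \<in> N \<bullet> B" and n: "n \<in> N"
  then obtain a b where ab: "a \<in> N" "b \<in> B" "x = a * b" by (auto elim!: setmulE)
  have "cj x n = cj a (cj b n)" using ab by simp
  then show "cj x n \<in> N" using ab n assms sg_cj[OF assms(1)] by metis
qed (rule assms)

lemma setmul_Int: assumes "sg K" "U \<subseteq> K" "K \<inter> B = {1}" "sg B" shows "(U \<bullet> B) \<inter> K = U"
proof
  show "(U \<bullet> B) \<inter> K \<subseteq> U"
  proof
    fix x assume x: "x \<in> (U \<bullet> B) \<inter> K"
    then obtain u b where ub: "u \<in> U" "b \<in> B" "x = u * b" by (auto elim!: setmulE)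
    then have "b \<in> K" using x assms sg_mult_iff(1)[OF assms(1)] by blast
    then have "b = 1" using ub assms(3) by blast
    then show "x \<in> U" using ub by simp
  qed
  show "U \<subseteq> (U \<bullet> B) \<inter> K" using setmul_left[OF assms(4), of U] assms(2) by blast
qed

text \<open>For a prime \<open>p\<close> this is the largest normal \<open>p\<close>-subgroup,
  usually written \<open>O_p(X)\<close>, obtained as the intersection of the Sylow
  subgroups.\<close>

definition core :: "nat \<Rightarrow> 'g::group_mult set \<Rightarrow> 'g set" where
  "core p X = {x \<in> X. \<forall>S. syl p X S \<longrightarrow> x \<in> S}"

lemma nml_core: assumes "sg X" shows "nml (core p X) X"
  unfolding nml_def
proof (intro conjI ballI)
  show "sg (core p X)" unfolding sg_def
  proof (intro conjI ballI)
    show "finite (core p X)" using sg_finite[OF assms] by (simp add: core_def)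
    show "1 \<in> core p X" using sg_one[OF assms] sylD(1) sg_one by (auto simp: core_def)
    show "x * y \<in> core p X" if "x \<in> core p X" "y \<in> core p X" for x y
      using that sg_mult[OF assms] by (auto simp: core_def intro: sg_mult[OF sylD(1)])
  qed
  fix x n assume x: "x \<in> X" and n: "n \<in> core p X"
  have "cj x n \<in> S" if "syl p X S" for S
  proof -
    have "n \<in> cj (x\<^sup>-) ` S" using n syl_cj[OF assms that sg_inv[OF assms x]] by (auto simp: core_def)
    then show ?thesis by (simp add: mem_cj_image)
  qed
  then show "cj x n \<in> core p X" using n x sg_cj[OF assms] by (auto simp: core_def)
qed (use assms in \<open>auto simp: core_def\<close>)

lemma core_sub_syl: "syl p X S \<Longrightarrow> core p X \<subseteq> S"
  by (auto simp: core_def)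

lemma sn_pgrp_sub_core: "prime p \<Longrightarrow> sn X T \<Longrightarrow> pgrp p T \<Longrightarrow> T \<subseteq> core p X"
  using sn_pgrp_sub_syl sn_sg(3) unfolding core_def by blast

lemma pgrp_perfect: "prime p \<Longrightarrow> pgrp p X \<Longrightarrow> comm X X = X \<Longrightarrow> X = {1}"
  using nilp_perfect nilp_pgrp pgrp_sg by blast

text \<open>Let \<open>D\<close> be a maximal bad intersection. It is not normal, so its normalizer
  is proper, hence nilpotent, and its unique Sylow \<open>r\<close>-subgroup lies in some
  \<open>S3\<close>. Any Sylow \<open>U\<close> properly above \<open>D\<close> has elements outside
  \<open>D\<close> that normalize \<open>D\<close>; they lie in \<open>S3 \<inter> U\<close>, so
  maximality forces \<open>U = S3\<close>. This holds for both Sylow subgroups that define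
  \<open>D\<close>.\<close>

lemma syl_Int_sub_core:
  assumes L: "sg L" and r: "prime r"
    and nil: "\<And>T. sg T \<Longrightarrow> T \<subset> L \<Longrightarrow> r dvd card T \<Longrightarrow> nilp T"
    and S: "syl r L S" "syl r L T" "S \<noteq> T"
  shows "S \<inter> T \<subseteq> core r L"
proof (rule ccontr)
  let ?P = "\<lambda>D. \<exists>S T. syl r L S \<and> syl r L T \<and> S \<noteq> T \<and> D = S \<inter> T \<and> \<not> D \<subseteq> core r L"
  assume "\<not> S \<inter> T \<subseteq> core r L"
  then have 1: "?P (S \<inter> T)" using S by blast
  have 2: "D \<subseteq> L" if "?P D" for D using that sylD(2) by blast
  have "\<exists>D. ?P D \<and> S \<inter> T \<subseteq> D \<and> (\<forall>B. ?P B \<longrightarrow> D \<subseteq> B \<longrightarrow> B = D)"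
    by (rule ex_maximal_set[OF sg_finite[OF L], of ?P, OF 1 2])
  then obtain D where "?P D \<and> S \<inter> T \<subseteq> D \<and> (\<forall>B. ?P B \<longrightarrow> D \<subseteq> B \<longrightarrow> B = D)" by (rule exE)
  note D = this[THEN conjunct1] this[THEN conjunct2, THEN conjunct2]
  obtain S1 S2 where S12: "syl r L S1" "syl r L S2" "S1 \<noteq> S2" "D = S1 \<inter> S2" "\<not> D \<subseteq> core r L" using D(1) by blast
  have sD: "sg D" using S12 sg_Int sylD(1) by blast
  have DL: "D \<subseteq> L" using S12 sylD(2) by blast
  have pD: "pgrp r D" using pgrp_sub[OF sylD(3)[OF S12(1)] sD _ r] S12(4) by blast
  let ?N = "nrm L D"
  have nD: "nml D ?N" using nml_nrm[OF L sD DL] .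
  have sN: "sg ?N" using sg_nrm[OF L] .
  have "?N \<noteq> L"
  proof
    assume "?N = L"
    then have "sn L D" using nD sn_nml by simp
    then show False using sn_pgrp_sub_core[OF r _ pD] S12(5) by blast
  qed
  moreover have "r dvd card ?N"
  proof -
    obtain n where n: "card D = r ^ n" using pD pgrp_def by blast
    have "D \<noteq> {1}" using S12(5) sg_one[OF nmlD(1)[OF nml_core[OF L]]] by blast
    then have "n \<noteq> 0" using n sg_eq_one_iff[OF sD] by (metis power_0)
    then have "r dvd card D" using n by (simp add: dvd_power)
    then show ?thesis using sg_card_dvd[OF sD sN nmlD(3)[OF nD]] dvd_trans by blast
  qed
  ultimately have nilN: "nilp ?N" using nil[OF sN] nrm_sub[of L D] by blast
  obtain S0 where S0: "syl r ?N S0" using ex_syl[OF sN r] by blast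
  have nS0: "nml S0 ?N" using nilp_syl_nml[OF nilN sN r S0] .
  have in0: "A \<subseteq> S0" if "pgrp r A" "A \<subseteq> ?N" for A
    using pgrp_sub_cj_syl[OF sN r S0 that] nml_image[OF nS0] by blast
  obtain S3 where S3: "syl r L S3" "S0 \<subseteq> S3"
    using pgrp_sub_syl[OF L r sylD(3)[OF S0]] sylD(2)[OF S0] nrm_sub[of L D] by blast
  have "S3 = U" if U: "syl r L U" "D \<subseteq> U" "D \<noteq> U" for U
  proof (rule ccontr)
    assume ne: "S3 \<noteq> U"
    have nilU: "nilp U" using nilp_pgrp[OF r sylD(3)[OF U(1)]] .
    obtain w where w: "w \<in> U - D" "cj w ` D = D"
      using nilp_normalizer_grows[OF nilU sylD(1)[OF U(1)] sD U(2,3)] by blast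
    have "nrm U D \<subseteq> ?N" using sylD(2)[OF U(1)] by (auto simp: nrm_def)
    moreover have "pgrp r (nrm U D)"
      using pgrp_sub[OF sylD(3)[OF U(1)] sg_nrm[OF sylD(1)[OF U(1)]] nrm_sub r] .
    ultimately have sub: "nrm U D \<subseteq> S3" using in0 S3(2) by blast
    have "w \<in> nrm U D" using w by (simp add: nrm_def)
    moreover have "D \<subseteq> nrm U D" using U(2) cj_image_self[OF sD] by (auto simp: nrm_def)
    ultimately have "D \<subseteq> S3 \<inter> U" "w \<in> S3 \<inter> U" using sub U(2) w by blast+
    moreover have "?P (S3 \<inter> U)" using S3(1) U(1) ne S12(5) \<open>D \<subseteq> S3 \<inter> U\<close> by blast
    ultimately show False using D(2) w by blast
  qed
  note eq = this
  have "card S1 = card S2" using S12 by (simp add: syl_def)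
  then have "D \<noteq> S1" "D \<noteq> S2"
    using S12(3,4) sg_finite sylD(1)[OF S12(1)] sylD(1)[OF S12(2)] by (metis card_subset_eq inf.cobounded1 inf.cobounded2)+
  then have "S3 = S1" "S3 = S2" using eq S12 by blast+
  then show False using S12(3) by blast
qed

text \<open>Suppose all proper subgroups of order divisible by \<open>r\<close> are nilpotent. Then
  \<open>r'\<close>-elements of the normalizer of a Sylow subgroup \<open>Q\<close> centralize
  \<open>Q\<close>, and distinct Sylow subgroups meet inside the core. So the transfer of
  \<open>Q\<close> onto an abelian quotient raises \<open>\<phi> x\<close> to a power prime to
  \<open>r\<close> and cannot vanish, whereas a perfect group has no non-trivial homomorphism into
  an abelian group.\<close>

lemma perfect_ex_not_nilp:
  assumes L: "sg L" "comm L L = L" "L \<noteq> {1}" and r: "prime r" "r dvd card L"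
  shows "\<exists>T. sg T \<and> T \<subset> L \<and> r dvd card T \<and> \<not> nilp T"
proof (rule ccontr)
  assume "\<not> ?thesis"
  then have nil: "\<And>T. sg T \<Longrightarrow> T \<subset> L \<Longrightarrow> r dvd card T \<Longrightarrow> nilp T" by blast
  obtain Q where Q: "syl r L Q" using ex_syl[OF L(1) r(1)] by blast
  note sQ = sylD(1)[OF Q] and QL = sylD(2)[OF Q] and pQ = sylD(3)[OF Q]
  have rQ: "r dvd card Q"
  proof -
    have "multiplicity r (card L) > 0" using r sg_card_pos[OF L(1)] by (simp add: prime_multiplicity_gt_zero_iff)
    then show ?thesis using Q by (simp add: syl_def dvd_power)
  qed
  let ?N = "nrm L Q"
  have sN: "sg ?N" and nQ: "nml Q ?N" and NL: "?N \<subseteq> L"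
    using sg_nrm[OF L(1)] nml_nrm[OF L(1) sQ QL] nrm_sub by blast+
  have commQ: "x * q = q * x" if x: "x \<in> ?N" "p'el r x" and q: "q \<in> Q" for x q
  proof -
    have sc: "sg (cyc x)" "x \<in> L" using sg_cyc[OF sN x(1)] x(1) NL by blast+
    let ?T = "Q \<bullet> cyc x"
    have nT: "nml Q ?T"
      by (rule nml_setmul_self[OF sQ sc(1)]) (use cyc_normalizes x(1) in \<open>auto simp: nrm_def\<close>)
    have TL: "?T \<subseteq> L" using setmul_least[OF L(1) QL cyc_least[OF L(1) sc(2)]] .
    have xT: "x \<in> ?T" using setmul_right[OF sQ, of "cyc x"] cyc_self by blast
    \<comment> \<open>If this product were all of \<open>L\<close>, then \<open>L\<close> modulo
      \<open>Q\<close> would be cyclic and the perfect group \<open>L\<close> would be the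
      \<open>r\<close>-group \<open>Q\<close>.\<close>
    have "?T \<noteq> L"
    proof
      assume e: "?T = L"
      then have "comm L L \<subseteq> Q" using comm_sub_of_cyclic_quotient[OF nT xT] by simp
      then have "Q = L" using L(2) QL by simp
      then show False using pgrp_perfect[OF r(1) pQ] L by simp
    qed
    then have "nilp ?T"
      using nil[OF nmlD(2)[OF nT]] TL sg_card_dvd[OF sQ nmlD(2)[OF nT] nmlD(3)[OF nT]] rQ dvd_trans by blast
    then have "q * x = x * q"
      using nilp_pel_p'el_commute[OF _ nmlD(2)[OF nT] _ xT _ x(2)] pgrp_pel[OF pQ q] q nmlD(3)[OF nT] by blast
    then show ?thesis by simp
  qed
  \<comment> \<open>The kernel \<open>W\<close> of the quotient must be proper in \<open>Q\<close>
    and contain the core, which controls the conjugates from outside the normalizer. If the core is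
    all of \<open>Q\<close>, then \<open>Q\<close> is normal, there are no elements outside, and
    \<open>{1}\<close> can take its place.\<close>
  define W0 where "W0 = (if core r L = Q then {1} else core r L)"
  have "nml W0 L" using nml_core[OF L(1)] nml_one[OF L(1)] by (simp add: W0_def)
  moreover have W0Q: "W0 \<subseteq> Q" using core_sub_syl[OF Q] sg_one[OF sQ] by (simp add: W0_def)
  ultimately have "nml W0 Q" using nml_sub sQ QL by blast
  moreover have "Q \<noteq> {1}"
  proof
    assume "Q = {1}"
    then have "card Q = 1" by simp
    then show False using rQ r(1) by simp
  qed
  then have "W0 \<noteq> Q" by (auto simp: W0_def)
  ultimately obtain W where W: "nml W Q" "W0 \<subseteq> W" "W \<noteq> Q" "comm Q Q \<subseteq> W"
    using nilp_ex_nml_derived[OF nilp_pgrp[OF r(1) pQ] sQ, of W0] by blast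
  obtain x where x: "x \<in> Q" "x \<notin> W" using W(1,3) nmlD(3) by blast
  define \<phi> where "\<phi> = (\<lambda>m. W #>\<^bsub>rec Q\<^esub> m)"
  define A where "A = rec Q Mod W"
  note A = abelian_quotient[OF W(1,4), folded \<phi>_def A_def]
  interpret A: comm_group A using A(1) .
  interpret transfer A L Q \<phi>
    by unfold_locales (use L(1) sQ QL A in auto)
  have phi_cj: "\<phi> (cj q x) = \<phi> x" if q: "q \<in> Q" for q
  proof -
    have "cj q x = cm q x * x" by (simp add: cm_cj(2) mult.assoc)
    moreover have "cm q x \<in> W" using W(4) comm_mem[OF q x(1)] by blast
    moreover have "cm q x \<in> Q" using sg_cm[OF sQ q x(1)] .
    ultimately show ?thesis using A(3)[of "cm q x" x] A(4)[of "cm q x"] A(2)[of x] x(1) by simp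
  qed
  have "V x = \<phi> x [^]\<^bsub>A\<^esub> (card ?N div card Q)"
  proof (rule V_eval[OF x(1) sN nmlD(3)[OF nQ] NL])
    fix t assume t: "t \<in> ?N"
    then show "cj t x \<in> Q" using nmlD(4)[OF nQ] x by blast
    obtain i j where ij: "t = t ^ i * t ^ j" "pel r (t ^ i)" "p'el r (t ^ j)"
      using pel_p'el_decompose[OF sN t r(1)] by blast
    have ti: "t ^ i \<in> ?N" "t ^ j \<in> ?N" using sg_power[OF sN t] by auto
    have "t ^ i \<in> Q"
    proof -
      have "syl r ?N Q" using syl_sub[OF L(1) r(1) Q sN nmlD(3)[OF nQ] NL] .
      then obtain z where "z \<in> ?N" "cyc (t ^ i) \<subseteq> cj z ` Q"
        using pgrp_sub_cj_syl[OF sN r(1) _ pgrp_cyc[OF sN ti(1) r(1) ij(2)] cyc_least[OF sN ti(1)]] by blast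
      then show ?thesis using nml_image[OF nQ] cyc_self by blast
    qed
    moreover have "cj (t ^ j) x = x" using commQ[OF ti(2) ij(3) x(1)] by (simp add: cj_eq_self_iff)
    then have "cj t x = cj (t ^ i) x" using ij(1) by (metis cj_cj)
    ultimately show "\<phi> (cj t x) = \<phi> x" using phi_cj by simp
  next
    fix t k assume t: "t \<in> L - ?N" and m: "cj t (x ^ k) \<in> Q"
    have "cj t ` Q \<noteq> Q" using t by (auto simp: nrm_def)
    then have "Q \<inter> cj t ` Q \<subseteq> core r L"
      using syl_Int_sub_core[OF L(1) r(1) nil Q syl_cj[OF L(1) Q]] t by blast
    moreover have "cj t (x ^ k) \<in> cj t ` Q" using sg_power[OF sQ x(1)] by blast
    ultimately have "cj t (x ^ k) \<in> core r L" using m by blast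
    moreover have "core r L \<noteq> Q"
    proof
      assume "core r L = Q"
      then have "?N = L" using nml_core[OF L(1), of r] nml_iff_nrm[OF L(1) sQ QL] by simp
      then show False using t by blast
    qed
    ultimately have "cj t (x ^ k) \<in> W" using W(2) by (auto simp: W0_def)
    then show "\<phi> (cj t (x ^ k)) = \<one>\<^bsub>A\<^esub>" using A(4)[OF m] by simp
  qed
  moreover have "V x = \<one>\<^bsub>A\<^esub>" using V_kernel(2) L(2) x(1) QL by blast
  ultimately have *: "\<phi> x [^]\<^bsub>A\<^esub> (card ?N div card Q) = \<one>\<^bsub>A\<^esub>" by simp
  have pow: "\<phi> (x ^ n) = \<phi> x [^]\<^bsub>A\<^esub> n" for n :: nat
  proof (induction n)
    case 0
    then show ?case using A(4)[of 1] sg_one[OF sQ] sg_one[OF nmlD(1)[OF W(1)]] by simp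
  next
    case (Suc n)
    have "\<phi> (x ^ n * x) = \<phi> (x ^ n) \<otimes>\<^bsub>A\<^esub> \<phi> x" using A(3) sg_power[OF sQ x(1)] x(1) by blast
    then show ?case using Suc by (simp add: power_commutes)
  qed
  \<comment> \<open>Both the power of \<open>x\<close> with exponent \<open>m\<close> and the one
    with exponent \<open>card Q\<close> lie in \<open>W\<close>; as \<open>m\<close> is prime to
    \<open>r\<close>, so does \<open>x\<close>.\<close>
  define m where "m = card ?N div card Q"
  have xm: "x ^ m \<in> W" using * pow[of m] A(4)[OF sg_power[OF sQ x(1)], of m] by (simp add: m_def)
  have "card ?N = card Q * m" using sg_card_dvd[OF sQ sN nmlD(3)[OF nQ]] by (simp add: m_def)
  then have "\<not> r dvd m" using syl_index[OF sN r(1) syl_sub[OF L(1) r(1) Q sN nmlD(3)[OF nQ] NL]] by blast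
  then have "coprime m (card Q)" using pgrp_card_coprime[OF r(1) pQ] by (simp add: coprime_commute)
  moreover have "x ^ card Q \<in> W" using power_card_eq_one[OF sQ x(1)] sg_one[OF nmlD(1)[OF W(1)]] by simp
  ultimately have "x \<in> W" using mem_of_coprime_powers[OF nmlD(1)[OF W(1)] sQ x(1) xm] by blast
  then show False using x by blast
qed

text \<open>A proper non-nilpotent \<open>T\<close> lies in a maximal normal \<open>N\<close>. For
  \<open>x\<close> outside \<open>N\<close> the subgroup \<open>N \<bullet> cyc x\<close> contains
  \<open>T\<close>, so it is subnormal as well and therefore equal to \<open>L\<close>; but then
  \<open>L\<close> modulo \<open>N\<close> is cyclic.\<close>

lemma perfect_not_all_sn:
  assumes L: "sg L" "comm L L = L" "L \<noteq> {1}" and r: "prime r" "r dvd card L"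
    and sn: "\<And>T. sg T \<Longrightarrow> T \<subseteq> L \<Longrightarrow> \<not> nilp T \<Longrightarrow> r dvd card T \<Longrightarrow> sn L T"
  shows False
proof -
  obtain T where T: "sg T" "T \<subset> L" "r dvd card T" "\<not> nilp T" using perfect_ex_not_nilp[OF L r] by blast
  have "sn L T" using sn T by blast
  then obtain N0 where N0: "nml N0 L" "N0 \<noteq> L" "T \<subseteq> N0" using sn_proper[of L T] T(2) by blast
  obtain N where N: "nml N L \<and> N \<noteq> L" "N0 \<subseteq> N" "\<forall>B. nml B L \<and> B \<noteq> L \<longrightarrow> N \<subseteq> B \<longrightarrow> B = N"
    using ex_maximal_set[of L "\<lambda>N. nml N L \<and> N \<noteq> L" N0] sg_finite[OF L(1)] N0 nmlD(3)[of _ L] by blast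
  then have nN: "nml N L" by blast
  obtain x where x: "x \<in> L" "x \<notin> N" using N(1) nmlD(3)[OF nN] by blast
  let ?Y = "N \<bullet> cyc x"
  have sY: "sg ?Y" using sg_nml_setmul[OF nN sg_cyc[OF L(1) x(1)] cyc_least[OF L(1) x(1)]] .
  have YL: "?Y \<subseteq> L" using setmul_least[OF L(1) nmlD(3)[OF nN] cyc_least[OF L(1) x(1)]] .
  have NY: "N \<subseteq> ?Y" using setmul_left[OF sg_cyc[OF L(1) x(1)]] .
  have xY: "x \<in> ?Y" using setmul_right[OF nmlD(1)[OF nN], of "cyc x"] cyc_self by blast
  have TY: "T \<subseteq> ?Y" using N0 N NY by blast
  have "\<not> nilp ?Y" using nilp_mono[OF _ sY T(1) TY] T(4) by blast
  moreover have "r dvd card ?Y" using sg_card_dvd[OF T(1) sY TY] T(3) dvd_trans by blast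
  ultimately have "sn L ?Y" using sn[OF sY YL] by blast
  have "?Y = L"
  proof (rule ccontr)
    assume "?Y \<noteq> L"
    then obtain B where B: "nml B L" "B \<noteq> L" "?Y \<subseteq> B" using sn_proper[OF \<open>sn L ?Y\<close>] by blast
    then have "B = N" using N(3) NY by blast
    then show False using B xY x by blast
  qed
  then have "comm L L \<subseteq> N" using comm_sub_of_cyclic_quotient[OF nN x(1)] by simp
  then show False using L(2) N(1) nmlD(3)[OF nN] by blast
qed

text \<open>Coprime action: \<open>A\<close> permutes the elements of the coset of \<open>x\<close>
  modulo \<open>F\<close>, whose number is prime to \<open>p\<close>. A coset that \<open>A\<close>
  leaves invariant therefore contains an element that \<open>A\<close> centralizes.\<close>

lemma coset_ex_centralized:
  assumes p: "prime p" and A: "pgrp p A" and F: "sg F" "\<not> p dvd card F"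
    and x: "\<And>a. a \<in> A \<Longrightarrow> x\<^sup>- * cj a x \<in> F" and inv: "\<And>a f. a \<in> A \<Longrightarrow> f \<in> F \<Longrightarrow> cj a f \<in> F"
  shows "\<exists>y. x\<^sup>- * y \<in> F \<and> (\<forall>a\<in>A. a * y = y * a)"
proof -
  obtain n where n: "card A = p ^ n" using A pgrp_def by blast
  have "\<exists>y\<in>lcos x F. \<forall>a\<in>A. cj a y = y"
  proof (rule ex_fixed_point[OF p pgrp_sg[OF A] n])
    show "finite (lcos x F)" using sg_finite[OF F(1)] by (simp add: lcos_def)
    show "\<not> p dvd card (lcos x F)" using F(2) by simp
    show "cj a y \<in> lcos x F" if a: "a \<in> A" and y: "y \<in> lcos x F" for a y
    proof -
      have "x\<^sup>- * cj a y = (x\<^sup>- * cj a x) * cj a (x\<^sup>- * y)" by (simp add: cj_def gsimps)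
      then show ?thesis using x[OF a] inv[OF a] y sg_mult[OF F(1)] by (simp add: mem_lcos)
    qed
  qed auto
  then show ?thesis by (auto simp: mem_lcos cj_eq_self_iff)
qed

text \<open>A perfect \<open>Y\<close> generates a perfect normal subgroup \<open>L\<close>. If
  \<open>p\<close> divides its order, \<open>perfect_not_all_sn\<close> applies at once. Otherwise
  \<open>P\<close> of order \<open>p\<close> acts coprimely on \<open>L\<close>, and the
  contradiction comes from a perfect subgroup \<open>Z\<close> of \<open>L\<close> that
  \<open>P\<close> centralizes.\<close>

lemma solv_of_sn:
  assumes X: "sg X" and p: "prime p" "p dvd card X"
    and sn: "\<And>T. sg T \<Longrightarrow> T \<subseteq> X \<Longrightarrow> \<not> nilp T \<Longrightarrow> p dvd card T \<Longrightarrow> sn X T"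
  shows "solv X"
  unfolding solv_def
proof (intro allI impI, rule ccontr)
  fix Y assume "sg Y \<and> Y \<subseteq> X \<and> comm Y Y = Y" and Y1: "Y \<noteq> {1}"
  then have Y: "sg Y" "Y \<subseteq> X" "comm Y Y = Y" by auto
  obtain L where L: "nml L X \<and> Y \<subseteq> L" "\<forall>B. nml B X \<and> Y \<subseteq> B \<longrightarrow> B \<subseteq> L \<longrightarrow> B = L"
    using ex_minimal_set[of "\<lambda>N. nml N X \<and> Y \<subseteq> N" X] sg_finite[OF X] nml_refl[OF X] Y(2) by blast
  then have nL: "nml L X" and YL: "Y \<subseteq> L" by blast+
  note sL = nmlD(1)[OF nL] and LX = nmlD(3)[OF nL]
  \<comment> \<open>The derived subgroup of \<open>L\<close> is normal in \<open>X\<close> and still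
    contains \<open>Y\<close>, so minimality of \<open>L\<close> makes it equal to
    \<open>L\<close>.\<close>
  have perf: "comm L L = L"
    using L(2) nml_comm[OF nL nL] comm_mono[OF YL YL] comm_sub[OF sL subset_refl subset_refl] Y(3) by blast
  have L1: "L \<noteq> {1}" using YL Y1 sg_one[OF Y(1)] by blast
  have pL: "\<not> p dvd card L"
  proof
    assume "p dvd card L"
    then show False
    proof (rule perfect_not_all_sn[OF sL perf L1 p(1)])
      show "sn L T" if "sg T" "T \<subseteq> L" "\<not> nilp T" "p dvd card T" for T
        using sn_restrict[OF sn sL LX] that LX by blast
    qed
  qed
  obtain P where P: "sg P" "P \<subseteq> X" "card P = p" using ex_subgroup_card_power[OF X p(1), of 1] p(2) by auto
  have pP: "pgrp p P" unfolding pgrp_def using P by (metis power_one_right)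
  have LP: "L \<inter> P = {1}"
  proof -
    have "sg (L \<inter> P)" using sg_Int sL P(1) by blast
    moreover have "card (L \<inter> P) dvd p" "card (L \<inter> P) dvd card L"
      using sg_card_dvd calculation sL P by (metis inf.cobounded2, metis inf.cobounded1)
    then have "card (L \<inter> P) = 1" using p(1) pL by (metis prime_nat_iff)
    ultimately show ?thesis using sg_eq_one_iff by blast
  qed
  have invL: "cj a ` L = L" if "a \<in> P" for a using nml_image[OF nL] that P(2) by blast
  have sUP: "sg (U \<bullet> P)" if U: "sg U" "\<And>a. a \<in> P \<Longrightarrow> cj a ` U = U" for U
    by (rule sg_setmul) (use U P in auto)
  have pUP: "p dvd card (U \<bullet> P)" if U: "sg U" "\<And>a. a \<in> P \<Longrightarrow> cj a ` U = U" for U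
    using sg_card_dvd[OF P(1) sUP[OF U] setmul_right[OF U(1)]] P(3) by simp
  \<comment> \<open>If every proper \<open>P\<close>-invariant \<open>U\<close> gives a nilpotent
    \<open>U \<bullet> P\<close>, then \<open>P\<close> centralizes an invariant Sylow subgroup for
    each prime, hence \<open>L\<close>, and \<open>Z = L\<close> works. Otherwise
    \<open>U \<bullet> P\<close> lies in a proper normal \<open>N\<close> of
    \<open>L \<bullet> P\<close>, which provides the normal subgroup \<open>F\<close> of
    \<open>L\<close>.\<close>
  have "\<exists>Z. sg Z \<and> Z \<subseteq> L \<and> Z \<noteq> {1} \<and> comm Z Z = Z \<and> (\<forall>a\<in>P. \<forall>z\<in>Z. a * z = z * a)"
  proof (cases "\<exists>U. sg U \<and> U \<subset> L \<and> (\<forall>a\<in>P. cj a ` U = U) \<and> \<not> nilp (U \<bullet> P)")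
    case False
    have "cent L P = L"
    proof (rule sg_eq_of_sylows[OF sg_cent[OF sL] sL cent_sub])
      fix r :: nat assume r: "prime r"
      obtain R where R: "syl r L R" "\<forall>a\<in>P. cj a ` R = R"
        using ex_invariant_syl[OF p(1) r pP sL pL invL] by blast
      have "R \<noteq> L" using pgrp_perfect[OF r, of L] sylD(3)[OF R(1)] perf L1 by blast
      then have nil: "nilp (R \<bullet> P)" using False sylD(1,2)[OF R(1)] R(2) by blast
      have sR: "sg (R \<bullet> P)" using sUP[OF sylD(1)[OF R(1)]] R(2) by blast
      have "x * a = a * x" if x: "x \<in> R" and a: "a \<in> P" for x a
      proof (rule nilp_coprime_commute[OF nil sR])
        show "x \<in> R \<bullet> P" "a \<in> R \<bullet> P"
          using x a setmul_left[OF P(1), of R] setmul_right[OF sylD(1)[OF R(1)], of P] by blast+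
        show "x ^ card R = 1" using power_card_eq_one[OF sylD(1)[OF R(1)] x] .
        show "a ^ p = 1" using power_card_eq_one[OF P(1) a] P(3) by simp
        have "\<not> p dvd card R" using pL sg_card_dvd[OF sylD(1)[OF R(1)] sL sylD(2)[OF R(1)]] dvd_trans by blast
        then show "coprime (card R) p" using p(1) prime_imp_coprime coprime_commute by blast
      qed
      then have "R \<subseteq> cent L P" using sylD(2)[OF R(1)] by (auto simp: cent_def)
      then show "\<exists>S. syl r L S \<and> S \<subseteq> cent L P" using R(1) by blast
    qed
    then have "\<forall>z\<in>L. \<forall>a\<in>P. z * a = a * z" unfolding cent_def by blast
    then have "\<forall>a\<in>P. \<forall>z\<in>L. a * z = z * a" by metis
    then show ?thesis using sL perf L1 by blast
  next
    case True
    then obtain U where U: "sg U" "U \<subset> L" "\<And>a. a \<in> P \<Longrightarrow> cj a ` U = U" "\<not> nilp (U \<bullet> P)" by blast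
    have sLP: "sg (L \<bullet> P)" using sUP[OF sL invL] .
    have LPX: "L \<bullet> P \<subseteq> X" using setmul_least[OF X LX P(2)] .
    have sub: "U \<bullet> P \<subseteq> L \<bullet> P" using setmul_mono U(2) by blast
    have "sn X (U \<bullet> P)" using sn[OF sUP[OF U(1,3)]] sub LPX U(4) pUP[OF U(1,3)] by blast
    then have snU: "sn (L \<bullet> P) (U \<bullet> P)" using sn_restrict[OF _ sLP LPX sub] by blast
    have "U \<bullet> P \<noteq> L \<bullet> P"
      using setmul_Int[OF sL _ LP P(1), of U] setmul_Int[OF sL _ LP P(1), of L] U(2) by blast
    then obtain N where N: "nml N (L \<bullet> P)" "N \<noteq> L \<bullet> P" "U \<bullet> P \<subseteq> N" using sn_proper[OF snU] by blast
    have PN: "P \<subseteq> N" using N(3) setmul_right[OF U(1), of P] by blast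
    have LLP: "L \<subseteq> L \<bullet> P" using setmul_left[OF P(1)] .
    define F where "F = N \<inter> L"
    have nF: "nml F (L \<bullet> P)" unfolding F_def
      using nml_Int[OF N(1)] nml_sub[OF nL sLP LLP LPX] by blast
    have FL: "F \<noteq> L"
    proof
      assume "F = L"
      then have "L \<bullet> P \<subseteq> N" using setmul_least[OF nmlD(1)[OF N(1)] _ PN] by (auto simp: F_def)
      then show False using N nmlD(3)[OF N(1)] by blast
    qed
    have pF: "\<not> p dvd card F"
      using pL sg_card_dvd[OF nmlD(1)[OF nF] sL] dvd_trans by (auto simp: F_def)
    have PLP: "P \<subseteq> L \<bullet> P" using setmul_right[OF sL] .
    \<comment> \<open>Since \<open>P \<subseteq> N\<close>, the group \<open>P\<close> acts
      trivially on \<open>L\<close> modulo \<open>F\<close>; each coset therefore contains an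
      element centralized by \<open>P\<close>.\<close>
    have LF: "L = F \<bullet> cent L P"
    proof
      show "F \<bullet> cent L P \<subseteq> L" using setmul_least[OF sL] cent_sub[of L P] by (auto simp: F_def)
      show "L \<subseteq> F \<bullet> cent L P"
      proof
        fix x assume x: "x \<in> L"
        have "\<exists>y. x\<^sup>- * y \<in> F \<and> (\<forall>a\<in>P. a * y = y * a)"
        proof (rule coset_ex_centralized[OF p(1) pP nmlD(1)[OF nF] pF])
          fix a assume a: "a \<in> P"
          have "x\<^sup>- * cj a x = cj (x\<^sup>-) a * a\<^sup>-" by (simp add: cj_def mult.assoc)
          moreover have "cj (x\<^sup>-) a \<in> N" using nmlD(4)[OF N(1)] sg_inv[OF sL x] a LLP PN by blast
          ultimately have "x\<^sup>- * cj a x \<in> N" using sg_mult[OF nmlD(1)[OF N(1)]] sg_inv[OF nmlD(1)[OF N(1)]] a PN by auto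
          moreover have "x\<^sup>- * cj a x \<in> L" using x a P(2) nmlD(4)[OF nL] sg_mult[OF sL] sg_inv[OF sL] by blast
          ultimately show "x\<^sup>- * cj a x \<in> F" by (simp add: F_def)
          show "cj a f \<in> F" if "f \<in> F" for f using nmlD(4)[OF nF] that a PLP by blast
        qed
        then obtain y where y: "x\<^sup>- * y \<in> F" "\<forall>a\<in>P. a * y = y * a" by blast
        then have "x\<^sup>- * y \<in> L" by (simp add: F_def)
        then have yL: "y \<in> L" using sg_mult_iff(1)[OF sL sg_inv[OF sL x]] by blast
        then have "y \<in> cent L P" using y(2) by (auto simp: cent_def)
        moreover have "cj y ((x\<^sup>- * y)\<^sup>-) \<in> F"
          using nmlD(4)[OF nF] sg_inv[OF nmlD(1)[OF nF] y(1)] yL LLP by blast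
        moreover have "x = cj y ((x\<^sup>- * y)\<^sup>-) * y" by (simp add: cj_def gsimps)
        ultimately show "x \<in> F \<bullet> cent L P" using setmulI by metis
      qed
    qed
    \<comment> \<open>A minimal supplement of \<open>F\<close> among the subgroups centralized by
      \<open>P\<close> is perfect by \<open>comm_setmul_sub\<close>.\<close>
    obtain Z where Z: "sg Z \<and> Z \<subseteq> cent L P \<and> L = F \<bullet> Z" "\<forall>B. sg B \<and> B \<subseteq> cent L P \<and> L = F \<bullet> B \<longrightarrow> B \<subseteq> Z \<longrightarrow> B = Z"
      using ex_minimal_set[of "\<lambda>Z. sg Z \<and> Z \<subseteq> cent L P \<and> L = F \<bullet> Z" "cent L P"]
        LF sg_cent[OF sL] sg_finite[OF sg_cent[OF sL]] by blast
    have sZ: "sg Z" and ZL: "Z \<subseteq> L" and LZ: "L = F \<bullet> Z" using Z(1) cent_sub[of L P] by blast+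
    have "nml F L" using nml_sub[OF nF sL _ LLP] by (auto simp: F_def)
    then have "L \<subseteq> F \<bullet> comm Z Z" using comm_setmul_sub[of F Z] LZ sZ perf by simp
    moreover have "F \<bullet> comm Z Z \<subseteq> L"
      using setmul_least[OF sL _ comm_sub[OF sL ZL ZL], of F] by (auto simp: F_def)
    ultimately have "L = F \<bullet> comm Z Z" by blast
    then have "comm Z Z = Z"
      using Z sg_comm[OF sZ subset_refl subset_refl] comm_sub[OF sZ subset_refl subset_refl] by blast
    moreover have "Z \<noteq> {1}" using LZ FL by auto
    moreover have "\<forall>a\<in>P. \<forall>z\<in>Z. a * z = z * a" using Z(1) by (auto simp: cent_def)
    ultimately show ?thesis using sZ ZL by blast
  qed
  then obtain Z where Z: "sg Z" "Z \<subseteq> L" "Z \<noteq> {1}" "comm Z Z = Z" "\<forall>a\<in>P. \<forall>z\<in>Z. a * z = z * a" by blast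
  have "card Z \<noteq> 1" using Z(3) sg_eq_one_iff[OF Z(1)] by blast
  \<comment> \<open>Any prime divisor of \<open>card Z\<close> serves. A non-nilpotent
    \<open>T \<subseteq> Z\<close> becomes subject to the hypothesis after multiplication by
    \<open>P\<close>, and intersecting \<open>T \<bullet> P\<close> with \<open>Z\<close> recovers
    \<open>T\<close>.\<close>
  then obtain r where r: "prime r" "r dvd card Z" using prime_factor_nat by blast
  show False
  proof (rule perfect_not_all_sn[OF Z(1,4,3) r])
    fix T assume T: "sg T" "T \<subseteq> Z" "\<not> nilp T" "r dvd card T"
    have inv: "cj a ` T = T" if "a \<in> P" for a
    proof -
      have "cj a t = t" if "t \<in> T" for t using that \<open>a \<in> P\<close> Z(5) T(2) by (metis cj_eq_self_iff subsetD)
      then show ?thesis by force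
    qed
    have s: "sg (T \<bullet> P)" using sUP[OF T(1) inv] .
    have "T \<subseteq> T \<bullet> P" using setmul_left[OF P(1)] .
    then have "\<not> nilp (T \<bullet> P)" using nilp_mono[OF _ s T(1)] T(3) by blast
    moreover have "T \<bullet> P \<subseteq> X" using setmul_least[OF X] T(2) Z(2) LX P(2) by blast
    ultimately have "sn X (T \<bullet> P)" using sn[OF s] pUP[OF T(1) inv] by blast
    then have "sn Z ((T \<bullet> P) \<inter> Z)" using sn_Int Z(1,2) LX by blast
    moreover have "(T \<bullet> P) \<inter> Z = T"
    proof (rule setmul_Int[OF Z(1) T(2) _ P(1)])
      show "Z \<inter> P = {1}" using LP Z(2) sg_one[OF Z(1)] sg_one[OF P(1)] by blast
    qed
    ultimately show "sn Z T" by simp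
  qed
qed

section \<open>TI-subgroups and the maximal non-subnormal subgroup\<close>

definition TI :: "'g::group_mult set \<Rightarrow> 'g set \<Rightarrow> bool" where
  "TI X T \<longleftrightarrow> (\<forall>g\<in>X. cj g ` T \<inter> T = {1} \<or> cj g ` T \<inter> T = T)"

definition TI_or_sn :: "nat \<Rightarrow> 'g::group_mult set \<Rightarrow> bool" where
  "TI_or_sn p X \<longleftrightarrow> (\<forall>T. sg T \<longrightarrow> T \<subseteq> X \<longrightarrow> \<not> nilp T \<longrightarrow> p dvd card T \<longrightarrow> TI X T \<or> sn X T)"

lemma TI_cj: assumes "TI X T" "sg T" "g \<in> X" "x \<in> T" "x \<noteq> 1" "cj g x \<in> T" shows "cj g ` T = T"
proof -
  have "cj g x \<in> cj g ` T \<inter> T" "cj g x \<noteq> 1" using assms by auto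
  then have "cj g ` T \<inter> T \<noteq> {1}" by blast
  then have "T \<subseteq> cj g ` T" using assms(1,3) unfolding TI_def by blast
  then show ?thesis using sg_finite[OF assms(2)] by (metis card_cj card_subset_eq finite_imageI)
qed

lemma TI_nml: assumes "TI X T" "sg X" "sg T" "T \<subseteq> X" "nml N X" "N \<subseteq> T" "N \<noteq> {1}" shows "nml T X"
proof -
  obtain x where x: "x \<in> N" "x \<noteq> 1" using sg_ne_one nmlD(1)[OF assms(5)] assms(7) by blast
  have "cj g ` T = T" if "g \<in> X" for g
    using TI_cj[OF assms(1,3) that, of x] x nmlD(4)[OF assms(5) that] assms(6) by blast
  then show ?thesis unfolding nml_def using assms by blast
qed

lemma TI_or_sn_mono: assumes "TI_or_sn p X" "sg Y" "Y \<subseteq> X" shows "TI_or_sn p Y"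
  unfolding TI_or_sn_def
proof (intro allI impI)
  fix T assume T: "sg T" "T \<subseteq> Y" "\<not> nilp T" "p dvd card T"
  then have "TI X T \<or> sn X T" using assms unfolding TI_or_sn_def by blast
  then show "TI Y T \<or> sn Y T" using assms T sn_restrict[of X T Y] unfolding TI_def by blast
qed

lemma nilp_trivial: "nilp {1}"
  unfolding nilp_def by (metis lcs.simps(1))

lemma ex_FP:
  assumes X: "sg X" and hyp: "TI_or_sn p X" and T: "sg T" "T \<subseteq> X" "\<not> nilp T" "p dvd card T" "\<not> sn X T"
  shows "\<exists>M. FP X M \<and> \<not> nilp M \<and> p dvd card M \<and> (\<forall>L. sg L \<longrightarrow> M \<subseteq> L \<longrightarrow> L \<subseteq> X \<longrightarrow> L = M \<or> L = X)"
proof -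
  let ?P = "\<lambda>T. sg T \<and> T \<subseteq> X \<and> \<not> nilp T \<and> p dvd card T \<and> \<not> sn X T"
  obtain M where M: "?P M" "\<forall>B. ?P B \<longrightarrow> M \<subseteq> B \<longrightarrow> B = M"
    using ex_maximal_set[of X ?P T] sg_finite[OF X] T by blast
  then have sM: "sg M" "M \<subseteq> X" "\<not> nilp M" "p dvd card M" "\<not> sn X M" by blast+
  \<comment> \<open>Larger subgroups are again non-nilpotent and of order divisible by
    \<open>p\<close>, so by the choice of \<open>M\<close> they can only be subnormal. This gives
    first that \<open>M\<close> is self-normalizing and then, by \<open>FP_sn_eq\<close>, that it is
    maximal.\<close>
  have up: "sn X L" if L: "sg L" "M \<subseteq> L" "L \<subseteq> X" "L \<noteq> M" for L
    using M(2) L nilp_mono[OF _ L(1) sM(1) L(2)] sM(3,4) sg_card_dvd[OF sM(1) L(1,2)] dvd_trans by blast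
  have N: "nrm X M = M"
  proof (rule ccontr)
    assume "nrm X M \<noteq> M"
    then have "sn X (nrm X M)" using up[OF sg_nrm[OF X] _ nrm_sub] nmlD(3)[OF nml_nrm[OF X sM(1,2)]] by blast
    then show False using sn.step nml_nrm[OF X sM(1,2)] sM(5) by blast
  qed
  have TI: "TI X M" using hyp sM unfolding TI_or_sn_def by blast
  have FP: "FP X M" unfolding FP_def
  proof (intro conjI ballI)
    show "M \<noteq> X" using sM(5) sn.top[OF X] by blast
    show "M \<noteq> {1}" using sM(3) nilp_trivial by blast
    fix g assume g: "g \<in> X - M"
    have "cj g ` M \<inter> M \<noteq> M"
    proof
      assume "cj g ` M \<inter> M = M"
      then have "cj g ` M = M" using sg_finite[OF sM(1)] by (metis card_cj card_subset_eq finite_imageI inf.cobounded1)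
      then show False using g N by (auto simp: nrm_def)
    qed
    then show "M \<inter> cj g ` M = {1}" using TI g unfolding TI_def by (metis DiffD1 Int_commute)
  qed (use X sM in auto)
  moreover have "L = M \<or> L = X" if "sg L" "M \<subseteq> L" "L \<subseteq> X" for L
    using FP_sn_eq[OF FP up[OF that]] that by blast
  ultimately show ?thesis using sM by blast
qed

lemma power_mult_commuting: "x * y = y * x \<Longrightarrow> (x * y) ^ n = x ^ n * y ^ n" for x :: "'a::monoid_mult"
proof (induction n)
  case (Suc n)
  have "(x * y) ^ Suc n = x * (y * x ^ n) * y ^ n" using Suc.IH[OF Suc.prems] by (simp add: mult.assoc)
  also have "y * x ^ n = x ^ n * y" using power_commuting_commutes[OF Suc.prems] by simp
  finally show ?case by (simp add: mult.assoc)
qed simp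

section \<open>The Frobenius kernel\<close>

locale frob =
  fixes X M :: "'g::group_mult set" and p :: nat
  assumes FP: "FP X M" and maximal: "\<And>L. sg L \<Longrightarrow> M \<subseteq> L \<Longrightarrow> L \<subseteq> X \<Longrightarrow> L = M \<or> L = X"
    and solvM: "solv M" and p: "prime p" and pM: "p dvd card M" and hyp: "TI_or_sn p X"
begin

definition K :: "'g set" where "K = kern X M"

lemmas sX = FPD(1)[OF FP] and sM = FPD(2)[OF FP] and MX = FPD(3)[OF FP]

lemma nK: "nml K X"
  unfolding K_def using FP_nml_kern[OF FP solvM] .

lemmas sK = nmlD(1)[OF nK] and KX = nmlD(3)[OF nK]

lemma KM: "K \<inter> M = {1}" and KMX: "K \<bullet> M = X" and cardK: "card K * card M = card X"
  unfolding K_def using kern_Int[OF sX sM] FP_kern_setmul[OF FP] sK FP_card_kern[OF FP] by (auto simp: K_def)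

lemma K_ne: "K \<noteq> {1}"
proof
  assume "K = {1}"
  then have "card M = card X" using cardK by simp
  then show False using FPD(4)[OF FP] MX sX sg_finite card_subset_eq by metis
qed

lemma fpf: assumes "x \<in> K" "a \<in> M" "a \<noteq> 1" "a * x = x * a" shows "x = 1"
proof -
  have "cj x a = a" using assms(4) by (simp add: cj_eq_self_iff)
  then have "x \<in> M" using FP_mem[OF FP, of x a] assms KX by auto
  then show ?thesis using KM assms(1) by blast
qed

lemma invK: "a \<in> M \<Longrightarrow> cj a ` K = K"
  using nml_image[OF nK] MX by blast

text \<open>By maximality of \<open>M\<close> the subgroup \<open>N \<bullet> M\<close> is
  \<open>X\<close>, and comparing orders gives \<open>card N = card K\<close>.\<close>

lemma K_minimal: assumes "nml N X" "N \<subseteq> K" "N \<noteq> {1}" shows "N = K"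
proof -
  have s: "sg (N \<bullet> M)" using sg_nml_setmul[OF assms(1) sM MX] .
  have "N \<bullet> M \<noteq> M"
  proof
    assume "N \<bullet> M = M"
    then have "N \<subseteq> K \<inter> M" using setmul_left[OF sM, of N] assms(2) by blast
    then show False using KM assms(3) sg_one[OF nmlD(1)[OF assms(1)]] by blast
  qed
  then have "N \<bullet> M = X"
    using maximal[OF s setmul_right[OF nmlD(1)[OF assms(1)]]] setmul_least[OF sX nmlD(3)[OF assms(1)] MX] by blast
  then have "card N * card M = card (N \<inter> M) * card X" using card_setmul[OF nmlD(1)[OF assms(1)] sM] by simp
  moreover have "N \<inter> M = {1}" using KM assms(2) sg_one[OF nmlD(1)[OF assms(1)]] sg_one[OF sM] by blast
  ultimately have "card N * card M = card K * card M" using cardK by simp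
  then have "card N = card K" using sg_card_pos[OF sM] by simp
  then show ?thesis using card_subset_eq[OF sg_finite[OF sK] assms(2)] by blast
qed

text \<open>An element of order \<open>a\<close> in \<open>M\<close> fixes only the identity of
  \<open>K\<close>, so \<open>card K\<close> is congruent to 1 modulo \<open>a\<close>.\<close>

lemma coprime_K: assumes a: "prime a" "a dvd card M" shows "\<not> a dvd card K"
proof
  assume aK: "a dvd card K"
  obtain y where y: "y \<in> M" "od y = a" using cauchy[OF sM a] by blast
  then have y1: "y \<noteq> 1" using od_eq_one_iff[OF sM y(1)] a(1) by (metis not_prime_1)
  let ?F = "{w \<in> K. \<forall>t\<in>cyc y. cj t w = w}"
  have "card K mod a = card ?F mod a"
  proof (rule card_mod_fixed_points[OF a(1) sg_cyc[OF sM y(1)], of 1])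
    show "card (cyc y) = a ^ 1" using y(2) by (simp add: od_def)
    show "finite K" using sg_finite[OF sK] .
    show "cj t w \<in> K" if "t \<in> cyc y" "w \<in> K" for t w
      using that nmlD(4)[OF nK] cyc_least[OF sM y(1)] MX by blast
  qed auto
  moreover have "?F = {1}"
  proof -
    have "w = 1" if "w \<in> K" "cj y w = w" for w
      using fpf[OF that(1) y(1) y1] that(2) by (simp add: cj_eq_self_iff)
    then show ?thesis using sg_one[OF sK] by auto
  qed
  ultimately have "card K mod a = 1 mod a" by simp
  then show False using aK a(1) by (simp add: dvd_eq_mod_eq_0 prime_nat_iff)
qed

lemmas pK = coprime_K[OF p pM]

text \<open>If \<open>U \<bullet> P\<close> were nilpotent, its elements of coprime orders would
  commute, but no non-identity element of \<open>P\<close> commutes with one of \<open>K\<close>. So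
  the hypothesis on \<open>X\<close> applies to \<open>U \<bullet> P\<close>.\<close>

lemma UP:
  assumes P: "sg P" "P \<subseteq> M" "card P = p" and U: "sg U" "U \<subseteq> K" "U \<noteq> {1}" "\<And>a. a \<in> P \<Longrightarrow> cj a ` U = U"
  shows "sg (U \<bullet> P)" "U \<bullet> P \<subseteq> X" "\<not> nilp (U \<bullet> P)" "p dvd card (U \<bullet> P)" "(U \<bullet> P) \<inter> K = U" "nml U (U \<bullet> P)"
    "TI X (U \<bullet> P) \<or> sn X (U \<bullet> P)"
proof -
  show s: "sg (U \<bullet> P)" by (rule sg_setmul[OF U(1) P(1)]) (use U(4) in blast)
  show UX: "U \<bullet> P \<subseteq> X" using setmul_least[OF sX] U(2) KX P(2) MX by blast
  have PU: "P \<subseteq> U \<bullet> P" using setmul_right[OF U(1)] .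
  show nn: "\<not> nilp (U \<bullet> P)"
  proof
    assume nil: "nilp (U \<bullet> P)"
    obtain u where u: "u \<in> U" "u \<noteq> 1" using sg_ne_one[OF U(1,3)] by blast
    have "P \<noteq> {1}" using P(3) p by (auto simp: prime_nat_iff)
    then obtain a where a: "a \<in> P" "a \<noteq> 1" using sg_ne_one[OF P(1)] by blast
    have "a * u = u * a"
    proof (rule nilp_coprime_commute[OF nil s])
      show "a \<in> U \<bullet> P" "u \<in> U \<bullet> P" using a u PU setmul_left[OF P(1), of U] by blast+
      show "a ^ p = 1" using power_card_eq_one[OF P(1) a(1)] P(3) by simp
      show "u ^ card K = 1" using power_card_eq_one[OF sK] u U(2) by blast
      show "coprime p (card K)" using pK p prime_imp_coprime by blast
    qed
    then show False using fpf[of u a] u a U(2) P(2) by blast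
  qed
  show pd: "p dvd card (U \<bullet> P)" using sg_card_dvd[OF P(1) s PU] P(3) by simp
  have KP: "K \<inter> P = {1}" using KM P(2) sg_one[OF sK] sg_one[OF P(1)] by blast
  show "(U \<bullet> P) \<inter> K = U" using setmul_Int[OF sK U(2) KP P(1)] .
  show "nml U (U \<bullet> P)" by (rule nml_setmul_self[OF U(1) P(1)]) (use U(4) in blast)
  show "TI X (U \<bullet> P) \<or> sn X (U \<bullet> P)" using hyp s UX nn pd unfolding TI_or_sn_def by blast
qed

text \<open>For such a \<open>y\<close> the coset of \<open>y\<close> modulo \<open>U\<close> is
  invariant under \<open>P\<close>, so it contains an element centralized by \<open>P\<close>; in
  \<open>K\<close> this can only be 1.\<close>

lemma normalizer_UP:
  assumes P: "sg P" "P \<subseteq> M" "card P = p" and U: "sg U" "U \<subseteq> K" "U \<noteq> {1}" "\<And>a. a \<in> P \<Longrightarrow> cj a ` U = U"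
    and y: "y \<in> K" "cj y ` (U \<bullet> P) = U \<bullet> P"
  shows "y \<in> U"
proof -
  note UP = UP[OF assms(1-7)]
  have pP: "pgrp p P" unfolding pgrp_def using P by (metis power_one_right)
  have "P \<noteq> {1}" using P(3) p by (auto simp: prime_nat_iff)
  then obtain a where a: "a \<in> P" "a \<noteq> 1" using sg_ne_one[OF P(1)] by blast
  have "\<exists>z. y\<^sup>- * z \<in> U \<and> (\<forall>a\<in>P. a * z = z * a)"
  proof (rule coset_ex_centralized[OF p pP U(1)])
    show "\<not> p dvd card U" using pK sg_card_dvd[OF U(1) sK U(2)] dvd_trans by blast
    fix a assume a: "a \<in> P"
    then have aUP: "a \<in> U \<bullet> P" using setmul_right[OF U(1), of P] by blast
    have "y\<^sup>- * cj a y = cj (y\<^sup>-) a * a\<^sup>-" by (simp add: cj_def mult.assoc)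
    moreover have "cj (y\<^sup>-) a \<in> U \<bullet> P" using y(2) aUP by (metis inverse_inv mem_cj_image)
    ultimately have "y\<^sup>- * cj a y \<in> U \<bullet> P" using sg_mult[OF UP(1)] sg_inv[OF UP(1)] aUP by simp
    moreover have "y\<^sup>- * cj a y \<in> K"
      using y(1) a P(2) MX nmlD(4)[OF nK] sg_mult[OF sK] sg_inv[OF sK] by blast
    ultimately show "y\<^sup>- * cj a y \<in> U" using UP(5) by blast
    show "cj a f \<in> U" if "f \<in> U" for f using U(4)[OF a] that by blast
  qed
  then obtain z where z: "y\<^sup>- * z \<in> U" "\<forall>a\<in>P. a * z = z * a" by blast
  have "z \<in> K" using z(1) U(2) y(1) sg_mult_iff(1)[OF sK sg_inv[OF sK y(1)]] by blast
  then have "z = 1" using fpf[of z a] a P(2) z(2) by blast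
  then show ?thesis using z(1) sg_inv_iff[OF U(1)] by simp
qed

lemma ex_P: "\<exists>P. sg P \<and> P \<subseteq> M \<and> card P = p"
  using ex_subgroup_card_power[OF sM p, of 1] pM by simp

text \<open>Let \<open>R\<close> be a \<open>P\<close>-invariant Sylow \<open>r\<close>-subgroup and
  suppose \<open>K\<close> is no \<open>r\<close>-group. Then no non-trivial
  \<open>P\<close>-invariant \<open>U \<subseteq> R\<close> yields a subnormal
  \<open>U \<bullet> P\<close>, as \<open>U\<close> would lie in \<open>core r K\<close>, which
  minimality of \<open>K\<close> would make equal to \<open>K\<close>. So
  \<open>U \<bullet> P\<close> is TI, from which \<open>R\<close> becomes an abelian Frobenius
  complement of \<open>K\<close>; its kernel is normal in \<open>X\<close>, against
  minimality.\<close>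

lemma K_pgrp: "\<exists>r. prime r \<and> pgrp r K"
proof -
  obtain P where P: "sg P" "P \<subseteq> M" "card P = p" using ex_P by blast
  have pP: "pgrp p P" unfolding pgrp_def using P by (metis power_one_right)
  have "card K \<noteq> 1" using K_ne sg_eq_one_iff[OF sK] by blast
  then obtain r where r: "prime r" "r dvd card K" using prime_factor_nat by blast
  obtain R where R: "syl r K R" "\<forall>a\<in>P. cj a ` R = R"
    using ex_invariant_syl[OF p r(1) pP sK pK] invK P(2) by blast
  note sR = sylD(1)[OF R(1)] and RK = sylD(2)[OF R(1)] and pR = sylD(3)[OF R(1)]
  have R1: "R \<noteq> {1}"
  proof
    assume "R = {1}"
    then have "r ^ multiplicity r (card K) = 1" using R(1) by (simp add: syl_def)
    then have "multiplicity r (card K) = 0" using r(1) by (metis gr0I one_less_power prime_gt_1_nat less_irrefl)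
    then show False using r sg_card_pos[OF sK] prime_multiplicity_gt_zero_iff[of r "card K"] by simp
  qed
  have "pgrp r K"
  proof (rule ccontr)
    assume npg: "\<not> pgrp r K"
    have TI: "TI X (U \<bullet> P)" if U: "sg U" "U \<subseteq> R" "U \<noteq> {1}" "\<And>a. a \<in> P \<Longrightarrow> cj a ` U = U" for U
    proof (rule ccontr)
      assume "\<not> TI X (U \<bullet> P)"
      then have "sn X (U \<bullet> P)" using UP(7)[OF P U(1) _ U(3,4)] U(2) RK by blast
      then have "sn X U" using sn.step UP(6)[OF P U(1) _ U(3,4)] U(2) RK by blast
      then have "sn K U" using sn_restrict[OF _ sK KX] U(2) RK by blast
      then have "U \<subseteq> core r K" using sn_pgrp_sub_core[OF r(1)] pgrp_sub[OF pR U(1,2) r(1)] by blast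
      moreover have "nml (core r K) X" unfolding nml_def
      proof (intro conjI ballI)
        show "core r K \<subseteq> X" using KX by (auto simp: core_def)
        fix x n assume x: "x \<in> X" and n: "n \<in> core r K"
        have "cj x n \<in> S" if "syl r K S" for S
        proof -
          have "syl r K (cj (x\<^sup>-) ` S)" using syl_cj_eq[OF that] nml_image[OF nK sg_inv[OF sX x]] by blast
          then have "n \<in> cj (x\<^sup>-) ` S" using n by (auto simp: core_def)
          then show ?thesis by (simp add: mem_cj_image)
        qed
        then show "cj x n \<in> core r K" using n nmlD(4)[OF nK x] by (auto simp: core_def)
      qed (use sX nmlD(1)[OF nml_core[OF sK]] in auto)
      moreover have "core r K \<noteq> {1}" using calculation(1) U(1,3) sg_one[OF U(1)] by blast
      ultimately have "core r K = K" using K_minimal[of "core r K"] by (auto simp: core_def)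
      then have "K \<subseteq> R" using core_sub_syl[OF R(1)] by simp
      then show False using pgrp_sub[OF pR sK _ r(1)] npg by blast
    qed
    \<comment> \<open>An element of \<open>K\<close> normalizing \<open>U\<close> sends a
      non-identity element of \<open>U \<bullet> P\<close> into \<open>U \<bullet> P\<close>. By TI
      it normalizes \<open>U \<bullet> P\<close>, and \<open>normalizer_UP\<close> puts it into
      \<open>U\<close>.\<close>
    have selfn: "y \<in> U" if U: "sg U" "U \<subseteq> R" "U \<noteq> {1}" "\<And>a. a \<in> P \<Longrightarrow> cj a ` U = U"
      and y: "y \<in> K" "cj y ` U = U" for U y
    proof -
      have UK: "U \<subseteq> K" using U(2) RK by blast
      obtain u where u: "u \<in> U" "u \<noteq> 1" using sg_ne_one[OF U(1,3)] by blast
      have "U \<subseteq> U \<bullet> P" using setmul_left[OF P(1)] .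
      then have "u \<in> U \<bullet> P" "cj y u \<in> U \<bullet> P" using u(1) y(2) by blast+
      then have "cj y ` (U \<bullet> P) = U \<bullet> P"
        using TI_cj[OF TI[OF U] UP(1)[OF P U(1) UK U(3,4)], of y u] y(1) KX u(2) by blast
      then show ?thesis using normalizer_UP[OF P U(1) UK U(3,4) y(1)] by blast
    qed
    \<comment> \<open>In the \<open>r\<close>-group \<open>R\<close> the normalizer of a proper
      subgroup is larger, while \<open>U\<close> is self-normalizing. In particular the derived
      subgroup of \<open>R\<close> is trivial.\<close>
    have irr: "U = R" if U: "sg U" "U \<subseteq> R" "U \<noteq> {1}" "\<And>a. a \<in> P \<Longrightarrow> cj a ` U = U" for U
    proof (rule ccontr)
      assume "U \<noteq> R"
      then obtain w where "w \<in> R - U" "cj w ` U = U"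
        using nilp_normalizer_grows[OF nilp_pgrp[OF r(1) pR] sR U(1,2)] by blast
      then show False using selfn[OF U, of w] RK by blast
    qed
    have abR: "comm R R = {1}"
    proof (rule ccontr)
      assume ne: "comm R R \<noteq> {1}"
      have "cj a ` comm R R = comm R R" if a: "a \<in> P" for a
      proof -
        have g: "{cm x y |x y. x \<in> R \<and> y \<in> R} \<subseteq> R" using sg_cm[OF sR] by blast
        have "cj a s \<in> gen {cm x y |x y. x \<in> R \<and> y \<in> R}" if "s \<in> {cm x y |x y. x \<in> R \<and> y \<in> R}" for s
        proof -
          from that obtain x y where xy: "x \<in> R" "y \<in> R" "s = cm x y" by blast
          then have "cj a x \<in> R" "cj a y \<in> R" using R(2) a by blast+
          then have "cj a s \<in> {cm x y |x y. x \<in> R \<and> y \<in> R}" using xy(3) by (auto simp: cj_cm)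
          then show ?thesis by (rule subsetD[OF gen_incl])
        qed
        then have "cj a c \<in> comm R R" if "c \<in> comm R R" for c
          using gen_cj[OF sR g] that unfolding comm_def by blast
        then show ?thesis using cj_image_eqI sg_finite[OF sg_comm[OF sR subset_refl subset_refl]] by blast
      qed
      then have "comm R R = R"
        using irr[OF sg_comm[OF sR subset_refl subset_refl] comm_sub[OF sR subset_refl subset_refl] ne] by blast
      then show False using pgrp_perfect[OF r(1) pR] R1 by blast
    qed
    have RneK: "R \<noteq> K" using pR npg by blast
    have FPK: "FP K R" unfolding FP_def
    proof (intro conjI ballI)
      fix g assume g: "g \<in> K - R"
      show "R \<inter> cj g ` R = {1}"
      proof (rule ccontr)
        assume ne: "R \<inter> cj g ` R \<noteq> {1}"
        have "sg (R \<inter> cj g ` R)" using sg_Int[OF sR sg_cj_image[OF sR]] .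
        then obtain x where x: "x \<in> R" "x \<in> cj g ` R" "x \<noteq> 1" using sg_ne_one ne by blast
        let ?T = "R \<bullet> P"
        have RT: "R \<subseteq> ?T" using setmul_left[OF P(1)] .
        have "cj (g\<^sup>-) x \<in> ?T" "x \<in> ?T" using x RT by (auto simp: mem_cj_image)
        moreover have "g\<^sup>- \<in> X" "g \<in> X" using g KX sg_inv[OF sX] by auto
        ultimately have "cj g ` ?T = ?T"
          using TI_cj[OF TI[OF sR subset_refl R1] UP(1)[OF P sR RK R1], of g "cj (g\<^sup>-) x"] R(2) x(3) by simp
        then have "g \<in> R" using normalizer_UP[OF P sR RK R1] R(2) g by blast
        then show False using g by blast
      qed
    qed (use sK sR RK R1 RneK in auto)
    have "solv R" unfolding solv_def
    proof (intro allI impI)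
      fix Y assume Y: "sg Y \<and> Y \<subseteq> R \<and> comm Y Y = Y"
      then have "Y \<subseteq> {1}" using comm_mono[of Y R Y R] abR by auto
      then show "Y = {1}" using Y sg_one by blast
    qed
    then have nV: "nml (kern K R) K" using FP_nml_kern[OF FPK] by blast
    have "nml (kern K R) X" unfolding nml_def
    proof (intro conjI ballI)
      fix x n assume x: "x \<in> X" and n: "n \<in> kern K R"
      show "cj x n \<in> kern K R"
      proof (cases "n = 1")
        case False
        then have nK': "n \<in> K" "\<And>g. g \<in> K \<Longrightarrow> n \<notin> cj g ` R" using n by (auto simp: kern_def)
        have "cj x n \<notin> cj g ` R" if g: "g \<in> K" for g
        proof
          assume "cj x n \<in> cj g ` R"
          then have "n \<in> cj (x\<^sup>-) ` cj g ` R" by (simp add: mem_cj_image gsimps)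
          \<comment> \<open>The kernel is defined from the conjugates of \<open>R\<close> in
            \<open>K\<close>, which are all Sylow \<open>r\<close>-subgroups of \<open>K\<close>.
            Elements of \<open>X\<close> permute these, so the kernel is normal in \<open>X\<close>
            and not only in \<open>K\<close>.\<close>
          moreover have "syl r K (cj (x\<^sup>-) ` cj g ` R)"
            using syl_cj_eq[OF syl_cj[OF sK R(1) g]] nml_image[OF nK sg_inv[OF sX x]] by blast
          then obtain k where "k \<in> K" "cj (x\<^sup>-) ` cj g ` R = cj k ` R"
            using syl_conjugate[OF sK r(1) R(1)] by blast
          ultimately show False using nK' by blast
        qed
        then show ?thesis using nmlD(4)[OF nK x nK'(1)] by (auto simp: kern_def)
      qed (simp add: kern_def)
    qed (use nmlD[OF nV] sX KX in auto)
    moreover have "kern K R \<noteq> K"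
      using kern_Int[OF sK sR] RK R1 by blast
    ultimately have "kern K R = {1}" using K_minimal nmlD(3)[OF nV] by blast
    then have "card R = card K" using FP_card_kern[OF FPK] by simp
    then show False using RneK RK sg_finite[OF sK] card_subset_eq by blast
  qed
  then show ?thesis using r by blast
qed

lemma K_commute: assumes "x \<in> K" "y \<in> K" shows "x * y = y * x"
proof -
  obtain r where r: "prime r" "pgrp r K" using K_pgrp by blast
  have "comm K K = {1}"
  proof (rule ccontr)
    assume "comm K K \<noteq> {1}"
    then have "comm K K = K"
      using K_minimal[OF nml_comm[OF nK nK] comm_sub[OF sK subset_refl subset_refl]] by blast
    then show False using pgrp_perfect[OF r] K_ne by blast
  qed
  then have "cm x y = 1" using comm_mem[OF assms] by simp
  then show ?thesis by (simp add: cm_eq_one_iff)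
qed

lemma K_elementary: "\<exists>r. prime r \<and> pgrp r K \<and> (\<forall>x\<in>K. x ^ r = 1)"
proof -
  obtain r where r: "prime r" "pgrp r K" using K_pgrp by blast
  let ?E = "{x \<in> K. x ^ r = 1}"
  have pm: "(x * y) ^ n = x ^ n * y ^ n" if "x \<in> K" "y \<in> K" for x y and n :: nat
    using power_mult_commuting K_commute[OF that] by blast
  have "sg ?E" unfolding sg_def using sg_finite[OF sK] sg_one[OF sK] sg_mult[OF sK] pm by auto
  then have "nml ?E X" unfolding nml_def using sX KX nmlD(4)[OF nK] by (auto simp flip: cj_power)
  moreover have "?E \<noteq> {1}"
  proof -
    obtain n where n: "card K = r ^ n" using r(2) pgrp_def by blast
    have "n \<noteq> 0" using n K_ne sg_eq_one_iff[OF sK] by (metis power_0)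
    then have "r dvd card K" using n by (simp add: dvd_power)
    then obtain x where x: "x \<in> K" "od x = r" using cauchy[OF sK r(1)] by blast
    then have "x \<in> ?E" using power_od[OF sK x(1)] by simp
    moreover have "x \<noteq> 1" using x od_eq_one_iff[OF sK x(1)] r(1) by (metis not_prime_1)
    ultimately show ?thesis by blast
  qed
  ultimately have "?E = K" using K_minimal by blast
  then show ?thesis using r by blast
qed

text \<open>A minimal \<open>Z \<subseteq> M\<close> with \<open>Y \<subseteq> K \<bullet> Z\<close>
  is perfect by \<open>comm_setmul_sub\<close>, hence trivial. Then \<open>Y\<close> lies in the
  abelian group \<open>K\<close>.\<close>

lemma solvX: "solv X"
  unfolding solv_def
proof (intro allI impI)
  fix Y assume Y: "sg Y \<and> Y \<subseteq> X \<and> comm Y Y = Y"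
  have "sg M \<and> M \<subseteq> M \<and> Y \<subseteq> K \<bullet> M" using sM Y KMX by simp
  from ex_minimal_set[of "\<lambda>Z. sg Z \<and> Z \<subseteq> M \<and> Y \<subseteq> K \<bullet> Z", OF this sg_finite[OF sM]]
  obtain Z where Z: "sg Z \<and> Z \<subseteq> M \<and> Y \<subseteq> K \<bullet> Z" "\<forall>B. sg B \<and> B \<subseteq> M \<and> Y \<subseteq> K \<bullet> B \<longrightarrow> B \<subseteq> Z \<longrightarrow> B = Z"
    by metis
  then have sZ: "sg Z" "Z \<subseteq> M" "Y \<subseteq> K \<bullet> Z" by blast+
  have "nml K (K \<bullet> Z)"
    by (rule nml_setmul_self[OF sK sZ(1)]) (use nmlD(4)[OF nK] sZ(2) MX in blast)
  then have "comm (K \<bullet> Z) (K \<bullet> Z) \<subseteq> K \<bullet> comm Z Z" using comm_setmul_sub sZ(1) by blast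
  then have "Y \<subseteq> K \<bullet> comm Z Z" using comm_mono[OF sZ(3) sZ(3)] Y by auto
  then have "comm Z Z = Z"
    using Z(2) sZ sg_comm[OF sZ(1) subset_refl subset_refl] comm_sub[OF sZ(1) subset_refl subset_refl] by blast
  then have "Z = {1}" using solvM sZ unfolding solv_def by blast
  then have "Y \<subseteq> K" using sZ(3) by simp
  then have "comm Y Y \<subseteq> {1}"
    by (intro comm_least) (use K_commute in \<open>auto simp: cm_eq_one_iff subset_iff\<close>)
  then show "Y = {1}" using Y sg_one by blast
qed

end

text \<open>If all relevant subgroups are subnormal, \<open>solv_of_sn\<close> applies. Otherwise
  there is a Frobenius complement \<open>M\<close>, smaller than \<open>X\<close> and subject to the
  same hypothesis; its solubility by induction opens the locale \<open>frob\<close>.\<close>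

lemma TI_or_sn_solv:
  assumes "sg X" "prime p" "p dvd card X" "TI_or_sn p X"
  shows "solv X"
  using assms
proof (induction "card X" arbitrary: X rule: less_induct)
  case less
  show ?case
  proof (cases "\<forall>T. sg T \<longrightarrow> T \<subseteq> X \<longrightarrow> \<not> nilp T \<longrightarrow> p dvd card T \<longrightarrow> sn X T")
    case True
    then show ?thesis using solv_of_sn[OF less.prems(1-3)] by blast
  next
    case False
    then obtain T where T: "sg T" "T \<subseteq> X" "\<not> nilp T" "p dvd card T" "\<not> sn X T" by blast
    obtain M where M: "FP X M" "p dvd card M" "\<forall>L. sg L \<longrightarrow> M \<subseteq> L \<longrightarrow> L \<subseteq> X \<longrightarrow> L = M \<or> L = X"
      using ex_FP[OF less.prems(1,4) T] by blast
    have "card M < card X" using FPD[OF M(1)] sg_finite by (metis psubsetI psubset_card_mono)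
    then have "solv M"
      using less.hyps[of M] FPD[OF M(1)] TI_or_sn_mono[OF less.prems(4)] less.prems(2) M(2) by blast
    then interpret frob X M p
      by unfold_locales (use M less.prems in auto)
    show ?thesis by (rule solvX)
  qed
qed

section \<open>The Frobenius complement\<close>

lemma finprod_cj:
  assumes "comm_group (rec K)" "\<And>k. k \<in> K \<Longrightarrow> cj s k \<in> K" "finite A" "\<And>i. i \<in> A \<Longrightarrow> f i \<in> K"
  shows "cj s (finprod (rec K) f A) = finprod (rec K) (\<lambda>i. cj s (f i)) A"
proof -
  interpret K: comm_group "rec K" using assms(1) .
  show ?thesis using assms(3,4)
  proof (induction A rule: finite_induct)
    case empty
    then show ?case by simp
  next
    case (insert x F)
    then have "f \<in> F \<rightarrow> carrier (rec K)" "f x \<in> carrier (rec K)"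
      "(\<lambda>i. cj s (f i)) \<in> F \<rightarrow> carrier (rec K)" "cj s (f x) \<in> carrier (rec K)" using assms(2) by auto
    then show ?case using insert K.finprod_insert[of F x f] K.finprod_insert[of F x "\<lambda>i. cj s (f i)"]
      by (simp add: cj_mult)
  qed
qed

lemma (in comm_monoid) finprod_swap:
  assumes "finite A" "finite B" "\<And>i j. i \<in> A \<Longrightarrow> j \<in> B \<Longrightarrow> f i j \<in> carrier G"
  shows "finprod G (\<lambda>i. finprod G (f i) B) A = finprod G (\<lambda>j. finprod G (\<lambda>i. f i j) A) B"
  using assms(1,3)
proof (induction A rule: finite_induct)
  case empty
  then show ?case by simp
next
  case (insert x F)
  have "finprod G (\<lambda>i. finprod G (f i) B) (insert x F)
      = finprod G (f x) B \<otimes> finprod G (\<lambda>i. finprod G (f i) B) F"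
    by (rule finprod_insert) (use insert in \<open>auto intro!: finprod_closed\<close>)
  also have "\<dots> = finprod G (f x) B \<otimes> finprod G (\<lambda>j. finprod G (\<lambda>i. f i j) F) B"
    using insert by simp
  also have "\<dots> = finprod G (\<lambda>j. f x j \<otimes> finprod G (\<lambda>i. f i j) F) B"
    by (rule finprod_multf[symmetric]) (use insert in \<open>auto intro!: finprod_closed\<close>)
  also have "\<dots> = finprod G (\<lambda>j. finprod G (\<lambda>i. f i j) (insert x F)) B"
    by (rule finprod_cong') (use insert in \<open>auto intro!: finprod_closed simp: Pi_iff\<close>)
  finally show ?case .
qed

lemma mult_mod_bij_betw:
  fixes a j :: nat
  assumes "coprime j a" "a > 0"
  shows "bij_betw (\<lambda>i. i * j mod a) {..<a} {..<a}"
proof -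
  have "inj_on (\<lambda>i. i * j mod a) {..<a}"
  proof (rule inj_onI)
    fix x y assume "x \<in> {..<a}" "y \<in> {..<a}" "x * j mod a = y * j mod a"
    then have "[x = y] (mod a)" using assms(1) cong_mult_rcancel_nat[of j a x y] by (simp add: cong_def)
    then show "x = y" using \<open>x \<in> {..<a}\<close> \<open>y \<in> {..<a}\<close> by (simp add: cong_def)
  qed
  moreover have "(\<lambda>i. i * j mod a) ` {..<a} \<subseteq> {..<a}" using assms(2) by auto
  ultimately show ?thesis by (simp add: bij_betw_def endo_inj_surj)
qed

lemma power_mod_eq: fixes x :: "'a::monoid_mult" assumes "x ^ a = 1" shows "x ^ (n mod a) = x ^ n"
proof -
  have "x ^ n = x ^ (a * (n div a) + n mod a)" by simp
  also have "\<dots> = x ^ (n mod a)" by (simp only: power_add power_mult assms) simp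
  finally show ?thesis ..
qed

context frob
begin

lemma K_comm_group: "comm_group (rec K)"
  by (rule group.group_comm_groupI[OF group_rec[OF sK]]) (simp add: K_commute)

lemma cjK: "s \<in> M \<Longrightarrow> k \<in> K \<Longrightarrow> cj s k \<in> K"
  using nmlD(4)[OF nK] MX by blast

text \<open>The product is a norm: conjugation by \<open>s\<close> permutes its factors cyclically
  and so fixes it, but \<open>s\<close> fixes only 1 in \<open>K\<close>.\<close>

lemma norm_trivial:
  assumes s: "s \<in> M" "s \<noteq> 1" "s ^ a = 1" "a > 0" and v: "v \<in> K"
  shows "finprod (rec K) (\<lambda>j. cj (s ^ j) v) {..<a} = 1"
proof -
  interpret K: comm_group "rec K" using K_comm_group .
  let ?n = "finprod (rec K) (\<lambda>j. cj (s ^ j) v) {..<a}"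
  have in_K: "cj (s ^ j) v \<in> K" for j using cjK sg_power[OF sM s(1)] v by blast
  have nK: "?n \<in> K" using K.finprod_closed[of "\<lambda>j. cj (s ^ j) v" "{..<a}"] in_K by simp
  have "cj s ?n = finprod (rec K) (\<lambda>j. cj (s ^ Suc j) v) {..<a}"
    using finprod_cj[OF K_comm_group cjK[OF s(1)], of "{..<a}" "\<lambda>j. cj (s ^ j) v"] in_K by simp
  also have "\<dots> = finprod (rec K) (\<lambda>j. cj (s ^ (Suc j mod a)) v) {..<a}"
    by (simp add: power_mod_eq[OF s(3)])
  also have "\<dots> = finprod (rec K) (\<lambda>j. cj (s ^ j) v) ((\<lambda>j. Suc j mod a) ` {..<a})"
  proof (rule K.finprod_reindex[symmetric])
    show "inj_on (\<lambda>j. Suc j mod a) {..<a}"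
    proof (rule inj_onI)
      fix x y assume "x \<in> {..<a}" "y \<in> {..<a}" "Suc x mod a = Suc y mod a"
      then show "x = y" using cong_add_rcancel_nat[of x 1 y a] by (simp add: cong_def)
    qed
  qed (use in_K in auto)
  also have "(\<lambda>j. Suc j mod a) ` {..<a} = {..<a}"
  proof (rule endo_inj_surj)
    show "inj_on (\<lambda>j. Suc j mod a) {..<a}"
    proof (rule inj_onI)
      fix x y assume "x \<in> {..<a}" "y \<in> {..<a}" "Suc x mod a = Suc y mod a"
      then show "x = y" using cong_add_rcancel_nat[of x 1 y a] by (simp add: cong_def)
    qed
  qed (use s(4) in auto)
  finally have "cj s ?n = ?n" .
  then show ?thesis using fpf[OF nK s(1,2)] by (simp add: cj_eq_self_iff)
qed

text \<open>Multiplying the trivial norms of \<open>v\<close> over the cyclic subgroups generated by \<open>x y\<^sup>i\<close> gives \<open>v\<^sup>a = 1\<close>.\<close>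

lemma no_elementary_square:
  assumes a: "prime a" and xy: "x \<in> M" "y \<in> M" "x ^ a = 1" "y ^ a = 1" "x * y = y * x" "y \<noteq> 1"
  shows "x \<in> cyc y"
proof (rule ccontr)
  assume nx: "x \<notin> cyc y"
  interpret K: comm_group "rec K" using K_comm_group .
  have a0: "a > 0" using a prime_gt_0_nat by blast
  have "v = 1" if v: "v \<in> K" for v
  proof -
    \<comment> \<open>For fixed \<open>i\<close> the product over \<open>j\<close> is a norm of
      \<open>v\<close> under \<open>x * y ^ i\<close>, hence trivial. For fixed \<open>j\<close> the
      product over \<open>i\<close> is the power of \<open>v\<close> with exponent \<open>a\<close>
      if \<open>j = 0\<close>; otherwise, as \<open>i * j mod a\<close> runs through all residues,
      it is a norm of \<open>cj (x ^ j) v\<close> under \<open>y\<close>.\<close>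
    define f where "f i j = cj ((x * y ^ i) ^ j) v" for i j
    have fK: "f i j \<in> K" for i j unfolding f_def
      using cjK sg_power[OF sM sg_mult[OF sM xy(1) sg_power[OF sM xy(2)]]] v by blast
    have comm: "x * y ^ i = y ^ i * x" for i using power_commuting_commutes[OF xy(5)[symmetric]] by simp
    have exp: "(x * y ^ i) ^ j = x ^ j * y ^ (i * j)" for i j
      using power_mult_commuting[OF comm[of i], of j] by (simp add: power_mult)
    have row: "finprod (rec K) (f i) {..<a} = 1" for i
      unfolding f_def
    proof (rule norm_trivial[OF _ _ _ a0 v])
      show "x * y ^ i \<in> M" using sg_mult[OF sM xy(1) sg_power[OF sM xy(2)]] .
      show "x * y ^ i \<noteq> 1"
      proof
        assume "x * y ^ i = 1"
        then have "y ^ i * x = 1" using comm by simp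
        then have "x = (y ^ i)\<^sup>-" by (rule inv_eqI)
        then have "x \<in> cyc y" using sg_inv[OF sg_cyc[OF sM xy(2)] cyc_power] by simp
        then show False using nx by blast
      qed
      show "(x * y ^ i) ^ a = 1" unfolding exp using xy(3,4) by (metis mult.commute mult_1_left power_mult power_one)
    qed
    have col: "finprod (rec K) (\<lambda>i. f i j) {..<a} = (if j = 0 then v ^ a else 1)" if j: "j < a" for j
    proof (cases "j = 0")
      case True
      have "finprod (rec K) (\<lambda>i. f i j) {..<a} = finprod (rec K) (\<lambda>i. v) {..<a}" using True by (simp add: f_def)
      also have "\<dots> = v ^ a" using K.finprod_const[of v "{..<a}"] v by simp
      finally show ?thesis using True by simp
    next
      case False
      have cop: "coprime j a" using False j a by (metis coprime_commute nat_dvd_not_less not_gr_zero prime_imp_coprime)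
      define w where "w = cj (x ^ j) v"
      have wK: "w \<in> K" unfolding w_def using cjK sg_power[OF sM xy(1)] v by blast
      have yw: "cj (y ^ k) w \<in> K" for k using cjK sg_power[OF sM xy(2)] wK by blast
      have fe: "f i j = cj (y ^ (i * j mod a)) w" for i
      proof -
        have "x ^ j * y ^ (i * j) = y ^ (i * j) * x ^ j"
          using power_commuting_commutes[OF comm[of "i * j"]] by simp
        then show ?thesis unfolding f_def exp w_def power_mod_eq[OF xy(4)] by simp
      qed
      note bij = mult_mod_bij_betw[OF cop a0]
      have "finprod (rec K) (\<lambda>i. f i j) {..<a} = finprod (rec K) (\<lambda>i. cj (y ^ (i * j mod a)) w) {..<a}"
        by (simp add: fe)
      also have "\<dots> = finprod (rec K) (\<lambda>k. cj (y ^ k) w) ((\<lambda>i. i * j mod a) ` {..<a})"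
        by (rule K.finprod_reindex[symmetric]) (use yw bij in \<open>auto simp: bij_betw_def\<close>)
      also have "(\<lambda>i. i * j mod a) ` {..<a} = {..<a}" using bij by (simp add: bij_betw_def)
      also have "finprod (rec K) (\<lambda>k. cj (y ^ k) w) {..<a} = 1"
        using norm_trivial[OF xy(2,6,4) a0 wK] .
      finally show ?thesis using False by simp
    qed
    have "1 = finprod (rec K) (\<lambda>i. finprod (rec K) (f i) {..<a}) {..<a}"
      using K.finprod_one_eqI[of "{..<a}" "\<lambda>i. finprod (rec K) (f i) {..<a}"] row by simp
    also have "\<dots> = finprod (rec K) (\<lambda>j. finprod (rec K) (\<lambda>i. f i j) {..<a}) {..<a}"
      by (rule K.finprod_swap) (use fK in auto)
    also have "\<dots> = finprod (rec K) (\<lambda>j. if j = 0 then v ^ a else 1) {..<a}"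
      by (rule K.finprod_cong') (use col sg_power[OF sK v] sg_one[OF sK] in auto)
    also have "\<dots> = v ^ a"
    proof -
      have e: "{..<a} = insert 0 {1..<a}" using a0 by auto
      have "finprod (rec K) (\<lambda>j. if j = 0 then v ^ a else 1) (insert 0 {1..<a})
          = v ^ a * finprod (rec K) (\<lambda>j. if j = 0 then v ^ a else 1) {1..<a}"
        using K.finprod_insert[of "{1..<a}" 0 "\<lambda>j. if j = 0 then v ^ a else 1"] sg_power[OF sK v] sg_one[OF sK]
        by (simp add: Pi_iff)
      also have "finprod (rec K) (\<lambda>j. if j = 0 then v ^ a else 1) {1..<a} = 1"
        using K.finprod_one_eqI[of "{1..<a}" "\<lambda>j. if j = 0 then v ^ a else 1"] by simp
      finally show ?thesis unfolding e by simp
    qed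
    finally have "v ^ a = 1" by simp
    moreover have "a dvd card M"
      using od_dvd_card[OF sM xy(2)] power_eq_one_iff[OF sM xy(2), of a] xy(4,6) od_eq_one_iff[OF sM xy(2)] a
      by (metis prime_nat_iff)
    then have "coprime a (card K)" using coprime_K[OF a] a prime_imp_coprime by blast
    ultimately show "v = 1" using eq_one_of_coprime_powers[OF sK v _ power_card_eq_one[OF sK v]] by blast
  qed
  then show False using K_ne sg_one[OF sK] by blast
qed

text \<open>\<open>K \<bullet> T\<close> contains a non-nilpotent \<open>K \<bullet> P\<close>. As
  it also contains the normal subgroup \<open>K\<close>, being TI would make it normal; so it is
  subnormal in either case, and its intersection with \<open>M\<close> is \<open>T\<close>.\<close>

lemma sub_sn: assumes T: "sg T" "T \<subseteq> M" "p dvd card T" shows "sn M T"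
proof -
  obtain P where P: "sg P" "P \<subseteq> T" "card P = p" using ex_subgroup_card_power[OF T(1) p, of 1] T(3) by auto
  have PM: "P \<subseteq> M" using P T by blast
  have inv: "cj a ` K = K" if "a \<in> P" for a using invK that PM by blast
  have nn: "\<not> nilp (K \<bullet> P)" and sKP: "sg (K \<bullet> P)" and pd: "p dvd card (K \<bullet> P)"
    using UP(1,3,4)[OF P(1) PM P(3) sK subset_refl K_ne inv] by blast+
  have s: "sg (K \<bullet> T)" using sg_nml_setmul[OF nK T(1)] T(2) MX by blast
  have KT: "K \<subseteq> K \<bullet> T" using setmul_left[OF T(1)] .
  have sub: "K \<bullet> P \<subseteq> K \<bullet> T" using setmul_mono P(2) by blast
  have KTX: "K \<bullet> T \<subseteq> X" using setmul_least[OF sX KX] T(2) MX by blast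
  have "\<not> nilp (K \<bullet> T)" using nilp_mono[OF _ s sKP sub] nn by blast
  moreover have "p dvd card (K \<bullet> T)" using sg_card_dvd[OF sKP s sub] pd dvd_trans by blast
  ultimately have "TI X (K \<bullet> T) \<or> sn X (K \<bullet> T)" using hyp s KTX unfolding TI_or_sn_def by blast
  then have "sn X (K \<bullet> T)" using TI_nml[OF _ sX s KTX nK KT K_ne] sn_nml by blast
  then have "sn M ((K \<bullet> T) \<inter> M)" using sn_Int sM MX by blast
  moreover have "(K \<bullet> T) \<inter> M = T"
  proof
    show "T \<subseteq> (K \<bullet> T) \<inter> M" using setmul_right[OF sK, of T] T(2) by blast
    show "(K \<bullet> T) \<inter> M \<subseteq> T"
    proof
      fix x assume x: "x \<in> (K \<bullet> T) \<inter> M"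
      then obtain k t where kt: "k \<in> K" "t \<in> T" "x = k * t" by (auto elim!: setmulE)
      then have "k \<in> M" using x T(2) sg_mult_iff(2)[OF sM] by blast
      then have "k = 1" using kt(1) KM by blast
      then show "x \<in> T" using kt by simp
    qed
  qed
  ultimately show ?thesis by simp
qed

text \<open>\<open>P\<close> is subnormal in \<open>M\<close> and so lies in every Sylow
  \<open>p\<close>-subgroup \<open>S\<close>. The centre of \<open>S\<close> contains some
  \<open>z\<close> of order \<open>p\<close>, and without a subgroup of type \<open>(p, p)\<close>
  the group \<open>P\<close> must be \<open>cyc z\<close>.\<close>

lemma P_central_in_syl:
  assumes P: "sg P" "P \<subseteq> M" "card P = p" and S: "syl p M S"
  shows "\<exists>z\<in>S. P = cyc z \<and> od z = p \<and> (\<forall>s\<in>S. z * s = s * z)"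
proof -
  note sS = sylD(1)[OF S] and SM = sylD(2)[OF S] and pS = sylD(3)[OF S]
  have pP: "pgrp p P" unfolding pgrp_def using P by (metis power_one_right)
  have PS: "P \<subseteq> S" using sn_pgrp_sub_syl[OF p sub_sn[OF P(1,2)] pP S] P(3) by simp
  have "P \<noteq> {1}" using P(3) p by (auto simp: prime_nat_iff)
  then have S1: "S \<noteq> {1}" using PS sg_one[OF P(1)] by blast
  obtain w where w: "w \<in> S" "w \<noteq> 1" "\<forall>x\<in>S. w * x = x * w"
    using nilp_center[OF nilp_pgrp[OF p pS] sS S1] by blast
  have sw: "sg (cyc w)" using sg_cyc[OF sS w(1)] .
  obtain n where n: "od w = p ^ n" using od_pel[OF sS w(1) p pgrp_pel[OF pS w(1)]] by blast
  have "n \<noteq> 0" using n w(2) od_eq_one_iff[OF sS w(1)] by (metis power_0)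
  then have "p dvd card (cyc w)" using n by (simp add: od_def dvd_power)
  then obtain z where z: "z \<in> cyc w" "od z = p" using cauchy[OF sw p] by blast
  have zS: "z \<in> S" using z(1) cyc_least[OF sS w(1)] by blast
  have zc: "z * s = s * z" if "s \<in> S" for s
  proof -
    obtain i where "z = w ^ i" using z(1) by (auto simp: mem_cyc)
    then show ?thesis using power_commuting_commutes[of w s i] w(3) that by simp
  qed
  have z1: "z \<noteq> 1" using z(2) od_eq_one_iff[OF sS zS] p by (metis not_prime_1)
  have "x \<in> cyc z" if "x \<in> P" for x
  proof (rule no_elementary_square[OF p _ _ _ _ _ z1])
    show "x \<in> M" "z \<in> M" using that P(2) zS SM by blast+
    show "x ^ p = 1" using power_card_eq_one[OF P(1) that] P(3) by simp
    show "z ^ p = 1" using power_od[OF sS zS] z(2) by simp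
    show "x * z = z * x" using zc that PS by auto
  qed
  then have "P = cyc z"
    using card_subset_eq[OF sg_finite[OF sg_cyc[OF sS zS]], of P] P(3) z(2) by (auto simp: od_def)
  then show ?thesis using zS z(2) zc by blast
qed

lemma P_unique:
  assumes "sg P" "P \<subseteq> M" "card P = p" "sg Q" "Q \<subseteq> M" "card Q = p"
  shows "Q = P"
proof -
  obtain S where S: "syl p M S" using ex_syl[OF sM p] by blast
  obtain z where z: "z \<in> S" "P = cyc z" "od z = p" "\<forall>s\<in>S. z * s = s * z"
    using P_central_in_syl[OF assms(1-3) S] by blast
  obtain w where w: "w \<in> S" "Q = cyc w" "od w = p" "\<forall>s\<in>S. w * s = s * w"
    using P_central_in_syl[OF assms(4-6) S] by blast
  note sS = sylD(1)[OF S] and SM = sylD(2)[OF S]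
  have "z \<noteq> 1" using z(3) od_eq_one_iff[OF sS z(1)] p by (metis not_prime_1)
  then have "w \<in> cyc z"
    using no_elementary_square[OF p, of w z] w z SM power_od[OF sS] by (metis subsetD)
  then have "Q \<subseteq> P" using z(2) w(2) cyc_least[OF assms(1)] by blast
  then show ?thesis using card_subset_eq[OF sg_finite[OF assms(1)]] assms by simp
qed

end

section \<open>The structure of the non-nilpotent complement\<close>

locale frob_nonnilp = frob X M p for X M :: "'g::group_mult set" and p +
  fixes P :: "'g set"
  assumes nn: "\<not> nilp M" and sP: "sg P" and PM: "P \<subseteq> M" and cardP: "card P = p"
begin

lemma pP: "pgrp p P"
  unfolding pgrp_def using sP cardP by (metis power_one_right)

lemma nP: "nml P M"
proof -
  have "cj m ` P = P" if "m \<in> M" for m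
    by (rule P_unique[OF sP PM cardP sg_cj_image[OF sP]]) (use that PM sM sg_cj cardP in auto)
  then show ?thesis unfolding nml_def using sP sM PM by blast
qed

lemma P_ne: "P \<noteq> {1}"
  using cardP p by (auto simp: prime_nat_iff)

abbreviation "C \<equiv> cent M P"

text \<open>\<open>P\<close> has prime order, so commuting with one non-identity element of
  \<open>P\<close> already means centralizing \<open>P\<close>.\<close>

lemma not_cent: assumes "g \<in> M - C" "u \<in> P" "g * u = u * g" shows "u = 1"
proof (rule ccontr)
  assume "u \<noteq> 1"
  then have "cyc u = P" using cyc_of_prime_card[OF sP p cardP assms(2)] by blast
  then have "g * v = v * g" if "v \<in> P" for v
    using that power_commuting_commutes[OF assms(3)[symmetric]] by (auto simp: mem_cyc)
  then show False using assms(1) by (auto simp: cent_def)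
qed

text \<open>Each \<open>p\<close>-element lies in some Sylow \<open>p\<close>-subgroup, and
  \<open>P\<close> is central in all of them.\<close>

lemma pel_cent: assumes "x \<in> M" "pel p x" shows "x \<in> C"
proof -
  obtain S where S: "syl p M S" "cyc x \<subseteq> S"
    using pgrp_sub_syl[OF sM p pgrp_cyc[OF sM assms(1) p assms(2)] cyc_least[OF sM assms(1)]] by blast
  obtain z where z: "z \<in> S" "P = cyc z" "\<forall>s\<in>S. z * s = s * z"
    using P_central_in_syl[OF sP PM cardP S(1)] by blast
  have "x \<in> S" using S(2) cyc_self by blast
  then have "z * x = x * z" using z(3) by blast
  then have "x * u = u * x" if "u \<in> P" for u
    using that power_commuting_commutes[of z x] unfolding z(2) by (auto simp: mem_cyc)
  then show ?thesis using assms(1) by (auto simp: cent_def)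
qed

lemma nC: "nml C M"
  unfolding nml_def
proof (intro conjI ballI)
  fix m c assume m: "m \<in> M" and c: "c \<in> C"
  have "cj m c * u = u * cj m c" if u: "u \<in> P" for u
  proof -
    have "cj (m\<^sup>-) u \<in> P" using nmlD(4)[OF nP sg_inv[OF sM m] u] .
    then have "c * cj (m\<^sup>-) u = cj (m\<^sup>-) u * c" using c by (auto simp: cent_def)
    then have "cj m (c * cj (m\<^sup>-) u) = cj m (cj (m\<^sup>-) u * c)" by simp
    then show ?thesis by (simp add: cj_mult)
  qed
  then show "cj m c \<in> C" using c m sg_cj[OF sM] by (auto simp: cent_def)
qed (use sM sg_cent[OF sM] cent_sub in auto)

lemma PC: "P \<subseteq> C"
  using pel_cent pgrp_pel[OF pP] PM by blast

lemma ex_p'el_not_cent: assumes "h \<in> M - C" shows "\<exists>j. h ^ j \<in> M - C \<and> p'el p (h ^ j)"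
proof -
  have hM: "h \<in> M" using assms by blast
  obtain i j where ij: "h = h ^ i * h ^ j" "pel p (h ^ i)" "p'el p (h ^ j)"
    using pel_p'el_decompose[OF sM hM p] by blast
  have "h ^ i \<in> C" using pel_cent[OF sg_power[OF sM hM] ij(2)] .
  then have "h ^ j \<notin> C" using assms ij(1) sg_mult[OF sg_cent[OF sM]] by (metis DiffD2)
  then show ?thesis using ij(3) sg_power[OF sM hM] by blast
qed

lemma sg_P_cyc: "h \<in> M \<Longrightarrow> sg (P \<bullet> cyc h)"
  using sg_nml_setmul[OF nP sg_cyc[OF sM] cyc_least[OF sM]] .

text \<open>This subgroup is non-nilpotent since a \<open>p'\<close>-power of \<open>h\<close> fails
  to centralize \<open>P\<close>. Lying in a Frobenius complement, it is not subnormal in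
  \<open>X\<close>, so it is TI; and a TI-subgroup that contains the normal subgroup
  \<open>P\<close> of \<open>M\<close> is normal in \<open>M\<close>.\<close>

lemma nml_P_cyc: assumes h: "h \<in> M - C" shows "nml (P \<bullet> cyc h) M"
proof -
  let ?T = "P \<bullet> cyc h"
  have hM: "h \<in> M" using h by blast
  have s: "sg ?T" using sg_P_cyc[OF hM] .
  have TM: "?T \<subseteq> M" using setmul_least[OF sM PM cyc_least[OF sM hM]] .
  have PT: "P \<subseteq> ?T" and hT: "cyc h \<subseteq> ?T" using setmul_left[OF sg_cyc[OF sM hM]] setmul_right[OF sP] by blast+
  have "\<not> nilp ?T"
  proof
    assume nil: "nilp ?T"
    obtain j where j: "h ^ j \<in> M - C" "p'el p (h ^ j)" using ex_p'el_not_cent[OF h] by blast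
    have "h ^ j * u = u * h ^ j" if "u \<in> P" for u
      using nilp_pel_p'el_commute[OF nil s _ _ pgrp_pel[OF pP that] j(2)] that PT hT cyc_power by (metis subsetD)
    then show False using j(1) by (auto simp: cent_def)
  qed
  moreover have "p dvd card ?T" using sg_card_dvd[OF sP s PT] cardP by simp
  ultimately have "TI X ?T \<or> sn X ?T" using hyp s TM MX unfolding TI_or_sn_def by blast
  moreover have "\<not> sn X ?T" using FP_no_sn[OF _ FP TM] PT P_ne sg_one[OF sP] by blast
  ultimately have "TI M ?T" using MX unfolding TI_def by blast
  then show ?thesis using TI_nml[OF _ sM s TM nP PT P_ne] by blast
qed

text \<open>If \<open>P\<close> were central in \<open>M\<close>, any Sylow subgroup
  \<open>R\<close> would be normal in the subnormal \<open>P \<bullet> R\<close>, hence normal in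
  \<open>M\<close>, and \<open>M\<close> would be nilpotent.\<close>

lemma ex_not_cent: "\<exists>h. h \<in> M - C"
proof (rule ccontr)
  assume "\<nexists>h. h \<in> M - C"
  then have c: "m * u = u * m" if "m \<in> M" "u \<in> P" for m u using that by (auto simp: cent_def)
  have "nilp M"
  proof (rule nilp_of_sylows_nml[OF sM])
    fix r R assume r: "prime r" and R: "syl r M R"
    note sR = sylD(1)[OF R] and RM = sylD(2)[OF R]
    have s: "sg (P \<bullet> R)" using sg_nml_setmul[OF nP sR RM] .
    have PR: "P \<bullet> R \<subseteq> M" using setmul_least[OF sM PM RM] .
    have "p dvd card (P \<bullet> R)" using sg_card_dvd[OF sP s setmul_left[OF sR]] cardP by simp
    then have "sn M (P \<bullet> R)" using sub_sn[OF s PR] by blast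
    moreover have "nml R (P \<bullet> R)" unfolding nml_def
    proof (intro conjI ballI)
      fix x n assume "x \<in> P \<bullet> R" and n: "n \<in> R"
      then obtain u y where uy: "u \<in> P" "y \<in> R" "x = u * y" by (auto elim!: setmulE)
      have yn: "cj y n \<in> R" using sg_cj[OF sR uy(2) n] .
      then have "cj u (cj y n) = cj y n" using c[of "cj y n" u] uy(1) RM by (metis cj_eq_self_iff subsetD)
      then show "cj x n \<in> R" using yn uy(3) by simp
    qed (use sR s setmul_right[OF sP] in auto)
    ultimately have "sn M R" by (rule sn.step)
    then show "nml R M" using sn_syl_nml[OF r sM _ R] by blast
  qed
  then show False using nn by blast
qed

text \<open>A group of order 2 has no automorphism but the identity, whereas some element of
  \<open>M\<close> acts non-trivially on \<open>P\<close>.\<close>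

lemma p_gt_2: "p > 2"
proof (rule ccontr)
  assume "\<not> p > 2"
  then have "p = 2" using p prime_ge_2_nat by (metis le_antisym linorder_not_le)
  then have c: "card P = 2" using cardP by simp
  obtain h where h: "h \<in> M - C" using ex_not_cent by blast
  obtain u where u: "u \<in> P" "u \<noteq> 1" using sg_ne_one[OF sP P_ne] by blast
  have "P = {1, u}"
    using c u sg_one[OF sP] sg_finite[OF sP] card_subset_eq[of P "{1, u}"] by (simp add: card_insert_if)
  moreover have "cj h u \<in> P" using nmlD(4)[OF nP] h u by blast
  ultimately have "cj h u = u" using u(2) by auto
  then show False using not_cent[OF h u(1)] u(2) by (simp add: cj_eq_self_iff)
qed

text \<open>The map \<open>d \<mapsto> d * (cj g d)\<^sup>-\<close> is injective on the finite set
  \<open>P\<close> because \<open>g\<close> fixes only 1 there; so it is onto. It serves to remove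
  factors in \<open>P\<close> by conjugation, without cohomology.\<close>

lemma ex_twist: assumes g: "g \<in> M - C" and c: "c \<in> P" shows "\<exists>d\<in>P. d * (cj g d)\<^sup>- = c"
proof -
  let ?f = "\<lambda>d. d * (cj g d)\<^sup>-"
  have cl: "?f d \<in> P" if "d \<in> P" for d
    using that nmlD(4)[OF nP] g sg_mult[OF sP] sg_inv[OF sP] by blast
  have "inj_on ?f P"
  proof (rule inj_onI)
    fix d e assume de: "d \<in> P" "e \<in> P" "?f d = ?f e"
    have "cj g (e\<^sup>- * d) = e\<^sup>- * d"
    proof -
      have "e\<^sup>- * (d * (cj g d)\<^sup>-) * cj g d = e\<^sup>- * (e * (cj g e)\<^sup>-) * cj g d" using de(3) by simp
      then have "e\<^sup>- * d = (cj g e)\<^sup>- * cj g d" by (simp add: mult.assoc)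
      then show ?thesis by (metis cj_mult cj_inv)
    qed
    then have "e\<^sup>- * d = 1"
      using not_cent[OF g, of "e\<^sup>- * d"] de sg_mult[OF sP] sg_inv[OF sP] by (simp add: cj_eq_self_iff)
    then show "d = e" by (metis mult_1_right mult_inv_cancel)
  qed
  then have "?f ` P = P" by (intro endo_inj_surj[OF sg_finite[OF sP]]) (use cl in \<open>simp_all add: image_subset_iff\<close>)
  then show ?thesis using c by (metis (no_types, lifting) imageE)
qed

text \<open>Elements outside \<open>C\<close> are central modulo \<open>P\<close> in their normal closure, which forces
  \<open>p\<close>-elements to commute with them modulo \<open>P\<close>.\<close>

lemma pel_mem_P: assumes x: "x \<in> M" "pel p x" shows "x \<in> P"
proof (rule ccontr)
  assume xP: "x \<notin> P"
  obtain h where h: "h \<in> M - C" "p'el p h" using ex_not_cent ex_p'el_not_cent by blast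
  have hM: "h \<in> M" using h by blast
  have xC: "x \<in> C" using pel_cent[OF x] .
  \<comment> \<open>Since \<open>x\<close> centralizes \<open>P\<close>, the product
    \<open>x * h\<close> also lies outside \<open>C\<close>. The two normal subgroups coming from
    \<open>h\<close> and \<open>x * h\<close> both contain the commutator of \<open>x\<close> and
    \<open>h\<close>.\<close>
  have xh: "x * h \<in> M - C"
    using h(1) xC sg_mult[OF sM x(1) hM] sg_mult_iff(1)[OF sg_cent[OF sM] xC] by blast
  have cmod: "cm a g \<in> P" if g: "g \<in> M" and a: "a \<in> P \<bullet> cyc g" for a g
  proof -
    obtain u i where ui: "u \<in> P" "a = u * g ^ i" using a by (auto elim!: setmulE simp: mem_cyc)
    have "g ^ i * (g * ((g ^ i)\<^sup>- * t)) = g * t" for t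
    proof -
      have "g ^ i * (g * ((g ^ i)\<^sup>- * t)) = (g ^ i * g) * ((g ^ i)\<^sup>- * t)" by (simp only: mult.assoc)
      also have "\<dots> = (g * g ^ i) * ((g ^ i)\<^sup>- * t)" by (simp only: power_commutes)
      also have "\<dots> = g * t" by (simp add: mult.assoc)
      finally show ?thesis .
    qed
    then have "cm a g = u * cj g (u\<^sup>-)" unfolding ui cm_def cj_def by (simp add: gsimps)
    then show ?thesis using ui(1) nmlD(4)[OF nP g] sg_mult[OF sP] sg_inv[OF sP] by metis
  qed
  let ?c = "cm x h"
  have cM: "?c \<in> M" using sg_cm[OF sM x(1) hM] .
  have c1: "?c \<in> P \<bullet> cyc h"
  proof -
    have hT: "h \<in> P \<bullet> cyc h" using setmul_right[OF sP, of "cyc h"] cyc_self by blast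
    then show ?thesis unfolding cm_cj(2)
      using nmlD(1,4)[OF nml_P_cyc[OF h(1)]] x(1) sg_mult sg_inv by metis
  qed
  have c2: "?c \<in> P \<bullet> cyc (x * h)"
  proof -
    have hT: "x * h \<in> P \<bullet> cyc (x * h)" using setmul_right[OF sP, of "cyc (x * h)"] cyc_self by blast
    have "?c = (x * h) * (cj (x\<^sup>-) (x * h))\<^sup>-" by (simp add: cm_def cj_def gsimps)
    then show ?thesis
      using nmlD(1,4)[OF nml_P_cyc[OF xh]] sg_inv[OF sM x(1)] hT sg_mult sg_inv by metis
  qed
  \<comment> \<open>\<open>?c\<close> commutes modulo \<open>P\<close> with \<open>h\<close> and
    with \<open>x * h\<close>, hence with \<open>x\<close>. As \<open>x\<close> and \<open>h\<close>
    have coprime orders, \<open>cm_coprime_mem\<close> forces \<open>?c\<close> into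
    \<open>P\<close>.\<close>
  let ?D = "{y \<in> M. cm ?c y \<in> P}"
  have mulD: "cm c (y * z) = cm c y * cj y (cm c z)" for c y z :: 'g by (simp add: cm_def cj_def gsimps)
  have "sg ?D" unfolding sg_def
    using sg_finite[OF sM] sg_one[OF sM] sg_one[OF sP] sg_mult[OF sM] sg_mult[OF sP] nmlD(4)[OF nP]
    by (auto simp: mulD)
  moreover have hD: "h \<in> ?D" using cmod[OF hM c1] hM by simp
  moreover have "x * h \<in> ?D" using cmod[OF _ c2] xh by simp
  ultimately have xD: "x \<in> ?D" using sg_mult_iff(2) by blast
  obtain n where n: "x ^ (p ^ n) = 1" using x(2) pel_def by blast
  obtain m where m: "coprime p m" "h ^ m = 1" using h(2) p'el_def by blast
  have "cm x ?c \<in> P" "cm h ?c \<in> P" using xD hD sg_inv[OF sP] inv_cm by (metis (no_types, lifting) mem_Collect_eq)+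
  then have cP: "?c \<in> P"
    by (rule cm_coprime_mem[OF nP x(1) hM _ _ n m(2)]) (use m(1) in simp)
  have "cj (x\<^sup>-) (?c\<^sup>-) \<in> P" using nmlD(4)[OF nP sg_inv[OF sM x(1)] sg_inv[OF sP cP]] .
  \<comment> \<open>The twist by \<open>d\<close> turns commuting modulo \<open>P\<close> into
    commuting: \<open>x * d\<close> centralizes \<open>h\<close> exactly.\<close>
  then obtain d where d: "d \<in> P" "d * (cj h d)\<^sup>- = cj (x\<^sup>-) (?c\<^sup>-)" using ex_twist[OF h(1)] by blast
  let ?y = "x * d"
  have "cj h ?y = ?y"
  proof -
    have "cj h x = x * cj (x\<^sup>-) (?c\<^sup>-)" by (simp add: cj_def cm_def gsimps)
    then have "cj h ?y = x * (d * (cj h d)\<^sup>-) * cj h d" using d(2) by (simp add: cj_mult)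
    then show ?thesis by (simp add: mult.assoc)
  qed
  then have hy: "h * ?y = ?y * h" by (simp add: cj_eq_self_iff)
  have yM: "?y \<in> M" using x(1) d(1) PM sg_mult[OF sM] by blast
  have y1: "?y \<noteq> 1"
  proof
    assume "?y = 1"
    then have "d = x\<^sup>-" by (rule inv_eqI)
    then show False using d(1) xP sg_inv_iff[OF sP] by simp
  qed
  have "pel p ?y"
  proof -
    have "d * x = x * d" using xC d(1) by (auto simp: cent_def)
    moreover obtain k where "d ^ (p ^ k) = 1" using pgrp_pel[OF pP d(1)] pel_def by blast
    ultimately have "?y ^ (p ^ (n + k)) = 1"
      using n power_mult_commuting[of x d "p ^ (n + k)"] by (simp add: power_add power_mult) (metis mult.commute power_mult power_one)
    then show ?thesis using pel_def by blast
  qed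
  then obtain k where k: "od ?y = p ^ k" using od_pel[OF sM yM p] by blast
  then have "k \<noteq> 0" using y1 od_eq_one_iff[OF sM yM] by (metis power_0)
  then have "p dvd card (cyc ?y)" using k by (simp add: od_def dvd_power)
  then obtain z where z: "z \<in> cyc ?y" "od z = p" using cauchy[OF sg_cyc[OF sM yM] p] by blast
  have zM: "z \<in> M" using z(1) cyc_least[OF sM yM] by blast
  \<comment> \<open>The powers of \<open>?y\<close> contain a subgroup of order \<open>p\<close>,
    which is \<open>P\<close> by uniqueness; so \<open>h\<close>, which commutes with
    \<open>?y\<close>, would centralize \<open>P\<close>.\<close>
  have "cyc z = P" using P_unique[OF sP PM cardP sg_cyc[OF sM zM] cyc_least[OF sM zM]] z(2) by (simp add: od_def)
  then have zP: "z \<in> P" using cyc_self by blast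
  have "h * z = z * h" using z(1) power_commuting_commutes[OF hy[symmetric]] by (auto simp: mem_cyc)
  then have "z = 1" using not_cent[OF h(1) zP] by blast
  then show False using z(2) od_eq_one_iff[OF sM zM] p by (metis not_prime_1)
qed

lemma P_syl_M: "syl p M P"
proof -
  obtain S where S: "syl p M S" "P \<subseteq> S" using pgrp_sub_syl[OF sM p pP PM] by blast
  have "S \<subseteq> P" using pel_mem_P pgrp_pel[OF sylD(3)[OF S(1)]] sylD(2)[OF S(1)] by blast
  then show ?thesis using S by auto
qed

lemma P_syl: "syl p X P"
proof -
  have "multiplicity p (card X) = multiplicity p (card K) + multiplicity p (card M)"
    using cardK sg_card_pos[OF sK] sg_card_pos[OF sM] p prime_elem_multiplicity_mult_distrib[of p "card K" "card M"] by auto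
  moreover have "multiplicity p (card K) = 0" using pK by (simp add: not_dvd_imp_multiplicity_0)
  ultimately show ?thesis using P_syl_M MX unfolding syl_def by auto
qed

text \<open>The complement is the normalizer of \<open>cyc h\<close> for a \<open>p'\<close>-element
  \<open>h\<close> outside \<open>C\<close>. Every conjugate of \<open>h\<close> lies in
  \<open>P \<bullet> cyc h\<close>, and by \<open>ex_twist\<close> an element of \<open>P\<close>
  carries it into \<open>cyc h\<close>; so \<open>P\<close> and the normalizer generate
  \<open>M\<close>. An element of \<open>P\<close> that normalizes \<open>cyc h\<close> commutes
  with \<open>h\<close>, as the commutator lies in \<open>P \<inter> cyc h\<close>. Finally
  \<open>cyc e\<close> is the intersection of the normal \<open>P \<bullet> cyc e\<close> with
  \<open>H\<close>.\<close>

lemma ex_complement: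
  "\<exists>H. sg H \<and> H \<subseteq> M \<and> P \<inter> H = {1} \<and> P \<bullet> H = M \<and> \<not> H \<subseteq> C \<and> (\<forall>e\<in>H - C. nml (cyc e) H)"
proof -
  obtain h where h: "h \<in> M - C" "p'el p h" using ex_not_cent ex_p'el_not_cent by blast
  have hM: "h \<in> M" using h by blast
  have sc: "sg (cyc h)" "cyc h \<subseteq> M" using sg_cyc[OF sM hM] cyc_least[OF sM hM] by blast+
  define H where "H = nrm M (cyc h)"
  have sH: "sg H" and HM: "H \<subseteq> M" using sg_nrm[OF sM] nrm_sub by (auto simp: H_def)
  have Pc: "u = 1" if u: "u \<in> P" "u \<in> cyc h" for u
  proof -
    have "p'el p u" using u(2) p'el_power[OF h(2)] by (auto simp: mem_cyc)
    then show ?thesis using pel_p'el_one[OF sP u(1) p pgrp_pel[OF pP u(1)]] by blast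
  qed
  have PH: "P \<inter> H = {1}"
  proof -
    have "d = 1" if d: "d \<in> P" "d \<in> H" for d
    proof -
      have "cm d h = 1"
      proof (rule Pc)
        show "cm d h \<in> P" unfolding cm_cj(1)
          using nmlD(4)[OF nP hM] d(1) sg_mult[OF sP] sg_inv[OF sP] by blast
        have "cj d h \<in> cyc h" using d(2) cyc_self unfolding H_def nrm_def by blast
        then show "cm d h \<in> cyc h" unfolding cm_cj(2) using sg_mult[OF sc(1)] sg_inv[OF sc(1) cyc_self] by blast
      qed
      then have "h * d = d * h" by (simp add: cm_eq_one_iff)
      then show ?thesis using not_cent[OF h(1) d(1)] by blast
    qed
    then show ?thesis using sg_one[OF sP] sg_one[OF sH] by blast
  qed
  have "x \<in> P \<bullet> H" if x: "x \<in> M" for x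
  proof -
    have "h \<in> P \<bullet> cyc h" using setmul_right[OF sP, of "cyc h"] cyc_self by blast
    then have "cj x h \<in> P \<bullet> cyc h" using nmlD(4)[OF nml_P_cyc[OF h(1)] x] by blast
    then obtain c i where ci: "c \<in> P" "cj x h = c * h ^ i" by (auto elim!: setmulE simp: mem_cyc)
    have hi: "h ^ i \<in> M - C"
    proof -
      have "cj x h \<notin> C"
      proof
        assume "cj x h \<in> C"
        then have "cj (x\<^sup>-) (cj x h) \<in> C" using nmlD(4)[OF nC sg_inv[OF sM x]] by blast
        then show False using h(1) by simp
      qed
      then have "h ^ i \<notin> C" using ci PC sg_mult[OF sg_cent[OF sM]] by (metis subsetD)
      then show ?thesis using sg_power[OF sM hM] by blast
    qed
    obtain d where d: "d \<in> P" "d * (cj (h ^ i) d)\<^sup>- = c" using ex_twist[OF hi ci(1)] by blast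
    have "cj x h = cj d (h ^ i)" unfolding ci(2) d(2)[symmetric] by (simp add: cj_def gsimps)
    then have "cj (d\<^sup>- * x) h = h ^ i" by (metis cj_cj cj_one(1) left_inv)
    then have "cj (d\<^sup>- * x) ` cyc h \<subseteq> cyc h" unfolding cj_cyc using cyc_least[OF sc(1) cyc_power] by simp
    then have "cj (d\<^sup>- * x) ` cyc h = cyc h" by (metis card_cj card_subset_eq sg_finite[OF sc(1)])
    then have "d\<^sup>- * x \<in> H" unfolding H_def nrm_def
      using x d(1) PM sg_mult[OF sM] sg_inv[OF sM] by blast
    moreover have "x = d * (d\<^sup>- * x)" by simp
    ultimately show ?thesis using setmulI[OF d(1)] by metis
  qed
  then have PHM: "P \<bullet> H = M" using setmul_least[OF sM PM HM] by blast
  have "h \<in> H" using cj_image_self[OF sc(1) cyc_self] hM by (simp add: H_def nrm_def)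
  then have "\<not> H \<subseteq> C" using h(1) by blast
  moreover have "nml (cyc e) H" if e: "e \<in> H - C" for e
  proof -
    have eM: "e \<in> M - C" and eH: "e \<in> H" using e HM by blast+
    have "(P \<bullet> cyc e) \<inter> H = cyc e"
    proof
      show "cyc e \<subseteq> (P \<bullet> cyc e) \<inter> H" using setmul_right[OF sP, of "cyc e"] cyc_least[OF sH eH] by blast
      show "(P \<bullet> cyc e) \<inter> H \<subseteq> cyc e"
      proof
        fix x assume x: "x \<in> (P \<bullet> cyc e) \<inter> H"
        then obtain u t where ut: "u \<in> P" "t \<in> cyc e" "x = u * t" by (auto elim!: setmulE)
        have "t \<in> H" using ut(2) cyc_least[OF sH eH] by blast
        then have "u \<in> H" using x ut(3) sg_mult_iff(2)[OF sH] by blast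
        then have "u = 1" using ut(1) PH by blast
        then show "x \<in> cyc e" using ut by simp
      qed
    qed
    then show ?thesis using nml_Int_sg[OF nml_P_cyc[OF eM] sH HM] by simp
  qed
  ultimately show ?thesis using sH HM PH PHM by blast
qed

text \<open>If \<open>N \<bullet> P\<close> is subnormal, \<open>FP_sn_eq\<close> in the Frobenius
  group \<open>K \<bullet> P\<close> with complement \<open>P\<close> makes it everything. If it is
  TI, any \<open>y\<close> in the abelian group \<open>K\<close> fixes a non-identity element of
  \<open>N\<close>, so it normalizes \<open>N \<bullet> P\<close> and lies in \<open>N\<close> by
  \<open>normalizer_UP\<close>.\<close>

lemma P_irreducible:
  assumes N: "sg N" "N \<subseteq> K" "N \<noteq> {1}" "\<And>a. a \<in> P \<Longrightarrow> cj a ` N = N"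
  shows "N = K"
proof -
  note UPN = UP[OF sP PM cardP N]
  show ?thesis
  proof (cases "sn X (N \<bullet> P)")
    case True
    have inv: "cj a ` K = K" if "a \<in> P" for a using invK that PM by blast
    note UPK = UP[OF sP PM cardP sK subset_refl K_ne inv]
    have sub: "N \<bullet> P \<subseteq> K \<bullet> P" using setmul_mono N(2) by blast
    have sn: "sn (K \<bullet> P) (N \<bullet> P)" using sn_restrict[OF True UPK(1,2) sub] .
    have KPM: "(K \<bullet> P) \<inter> M = P"
    proof
      show "P \<subseteq> (K \<bullet> P) \<inter> M" using setmul_right[OF sK, of P] PM by blast
      show "(K \<bullet> P) \<inter> M \<subseteq> P"
      proof
        fix x assume x: "x \<in> (K \<bullet> P) \<inter> M"
        then obtain k u where ku: "k \<in> K" "u \<in> P" "x = k * u" by (auto elim!: setmulE)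
        then have "k \<in> M" using x PM sg_mult_iff(2)[OF sM] by blast
        then have "k = 1" using ku(1) KM by blast
        then show "x \<in> P" using ku by simp
      qed
    qed
    have "FP (K \<bullet> P) P" unfolding FP_def
    proof (intro conjI ballI)
      show "P \<noteq> K \<bullet> P"
      proof
        assume "P = K \<bullet> P"
        then have "K \<subseteq> K \<inter> M" using setmul_left[OF sP, of K] PM by blast
        then show False using KM K_ne sg_one[OF sK] by blast
      qed
      fix g assume g: "g \<in> K \<bullet> P - P"
      then have "g \<in> X - M" using KPM UPK(2) by blast
      then have "M \<inter> cj g ` M = {1}" using FP unfolding FP_def by blast
      moreover have "P \<inter> cj g ` P \<subseteq> M \<inter> cj g ` M" using PM by blast
      moreover have "1 \<in> P \<inter> cj g ` P" using sg_one[OF sP] by (simp add: mem_cj_image)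
      ultimately show "P \<inter> cj g ` P = {1}" by blast
    qed (use UPK sP P_ne setmul_right[OF sK] in auto)
    then have "N \<bullet> P = K \<bullet> P" using FP_sn_eq[OF _ sn setmul_right[OF N(1)]] by simp
    then have "(N \<bullet> P) \<inter> K = (K \<bullet> P) \<inter> K" by (rule arg_cong)
    also have "\<dots> = K" by (rule UPK(5))
    finally have "(N \<bullet> P) \<inter> K = K" .
    with UPN(5)[symmetric] show ?thesis by (rule trans)
  next
    case False
    then have TI: "TI X (N \<bullet> P)" using UPN(7) by blast
    obtain u where u: "u \<in> N" "u \<noteq> 1" using sg_ne_one[OF N(1,3)] by blast
    have uT: "u \<in> N \<bullet> P" using u(1) setmul_left[OF sP, of N] by blast
    have "y \<in> N" if y: "y \<in> K" for y
    proof -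
      have "cj y u = u" using K_commute[OF y] u(1) N(2) by (simp add: cj_eq_self_iff subset_iff)
      then have "cj y ` (N \<bullet> P) = N \<bullet> P" using TI_cj[OF TI UPN(1) subsetD[OF KX y] uT u(2)] uT by simp
      then show ?thesis using normalizer_UP[OF sP PM cardP N y] by blast
    qed
    then show ?thesis using N(2) by blast
  qed
qed

text \<open>On a cyclic \<open>K\<close> all elements of \<open>M\<close> act by power maps, which
  commute. The action is faithful because it is fixed-point-free, so \<open>P\<close> would commute
  with every element of \<open>M\<close>.\<close>

lemma K_not_prime: "\<not> prime (card K)"
proof
  assume pr: "prime (card K)"
  obtain k where k: "k \<in> K" "k \<noteq> 1" using sg_ne_one[OF sK K_ne] by blast
  have Kc: "K = cyc k" using cyc_of_prime_card[OF sK pr refl k] by simp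
  obtain h where h: "h \<in> M - C" using ex_not_cent by blast
  obtain x where x: "x \<in> P" "x \<noteq> 1" using sg_ne_one[OF sP P_ne] by blast
  have xM: "x \<in> M" and hM: "h \<in> M" using x PM h by blast+
  obtain i j where ij: "cj x k = k ^ i" "cj h k = k ^ j"
    using cjK[OF xM k(1)] cjK[OF hM k(1)] Kc by (auto simp: mem_cyc)
  have "cj (x * h) k = cj (h * x) k"
  proof -
    have "cj (x * h) k = cj x (cj h k)" by simp
    also have "\<dots> = k ^ (i * j)" unfolding ij(2) cj_power ij(1) by (simp add: power_mult)
    also have "\<dots> = cj h (cj x k)" unfolding ij(1) cj_power ij(2) by (simp add: power_mult mult.commute flip: power_mult)
    finally show ?thesis by simp
  qed
  then have "cj ((h * x)\<^sup>- * (x * h)) k = k" by (metis cj_cj cj_one(1) left_inv)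
  then have "(h * x)\<^sup>- * (x * h) = 1"
    using fpf[OF k(1), of "(h * x)\<^sup>- * (x * h)"] k(2) xM hM sg_mult[OF sM] sg_inv[OF sM]
    by (auto simp: cj_eq_self_iff)
  then have "h * x = x * h" by (metis inv_eqI inverse_inv mult_1_right mult_inv_cancel)
  then show False using not_cent[OF h x(1)] x(2) by blast
qed

end

section \<open>Groups generated by normal cyclic subgroups\<close>

lemma cyc_mono: assumes "sg X" "y \<in> X" "x \<in> cyc y" shows "cyc x \<subseteq> cyc y"
  using cyc_least[OF sg_cyc[OF assms(1,2)] assms(3)] .

lemma cyc_eq_of_card: assumes "sg X" "y \<in> X" "x \<in> cyc y" "od y \<le> od x" shows "cyc x = cyc y"
  using card_seteq[OF sg_finite[OF sg_cyc[OF assms(1,2)]] cyc_mono[OF assms(1-3)]] assms(4) by (simp add: od_def)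

lemma not_mem_cyc_power:
  assumes "sg X" "v \<in> X" "v \<noteq> 1" "prime a" "pel a v" "a dvd k"
  shows "v \<notin> cyc (v ^ k)"
proof
  assume "v \<in> cyc (v ^ k)"
  then obtain i where i: "v = v ^ (k * i)" by (auto simp: mem_cyc simp flip: power_mult)
  obtain n where n: "od v = a ^ n" using od_pel[OF assms(1,2,4,5)] by blast
  have "n \<noteq> 0" using n assms(3) od_eq_one_iff[OF assms(1,2)] by (metis power_0)
  then obtain m where m: "n = Suc m" using not0_implies_Suc by blast
  obtain l where l: "k = a * l" using assms(6) by blast
  have "v ^ (a ^ m) = v ^ (k * i * a ^ m)" using i by (metis power_mult)
  also have "k * i * a ^ m = od v * (l * i)" using n m l by simp
  also have "v ^ (od v * (l * i)) = 1" using power_od[OF assms(1,2)] by (simp add: power_mult)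
  finally have "a ^ n dvd a ^ m" using n power_eq_one_iff[OF assms(1,2)] by simp
  then show False using m power_dvd_imp_le[OF _ prime_gt_1_nat[OF assms(4)]] by fastforce
qed

text \<open>The elements of prime power order in \<open>cyc x\<close> make up its Sylow subgroups,
  so \<open>sg_eq_of_sylows\<close> applies to \<open>Y \<inter> cyc x\<close>.\<close>

lemma mem_of_prime_power_parts:
  assumes "sg X" "x \<in> X" "sg Y" "\<And>a k. prime a \<Longrightarrow> pel a (x ^ k) \<Longrightarrow> x ^ k \<in> Y"
  shows "x \<in> Y"
proof -
  have sc: "sg (cyc x)" using sg_cyc[OF assms(1,2)] .
  have "Y \<inter> cyc x = cyc x"
  proof (rule sg_eq_of_sylows[OF sg_Int[OF assms(3) sc] sc])
    fix a :: nat assume a: "prime a"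
    obtain S where S: "syl a (cyc x) S" using ex_syl[OF sc a] by blast
    have "S \<subseteq> Y" using sylD(2)[OF S] pgrp_pel[OF sylD(3)[OF S]] assms(4)[OF a] by (auto simp: mem_cyc dest!: subsetD)
    then show "\<exists>S. syl a (cyc x) S \<and> S \<subseteq> Y \<inter> cyc x" using S sylD(2)[OF S] by blast
  qed blast
  then show ?thesis using cyc_self by blast
qed

text \<open>The power formula of class two. The exponent \<open>n * (n - 1) / 2\<close> is kept as a
  sum, which suits the induction.\<close>

lemma power_mult_central_cm:
  assumes "\<And>w. w \<in> {x, y} \<Longrightarrow> cm y x * w = w * cm y x"
  shows "(x * y) ^ n = x ^ n * y ^ n * cm y x ^ (\<Sum>i<n. i)"
proof (induction n)
  case (Suc n)
  let ?c = "cm y x"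
  have yx: "y * x = ?c * (x * y)" by (simp add: cm_def mult.assoc)
  have c: "?c ^ k * x = x * ?c ^ k" "?c ^ k * y = y * ?c ^ k" for k
    using assms power_commuting_commutes[of ?c] by auto
  have cxy: "?c ^ k * (x * y) = x * (y * ?c ^ k)" for k using c[of k] by (metis mult.assoc)
  have ynx: "y ^ n * x = x * y ^ n * ?c ^ n" for n
  proof (induction n)
    case (Suc n)
    have "y ^ Suc n * x = y * (y ^ n * x)" by (simp add: mult.assoc)
    also have "\<dots> = (y * x) * y ^ n * ?c ^ n" using Suc by (simp add: mult.assoc)
    also have "\<dots> = x * y * (y ^ n * ?c) * ?c ^ n"
    proof -
      have "?c * y ^ n = y ^ n * ?c" using power_commuting_commutes[of y ?c n] assms by simp
      moreover have "y * x = x * y * ?c" using yx assms by (metis insertI1 insertI2 mult.assoc)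
      ultimately show ?thesis by (simp add: mult.assoc)
    qed
    finally show ?case by (simp add: mult.assoc)
  qed simp
  have "(x * y) ^ Suc n = (x * y) ^ n * (x * y)" by (simp only: power_Suc2)
  also have "\<dots> = x ^ n * (y ^ n * x) * y * ?c ^ (\<Sum>i<n. i)"
    unfolding Suc using cxy[of "\<Sum>i<n. i"] by (simp add: mult.assoc)
  also have "\<dots> = x ^ n * x * y ^ n * y * (?c ^ n * ?c ^ (\<Sum>i<n. i))"
    unfolding ynx using c[of n] by (simp add: mult.assoc)
  also have "\<dots> = x ^ Suc n * y ^ Suc n * ?c ^ (\<Sum>i<Suc n. i)"
    by (simp only: power_Suc2 mult.assoc power_add[symmetric] sum.lessThan_Suc add.commute)
  finally show ?case .
qed simp

lemma mem_cyc_mult: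
  assumes sH: "sg H" and xy: "x \<in> H" "y \<in> H" and c: "x * y = y * x" and nm: "x ^ n = 1" "y ^ m = 1" "coprime n m"
  shows "x \<in> cyc (x * y)" "y \<in> cyc (x * y)"
proof -
  have xyH: "x * y \<in> H" using sg_mult[OF sH] xy by blast
  have sc: "sg (cyc (x * y))" using sg_cyc[OF sH xyH] .
  have "x ^ m \<in> cyc (x * y)"
    using power_mult_commuting[OF c, of m] nm(2) cyc_power[of "x * y" m] by simp
  moreover have "x ^ n \<in> cyc (x * y)" using nm(1) by simp
  ultimately show 1: "x \<in> cyc (x * y)" using mem_of_coprime_powers[OF sc sH xy(1) _ _ nm(3)] by blast
  then show "y \<in> cyc (x * y)" using sg_mult_iff(1)[OF sc 1, of y] cyc_self by blast
qed

text \<open>In the application \<open>D\<close> is the centralizer of \<open>P\<close> in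
  \<open>M\<close>, and \<open>no_sq\<close> comes from the fixed-point-free action on
  \<open>K\<close>.\<close>

locale normal_gen =
  fixes H D :: "'g::group_mult set"
  assumes sH: "sg H" and sD: "sg D" and HD: "\<not> H \<subseteq> D"
    and normal_cyc: "\<And>e. e \<in> H - D \<Longrightarrow> nml (cyc e) H"
    and no_sq: "\<And>a x y. prime a \<Longrightarrow> x \<in> H \<Longrightarrow> y \<in> H \<Longrightarrow> x ^ a = 1 \<Longrightarrow> y ^ a = 1 \<Longrightarrow> x * y = y * x
      \<Longrightarrow> y \<noteq> 1 \<Longrightarrow> x \<in> cyc y"
begin

text \<open>This set need not be closed under products; what matters is that it generates
  \<open>H\<close>.\<close>

definition Nm :: "'g set" where "Nm = {x \<in> H. nml (cyc x) H}"

lemma NmH: "x \<in> Nm \<Longrightarrow> x \<in> H" and Nm_nml: "x \<in> Nm \<Longrightarrow> nml (cyc x) H"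
  by (auto simp: Nm_def)

lemma Nm_cj: "x \<in> Nm \<Longrightarrow> h \<in> H \<Longrightarrow> \<exists>i. cj h x = x ^ i"
  using nmlD(4)[OF Nm_nml, of x h x] cyc_self by (auto simp: mem_cyc)

lemma NmI: assumes "x \<in> H" "\<And>h. h \<in> H \<Longrightarrow> cj h x \<in> cyc x" shows "x \<in> Nm"
proof -
  have sc: "sg (cyc x)" using sg_cyc[OF sH assms(1)] .
  have "cj h y \<in> cyc x" if "h \<in> H" "y \<in> cyc x" for h y
  proof -
    obtain n where "y = x ^ n" using \<open>y \<in> cyc x\<close> unfolding mem_cyc by (rule exE)
    then show ?thesis using sg_power[OF sc assms(2)[OF that(1)]] by (simp add: cj_power)
  qed
  then show ?thesis unfolding Nm_def nml_def using sc sH cyc_least[OF sH assms(1)] assms(1) by blast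
qed

text \<open>A group is generated by the elements outside \<open>D\<close>: if \<open>x\<close> lies
  in \<open>D\<close> and \<open>e\<close> does not, then \<open>x * e\<close> does not
  either.\<close>

lemma gen_Nm: assumes "sg Y" "Nm \<subseteq> Y" shows "H \<subseteq> Y"
proof
  fix x assume x: "x \<in> H"
  have out: "e \<in> Y" if "e \<in> H - D" for e using normal_cyc[OF that] that assms(2) by (auto simp: Nm_def)
  obtain e where e: "e \<in> H - D" using HD by blast
  show "x \<in> Y"
  proof (cases "x \<in> D")
    case True
    then have "x * e \<in> H - D" using e x sg_mult[OF sH] sg_mult_iff(1)[OF sD] by blast
    then show ?thesis using out e sg_mult_iff(2)[OF assms(1)] by blast
  qed (use out x in blast)
qed

text \<open>Automorphisms of a cyclic group are power maps and commute with each other. So a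
  commutator centralizes every normal cyclic subgroup, and these generate \<open>H\<close>; thus
  \<open>H\<close> has class at most two.\<close>

lemma cm_central: assumes "x \<in> H" "y \<in> H" "w \<in> H" shows "cm x y * w = w * cm x y"
proof -
  have "e \<in> cent H {cm x y}" if e: "e \<in> Nm" for e
  proof -
    obtain i j where ij: "cj x e = e ^ i" "cj y e = e ^ j" using Nm_cj[OF e] assms by blast
    have "cj (x * y) e = e ^ (i * j)"
    proof -
      have "cj (x * y) e = cj x (cj y e)" by simp
      also have "\<dots> = e ^ (i * j)" unfolding ij(2) cj_power ij(1) by (simp add: power_mult)
      finally show ?thesis .
    qed
    moreover have "cj (y * x) e = e ^ (j * i)"
    proof -
      have "cj (y * x) e = cj y (cj x e)" by simp
      also have "\<dots> = e ^ (j * i)" unfolding ij(1) cj_power ij(2) by (simp add: power_mult)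
      finally show ?thesis .
    qed
    ultimately have "cj (x * y) e = cj (y * x) e" by (simp add: mult.commute)
    moreover have "cm x y * (y * x) = x * y" by (simp add: cm_def mult.assoc)
    ultimately have "cj (cm x y) (cj (y * x) e) = cj (y * x) e" by (metis cj_cj)
    then have "cm x y * e ^ (j * i) = e ^ (j * i) * cm x y" using \<open>cj (y * x) e = e ^ (j * i)\<close> by (simp add: cj_eq_self_iff)
    moreover have "e \<in> cyc (e ^ (j * i))"
    proof -
      have "cyc (cj (y * x) e) = cyc e"
        unfolding cj_cyc[symmetric] using nml_image[OF Nm_nml[OF e] sg_mult[OF sH assms(2,1)]] .
      then show ?thesis using \<open>cj (y * x) e = e ^ (j * i)\<close> cyc_self by metis
    qed
    then obtain k where "e = (e ^ (j * i)) ^ k" by (auto simp: mem_cyc)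
    ultimately have "e * cm x y = cm x y * e"
      using power_commuting_commutes[of "e ^ (j * i)" "cm x y" k] by simp
    then show ?thesis using NmH[OF e] by (simp add: cent_def)
  qed
  then have "H \<subseteq> cent H {cm x y}" using gen_Nm[OF sg_cent[OF sH]] by blast
  then show ?thesis using assms(3) by (auto simp: cent_def)
qed

lemma coprime_commute_H:
  assumes "x \<in> H" "y \<in> H" "x ^ n = 1" "y ^ m = 1" "coprime n m"
  shows "x * y = y * x"
proof -
  have "cm t (cm x y) = 1" if "t \<in> H" for t
    unfolding cm_eq_one_iff using cm_central[OF assms(1,2) that] by simp
  then have "cm x y \<in> {1}" using cm_coprime_mem[OF nml_one[OF sH] assms(1,2) _ _ assms(3-5)] assms(1,2) by blast
  then show ?thesis by (simp add: cm_eq_one_iff)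
qed

lemma cm_mult_H: assumes "x \<in> H" "y \<in> H" "z \<in> H"
  shows "cm (x * y) z = cm x z * cm y z" "cm x (y * z) = cm x y * cm x z"
proof -
  have "cj x (cm y z) = cm y z" using cm_central[OF assms(2,3,1)] by (simp add: cj_eq_self_iff)
  then show "cm (x * y) z = cm x z * cm y z"
    unfolding cm_mult_left using cm_central[OF assms(2,3) sg_cm[OF sH assms(1,3)]] by simp
  have "cj y (cm x z) = cm x z" using cm_central[OF assms(1,3,2)] by (simp add: cj_eq_self_iff)
  moreover have "cm x (y * z) = cm x y * cj y (cm x z)" by (simp add: cm_def cj_def gsimps)
  ultimately show "cm x (y * z) = cm x y * cm x z" by simp
qed

lemma cm_power_H: assumes "x \<in> H" "y \<in> H"
  shows "cm (x ^ n) y = cm x y ^ n" "cm x (y ^ n) = cm x y ^ n"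
proof -
  show "cm (x ^ n) y = cm x y ^ n"
    by (induction n) (simp_all add: cm_mult_H assms sg_power[OF sH])
  show "cm x (y ^ n) = cm x y ^ n"
    by (induction n) (simp_all add: cm_mult_H assms sg_power[OF sH])
qed

lemma Nm_power: assumes "x \<in> Nm" shows "x ^ k \<in> Nm"
proof (rule NmI)
  show "x ^ k \<in> H" using sg_power[OF sH NmH[OF assms]] .
  fix h assume "h \<in> H"
  then obtain i where "cj h x = x ^ i" using Nm_cj[OF assms] by blast
  then have "cj h (x ^ k) = (x ^ k) ^ i" by (simp add: cj_power mult.commute flip: power_mult)
  then show "cj h (x ^ k) \<in> cyc (x ^ k)" by simp
qed

lemma Nm_one: "1 \<in> Nm"
  by (rule NmI) (auto simp: sg_one[OF sH])

lemma Nm_mult: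
  assumes "x \<in> Nm" "y \<in> Nm" "x ^ n = 1" "y ^ m = 1" "coprime n m"
  shows "x * y \<in> Nm"
proof (rule NmI)
  show xy: "x * y \<in> H" using sg_mult[OF sH] NmH assms(1,2) by blast
  have c: "x * y = y * x" using coprime_commute_H[OF NmH[OF assms(1)] NmH[OF assms(2)] assms(3-5)] .
  note m = mem_cyc_mult[OF sH NmH[OF assms(1)] NmH[OF assms(2)] c assms(3-5)]
  have sc: "sg (cyc (x * y))" using sg_cyc[OF sH xy] .
  fix h assume h: "h \<in> H"
  obtain i j where "cj h x = x ^ i" "cj h y = y ^ j" using Nm_cj[OF assms(1) h] Nm_cj[OF assms(2) h] by blast
  then show "cj h (x * y) \<in> cyc (x * y)" using m sg_power[OF sc] sg_mult[OF sc] by (simp add: cj_mult)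
qed

text \<open>The subgroup of order \<open>a\<close> in \<open>cyc u\<close> is normal, say
  \<open>cyc z\<close>. A non-trivial commutator of \<open>w\<close> and \<open>z\<close> would
  generate \<open>cyc z\<close>, which would then be central; so \<open>w\<close> and
  \<open>z\<close> commute and \<open>no_sq\<close> applies.\<close>

lemma no_new_prime_order:
  assumes a: "prime a" and u: "u \<in> Nm" "u \<noteq> 1" "pel a u" and w: "w \<in> H" "w ^ a = 1"
  shows "w \<in> cyc u"
proof -
  note uH = NmH[OF u(1)]
  obtain n where n: "od u = a ^ n" using od_pel[OF sH uH a u(3)] by blast
  have "n \<noteq> 0" using n u(2) od_eq_one_iff[OF sH uH] by (metis power_0)
  then have "a dvd card (cyc u)" using n by (simp add: od_def dvd_power)
  then obtain z where z: "z \<in> cyc u" "od z = a" using cauchy[OF sg_cyc[OF sH uH] a] by blast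
  then obtain k where k: "z = u ^ k" by (auto simp: mem_cyc)
  have zN: "z \<in> Nm" using Nm_power[OF u(1)] k by simp
  note zH = NmH[OF zN]
  have z1: "z \<noteq> 1" using z(2) od_eq_one_iff[OF sH zH] a by (metis not_prime_1)
  have "w * z = z * w"
  proof (rule ccontr)
    assume nc: "w * z \<noteq> z * w"
    let ?c = "cm w z"
    have sz: "sg (cyc z)" using sg_cyc[OF sH zH] .
    have "?c \<in> cyc z" unfolding cm_cj(2)
      using nmlD(4)[OF Nm_nml[OF zN] w(1) cyc_self] sg_mult[OF sz] sg_inv[OF sz cyc_self] by blast
    moreover have "?c \<noteq> 1" using nc by (simp add: cm_eq_one_iff)
    ultimately have "cyc ?c = cyc z" using cyc_of_prime_card[OF sz a z(2)[unfolded od_def]] by blast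
    then have "z \<in> cyc ?c" using cyc_self by blast
    then obtain i where "z = ?c ^ i" by (auto simp: mem_cyc)
    then show False using nc power_commuting_commutes[OF cm_central[OF w(1) zH w(1)], of i] by simp
  qed
  then have "w \<in> cyc z" using no_sq[OF a w(1) zH w(2) _ _ z1] power_od[OF sH zH] z(2) by simp
  then show ?thesis using cyc_mono[OF sH uH z(1)] by blast
qed

text \<open>If the conclusion fails, a suitable quotient \<open>w\<close> of generators has order \<open>a\<close> and lies outside.\<close>

lemma comparable_or_quaternion:
  assumes a: "prime a" and u: "u \<in> Nm" "pel a u" and v: "v \<in> Nm" "pel a v"
    and le: "od v \<le> od u" and nv: "v \<notin> cyc u"
  shows "a = 2 \<and> od u = 4 \<and> od v = 4 \<and> v ^ 2 = u ^ 2 \<and> cm v u = u ^ 2"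
proof -
  note uH = NmH[OF u(1)] and vH = NmH[OF v(1)]
  have su: "sg (cyc u)" using sg_cyc[OF sH uH] .
  have v1: "v \<noteq> 1" using nv by auto
  have u1: "u \<noteq> 1"
  proof
    assume "u = 1"
    then have "od v \<le> 1" using le od_eq_one_iff[OF sH uH] by simp
    then have "od v = 1" using od_pos[OF sH vH] by simp
    then show False using v1 od_eq_one_iff[OF sH vH] by simp
  qed
  note key = no_new_prime_order[OF a u(1) u1 u(2)]
  obtain n where n: "od u = a ^ n" using od_pel[OF sH uH a u(2)] by blast
  obtain e where "v ^ (a ^ e) = 1" using v(2) pel_def by blast
  then have ex: "v ^ (a ^ e) \<in> cyc u" by simp
  define j where "j = (LEAST j. v ^ (a ^ j) \<in> cyc u)"
  have j: "v ^ (a ^ j) \<in> cyc u" unfolding j_def by (rule LeastI[of _ e]) (rule ex)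
  have "j \<noteq> 0"
  proof
    assume "j = 0"
    then show False using j nv by simp
  qed
  then obtain i where i: "j = Suc i" using not0_implies_Suc by blast
  \<comment> \<open>\<open>v0\<close> is the last power of \<open>v\<close>, among the exponents
    \<open>a ^ i\<close>, that is still outside \<open>cyc u\<close>; its own power with exponent
    \<open>a\<close> is inside.\<close>
  define v0 where "v0 = v ^ (a ^ i)"
  have v0u: "v0 \<notin> cyc u" unfolding v0_def using not_less_Least[of i "\<lambda>j. v ^ (a ^ j) \<in> cyc u"] i j_def by simp
  have v0a: "v0 ^ a \<in> cyc u" using j unfolding v0_def i by (simp add: mult.commute flip: power_mult)
  have v0N: "v0 \<in> Nm" unfolding v0_def using Nm_power[OF v(1)] .
  note v0H = NmH[OF v0N]
  have v0p: "pel a v0" unfolding v0_def using pel_power[OF v(2)] .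
  have v01: "v0 \<noteq> 1" using v0u by auto
  have odv0: "od v0 \<le> od v" unfolding od_def v0_def
    using card_mono[OF sg_finite[OF sg_cyc[OF sH vH]] cyc_mono[OF sH vH cyc_power]] .
  obtain k where k: "v0 ^ a = u ^ k" using v0a by (auto simp: mem_cyc)
  \<comment> \<open>Otherwise \<open>u ^ k\<close> generates \<open>cyc u\<close>, so
    \<open>v0 ^ a\<close> has order \<open>od u\<close>; but that order is smaller than
    \<open>od v0\<close>, which is at most \<open>od u\<close>.\<close>
  have "a dvd k"
  proof (rule ccontr)
    assume "\<not> a dvd k"
    then have "coprime k (od u)" using a n by (simp add: coprime_commute prime_imp_coprime)
    moreover have "u ^ od u \<in> cyc (u ^ k)" using power_od[OF sH uH] by simp
    ultimately have "u \<in> cyc (u ^ k)"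
      using mem_of_coprime_powers[OF sg_cyc[OF sH sg_power[OF sH uH]] sH uH, of k k "od u"] by simp
    then have "od u \<le> od (v0 ^ a)"
      unfolding od_def k using card_mono[OF sg_finite cyc_mono[OF sH sg_power[OF sH uH]]] sg_cyc[OF sH sg_power[OF sH uH]] by blast
    moreover have "cyc (v0 ^ a) \<subset> cyc v0"
      using cyc_mono[OF sH v0H cyc_power] not_mem_cyc_power[OF sH v0H v01 a v0p dvd_refl] cyc_self by blast
    then have "od (v0 ^ a) < od v0" unfolding od_def using psubset_card_mono sg_finite[OF sg_cyc[OF sH v0H]] by blast
    ultimately show False using odv0 le by simp
  qed
  then obtain m where m: "k = a * m" by blast
  define t where "t = u ^ m"
  have tH: "t \<in> H" unfolding t_def using sg_power[OF sH uH] .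
  have tu: "t \<in> cyc u" unfolding t_def by simp
  have ta: "v0 ^ a = t ^ a" unfolding t_def k m by (simp add: mult.commute flip: power_mult)
  define c where "c = cm v0 t"
  have cH: "c \<in> H" unfolding c_def using sg_cm[OF sH v0H tH] .
  have ca: "c ^ a = 1"
    unfolding c_def cm_power_H(1)[OF v0H tH, symmetric] using cyc_commute[OF v0a tu] by (simp add: cm_eq_one_iff)
  \<comment> \<open>As \<open>v0 ^ a = t ^ a\<close>, this quotient would satisfy
    \<open>w ^ a = 1\<close> if \<open>v0\<close> and \<open>t\<close> commuted. In general the
    class-two formula leaves a power of \<open>c\<close> with exponent
    \<open>a * (a - 1) / 2\<close>, which vanishes for odd \<open>a\<close>.\<close>
  define w where "w = v0 * t\<^sup>-"
  have tiH: "t\<^sup>- \<in> H" using sg_inv[OF sH tH] .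
  have wH: "w \<in> H" unfolding w_def using sg_mult[OF sH v0H tiH] .
  have wu: "w * s \<notin> cyc u" if "s \<in> cyc u" for s
  proof
    assume "w * s \<in> cyc u"
    then have "w \<in> cyc u" using sg_mult_iff(2)[OF su that] by blast
    then have "v0 \<in> cyc u" unfolding w_def using sg_mult_iff(2)[OF su sg_inv[OF su tu]] by blast
    then show False using v0u by blast
  qed
  have cmt: "cm (t\<^sup>-) v0 = c"
  proof -
    have "cm (t * t\<^sup>-) v0 = cm t v0 * cm (t\<^sup>-) v0" using cm_mult_H(1)[OF tH tiH v0H] .
    then have "cm t v0 * cm (t\<^sup>-) v0 = 1" by simp
    then have "cm (t\<^sup>-) v0 = (cm t v0)\<^sup>-" by (rule inv_eqI)
    then show ?thesis by (simp add: inv_cm c_def)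
  qed
  have wa: "w ^ a = c ^ (\<Sum>i<a. i)"
  proof -
    have "w ^ a = v0 ^ a * (t\<^sup>-) ^ a * cm (t\<^sup>-) v0 ^ (\<Sum>i<a. i)"
      unfolding w_def by (rule power_mult_central_cm) (use cm_central[OF tiH v0H] tiH v0H in blast)
    also have "v0 ^ a * (t\<^sup>-) ^ a = 1" unfolding ta by (simp flip: inv_power)
    finally show ?thesis by (simp add: cmt)
  qed
  have a2: "a = 2"
  proof (rule ccontr)
    assume "a \<noteq> 2"
    then have "odd a" using a by (metis prime_odd_nat prime_ge_2_nat le_neq_implies_less)
    then have "a dvd (\<Sum>i<a. i)"
    proof -
      have "2 * (\<Sum>i<a. i) = a * (a - 1)" by (induction a) (auto simp: algebra_simps)
      then have "a dvd 2 * (\<Sum>i<a. i)" by simp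
      moreover have "coprime a 2" using \<open>odd a\<close> by simp
      ultimately show ?thesis by (simp add: coprime_dvd_mult_right_iff)
    qed
    then have "w ^ a = 1" unfolding wa using ca by (auto simp: power_mult)
    then have "w \<in> cyc u" using key[OF wH] by blast
    then show False using wu[of 1] by simp
  qed
  have w2: "w ^ 2 = c" using wa unfolding a2 by (simp add: numeral_2_eq_2)
  have c1: "c \<noteq> 1"
  proof
    assume "c = 1"
    then have "w \<in> cyc u" using key[OF wH] w2 a2 by simp
    then show False using wu[of 1] by simp
  qed
  have c2: "c ^ 2 = 1" using ca a2 by simp
  have vu2: "cm v0 u ^ 2 = 1"
    unfolding cm_power_H(1)[OF v0H uH, symmetric] using cyc_commute[OF v0a[unfolded a2] cyc_self] by (simp add: cm_eq_one_iff)
  have cvu: "c = cm v0 u ^ m" unfolding c_def t_def cm_power_H(2)[OF v0H uH] ..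
  have om: "odd m"
  proof
    assume "even m"
    then have "c = 1" unfolding cvu using vu2 by (auto simp: power_mult elim!: evenE)
    then show False using c1 by blast
  qed
  have cvu': "c = cm v0 u"
    unfolding cvu using om vu2 by (auto simp: power_add power_mult elim!: oddE)
  have ut: "u \<in> cyc t"
  proof -
    have "coprime m (od u)" using om n a2 by simp
    moreover have "u ^ od u \<in> cyc t" using power_od[OF sH uH] by simp
    moreover have "u ^ m \<in> cyc t" by (simp add: t_def)
    ultimately show ?thesis using mem_of_coprime_powers[OF sg_cyc[OF sH tH] sH uH] by blast
  qed
  have cut: "cyc t = cyc u" using cyc_mono[OF sH tH ut] cyc_mono[OF sH uH tu] by blast
  have t1: "t \<noteq> 1" using ut u1 by auto
  have half: "od x = 2 * od (x ^ 2)" if x: "x \<in> H" "pel 2 x" "x \<noteq> 1" for x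
  proof -
    obtain n where n: "od x = 2 ^ n" using od_pel[OF sH x(1) two_is_prime_nat x(2)] by blast
    have "n \<noteq> 0" using n x(3) od_eq_one_iff[OF sH x(1)] by (metis power_0)
    then obtain k where k: "od x = 2 * k" using n by (metis not0_implies_Suc power_Suc)
    have "od (x ^ 2) dvd k" using power_eq_one_iff[OF sH sg_power[OF sH x(1)], of 2 k] power_od[OF sH x(1)] k
      by (simp flip: power_mult)
    moreover have "od x dvd 2 * od (x ^ 2)"
      using power_eq_one_iff[OF sH x(1), of "2 * od (x ^ 2)"] power_od[OF sH sg_power[OF sH x(1)], of 2]
      by (simp flip: power_mult)
    ultimately show ?thesis using k by (simp add: dvd_antisym)
  qed
  have odv0u: "od v0 = od u"
  proof -
    have "od v0 = 2 * od (v0 ^ 2)" using half[OF v0H _ v01] v0p a2 by simp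
    also have "\<dots> = 2 * od (t ^ 2)" using ta a2 by simp
    also have "\<dots> = od t" using half[OF tH _ t1] pel_power[OF u(2)] a2 unfolding t_def by simp
    also have "\<dots> = od u" using cut by (simp add: od_def)
    finally show ?thesis .
  qed
  \<comment> \<open>The order of \<open>v0\<close> is \<open>od u\<close>, hence at least
    \<open>od v\<close>; so \<open>v0\<close> cannot be a power of \<open>v\<close> with an exponent
    divisible by \<open>a\<close>.\<close>
  have "i = 0"
  proof (rule ccontr)
    assume "i \<noteq> 0"
    then have "a dvd a ^ i" by (simp add: dvd_power)
    then have "v \<notin> cyc v0" unfolding v0_def using not_mem_cyc_power[OF sH vH v1 a v(2)] by blast
    moreover have "cyc v0 = cyc v"
      using cyc_eq_of_card[OF sH vH, of v0] odv0u le by (simp add: v0_def)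
    ultimately show False using cyc_self by blast
  qed
  then have v0v: "v0 = v" by (simp add: v0_def)
  have n2: "n \<ge> 2"
  proof (rule ccontr)
    assume "\<not> n \<ge> 2"
    then have "od u dvd 2" using n a2 by (cases n) auto
    then have "v ^ 2 = 1" using odv0u v0v power_eq_one_iff[OF sH vH, of 2] by simp
    then have "v \<in> cyc u" using key[OF vH] a2 by simp
    then show False using nv by blast
  qed
  define z where "z = u ^ (2 ^ (n - 1))"
  have zn: "z \<noteq> 1" unfolding z_def
  proof
    assume "u ^ (2 ^ (n - 1)) = 1"
    then have "(2::nat) ^ n dvd 2 ^ (n - 1)" using power_eq_one_iff[OF sH uH] n a2 by simp
    then show False using n2 by (simp add: power_dvd_imp_le) (metis One_nat_def Suc_1 diff_less le_antisym less_le_not_le nat_less_le not_less_eq_eq one_less_numeral_iff power_dvd_imp_le semiring_norm(76) zero_less_one zero_less_two le_trans)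
  qed
  have z2: "z ^ 2 = 1"
  proof -
    have "z ^ 2 = u ^ (2 ^ n)" unfolding z_def using n2 by (simp flip: power_mult power_Suc2)
    then show ?thesis using power_od[OF sH uH] n a2 by simp
  qed
  have zu: "z \<in> cyc u" by (simp add: z_def)
  have zH: "z \<in> H" using zu cyc_least[OF sH uH] by blast
  have cz: "c = z"
  proof -
    have "c \<in> cyc u" using key[OF cH] c2 a2 by simp
    then have "c * z = z * c" using cyc_commute zu by blast
    then have "c \<in> cyc z" using no_sq[OF two_is_prime_nat cH zH c2 z2 _ zn] by blast
    then obtain i where "c = z ^ i" by (auto simp: mem_cyc)
    then have "c = z ^ (i mod 2)" using power_mod_eq[OF z2, of i] by simp
    then show ?thesis using c1 by (cases "even i") (auto simp: odd_iff_mod_2_eq_one)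
  qed
  \<comment> \<open>If \<open>od u\<close> were at least 8, the element \<open>u0\<close> of order 4
    would commute with \<open>w\<close>, since \<open>cm v0 u\<close> has order at most 2. Then
    \<open>w * u0\<close> squares to \<open>z * z = 1\<close> and lies outside \<open>cyc u\<close>,
    against \<open>key\<close>.\<close>
  have n2': "n = 2"
  proof (rule ccontr)
    assume "n \<noteq> 2"
    then obtain l where l: "n = Suc (Suc (Suc l))" using n2 by (cases n; cases "n - 1"; cases "n - 2") auto
    define u0 where "u0 = u ^ (2 ^ (n - 2))"
    have u0u: "u0 \<in> cyc u" by (simp add: u0_def)
    have u0H: "u0 \<in> H" using u0u cyc_least[OF sH uH] by blast
    have u02: "u0 ^ 2 = z" unfolding u0_def z_def l by (simp flip: power_mult)
    have "cm w u0 = cm v0 u0 * cm (t\<^sup>-) u0" unfolding w_def using cm_mult_H(1)[OF v0H tiH u0H] .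
    also have "cm (t\<^sup>-) u0 = 1" using cyc_commute[OF sg_inv[OF su tu] u0u] by (simp add: cm_eq_one_iff)
    also have "cm v0 u0 = 1"
      unfolding u0_def cm_power_H(2)[OF v0H uH] l using vu2 by (simp add: power_mult)
    finally have "w * u0 = u0 * w" by (simp add: cm_eq_one_iff)
    then have "(w * u0) ^ 2 = w ^ 2 * u0 ^ 2" by (rule power_mult_commuting)
    also have "\<dots> = 1" using w2 u02 cz z2 by (simp add: power2_eq_square)
    finally have "w * u0 \<in> cyc u" using key[OF sg_mult[OF sH wH u0H]] a2 by simp
    then show False using wu[OF u0u] by blast
  qed
  have zuu: "z = u ^ 2" unfolding z_def n2' by simp
  have u4: "u ^ 4 = 1" using power_od[OF sH uH] n n2' a2 by simp
  have "v ^ 2 = u ^ 2"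
  proof -
    have "v ^ 2 = u ^ (m * 2)" using ta v0v a2 unfolding t_def by (simp add: power_mult)
    also have "\<dots> = u ^ 2"
    proof -
      obtain q where "m = 2 * q + 1" using om oddE by blast
      then have "m * 2 = 4 * q + 2" by simp
      then show ?thesis using u4 by (simp only: power_add power_mult) simp
    qed
    finally show ?thesis .
  qed
  then show ?thesis using a2 n n2' odv0u v0v cvu' cz zuu by simp
qed

text \<open>The previous lemma wants the larger order first. After exchanging the roles the
  commutator is inverted, which changes nothing because \<open>u ^ 2\<close> has order 2.\<close>

lemma incomparable_quaternion:
  assumes a: "prime a" and u: "u \<in> Nm" "pel a u" and v: "v \<in> Nm" "pel a v"
    and nc: "u \<notin> cyc v" "v \<notin> cyc u"
  shows "a = 2" "od u = 4" "od v = 4" "v ^ 2 = u ^ 2" "cm v u = u ^ 2"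
proof -
  have "a = 2 \<and> od u = 4 \<and> od v = 4 \<and> v ^ 2 = u ^ 2 \<and> cm v u = u ^ 2"
  proof (cases "od v \<le> od u")
    case True
    then show ?thesis using comparable_or_quaternion[OF a u v] nc by blast
  next
    case False
    then have *: "a = 2 \<and> od v = 4 \<and> od u = 4 \<and> u ^ 2 = v ^ 2 \<and> cm u v = v ^ 2"
      using comparable_or_quaternion[OF a v u] nc by simp
    moreover have "cm v u = u ^ 2"
    proof -
      have "cm v u = (u ^ 2)\<^sup>-" using * inv_cm by metis
      also have "\<dots> = u ^ 2"
      proof (rule inv_eqI[symmetric])
        have "u ^ 4 = 1" using power_od[OF sH NmH[OF u(1)]] * by simp
        then show "u ^ 2 * u ^ 2 = 1" by (simp flip: power_add)
      qed
      finally show ?thesis .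
    qed
    ultimately show ?thesis by simp
  qed
  then show "a = 2" "od u = 4" "od v = 4" "v ^ 2 = u ^ 2" "cm v u = u ^ 2" by blast+
qed

text \<open>A \<open>g\<close> of maximal order in \<open>N\<pi>\<close> works. The predicate
  \<open>\<pi>\<close> restricts the primes: it admits all primes in the cyclic case and the odd
  ones in the quaternion case.\<close>

lemma ex_cyclic_cover:
  assumes cmp: "\<And>a u v. prime a \<Longrightarrow> \<pi> a \<Longrightarrow> u \<in> Nm \<Longrightarrow> v \<in> Nm \<Longrightarrow> pel a u \<Longrightarrow> pel a v \<Longrightarrow> u \<in> cyc v \<or> v \<in> cyc u"
  defines "N\<pi> \<equiv> {x \<in> Nm. \<forall>a. prime a \<longrightarrow> a dvd od x \<longrightarrow> \<pi> a}"
  shows "\<exists>g\<in>N\<pi>. N\<pi> \<subseteq> cyc g"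
proof -
  have fin: "finite N\<pi>" unfolding N\<pi>_def using sg_finite[OF sH] NmH by (auto intro: finite_subset[of _ H])
  have "1 \<in> N\<pi>"
  proof -
    have "od (1::'g) = 1" using od_eq_one_iff[OF sH sg_one[OF sH]] by blast
    then show ?thesis using Nm_one by (auto simp: N\<pi>_def)
  qed
  then have "Max (od ` N\<pi>) \<in> od ` N\<pi>" using fin by (intro Max_in) auto
  then obtain g where "g \<in> N\<pi>" "od g = Max (od ` N\<pi>)" by (metis imageE)
  then have g: "g \<in> N\<pi>" "\<And>x. x \<in> N\<pi> \<Longrightarrow> od x \<le> od g" using fin by simp_all
  have gN: "g \<in> Nm" using g(1) by (simp add: N\<pi>_def)
  note gH = NmH[OF gN]
  have sg: "sg (cyc g)" using sg_cyc[OF sH gH] .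
  have "x \<in> cyc g" if x: "x \<in> N\<pi>" for x
  proof (rule mem_of_prime_power_parts[OF sH _ sg])
    have xN: "x \<in> Nm" using x by (simp add: N\<pi>_def)
    then show "x \<in> H" by (rule NmH)
    fix a k assume a: "prime a" and pk: "pel a (x ^ k)"
    let ?y = "x ^ k"
    have yN: "?y \<in> Nm" using Nm_power[OF xN] .
    note yH = NmH[OF yN]
    show "?y \<in> cyc g"
    proof (cases "?y = 1")
      case False
      have odyx: "od ?y dvd od x"
        using power_eq_one_iff[OF sH yH, of "od x"] power_od[OF sH NmH[OF xN]]
        by (metis mult.commute power_mult power_one)
      obtain n where n: "od ?y = a ^ n" using od_pel[OF sH yH a pk] by blast
      have "n \<noteq> 0" using n False od_eq_one_iff[OF sH yH] by (metis power_0)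
      then have "a dvd od ?y" using n by (simp add: dvd_power)
      then have pia: "\<pi> a" using x a odyx dvd_trans unfolding N\<pi>_def by blast
      obtain i j where ij: "g = g ^ i * g ^ j" "pel a (g ^ i)" "p'el a (g ^ j)"
        using pel_p'el_decompose[OF sH gH a] by blast
      have giN: "g ^ i \<in> Nm" "g ^ j \<in> Nm" using Nm_power[OF gN] by blast+
      consider "?y \<in> cyc (g ^ i)" | "g ^ i \<in> cyc ?y" using cmp[OF a pia yN giN(1) pk ij(2)] by blast
      then show ?thesis
      proof cases
        case 1
        then show ?thesis using cyc_mono[OF sH gH cyc_power] by blast
      next
        case 2
        obtain l where l: "?y ^ (a ^ l) = 1" using pk pel_def by blast
        obtain m where m: "coprime a m" "(g ^ j) ^ m = 1" using ij(3) p'el_def by blast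
        have cop: "coprime (a ^ l) m" using m(1) by simp
        \<comment> \<open>Here the part of \<open>g\<close> for the prime \<open>a\<close> is
          replaced by the larger \<open>?y\<close>. The new element is again in
          \<open>N\<pi>\<close> and has \<open>g\<close> among its powers, so by the maximal order
          of \<open>g\<close> it generates the same cyclic group.\<close>
        let ?g = "?y * g ^ j"
        have g'N: "?g \<in> Nm" using Nm_mult[OF yN giN(2) l m(2) cop] .
        note g'H = NmH[OF g'N]
        have c: "?y * g ^ j = g ^ j * ?y" using coprime_commute_H[OF yH NmH[OF giN(2)] l m(2) cop] .
        have mem: "?y \<in> cyc ?g" "g ^ j \<in> cyc ?g"
          using mem_cyc_mult[OF sH yH NmH[OF giN(2)] c l m(2) cop] by blast+
        have sg': "sg (cyc ?g)" using sg_cyc[OF sH g'H] .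
        have "g ^ i \<in> cyc ?g" using 2 cyc_mono[OF sH g'H mem(1)] by blast
        then have gg': "g \<in> cyc ?g" using ij(1) sg_mult[OF sg' _ mem(2)] by metis
        have "?g \<in> N\<pi>" unfolding N\<pi>_def
        proof (intro CollectI conjI allI impI g'N)
          fix b assume b: "prime b" "b dvd od ?g"
          have "?g ^ (od ?y * od g) = 1"
          proof -
            have "?y ^ (od ?y * od g) = 1" using power_od[OF sH yH] by (simp add: power_mult)
            moreover have "(g ^ j) ^ (od ?y * od g) = 1" using power_od[OF sH gH]
              by (metis mult.commute power_mult power_one)
            ultimately show ?thesis using power_mult_commuting[OF c] by simp
          qed
          then have "b dvd od ?y * od g" using power_eq_one_iff[OF sH g'H] b(2) dvd_trans by blast
          then have "b dvd od ?y \<or> b dvd od g" using b(1) by (simp add: prime_dvd_mult_iff)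
          then show "\<pi> b" using x g(1) b(1) odyx dvd_trans unfolding N\<pi>_def by blast
        qed
        then have "cyc g = cyc ?g" using cyc_eq_of_card[OF sH g'H gg'] g(2) by blast
        then show ?thesis using mem(1) by blast
      qed
    qed simp
  qed
  then show ?thesis using g(1) by blast
qed

text \<open>If elements of \<open>Nm\<close> of prime power order for the same prime are always
  comparable, one cyclic group contains \<open>Nm\<close>. An incomparable pair \<open>u\<close>,
  \<open>v\<close> forces the prime 2 and quaternion relations; then
  \<open>cyc u \<bullet> cyc v\<close> absorbs all 2-elements of \<open>Nm\<close>, and those of odd
  order lie in one cyclic group.\<close>

theorem cyclic_or_quaternion:
  "(\<exists>g\<in>H. H = cyc g) \<or>
   (\<exists>u v g. u \<in> H \<and> v \<in> H \<and> g \<in> H \<and> u ^ 4 = 1 \<and> u ^ 2 \<noteq> 1 \<and> v ^ 2 = u ^ 2 \<and> v \<notin> cyc u \<and>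
      v * u = u ^ 2 * (u * v) \<and> nml (cyc u \<bullet> cyc v) H \<and> nml (cyc g) H \<and> odd (card (cyc g)) \<and>
      (cyc u \<bullet> cyc v) \<inter> cyc g = {1} \<and> (cyc u \<bullet> cyc v) \<bullet> cyc g = H)"
proof (cases "\<exists>a u v. prime a \<and> u \<in> Nm \<and> v \<in> Nm \<and> pel a u \<and> pel a v \<and> u \<notin> cyc v \<and> v \<notin> cyc u")
  case False
  then obtain g where g: "g \<in> Nm" "Nm \<subseteq> cyc g" using ex_cyclic_cover[of "\<lambda>_. True"] by auto
  then have "H \<subseteq> cyc g" using gen_Nm[OF sg_cyc[OF sH NmH]] by blast
  then show ?thesis using cyc_least[OF sH NmH[OF g(1)]] NmH[OF g(1)] by blast
next
  case True
  then obtain a u v where auv: "prime a" "u \<in> Nm" "v \<in> Nm" "pel a u" "pel a v" "u \<notin> cyc v" "v \<notin> cyc u" by blast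
  note q = incomparable_quaternion[OF auv(1,2,4,3,5-7)]
  have pu: "pel 2 u" and pv: "pel 2 v" using auv(4,5) q(1) by simp_all
  note uH = NmH[OF auv(2)] and vH = NmH[OF auv(3)]
  let ?z = "u ^ 2" and ?Q = "cyc u \<bullet> cyc v"
  have su: "sg (cyc u)" and sv: "sg (cyc v)" using sg_cyc[OF sH] uH vH by blast+
  have nQ: "nml ?Q H" using nml_setmul_nml[OF Nm_nml[OF auv(2)] Nm_nml[OF auv(3)]] .
  note sQ = nmlD(1)[OF nQ] and QH = nmlD(3)[OF nQ]
  have uQ: "cyc u \<subseteq> ?Q" and vQ: "cyc v \<subseteq> ?Q" using setmul_left[OF sv] setmul_right[OF su] by blast+
  have u4: "u ^ 4 = 1" using power_od[OF sH uH] q(2) by simp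
  have z1: "?z \<noteq> 1"
  proof
    assume "?z = 1"
    then have "4 dvd (2::nat)" using power_eq_one_iff[OF sH uH, of 2] q(2) by simp
    then show False by simp
  qed
  have zz: "?z * ?z = 1" using u4 by (simp flip: power_add)
  have zH: "?z \<in> H" using sg_power[OF sH uH] .
  have swap: "x * y = ?z * (y * x)" if "cm x y = ?z" for x y
    unfolding that[symmetric] by (simp add: cm_def mult.assoc)
  have vu: "v * u = ?z * (u * v)" using swap[OF q(5)] .
  have zc: "?z * x = x * ?z" if "x \<in> H" for x using cm_central[OF vH uH that] q(5) by simp
  \<comment> \<open>An \<open>e\<close> outside would be incomparable with \<open>u\<close> and with
    \<open>v\<close>, so it would invert both and square to the same \<open>?z\<close>. It then
    commutes with \<open>u * v\<close>, and the product of the three squares to 1.\<close>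
  have inQ: "e \<in> ?Q" if e: "e \<in> Nm" "pel 2 e" for e
  proof (rule ccontr)
    assume eQ: "e \<notin> ?Q"
    note eH = NmH[OF e(1)]
    have eu: "e \<notin> cyc u" and ev: "e \<notin> cyc v" using eQ uQ vQ by blast+
    have ue: "u \<notin> cyc e"
    proof
      assume ue: "u \<in> cyc e"
      have ve: "v \<notin> cyc e"
      proof
        assume "v \<in> cyc e"
        then have "cm v u = 1" using cyc_commute ue by (simp add: cm_eq_one_iff)
        then show False using q(5) z1 by simp
      qed
      have "od e = 4" using incomparable_quaternion(3)[OF two_is_prime_nat auv(3) pv e ve ev] .
      then have "cyc u = cyc e" using cyc_eq_of_card[OF sH eH ue] q(2) by simp
      then show False using eu cyc_self by blast
    qed
    have e2: "e ^ 2 = ?z" and ecu: "cm e u = ?z" and ode: "od e = 4"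
      using incomparable_quaternion(3-5)[OF two_is_prime_nat auv(2) pu e ue eu] by auto
    have ve: "v \<notin> cyc e"
    proof
      assume ve: "v \<in> cyc e"
      then have "cyc v = cyc e" using cyc_eq_of_card[OF sH eH ve] q(3) ode by simp
      then show False using ev cyc_self by blast
    qed
    have ecv: "cm e v = ?z"
      using incomparable_quaternion(5)[OF two_is_prime_nat auv(3) pv e ve ev] q(4) by simp
    let ?f = "u * v * e"
    have fH: "?f \<in> H" using sg_mult[OF sH] uH vH eH by blast
    have euv: "e * (u * v) = u * v * e"
    proof -
      have "e * (u * v) = ?z * (u * e) * v" using swap[OF ecu] by (simp add: mult.assoc[symmetric])
      also have "\<dots> = ?z * u * (e * v)" by (simp add: mult.assoc)
      also have "\<dots> = ?z * u * (?z * (v * e))" using swap[OF ecv] by simp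
      also have "\<dots> = ?z * (u * ?z) * (v * e)" by (simp only: mult.assoc)
      also have "\<dots> = ?z * ?z * u * (v * e)" using zc[OF uH] by (simp only: mult.assoc)
      finally show ?thesis using zz by (simp add: mult.assoc)
    qed
    have uv2: "(u * v) * (u * v) = ?z"
    proof -
      have "(u * v) * (u * v) = u * (v * u) * v" by (simp only: mult.assoc)
      also have "\<dots> = (u * ?z) * (u * v * v)" unfolding vu by (simp only: mult.assoc)
      also have "\<dots> = ?z * (u * u) * (v * v)" unfolding zc[OF uH, symmetric] by (simp only: mult.assoc)
      also have "\<dots> = ?z * ?z * ?z" using q(4) by (simp add: power2_eq_square)
      finally show ?thesis by (simp only: zz mult_1_left)
    qed
    have "?f ^ 2 = (u * v) * (e * (u * v)) * e" by (simp only: power2_eq_square mult.assoc)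
    also have "\<dots> = (u * v) * (u * v) * e ^ 2" unfolding euv by (simp only: power2_eq_square mult.assoc)
    also have "\<dots> = 1" unfolding uv2 e2 by (rule zz)
    finally have f2: "?f ^ 2 = 1" .
    \<comment> \<open>By \<open>no_sq\<close> the subgroup of order 2 is unique, and it is generated
      by the central element \<open>?z\<close>.\<close>
    have "?f \<in> cyc ?z"
      by (rule no_sq[OF two_is_prime_nat fH zH f2]) (use zz zc[OF fH] z1 in \<open>auto simp: power2_eq_square\<close>)
    then have fQ: "?f \<in> ?Q" using cyc_mono[OF sH uH, of ?z] uQ by auto
    moreover have "u * v \<in> ?Q" by (intro setmulI cyc_self)
    ultimately have "e \<in> ?Q" using sg_mult_iff(1)[OF sQ] by blast
    then show False using eQ by blast
  qed
  have cmp: "u' \<in> cyc v' \<or> v' \<in> cyc u'"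
    if "prime b" "b \<noteq> 2" "u' \<in> Nm" "v' \<in> Nm" "pel b u'" "pel b v'" for b u' v'
    using incomparable_quaternion(1)[OF that(1,3,5,4,6)] that(2) by blast
  have "\<exists>g\<in>{x \<in> Nm. \<forall>a. prime a \<longrightarrow> a dvd od x \<longrightarrow> a \<noteq> 2}.
      {x \<in> Nm. \<forall>a. prime a \<longrightarrow> a dvd od x \<longrightarrow> a \<noteq> 2} \<subseteq> cyc g"
    by (rule ex_cyclic_cover) (rule cmp)
  then obtain g where g: "g \<in> Nm" "\<forall>a. prime a \<longrightarrow> a dvd od g \<longrightarrow> a \<noteq> 2"
    "{x \<in> Nm. \<forall>a. prime a \<longrightarrow> a dvd od x \<longrightarrow> a \<noteq> 2} \<subseteq> cyc g"
    by (elim bexE CollectE conjE)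
  note gH = NmH[OF g(1)]
  have ng: "nml (cyc g) H" using Nm_nml[OF g(1)] .
  have odg: "odd (card (cyc g))" using g(2)[rule_format, OF two_is_prime_nat] by (simp add: od_def) blast
  have QG: "?Q \<inter> cyc g = {1}"
  proof -
    have "x = 1" if x: "x \<in> ?Q" "x \<in> cyc g" for x
    proof -
      have "x ^ card (cyc g) = 1" using power_card_eq_one[OF nmlD(1)[OF ng] x(2)] .
      \<comment> \<open>The product formula bounds the order of \<open>?Q\<close> by 16 only, which
        is enough: being a power of two makes it coprime to the odd order of
        \<open>cyc g\<close>.\<close>
      moreover have "x ^ (2 ^ 4) = 1"
      proof -
        have "card ?Q dvd card (cyc u) * card (cyc v)" using card_setmul[OF su sv] by simp
        then have "card ?Q dvd 2 ^ 4" using q(2,3) by (simp add: od_def)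
        then show ?thesis using power_card_eq_one[OF sQ x(1)] by (metis dvd_def power_mult power_one)
      qed
      moreover have "coprime (card (cyc g)) (2 ^ 4)"
        using odg unfolding coprime_power_right_iff by simp
      ultimately show ?thesis using eq_one_of_coprime_powers[OF sQ x(1)] by blast
    qed
    then show ?thesis using sg_one[OF sQ] by auto
  qed
  have sQG: "sg (?Q \<bullet> cyc g)" using sg_nml_setmul[OF nQ nmlD(1,3)[OF ng]] .
  have "Nm \<subseteq> ?Q \<bullet> cyc g"
  proof
    fix x assume x: "x \<in> Nm"
    show "x \<in> ?Q \<bullet> cyc g"
    proof (rule mem_of_prime_power_parts[OF sH NmH[OF x] sQG])
      fix b k assume b: "prime b" "pel b (x ^ k)"
      have xk: "x ^ k \<in> Nm" using Nm_power[OF x] .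
      show "x ^ k \<in> ?Q \<bullet> cyc g"
      proof (cases "b = 2")
        case True
        then show ?thesis using inQ[OF xk] b(2) setmul_left[OF nmlD(1)[OF ng], of ?Q] by blast
      next
        case False
        obtain n where n: "od (x ^ k) = b ^ n" using od_pel[OF sH NmH[OF xk] b] by blast
        have "a \<noteq> 2" if "prime a" "a dvd od (x ^ k)" for a
        proof -
          have "a dvd b" using that n prime_dvd_power by metis
          then show ?thesis using that(1) b(1) False by (metis primes_dvd_imp_eq)
        qed
        then have "x ^ k \<in> cyc g" using g(3) xk by blast
        then show ?thesis using setmul_right[OF sQ, of "cyc g"] by blast
      qed
    qed
  qed
  then have "H \<subseteq> ?Q \<bullet> cyc g" using gen_Nm[OF sQG] by blast
  then have "?Q \<bullet> cyc g = H" using setmul_least[OF sH QH nmlD(3)[OF ng]] by blast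
  then show ?thesis using uH vH gH u4 z1 q(4) auv(7) vu nQ ng odg QG by blast
qed

end

section \<open>The two implications for subgroups of a group type\<close>

text \<open>The isomorphism types are left open here: the kernel is given by its exponent and
  commutativity, \<open>H\<close> by generators and relations. The conversion happens after the
  transport to arbitrary groups.\<close>

theorem TI_or_sn_structure:
  assumes X: "sg X" and p: "prime p" and hyp: "TI_or_sn p X"
    and T: "sg T" "T \<subseteq> X" "\<not> nilp T" "p dvd card T" "\<not> sn X T"
  shows "p > 2 \<and> (\<exists>M P H r. prime r \<and> r \<noteq> p \<and> \<not> prime (card (kern X M)) \<and> kern X M \<noteq> {1} \<and>
      (\<forall>x\<in>kern X M. x ^ r = 1 \<and> (\<forall>y\<in>kern X M. x * y = y * x)) \<and>
      nml (kern X M) X \<and> FP X M \<and> kern X M \<inter> M = {1} \<and> kern X M \<bullet> M = X \<and>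
      nml P M \<and> card P = p \<and> syl p X P \<and> sg H \<and> H \<subseteq> M \<and> P \<inter> H = {1} \<and> P \<bullet> H = M \<and>
      (\<exists>x\<in>P. \<exists>h\<in>H. x * h \<noteq> h * x) \<and>
      ((\<exists>g\<in>H. H = cyc g) \<or>
       (\<exists>u v g. u \<in> H \<and> v \<in> H \<and> g \<in> H \<and> u ^ 4 = 1 \<and> u ^ 2 \<noteq> 1 \<and> v ^ 2 = u ^ 2 \<and> v \<notin> cyc u \<and>
          v * u = u ^ 2 * (u * v) \<and> nml (cyc u \<bullet> cyc v) H \<and> nml (cyc g) H \<and> odd (card (cyc g)) \<and>
          (cyc u \<bullet> cyc v) \<inter> cyc g = {1} \<and> (cyc u \<bullet> cyc v) \<bullet> cyc g = H)) \<and>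
      (\<forall>N. sg N \<longrightarrow> N \<subseteq> kern X M \<longrightarrow> N \<noteq> {1} \<longrightarrow> (\<forall>a\<in>P. cj a ` N = N) \<longrightarrow> N = kern X M))"
proof -
  obtain M where M: "FP X M" "\<not> nilp M" "p dvd card M" "\<forall>L. sg L \<longrightarrow> M \<subseteq> L \<longrightarrow> L \<subseteq> X \<longrightarrow> L = M \<or> L = X"
    using ex_FP[OF X hyp T] by blast
  have "solv M"
    using TI_or_sn_solv[OF FPD(2)[OF M(1)] p M(3) TI_or_sn_mono[OF hyp FPD(2,3)[OF M(1)]]] .
  then interpret frob X M p by unfold_locales (use M p hyp in auto)
  obtain P where P: "sg P" "P \<subseteq> M" "card P = p" using ex_P by blast
  interpret frob_nonnilp X M p P by unfold_locales (use P M(2) in auto)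
  obtain H where H: "sg H" "H \<subseteq> M" "P \<inter> H = {1}" "P \<bullet> H = M" "\<not> H \<subseteq> C" "\<forall>e\<in>H - C. nml (cyc e) H"
    using ex_complement by blast
  interpret normal_gen H C
  proof unfold_locales
    show "sg H" "sg C" "\<not> H \<subseteq> C" using H sg_cent[OF sM] by blast+
    show "nml (cyc e) H" if "e \<in> H - C" for e using H(6) that by blast
    show "x \<in> cyc y" if "prime a" "x \<in> H" "y \<in> H" "x ^ a = 1" "y ^ a = 1" "x * y = y * x" "y \<noteq> 1" for a x y
      using no_elementary_square[OF that(1) _ _ that(4-7)] that(2,3) H(2) by blast
  qed
  obtain r where r: "prime r" "pgrp r K" "\<forall>x\<in>K. x ^ r = 1" using K_elementary by blast
  have rp: "r \<noteq> p"
  proof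
    assume "r = p"
    obtain n where n: "card K = r ^ n" using r(2) pgrp_def by blast
    have "n \<noteq> 0" using n K_ne sg_eq_one_iff[OF sK] by (metis power_0)
    then have "p dvd card K" using n \<open>r = p\<close> by (simp add: dvd_power)
    then show False using pK by blast
  qed
  have "\<exists>x\<in>P. \<exists>h\<in>H. x * h \<noteq> h * x" using H(2,5) unfolding cent_def by fastforce
  moreover have "\<forall>x\<in>K. x ^ r = 1 \<and> (\<forall>y\<in>K. x * y = y * x)" using r(3) K_commute by blast
  moreover have "\<forall>N. sg N \<longrightarrow> N \<subseteq> K \<longrightarrow> N \<noteq> {1} \<longrightarrow> (\<forall>a\<in>P. cj a ` N = N) \<longrightarrow> N = K"
    using P_irreducible by blast
  ultimately show ?thesis
    using r(1) rp K_not_prime K_ne nK FP KM KMX nP P(3) P_syl H(1-4) cyclic_or_quaternion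
    unfolding K_def by (intro conjI[OF p_gt_2] exI[of _ M] exI[of _ P] exI[of _ H] exI[of _ r] conjI)
qed

text \<open>After conjugation the subgroup contains \<open>P\<close>, and \<open>ded\<close> makes
  its intersection with \<open>C\<close> normal in \<open>C\<close>. If it contains
  \<open>K\<close>, it is normal in \<open>X\<close>. If it meets \<open>K\<close> trivially, it
  lies in \<open>C\<close>, is normal there, and malnormality of \<open>C\<close> makes it TI. The
  assumption \<open>ded\<close> is all that is used of the cyclic or quaternion shape of
  \<open>H\<close>.\<close>

theorem TI_or_sn_of_structure:
  assumes X: "sg X" and p: "prime p" and K: "nml K X" and C: "sg C" "C \<subseteq> X" "K \<bullet> C = X"
    and frob: "\<And>g. g \<in> X - C \<Longrightarrow> C \<inter> cj g ` C = {1}"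
    and P: "nml P C" "card P = p" "syl p X P" and H: "sg H" "H \<subseteq> C" "P \<bullet> H = C"
    and ded: "\<And>x h. x \<in> H \<Longrightarrow> h \<in> H \<Longrightarrow> cj h x \<in> cyc x"
    and irr: "\<And>N. sg N \<Longrightarrow> N \<subseteq> K \<Longrightarrow> (\<And>a. a \<in> P \<Longrightarrow> cj a ` N = N) \<Longrightarrow> N = {1} \<or> N = K"
  shows "TI_or_sn p X"
  unfolding TI_or_sn_def
proof (intro allI impI)
  fix T assume T: "sg T" "T \<subseteq> X" "p dvd card T"
  note sP = nmlD(1)[OF P(1)] and PC = nmlD(3)[OF P(1)] and sK = nmlD(1)[OF K] and KX = nmlD(3)[OF K]
  obtain P1 where P1: "sg P1" "P1 \<subseteq> T" "card P1 = p" using ex_subgroup_card_power[OF T(1) p, of 1] T(3) by auto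
  have "pgrp p P1" unfolding pgrp_def using P1 by (metis power_one_right)
  then obtain x where x: "x \<in> X" "P1 \<subseteq> cj x ` P" using pgrp_sub_cj_syl[OF X p P(3)] P1(2) T(2) by blast
  then have P1x: "P1 = cj x ` P"
    using card_subset_eq[OF finite_imageI[OF sg_finite[OF sP]] x(2)] P1(3) P(2) by simp
  define S where "S = cj (x\<^sup>-) ` T"
  have TS: "T = cj x ` S" unfolding S_def by simp
  have sS: "sg S" unfolding S_def using sg_cj_image[OF T(1)] .
  have SX: "S \<subseteq> X" unfolding S_def using T(2) sg_cj[OF X sg_inv[OF X x(1)]] by blast
  have PS: "P \<subseteq> S"
  proof -
    have "cj (x\<^sup>-) ` P1 = P" unfolding P1x by simp
    then show ?thesis unfolding S_def using P1(2) by blast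
  qed
  have P_ne: "P \<noteq> {1}" using P(2) p by (auto simp: prime_nat_iff)
  have KS: "S \<inter> K = {1} \<or> S \<inter> K = K"
  proof (rule irr)
    show "sg (S \<inter> K)" using sg_Int sS sK by blast
    show "cj a ` (S \<inter> K) = S \<inter> K" if "a \<in> P" for a
    proof (rule cj_image_eqI)
      show "finite (S \<inter> K)" using sg_finite[OF sS] by blast
      show "cj a k \<in> S \<inter> K" if "k \<in> S \<inter> K" for k
        using that \<open>a \<in> P\<close> PS sg_cj[OF sS] nmlD(4)[OF K] SX by blast
    qed
  qed blast
  \<comment> \<open>The \<open>P\<close>-parts stay in \<open>S\<close> because \<open>P\<close> is
    normal in \<open>C\<close> and contained in \<open>S\<close>; the \<open>H\<close>-part of
    \<open>t\<close> is sent by \<open>H\<close> to one of its own powers.\<close>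
  have normC: "cj c t \<in> S" if c: "c \<in> C" and t: "t \<in> S \<inter> C" for c t
  proof -
    obtain u h where uh: "u \<in> P" "h \<in> H" "c = u * h" using c H(3) by (auto elim!: setmulE)
    obtain u' y where uy: "u' \<in> P" "y \<in> H" "t = u' * y" using t H(3) by (auto elim!: setmulE)
    have "y \<in> S" using t uy PS sg_mult_iff(1)[OF sS] by blast
    then have "cj h y \<in> S" using ded[OF uy(2) uh(2)] cyc_least[OF sS] by blast
    moreover have "cj h u' \<in> S" using nmlD(4)[OF P(1)] uh(2) H(2) uy(1) PS by blast
    ultimately have "cj h t \<in> S" using sg_mult[OF sS] by (simp add: uy(3) cj_mult)
    then have "cj u (cj h t) \<in> S" using sg_cj[OF sS] uh(1) PS by blast
    then show ?thesis using uh(3) by simp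
  qed
  from KS show "TI X T \<or> sn X T"
  proof
    assume "S \<inter> K = K"
    then have KS: "K \<subseteq> S" by blast
    have "nml S X" unfolding nml_def
    proof (intro conjI ballI)
      fix g s assume g: "g \<in> X" and s: "s \<in> S"
      obtain k c where kc: "k \<in> K" "c \<in> C" "g = k * c" using g C(3) by (auto elim!: setmulE)
      obtain l d where ld: "l \<in> K" "d \<in> C" "s = l * d" using s SX C(3) by (auto elim!: setmulE)
      have "d \<in> S" using s ld KS sg_mult_iff(1)[OF sS] by blast
      then have "cj c d \<in> S" using normC[OF kc(2)] ld(2) by blast
      moreover have "cj c l \<in> S" using nmlD(4)[OF K] kc(2) C(2) ld(1) KS by blast
      ultimately have "cj c s \<in> S" using sg_mult[OF sS] by (simp add: ld(3) cj_mult)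
      then have "cj k (cj c s) \<in> S" using sg_cj[OF sS] kc(1) KS by blast
      then show "cj g s \<in> S" using kc(3) by simp
    qed (use sS X SX in auto)
    then have "nml T X" using nml_image[of S X x] x(1) TS by simp
    then show ?thesis using sn_nml by blast
  next
    assume S1: "S \<inter> K = {1}"
    have PX: "P \<subseteq> X" using PC C(2) by blast
    \<comment> \<open>In effect \<open>K \<bullet> P\<close> is normal in \<open>X\<close>, although
      \<open>P\<close> is normal only in \<open>C\<close>.\<close>
    have KPn: "cj g w \<in> K \<bullet> P" if g: "g \<in> X" and w: "w \<in> P" for g w
    proof -
      obtain k c where kc: "k \<in> K" "c \<in> C" "g = k * c" using g C(3) by (auto elim!: setmulE)
      have cw: "cj c w \<in> P" using nmlD(4)[OF P(1) kc(2) w] .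
      have "cj g w = (k * cj (cj c w) (k\<^sup>-)) * cj c w" unfolding kc(3) by (simp add: cj_def gsimps)
      moreover have "k * cj (cj c w) (k\<^sup>-) \<in> K"
        using nmlD(4)[OF K] cw PX kc(1) sg_mult[OF sK] sg_inv[OF sK] by blast
      ultimately show ?thesis using setmulI cw by metis
    qed
    obtain w where w: "w \<in> P" "w \<noteq> 1" using sg_ne_one[OF sP P_ne] by blast
    \<comment> \<open>The conjugate \<open>cj t w\<close> is \<open>k * u\<close> with
      \<open>k\<close> in \<open>S \<inter> K\<close>, hence \<open>k = 1\<close> and the conjugate
      is in \<open>P\<close>. Malnormality of \<open>C\<close> then puts \<open>t\<close> into
      \<open>C\<close>.\<close>
    have SC: "t \<in> C" if t: "t \<in> S" for t
    proof (rule ccontr)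
      assume "t \<notin> C"
      obtain k u where ku: "k \<in> K" "u \<in> P" "cj t w = k * u"
        using KPn[of t w] t SX w(1) by (auto elim!: setmulE)
      have "cj t w \<in> S" using sg_cj[OF sS t] w(1) PS by blast
      then have "k \<in> S" using ku PS sg_mult_iff(2)[OF sS] by (metis subsetD)
      then have "k = 1" using ku(1) S1 by blast
      then have "cj t w \<in> C \<inter> cj t ` C" using ku w(1) PC by auto
      then have "cj t w = 1" using frob[of t] t SX \<open>t \<notin> C\<close> by blast
      then show False using w(2) by simp
    qed
    have "TI X S" unfolding TI_def
    proof
      fix g assume g: "g \<in> X"
      show "cj g ` S \<inter> S = {1} \<or> cj g ` S \<inter> S = S"
      proof (cases "g \<in> C")
        case True
        have "cj g ` S = S" by (rule cj_image_eqI[OF sg_finite[OF sS]]) (use normC[OF True] SC in blast)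
        then show ?thesis by simp
      next
        case False
        then have "cj g ` S \<inter> S \<subseteq> {1}" using frob[of g] g SC by blast
        moreover have "1 \<in> cj g ` S \<inter> S" using sg_one[OF sS] by (simp add: mem_cj_image)
        ultimately show ?thesis by blast
      qed
    qed
    then have "TI X T" unfolding TI_def
    proof (intro ballI)
      fix g assume TI: "\<forall>g\<in>X. cj g ` S \<inter> S = {1} \<or> cj g ` S \<inter> S = S" and g: "g \<in> X"
      have e: "cj g ` T \<inter> T = cj x ` (cj (x\<^sup>- * (g * x)) ` S \<inter> S)"
        unfolding TS image_Int[OF inj_cj] by simp
      have "x\<^sup>- * (g * x) \<in> X" using g x(1) sg_mult[OF X] sg_inv[OF X] by blast
      then have "cj (x\<^sup>- * (g * x)) ` S \<inter> S = {1} \<or> cj (x\<^sup>- * (g * x)) ` S \<inter> S = S" using TI by blast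
      then show "cj g ` T \<inter> T = {1} \<or> cj g ` T \<inter> T = T"
      proof
        assume "cj (x\<^sup>- * (g * x)) ` S \<inter> S = {1}"
        then show ?thesis using e by simp
      next
        assume "cj (x\<^sup>- * (g * x)) ` S \<inter> S = S"
        then show ?thesis using e TS by simp
      qed
    qed
    then show ?thesis by blast
  qed
qed

section \<open>Isomorphism types\<close>

lemma iso_rec_integer_mod_group:
  assumes "sg X" "g \<in> X"
  shows "rec (cyc g) \<cong> integer_mod_group (od g)"
proof -
  let ?n = "od g"
  have n: "?n > 0" using od_pos[OF assms] .
  have one: "g ^ ?n = 1" using power_od[OF assms] .
  have "(\<lambda>i. g ^ nat i) \<in> iso (integer_mod_group ?n) (rec (cyc g))"
  proof (rule isoI)
    show "(\<lambda>i. g ^ nat i) \<in> hom (integer_mod_group ?n) (rec (cyc g))"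
    proof (rule homI)
      fix i j assume "i \<in> carrier (integer_mod_group ?n)" "j \<in> carrier (integer_mod_group ?n)"
      then have ij: "0 \<le> i" "0 \<le> j" using n by (auto simp: carrier_integer_mod_group)
      then have "nat ((i + j) mod int ?n) = (nat i + nat j) mod ?n"
        by (simp add: nat_mod_distrib nat_add_distrib)
      then show "g ^ nat (i \<otimes>\<^bsub>integer_mod_group ?n\<^esub> j) = g ^ nat i \<otimes>\<^bsub>rec (cyc g)\<^esub> g ^ nat j"
        using power_mod_eq[OF one] by (simp flip: power_add)
    qed simp
    have "(\<lambda>i. g ^ nat i) ` {0..<int ?n} = cyc g"
    proof
      show "(\<lambda>i. g ^ nat i) ` {0..<int ?n} \<subseteq> cyc g" by auto
      show "cyc g \<subseteq> (\<lambda>i. g ^ nat i) ` {0..<int ?n}"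
      proof
        fix y assume "y \<in> cyc g"
        then obtain k where "y = g ^ (k mod ?n)" using power_mod_eq[OF one] by (auto simp: mem_cyc)
        moreover have "int (k mod ?n) \<in> {0..<int ?n}" using n by simp
        ultimately show "y \<in> (\<lambda>i. g ^ nat i) ` {0..<int ?n}" by (intro image_eqI[of _ _ "int (k mod ?n)"]) auto
      qed
    qed
    moreover have "card {0..<int ?n} = card (cyc g)" by (simp add: od_def)
    ultimately have "bij_betw (\<lambda>i. g ^ nat i) {0..<int ?n} (cyc g)"
      by (metis bij_betw_def eq_card_imp_inj_on finite_atLeastLessThan_int)
    then show "bij_betw (\<lambda>i. g ^ nat i) (carrier (integer_mod_group ?n)) (carrier (rec (cyc g)))"
      using n by (simp add: carrier_integer_mod_group)
  qed
  then have "integer_mod_group ?n \<cong> rec (cyc g)" by (rule is_isoI)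
  then show ?thesis by (rule group.iso_sym[OF group_integer_mod_group])
qed

text \<open>A product in a fixed order, since multiplication in the ambient type is not commutative.
  The exponents are integers because the coordinates in \<open>elem_abelian_group\<close>
  are.\<close>

primrec lincomb :: "(nat \<Rightarrow> 'g::group_mult) \<Rightarrow> nat \<Rightarrow> (nat \<Rightarrow> int) \<Rightarrow> 'g" where
  "lincomb xs 0 v = 1"
| "lincomb xs (Suc n) v = lincomb xs n v * xs n ^ nat (v n)"

lemma lincomb_cong: "(\<And>i. i < n \<Longrightarrow> xs i = ys i \<and> v i = w i) \<Longrightarrow> lincomb xs n v = lincomb ys n w"
  by (induction n) auto

lemma lincomb_mem: "sg K \<Longrightarrow> (\<And>i. i < n \<Longrightarrow> xs i \<in> K) \<Longrightarrow> lincomb xs n v \<in> K"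
  by (induction n) (auto simp: sg_one sg_mult sg_power)

text \<open>A maximal independent tuple is a basis: the combinations form a subgroup, and an element
  outside it could be appended, because a power of it with exponent prime to \<open>q\<close> inside
  that subgroup would bring the element in.\<close>

lemma iso_rec_elem_abelian:
  assumes K: "sg K" and q: "prime q" and el: "\<And>x. x \<in> K \<Longrightarrow> x ^ q = 1"
    and ab: "\<And>x y. x \<in> K \<Longrightarrow> y \<in> K \<Longrightarrow> x * y = y * x"
  shows "\<exists>r. card K = q ^ r \<and> rec K \<cong> elem_abelian_group q r"
proof -
  have q0: "q > 0" using prime_gt_0_nat[OF q] .
  define E where "E r = (\<Pi>\<^sub>E i\<in>{..<r}. {0..<int q})" for r :: nat
  have carE: "carrier (elem_abelian_group q r) = E r" for r
    using q0 by (simp add: E_def carrier_integer_mod_group)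
  have cardE: "card (E r) = q ^ r" and finE: "finite (E r)" for r
    unfolding E_def by (simp_all add: card_PiE finite_PiE)
  have addE: "v \<otimes>\<^bsub>elem_abelian_group q r\<^esub> w \<in> E r" if "v \<in> E r" "w \<in> E r" for v w r
    using that q0 by (auto simp: E_def PiE_iff)
  have hom: "lincomb xs r (v \<otimes>\<^bsub>elem_abelian_group q r\<^esub> w) = lincomb xs r v * lincomb xs r w"
    if xs: "\<And>i. i < r \<Longrightarrow> xs i \<in> K" and vw: "v \<in> E r" "w \<in> E r" for xs r v w
  proof -
    have "lincomb xs n (\<lambda>i\<in>{..<r}. (v i + w i) mod int q) = lincomb xs n v * lincomb xs n w" if "n \<le> r" for n
      using that
    proof (induction n)
      case (Suc n)
      then have n: "n < r" by simp
      have x: "xs n \<in> K" using xs n by blast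
      have "0 \<le> v n" "0 \<le> w n" using vw n by (auto simp: E_def PiE_iff)
      then have e: "nat ((v n + w n) mod int q) = (nat (v n) + nat (w n)) mod q"
        by (simp add: nat_mod_distrib nat_add_distrib)
      have "lincomb xs (Suc n) (\<lambda>i\<in>{..<r}. (v i + w i) mod int q)
          = lincomb xs n v * lincomb xs n w * (xs n ^ nat (v n) * xs n ^ nat (w n))"
        using Suc.IH n e power_mod_eq[OF el[OF x]] by (simp add: power_add del: restrict_apply) (simp add: power_add)
      also have "\<dots> = lincomb xs n v * (lincomb xs n w * xs n ^ nat (v n)) * xs n ^ nat (w n)"
        by (simp only: mult.assoc)
      also have "lincomb xs n w * xs n ^ nat (v n) = xs n ^ nat (v n) * lincomb xs n w"
        by (rule ab) (use x xs n K in \<open>auto intro!: lincomb_mem sg_power\<close>)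
      finally show ?case by (simp only: mult.assoc lincomb.simps)
    qed simp
    then show ?thesis by simp
  qed
  \<comment> \<open>\<open>Q r\<close> says that an independent tuple of length \<open>r\<close>
    exists. Such an \<open>r\<close> is below \<open>q ^ r\<close>, hence at most
    \<open>card K\<close>, so a greatest one exists.\<close>
  define Q where "Q r \<longleftrightarrow> (\<exists>xs. (\<forall>i<r. xs i \<in> K) \<and> inj_on (lincomb xs r) (E r))" for r
  have "Q 0" unfolding Q_def E_def by simp
  moreover have bound: "r \<le> card K" if Qr: "Q r" for r
  proof -
    obtain xs where xs: "\<forall>i<r. xs i \<in> K" "inj_on (lincomb xs r) (E r)" using Qr Q_def by blast
    have "lincomb xs r ` E r \<subseteq> K" using lincomb_mem[OF K] xs(1) by blast
    then have "q ^ r \<le> card K" using card_inj_on_le[OF xs(2) _ sg_finite[OF K]] cardE by simp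
    moreover have "r < q ^ r" using power_gt_expt[of q r] prime_gt_1_nat[OF q] by simp
    ultimately show ?thesis by simp
  qed
  ultimately obtain r where r: "Q r" "\<And>s. Q s \<Longrightarrow> s \<le> r"
    using GreatestI_nat[of Q 0 "card K"] Greatest_le_nat[of Q _ "card K"] by blast
  then obtain xs where xs: "\<And>i. i < r \<Longrightarrow> xs i \<in> K" "inj_on (lincomb xs r) (E r)" using Q_def by blast
  let ?S = "lincomb xs r ` E r"
  have SK: "?S \<subseteq> K" using lincomb_mem[OF K] xs(1) by blast
  have sS: "sg ?S" unfolding sg_def
  proof (intro conjI ballI)
    show "finite ?S" using finE by blast
    have "(\<lambda>i\<in>{..<r}. 0) \<in> E r" using q0 by (auto simp: E_def)
    moreover have "lincomb xs n (\<lambda>i\<in>{..<r}. 0) = 1" if "n \<le> r" for n using that by (induction n) auto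
    ultimately show "1 \<in> ?S" by (metis (no_types, lifting) imageI order_refl)
    fix a b assume "a \<in> ?S" "b \<in> ?S"
    then obtain v w where vw: "v \<in> E r" "w \<in> E r" "a = lincomb xs r v" "b = lincomb xs r w" by blast
    then have "a * b = lincomb xs r (v \<otimes>\<^bsub>elem_abelian_group q r\<^esub> w)" using hom[OF xs(1)] by simp
    then show "a * b \<in> ?S" using addE[OF vw(1,2)] by blast
  qed
  have "K \<subseteq> ?S"
  proof
    fix x assume x: "x \<in> K"
    show "x \<in> ?S"
    proof (rule ccontr)
      assume nx: "x \<notin> ?S"
      define ys where "ys = xs(r := x)"
      have low: "lincomb ys r v = lincomb xs r (restrict v {..<r})" for v
        by (rule lincomb_cong) (simp add: ys_def)
      have resE: "restrict v {..<r} \<in> E r" if "v \<in> E (Suc r)" for v using that by (auto simp: E_def PiE_iff)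
      have key: "a = b" if "s \<in> ?S" "t \<in> ?S" "s * x ^ a = t * x ^ b" "a \<le> b" "b < q" for s t a b
      proof (rule ccontr)
        assume "a \<noteq> b"
        have "x ^ b = x ^ (b - a) * x ^ a" using that(4) by (simp flip: power_add)
        then have "s * x ^ a = t * x ^ (b - a) * x ^ a" using that(3) by (simp add: mult.assoc)
        then have "t * x ^ (b - a) \<in> ?S" using that(1) by simp
        then have "x ^ (b - a) \<in> ?S" using sg_mult_iff(1)[OF sS that(2)] by blast
        moreover have "x ^ q \<in> ?S" using el[OF x] sg_one[OF sS] by simp
        moreover have "coprime (b - a) q"
        proof -
          have "\<not> q dvd b - a" using that(4,5) \<open>a \<noteq> b\<close> by (auto dest: dvd_imp_le)
          then show ?thesis using q prime_imp_coprime coprime_commute by blast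
        qed
        ultimately show False using mem_of_coprime_powers[OF sS K x] nx by blast
      qed
      have "inj_on (lincomb ys (Suc r)) (E (Suc r))"
      proof (rule inj_onI)
        fix v w assume vw: "v \<in> E (Suc r)" "w \<in> E (Suc r)" "lincomb ys (Suc r) v = lincomb ys (Suc r) w"
        let ?s = "lincomb xs r (restrict v {..<r})" and ?t = "lincomb xs r (restrict w {..<r})"
        have eq: "?s * x ^ nat (v r) = ?t * x ^ nat (w r)" using vw(3) low by (simp add: ys_def)
        have st: "?s \<in> ?S" "?t \<in> ?S" using resE vw by blast+
        have rng: "0 \<le> v r" "v r < int q" "0 \<le> w r" "w r < int q" using vw(1,2) by (auto simp: E_def PiE_iff)
        have "nat (v r) = nat (w r)"
        proof (cases "nat (v r) \<le> nat (w r)")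
          case True
          then show ?thesis using key[OF st eq] rng by (simp add: nat_less_iff)
        next
          case False
          then show ?thesis using key[OF st(2,1) eq[symmetric]] rng by (simp add: nat_less_iff)
        qed
        then have vr: "v r = w r" using rng by simp
        then have "?s = ?t" using eq by simp
        then have res: "restrict v {..<r} = restrict w {..<r}" using xs(2) resE vw(1,2) by (meson inj_onD)
        show "v = w"
        proof
          fix i show "v i = w i"
          proof (cases "i < r")
            case True
            then show ?thesis using fun_cong[OF res, of i] by simp
          next
            case False
            then show ?thesis using vr vw(1,2) by (cases "i = r") (auto simp: E_def PiE_iff extensional_def)
          qed
        qed
      qed
      moreover have "\<forall>i<Suc r. ys i \<in> K" using xs(1) x by (auto simp: ys_def less_Suc_eq)
      ultimately have "Q (Suc r)" unfolding Q_def by blast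
      then show False using r(2) by fastforce
    qed
  qed
  then have SeqK: "?S = K" using SK by blast
  have "lincomb xs r \<in> iso (elem_abelian_group q r) (rec K)"
  proof (rule isoI)
    show "lincomb xs r \<in> hom (elem_abelian_group q r) (rec K)"
    proof (rule homI)
      show "lincomb xs r v \<in> carrier (rec K)" if "v \<in> carrier (elem_abelian_group q r)" for v
        using that SK unfolding carE by auto
      show "lincomb xs r (v \<otimes>\<^bsub>elem_abelian_group q r\<^esub> w) = lincomb xs r v \<otimes>\<^bsub>rec K\<^esub> lincomb xs r w"
        if "v \<in> carrier (elem_abelian_group q r)" "w \<in> carrier (elem_abelian_group q r)" for v w
        using hom[OF xs(1)] that unfolding carE by simp
    qed
    show "bij_betw (lincomb xs r) (carrier (elem_abelian_group q r)) (carrier (rec K))"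
      unfolding carE using xs(2) SeqK by (simp add: bij_betw_def)
  qed
  then have "elem_abelian_group q r \<cong> rec K" by (rule is_isoI)
  then have "rec K \<cong> elem_abelian_group q r"
    by (rule group.iso_sym[rotated]) (rule product_group, simp)
  moreover have "card K = q ^ r" using SeqK card_image[OF xs(2)] cardE by simp
  ultimately show ?thesis by blast
qed

lemma cyclic_group_rec: assumes "sg X" "g \<in> X" shows "cyclic_group (rec (cyc g))"
proof -
  have s: "sg (cyc g)" using sg_cyc[OF assms] .
  interpret group "rec (cyc g)" using group_rec[OF s] .
  have "carrier (rec (cyc g)) = range (\<lambda>n::int. g [^]\<^bsub>rec (cyc g)\<^esub> n)"
  proof
    show "range (\<lambda>n::int. g [^]\<^bsub>rec (cyc g)\<^esub> n) \<subseteq> carrier (rec (cyc g))"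
      using int_pow_closed[of g] by auto
    have "g ^ n = g [^]\<^bsub>rec (cyc g)\<^esub> (int n)" for n by (simp add: int_pow_int)
    then show "carrier (rec (cyc g)) \<subseteq> range (\<lambda>n::int. g [^]\<^bsub>rec (cyc g)\<^esub> n)"
      by (auto simp: mem_cyc simp del: pow_rec)
  qed
  then show ?thesis unfolding cyclic_group by (intro bexI[of _ g]) auto
qed

subsection \<open>The quaternion group\<close>

lemma q8_unit_mult_table [simp]:
  "q8_unit_mult 0 b = (False, b)" "q8_unit_mult a 0 = (False, a)"
  "q8_unit_mult 1 1 = (True, 0)" "q8_unit_mult 1 2 = (False, 3)" "q8_unit_mult 1 3 = (True, 2)"
  "q8_unit_mult 2 1 = (True, 3)" "q8_unit_mult 2 2 = (True, 0)" "q8_unit_mult 2 3 = (False, 1)"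
  "q8_unit_mult 3 1 = (False, 2)" "q8_unit_mult 3 2 = (True, 1)" "q8_unit_mult 3 3 = (True, 0)"
  by (simp_all add: q8_unit_mult_def)

lemma Q8_simps:
  "carrier Q8_group = UNIV \<times> {..<4}" "\<one>\<^bsub>Q8_group\<^esub> = (False, 0)"
  "(s, a) \<otimes>\<^bsub>Q8_group\<^esub> (t, b) = ((s \<noteq> t) \<noteq> fst (q8_unit_mult a b), snd (q8_unit_mult a b))"
  by (simp_all add: Q8_group_def split: prod.split)

lemma Q8_E:
  assumes "x \<in> carrier Q8_group"
  obtains s where "x = (s, 0)" | s where "x = (s, 1)" | s where "x = (s, 2)" | s where "x = (s, 3)"
proof -
  obtain s a where x: "x = (s, a)" "a < 4" using assms by (cases x) (auto simp: Q8_simps)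
  then consider "x = (s, 0)" | "x = (s, 1)" | "x = (s, 2)" | "x = (s, 3)" by fastforce
  then show thesis by cases (fact that)+
qed

lemma Q8_closed:
  assumes "x \<in> carrier Q8_group" "y \<in> carrier Q8_group"
  shows "x \<otimes>\<^bsub>Q8_group\<^esub> y \<in> carrier Q8_group"
  by (rule Q8_E[OF assms(1)]; rule Q8_E[OF assms(2)]; simp add: Q8_simps del: One_nat_def)

text \<open>Every element conjugates \<open>x\<close> to \<open>x\<close> or to its inverse. The
  inverse appears as a triple product because \<open>Q8_group\<close> is not yet known to be a
  group.\<close>

lemma Q8_conj:
  assumes "x \<in> carrier Q8_group" "y \<in> carrier Q8_group"
  shows "y \<otimes>\<^bsub>Q8_group\<^esub> x = x \<otimes>\<^bsub>Q8_group\<^esub> y \<or>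
    y \<otimes>\<^bsub>Q8_group\<^esub> x = x \<otimes>\<^bsub>Q8_group\<^esub> (x \<otimes>\<^bsub>Q8_group\<^esub> (x \<otimes>\<^bsub>Q8_group\<^esub> y))"
proof -
  obtain s a t b where xy: "x = (s, a)" "y = (t, b)" by (cases x; cases y) blast
  have "a = 0 \<or> a = 1 \<or> a = 2 \<or> a = 3" "b = 0 \<or> b = 1 \<or> b = 2 \<or> b = 3"
    using assms by (auto simp: xy Q8_simps)
  then show ?thesis unfolding xy
    by (elim disjE) (simp_all add: Q8_simps del: One_nat_def, (cases s; cases t; simp)+)
qed

lemma Q8_power_4:
  assumes "x \<in> carrier Q8_group"
  shows "x \<otimes>\<^bsub>Q8_group\<^esub> (x \<otimes>\<^bsub>Q8_group\<^esub> (x \<otimes>\<^bsub>Q8_group\<^esub> x)) = \<one>\<^bsub>Q8_group\<^esub>"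
  by (rule Q8_E[OF assms]; simp add: Q8_simps del: One_nat_def)

lemma Q8_idem:
  assumes "x \<in> carrier Q8_group" "x \<otimes>\<^bsub>Q8_group\<^esub> x = x"
  shows "x = \<one>\<^bsub>Q8_group\<^esub>"
  using assms(2) by (rule_tac Q8_E[OF assms(1)]; simp add: Q8_simps del: One_nat_def)

text \<open>Exponent 4 and conjugation by powers are the only facts about the quaternion group that
  the converse direction uses; they are pulled back through the isomorphism.\<close>

lemma Q8_group_properties:
  assumes Q: "sg Q" "rec Q \<cong> Q8_group" and xy: "x \<in> Q" "y \<in> Q"
  shows "x ^ 4 = 1" "y * x = x * y \<or> y * x = x ^ 3 * y"
proof -
  obtain f where f: "f \<in> iso (rec Q) Q8_group" using Q(2) is_iso_def by blast
  have hom: "f (a * b) = f a \<otimes>\<^bsub>Q8_group\<^esub> f b" if "a \<in> Q" "b \<in> Q" for a b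
    using f that by (auto simp: iso_def hom_def)
  have cl: "f a \<in> carrier Q8_group" if "a \<in> Q" for a using f that by (auto simp: iso_def hom_def)
  have inj: "inj_on f Q" using f by (auto simp: iso_def bij_betw_def)
  have f1: "f 1 = \<one>\<^bsub>Q8_group\<^esub>" using Q8_idem[OF cl] hom[of 1 1] sg_one[OF Q(1)] by simp
  note m = sg_mult[OF Q(1)]
  have "f (x * (x * (x * x))) = f 1" using Q8_power_4[OF cl[OF xy(1)]] f1 hom xy m by simp
  then have "x * (x * (x * x)) = 1" using inj_onD[OF inj] xy m sg_one[OF Q(1)] by blast
  then show "x ^ 4 = 1" by (simp add: numeral_eq_Suc)
  have "f (y * x) = f (x * y) \<or> f (y * x) = f (x * (x * (x * y)))"
    using Q8_conj[OF cl[OF xy(1)] cl[OF xy(2)]] hom xy m by simp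
  then have "y * x = x * y \<or> y * x = x * (x * (x * y))" using inj_onD[OF inj] xy m by blast
  then show "y * x = x * y \<or> y * x = x ^ 3 * y" by (simp add: numeral_eq_Suc mult.assoc)
qed

text \<open>The relations determine a map \<open>f\<close> from the sign and the unit to the power
  of \<open>z\<close> and one of \<open>1, u, v, u * v\<close>. It is multiplicative by rewriting to
  normal form, and its kernel is trivial since \<open>v\<close> lies outside
  \<open>cyc u\<close>.\<close>

lemma iso_rec_Q8:
  assumes H: "sg H" "u \<in> H" "v \<in> H" and u: "u ^ 4 = 1" "u ^ 2 \<noteq> 1" and v: "v ^ 2 = u ^ 2" "v \<notin> cyc u"
    and vu: "v * u = u ^ 2 * (u * v)" and Q: "sg (cyc u \<bullet> cyc v)"
  shows "rec (cyc u \<bullet> cyc v) \<cong> Q8_group"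
proof -
  define z where "z = u ^ 2"
  define b where "b i = (if i = 0 then 1 else if i = 1 then u else if i = 2 then v else u * v)" for i :: nat
  define f where "f = (\<lambda>(s, i). (if s then z else 1) * b i)"
  have uu: "u * u = z" and vv: "v * v = z" using v(1) by (simp_all add: z_def power2_eq_square)
  have zz: "z * z = 1" using u(1) by (simp add: z_def flip: power_add)
  have zu: "u * z = z * u" unfolding z_def by (simp add: power_commutes)
  have zv: "v * z = z * v" unfolding z_def v(1)[symmetric] by (simp add: power_commutes)
  have vu': "v * u = z * (u * v)" using vu by (simp add: z_def)
  \<comment> \<open>The same relations with a trailing factor \<open>t\<close>, so that they also
    apply inside products nested to the right; together they move \<open>z\<close> to the front and
    \<open>u\<close> before \<open>v\<close>.\<close>
  have L: "u * (u * t) = z * t" "v * (v * t) = z * t" "z * (z * t) = t" "u * (z * t) = z * (u * t)"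
    "v * (z * t) = z * (v * t)" "v * (u * t) = z * (u * (v * t))" for t
    using uu vv zz zu zv vu' by (metis mult.assoc, metis mult.assoc, metis mult.assoc mult_1_left, metis mult.assoc, metis mult.assoc, metis mult.assoc)
  note rules = uu vv zz zu zv vu' L mult.assoc
  have z1: "z \<noteq> 1" using u(2) by (simp add: z_def)
  have hom: "f (x \<otimes>\<^bsub>Q8_group\<^esub> y) = f x * f y" if "x \<in> carrier Q8_group" "y \<in> carrier Q8_group" for x y
    by (rule Q8_E[OF that(1)]; rule Q8_E[OF that(2)];
        simp add: Q8_simps f_def b_def rules del: One_nat_def split del: if_split; simp add: rules)
  let ?Q = "cyc u \<bullet> cyc v"
  have "u * v \<in> ?Q" "u \<in> ?Q" "v \<in> ?Q" "z \<in> ?Q"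
    using setmulI[of u "cyc u" v "cyc v"] setmulI[of u "cyc u" 1 "cyc v"] setmulI[of 1 "cyc u" v "cyc v"]
      setmulI[of z "cyc u" 1 "cyc v"] by (auto simp: z_def)
  then have cl: "f x \<in> ?Q" for x
    using sg_mult[OF Q] sg_one[OF Q] by (cases x) (auto simp: f_def b_def)
  have inj1: "x = (False, 0)" if x: "x \<in> carrier Q8_group" "f x = 1" for x
  proof -
    have nu: "v \<noteq> t" if "t \<in> cyc u" for t using v(2) that by blast
    have su: "sg (cyc u)" using sg_cyc[OF H(1,2)] .
    have zcu: "z \<in> cyc u" by (simp add: z_def)
    have "u \<noteq> 1" using z1 uu by auto
    moreover have "v \<noteq> 1" using nu[of 1] by auto
    moreover have "z * u \<noteq> 1" 
    proof
      assume "z * u = 1"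
      then have "z * (z * u) = z" by simp
      then have "u = z" using L(3)[of u] by simp
      then show False using uu zz z1 by simp
    qed
    moreover have "z * v \<noteq> 1"
    proof
      assume "z * v = 1"
      then have "z * v \<in> cyc u" by simp
      then show False using sg_mult_iff(1)[OF su zcu] v(2) by blast
    qed
    moreover have "u * v \<noteq> 1"
    proof
      assume "u * v = 1"
      then have "u * v \<in> cyc u" by simp
      then show False using sg_mult_iff(1)[OF su cyc_self] v(2) by blast
    qed
    moreover have "z * (u * v) \<noteq> 1"
    proof
      assume "z * (u * v) = 1"
      then have "z * (u * v) \<in> cyc u" by simp
      then have "u * v \<in> cyc u" using sg_mult_iff(1)[OF su zcu] by blast
      then show False using sg_mult_iff(1)[OF su cyc_self] v(2) by blast
    qed
    ultimately show ?thesis using x(2) z1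
      by (rule_tac Q8_E[OF x(1)]) (auto simp: f_def b_def split: if_splits)
  qed
  have inj: "inj_on f (carrier Q8_group)"
  proof (rule inj_onI)
    fix x y assume xy: "x \<in> carrier Q8_group" "y \<in> carrier Q8_group" "f x = f y"
    \<comment> \<open>The cube of \<open>y\<close> serves as its inverse, since
      \<open>Q8_group\<close> has not been shown to be a group at this point.\<close>
    let ?y3 = "y \<otimes>\<^bsub>Q8_group\<^esub> (y \<otimes>\<^bsub>Q8_group\<^esub> y)"
    have y2: "y \<otimes>\<^bsub>Q8_group\<^esub> y \<in> carrier Q8_group" using Q8_closed xy by blast
    then have y3: "?y3 \<in> carrier Q8_group" "x \<otimes>\<^bsub>Q8_group\<^esub> ?y3 \<in> carrier Q8_group" using Q8_closed xy by blast+
    then have "f (x \<otimes>\<^bsub>Q8_group\<^esub> ?y3) = f (y \<otimes>\<^bsub>Q8_group\<^esub> ?y3)" using hom xy y3 by simp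
    also have "\<dots> = f (False, 0)" using Q8_power_4[OF xy(2)] by (simp add: Q8_simps)
    also have "\<dots> = 1" by (simp add: f_def b_def)
    finally have "x \<otimes>\<^bsub>Q8_group\<^esub> ?y3 = (False, 0)" using inj1 y3 by blast
    then show "x = y"
      by (rule_tac Q8_E[OF xy(1)]; rule_tac Q8_E[OF xy(2)]; simp add: Q8_simps del: One_nat_def)
  qed
  have surj: "f ` carrier Q8_group = ?Q"
  proof
    show "f ` carrier Q8_group \<subseteq> ?Q" using cl by blast
    show "?Q \<subseteq> f ` carrier Q8_group"
    proof
      fix y assume "y \<in> ?Q"
      then obtain i j where ij: "y = u ^ i * v ^ j" by (auto elim!: setmulE simp: mem_cyc)
      have mem: "x \<in> f ` carrier Q8_group \<longleftrightarrow> (\<exists>s. \<exists>k<4. x = f (s, k))" for x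
        by (auto simp: Q8_simps image_iff)
      have ui: "\<exists>s. \<exists>k<2. u ^ i = (if s then z else 1) * b k" for i
      proof (induction i)
        case 0
        then show ?case by (intro exI[of _ False] exI[of _ 0]) (simp add: b_def)
      next
        case (Suc i)
        then obtain s k where sk: "k < 2" "u ^ i = (if s then z else 1) * b k" by blast
        then have "k = 0 \<or> k = 1" by auto
        then show ?case
        proof
          assume "k = 0"
          then have "u ^ Suc i = (if s then z else 1) * b 1" using sk by (auto simp: b_def rules)
          then show ?thesis by (intro exI[of _ s] exI[of _ 1]) simp
        next
          assume "k = 1"
          then have "u ^ Suc i = (if \<not> s then z else 1) * b 0" using sk by (auto simp: b_def rules)
          then show ?thesis by (intro exI[of _ "\<not> s"] exI[of _ 0]) simp
        qed
      qed
      have vj: "\<exists>s. \<exists>k\<in>{0, 2}. v ^ j = (if s then z else 1) * b k" for j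
      proof (induction j)
        case 0
        then show ?case by (intro exI[of _ False] bexI[of _ 0]) (simp_all add: b_def)
      next
        case (Suc i)
        then obtain s k where sk: "k \<in> {0, 2}" "v ^ i = (if s then z else 1) * b k" by blast
        then have "k = 0 \<or> k = 2" by auto
        then show ?case
        proof
          assume "k = 0"
          then have "v ^ Suc i = (if s then z else 1) * b 2" using sk by (auto simp: b_def rules)
          then show ?thesis by (intro exI[of _ s] bexI[of _ 2]) simp_all
        next
          assume "k = 2"
          then have "v ^ Suc i = (if \<not> s then z else 1) * b 0" using sk by (auto simp: b_def rules)
          then show ?thesis by (intro exI[of _ "\<not> s"] bexI[of _ 0]) simp_all
        qed
      qed
      obtain s k t l where skl: "k < 2" "u ^ i = (if s then z else 1) * b k" "l \<in> {0, 2}" "v ^ j = (if t then z else 1) * b l"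
        using ui vj by blast
      have kl: "(k = 0 \<or> k = 1) \<and> (l = 0 \<or> l = 2)" using skl by auto
      then have "y = f (s \<noteq> t, k + l)" unfolding ij skl f_def by (auto simp: b_def rules)
      moreover have "k + l < 4" using kl by auto
      ultimately show "y \<in> f ` carrier Q8_group" using mem by blast
    qed
  qed
  \<comment> \<open>Associativity and inverses are pulled back along the injective multiplicative
    map \<open>f\<close>, which avoids a check of all triples in the table.\<close>
  have "group Q8_group"
  proof (rule groupI)
    show "\<one>\<^bsub>Q8_group\<^esub> \<in> carrier Q8_group" by (simp add: Q8_simps)
    show cl: "x \<otimes>\<^bsub>Q8_group\<^esub> y \<in> carrier Q8_group" if "x \<in> carrier Q8_group" "y \<in> carrier Q8_group" for x y
      using that by (rule Q8_closed)
    show "x \<otimes>\<^bsub>Q8_group\<^esub> y \<otimes>\<^bsub>Q8_group\<^esub> w = x \<otimes>\<^bsub>Q8_group\<^esub> (y \<otimes>\<^bsub>Q8_group\<^esub> w)"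
      if "x \<in> carrier Q8_group" "y \<in> carrier Q8_group" "w \<in> carrier Q8_group" for x y w
      using that cl hom inj_onD[OF inj, of "x \<otimes>\<^bsub>Q8_group\<^esub> y \<otimes>\<^bsub>Q8_group\<^esub> w"] by (simp add: mult.assoc)
    show "\<one>\<^bsub>Q8_group\<^esub> \<otimes>\<^bsub>Q8_group\<^esub> x = x" if "x \<in> carrier Q8_group" for x
      using that by (cases x) (simp add: Q8_simps)
    show "\<exists>y\<in>carrier Q8_group. y \<otimes>\<^bsub>Q8_group\<^esub> x = \<one>\<^bsub>Q8_group\<^esub>" if x: "x \<in> carrier Q8_group" for x
    proof -
      have "f x \<in> ?Q" using cl x surj by blast
      then obtain y where y: "y \<in> carrier Q8_group" "f y = (f x)\<^sup>-" using surj sg_inv[OF Q] by (metis imageE)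
      then have "f (y \<otimes>\<^bsub>Q8_group\<^esub> x) = 1" using hom x by simp
      then show ?thesis using inj1 cl[OF y(1) x] y(1) by (auto simp: Q8_simps)
    qed
  qed
  moreover have "f \<in> iso Q8_group (rec ?Q)"
    by (rule isoI) (use cl hom inj surj in \<open>auto simp: hom_def bij_betw_def\<close>)
  then have "Q8_group \<cong> rec ?Q" by (rule is_isoI)
  ultimately show ?thesis by (rule group.iso_sym)
qed

text \<open>The two normal factors commute, and the parts \<open>a\<close> and \<open>b\<close> of
  \<open>x\<close> have coprime orders, so both are powers of \<open>x\<close>. Conjugation by
  \<open>h\<close> fixes \<open>b\<close> and sends \<open>a\<close> to \<open>a\<close> or
  \<open>a ^ 3\<close>.\<close>

lemma cyclic_or_quaternion_dedekind:
  assumes Q: "nml Q H" "rec Q \<cong> Q8_group" and Z: "nml Z H" "\<And>x y. x \<in> Z \<Longrightarrow> y \<in> Z \<Longrightarrow> x * y = y * x" "odd (card Z)"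
    and QZ: "Q \<inter> Z = {1}" "Q \<bullet> Z = H" and xh: "x \<in> H" "h \<in> H"
  shows "cj h x \<in> cyc x"
proof -
  note sQ = nmlD(1)[OF Q(1)] and sZ = nmlD(1)[OF Z(1)] and sH = nmlD(2)[OF Q(1)]
  have comm: "a * b = b * a" if "a \<in> Q" "b \<in> Z" for a b
  proof -
    have "cm a b \<in> Q" unfolding cm_cj(1)
      using that nmlD(4)[OF Q(1)] nmlD(3)[OF Z(1)] sg_mult[OF sQ] sg_inv[OF sQ] by blast
    moreover have "cm a b \<in> Z" unfolding cm_cj(2)
      using that nmlD(4)[OF Z(1)] nmlD(3)[OF Q(1)] sg_mult[OF sZ] sg_inv[OF sZ] by blast
    ultimately have "cm a b = 1" using QZ(1) by blast
    then show ?thesis by (simp add: cm_eq_one_iff)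
  qed
  obtain a b where ab: "a \<in> Q" "b \<in> Z" "x = a * b" using xh(1) QZ(2) by (auto elim!: setmulE)
  obtain c d where cd: "c \<in> Q" "d \<in> Z" "h = c * d" using xh(2) QZ(2) by (auto elim!: setmulE)
  have aH: "a \<in> H" and bH: "b \<in> H" using ab nmlD(3)[OF Q(1)] nmlD(3)[OF Z(1)] by blast+
  have a4: "a ^ 4 = 1" using Q8_group_properties(1)[OF sQ Q(2) ab(1) ab(1)] .
  have bZ: "b ^ card Z = 1" using power_card_eq_one[OF sZ ab(2)] .
  have cop: "coprime 4 (card Z)"
    using Z(3) coprime_power_left_iff[of 2 2 "card Z"] by simp
  note mem = mem_cyc_mult[OF sH aH bH comm[OF ab(1,2)] a4 bZ cop]
  have sx: "sg (cyc x)" using sg_cyc[OF sH xh(1)] .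
  have da: "cj d a = a" and db: "cj d b = b" and cb: "cj c b = b"
    unfolding cj_eq_self_iff using comm[OF ab(1) cd(2)] comm[OF cd(1) ab(2)] Z(2)[OF cd(2) ab(2)] by simp_all
  have "cj h x = cj c (cj d a) * cj c (cj d b)" unfolding ab(3) cd(3) by (simp add: cj_mult)
  then have e: "cj h x = cj c a * b" unfolding da db cb .
  have "cj c a = a \<or> cj c a = a ^ 3"
  proof -
    from Q8_group_properties(2)[OF sQ Q(2) ab(1) cd(1)] show ?thesis
    proof
      assume "c * a = a * c"
      then show ?thesis by (simp add: cj_eq_self_iff)
    next
      assume "c * a = a ^ 3 * c"
      then have "cj c a = a ^ 3" by (simp add: cj_def mult.assoc)
      then show ?thesis by blast
    qed
  qed
  then have "cj c a \<in> cyc x" using mem(1) sg_power[OF sx] unfolding ab(3) by auto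
  then show ?thesis unfolding e using mem(2) sg_mult[OF sx] unfolding ab(3) by blast
qed

section \<open>Cayley's embedding\<close>

instance perm :: (type) group_mult
proof
  fix x :: "'a perm"
  show "x\<^sup>- * x = 1"
    by (rule perm_eqI) (simp add: apply_times apply_inverse bij_is_inj)
qed

text \<open>Left multiplication, continued by the identity outside the carrier. As the carrier is
  finite, it moves only finitely many points and so belongs to the type \<open>perm\<close>, which
  is an instance of the group class.\<close>

definition cayley :: "('a, 'b) monoid_scheme \<Rightarrow> 'a \<Rightarrow> 'a perm" where
  "cayley G g = Perm (\<lambda>x. if x \<in> carrier G then g \<otimes>\<^bsub>G\<^esub> x else x)"

locale cayley_embedding = group G for G :: "('a, 'b) monoid_scheme" (structure) +
  assumes fin: "finite (carrier G)"
begin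

abbreviation \<iota> :: "'a \<Rightarrow> 'a perm" where "\<iota> \<equiv> cayley G"

abbreviation X :: "'a perm set" where "X \<equiv> \<iota> ` carrier G"

lemma apply_cayley: assumes "g \<in> carrier G"
  shows "apply (\<iota> g) x = (if x \<in> carrier G then g \<otimes> x else x)"
proof -
  let ?f = "\<lambda>x. if x \<in> carrier G then g \<otimes> x else x"
  have "bij ?f"
  proof (rule bijI)
    show "inj ?f" using assms by (auto simp: inj_on_def split: if_splits)
    show "surj ?f"
    proof (rule surjI)
      show "?f ((\<lambda>x. if x \<in> carrier G then inv g \<otimes> x else x) x) = x" for x
        using assms by (simp add: m_assoc[symmetric])
    qed
  qed
  moreover have "finite {a. ?f a \<noteq> a}" using fin by (auto intro: finite_subset[of _ "carrier G"])
  ultimately show ?thesis unfolding cayley_def by (simp add: Perm_inverse)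
qed

lemma cayley_mult: "g \<in> carrier G \<Longrightarrow> h \<in> carrier G \<Longrightarrow> \<iota> (g \<otimes> h) = \<iota> g * \<iota> h"
  by (rule perm_eqI) (simp add: apply_times apply_cayley m_assoc)

lemma inj_cayley: "inj_on \<iota> (carrier G)"
proof (rule inj_onI)
  fix g h assume "g \<in> carrier G" "h \<in> carrier G" "\<iota> g = \<iota> h"
  then show "g = h" by (metis apply_cayley one_closed r_one)
qed

lemma cayley_one: "\<iota> \<one> = 1"
  by (rule perm_eqI) (simp add: apply_cayley)

lemma cayley_inv: "g \<in> carrier G \<Longrightarrow> \<iota> (inv g) = (\<iota> g)\<^sup>-"
  by (rule inv_eqI[of "\<iota> g"]) (simp add: cayley_one flip: cayley_mult)

lemma cayley_cj: "g \<in> carrier G \<Longrightarrow> h \<in> carrier G \<Longrightarrow> \<iota> (g \<otimes> h \<otimes> inv g) = cj (\<iota> g) (\<iota> h)"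
  by (simp add: cj_def cayley_mult cayley_inv)

lemma cayley_cm: "g \<in> carrier G \<Longrightarrow> h \<in> carrier G \<Longrightarrow> \<iota> (g \<otimes> h \<otimes> inv g \<otimes> inv h) = cm (\<iota> g) (\<iota> h)"
  by (simp add: cm_def cayley_mult cayley_inv)

lemma image_subset_cayley: "A \<subseteq> carrier G \<Longrightarrow> B \<subseteq> carrier G \<Longrightarrow> \<iota> ` A \<subseteq> \<iota> ` B \<longleftrightarrow> A \<subseteq> B"
  by (metis image_mono image_subset_iff inj_cayley inj_on_image_mem_iff subset_iff)

lemma image_eq_cayley: "A \<subseteq> carrier G \<Longrightarrow> B \<subseteq> carrier G \<Longrightarrow> \<iota> ` A = \<iota> ` B \<longleftrightarrow> A = B"
  using inj_on_image_eq_iff[OF inj_cayley] .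

lemma mem_cayley: "A \<subseteq> carrier G \<Longrightarrow> g \<in> carrier G \<Longrightarrow> \<iota> g \<in> \<iota> ` A \<longleftrightarrow> g \<in> A"
  by (rule inj_on_image_mem_iff[OF inj_cayley])

lemma card_cayley: "A \<subseteq> carrier G \<Longrightarrow> card (\<iota> ` A) = card A"
  by (rule card_image) (rule inj_on_subset[OF inj_cayley])

lemma ex_preimage: "B \<subseteq> X \<Longrightarrow> \<exists>A. A \<subseteq> carrier G \<and> \<iota> ` A = B"
  by (metis subset_imageE)

lemma subgroup_cayley: assumes "S \<subseteq> carrier G" shows "subgroup S G \<longleftrightarrow> sg (\<iota> ` S)"
proof
  assume S: "subgroup S G"
  then show "sg (\<iota> ` S)" unfolding sg_def
  proof (intro conjI ballI)
    show "finite (\<iota> ` S)" using fin assms finite_subset by blast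
    show "1 \<in> \<iota> ` S" using subgroup.one_closed[OF S] cayley_one by (metis imageI)
    fix x y assume "x \<in> \<iota> ` S" "y \<in> \<iota> ` S"
    then obtain a b where ab: "a \<in> S" "b \<in> S" "x = \<iota> a" "y = \<iota> b" by blast
    then have "x * y = \<iota> (a \<otimes> b)" using cayley_mult assms by (simp add: subset_iff)
    then show "x * y \<in> \<iota> ` S" using subgroup.m_closed[OF S ab(1,2)] by blast
  qed
next
  assume S: "sg (\<iota> ` S)"
  show "subgroup S G"
  proof
    show "S \<subseteq> carrier G" by (rule assms)
    show "\<one> \<in> S" using sg_one[OF S] cayley_one mem_cayley[OF assms one_closed] by simp
    show "x \<otimes> y \<in> S" if "x \<in> S" "y \<in> S" for x y
    proof -
      have c: "x \<in> carrier G" "y \<in> carrier G" using that assms by auto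
      have "\<iota> x * \<iota> y \<in> \<iota> ` S" using that by (intro sg_mult[OF S]) auto
      then show ?thesis using cayley_mult[OF c] mem_cayley[OF assms m_closed[OF c]] by simp
    qed
    show "inv x \<in> S" if "x \<in> S" for x
    proof -
      have c: "x \<in> carrier G" using that assms by auto
      have "(\<iota> x)\<^sup>- \<in> \<iota> ` S" using that by (intro sg_inv[OF S]) auto
      then show ?thesis using cayley_inv[OF c] mem_cayley[OF assms inv_closed[OF c]] by simp
    qed
  qed
qed

lemma sgX: "sg X"
  using subgroup_cayley[OF subset_refl] subgroup_self by blast

lemma inv_restrict: "subgroup Y G \<Longrightarrow> y \<in> Y \<Longrightarrow> inv\<^bsub>G\<lparr>carrier := Y\<rparr>\<^esub> y = inv y"
  using m_inv_consistent by blast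

lemma normal_cayley:
  assumes Y: "subgroup Y G" and N: "N \<subseteq> carrier G"
  shows "N \<lhd> G\<lparr>carrier := Y\<rparr> \<longleftrightarrow> nml (\<iota> ` N) (\<iota> ` Y)"
proof -
  note YG = subgroup.subset[OF Y]
  interpret Y: group "G\<lparr>carrier := Y\<rparr>" using subgroup_imp_group[OF Y] .
  have sub: "subgroup N (G\<lparr>carrier := Y\<rparr>) \<longleftrightarrow> subgroup N G \<and> N \<subseteq> Y"
    using subgroup_incl[of N Y] incl_subgroup[OF Y, of N] Y subgroup.subset[of N "G\<lparr>carrier := Y\<rparr>"] by auto
  have "N \<lhd> G\<lparr>carrier := Y\<rparr> \<longleftrightarrow> subgroup N G \<and> N \<subseteq> Y \<and> (\<forall>y\<in>Y. \<forall>n\<in>N. y \<otimes> n \<otimes> inv y \<in> N)"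
    unfolding Y.normal_inv_iff sub using inv_restrict[OF Y] by auto
  also have "\<dots> \<longleftrightarrow> sg (\<iota> ` N) \<and> \<iota> ` N \<subseteq> \<iota> ` Y \<and> (\<forall>y\<in>Y. \<forall>n\<in>N. cj (\<iota> y) (\<iota> n) \<in> \<iota> ` N)"
  proof -
    have "y \<otimes> n \<otimes> inv y \<in> N \<longleftrightarrow> cj (\<iota> y) (\<iota> n) \<in> \<iota> ` N" if "y \<in> Y" "n \<in> N" for y n
    proof -
      have c: "y \<in> carrier G" "n \<in> carrier G" using that YG N by auto
      then show ?thesis using cayley_cj[OF c] mem_cayley[OF N, of "y \<otimes> n \<otimes> inv y"] by simp
    qed
    then show ?thesis using subgroup_cayley[OF N] image_subset_cayley[OF N YG] by simp
  qed
  finally show ?thesis unfolding nml_def using subgroup_cayley[OF YG] Y by auto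
qed

lemma conj_set_cayley: assumes "S \<subseteq> carrier G" "g \<in> carrier G"
  shows "\<iota> ` conj_set G S g = cj ((\<iota> g)\<^sup>-) ` \<iota> ` S" "conj_set G S g \<subseteq> carrier G"
proof -
  have "\<iota> (inv g \<otimes> h \<otimes> g) = cj ((\<iota> g)\<^sup>-) (\<iota> h)" if "h \<in> S" for h
    using that assms cayley_cj[of "inv g" h] cayley_inv[OF assms(2)] by auto
  then show "\<iota> ` conj_set G S g = cj ((\<iota> g)\<^sup>-) ` \<iota> ` S" unfolding conj_set_def image_image by (rule image_cong[OF refl])
  show "conj_set G S g \<subseteq> carrier G" unfolding conj_set_def using assms by auto
qed

text \<open>Absorbs the difference between \<open>conj_set\<close>, which conjugates by the inverse,
  and \<open>cj\<close>.\<close>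

lemma ball_inverse_X: "(\<forall>x\<in>X. Q (x\<^sup>-)) \<longleftrightarrow> (\<forall>x\<in>X. Q x)"
  using sg_inv[OF sgX] by (metis inverse_inv)

lemma TI_cayley: assumes S: "subgroup S G" shows "TI_subgroup G S \<longleftrightarrow> TI X (\<iota> ` S)"
proof -
  note SG = subgroup.subset[OF S]
  have "conj_set G S g \<inter> S = {\<one>} \<longleftrightarrow> cj ((\<iota> g)\<^sup>-) ` \<iota> ` S \<inter> \<iota> ` S = {1}"
    "conj_set G S g \<inter> S = S \<longleftrightarrow> cj ((\<iota> g)\<^sup>-) ` \<iota> ` S \<inter> \<iota> ` S = \<iota> ` S" if g: "g \<in> carrier G" for g
  proof -
    have i: "\<iota> ` (conj_set G S g \<inter> S) = cj ((\<iota> g)\<^sup>-) ` \<iota> ` S \<inter> \<iota> ` S"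
      using inj_on_image_Int[OF inj_cayley conj_set_cayley(2)[OF SG g] SG] conj_set_cayley(1)[OF SG g] by simp
    have sub: "conj_set G S g \<inter> S \<subseteq> carrier G" using SG by blast
    show "conj_set G S g \<inter> S = {\<one>} \<longleftrightarrow> cj ((\<iota> g)\<^sup>-) ` \<iota> ` S \<inter> \<iota> ` S = {1}"
      using image_eq_cayley[OF sub, of "{\<one>}"] i cayley_one by simp
    show "conj_set G S g \<inter> S = S \<longleftrightarrow> cj ((\<iota> g)\<^sup>-) ` \<iota> ` S \<inter> \<iota> ` S = \<iota> ` S"
      using image_eq_cayley[OF sub SG] i by simp
  qed
  then have "TI_subgroup G S \<longleftrightarrow> (\<forall>x\<in>X. cj (x\<^sup>-) ` \<iota> ` S \<inter> \<iota> ` S = {1} \<or> cj (x\<^sup>-) ` \<iota> ` S \<inter> \<iota> ` S = \<iota> ` S)"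
    unfolding TI_subgroup_def using S by simp
  also have "\<dots> \<longleftrightarrow> TI X (\<iota> ` S)" unfolding TI_def by (rule ball_inverse_X)
  finally show ?thesis .
qed

section \<open>Transport of subnormality, commutators, isomorphism types and Frobenius
  structure\<close>

lemma subnormal_sub: "subnormal G S \<Longrightarrow> subgroup S G"
proof (induction rule: subnormal.induct)
  case top
  then show ?case by (rule subgroup_self)
next
  case (step K H)
  then show ?case using incl_subgroup[OF step.IH] normal_imp_subgroup by blast
qed

lemma subnormal_cayley: assumes S: "subgroup S G" shows "subnormal G S \<longleftrightarrow> sn X (\<iota> ` S)"
proof
  show "sn X (\<iota> ` S)" if "subnormal G S" using that
  proof (induction rule: subnormal.induct)
    case top
    then show ?case by (rule sn.top[OF sgX])
  next
    case (step K H)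
    have K: "subgroup K G" using subnormal_sub[OF step.hyps(1)] .
    have "H \<subseteq> carrier G" using subnormal_sub[OF subnormal.step[OF step.hyps]] subgroup.subset by blast
    then show ?case using step normal_cayley[OF K] sn.step by blast
  qed
  \<comment> \<open>The preimage is quantified inside, so that rule induction on \<open>sn\<close>
    runs over arbitrary sets \<open>T\<close> rather than over images.\<close>
  have "\<forall>S\<subseteq>carrier G. \<iota> ` S = T \<longrightarrow> subnormal G S" if "sn X T" for T using that
  proof (induction rule: sn.induct)
    case top
    then show ?case using image_eq_cayley[OF _ subset_refl] subnormal.top by metis
  next
    case (step Y T)
    show ?case
    proof (intro allI impI)
      fix S assume S: "S \<subseteq> carrier G" "\<iota> ` S = T"
      obtain K where K: "K \<subseteq> carrier G" "\<iota> ` K = Y" using ex_preimage[OF sn_sg(3)[OF step.hyps(1)]] by blast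
      have "subnormal G K" using step.IH K by blast
      moreover have "S \<lhd> G\<lparr>carrier := K\<rparr>"
        using normal_cayley[OF subnormal_sub[OF calculation] S(1)] step.hyps(2) S K by simp
      ultimately show "subnormal G S" by (rule subnormal.step)
    qed
  qed
  then show "sn X (\<iota> ` S) \<Longrightarrow> subnormal G S" using subgroup.subset[OF S] by blast
qed

lemma gen_cayley: assumes A: "A \<subseteq> carrier G" shows "\<iota> ` generate G A = gen (\<iota> ` A)"
proof
  have sub: "subgroup (generate G A) G" using generate_is_subgroup[OF A] .
  note gG = subgroup.subset[OF sub]
  have "A \<subseteq> generate G A" by (auto intro: generate.incl)
  then show "gen (\<iota> ` A) \<subseteq> \<iota> ` generate G A"
    by (intro gen_least) (use subgroup_cayley[OF gG] sub in auto)
  have genX: "gen (\<iota> ` A) \<subseteq> X" using gen_least[OF sgX] A by blast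
  obtain B where B: "B \<subseteq> carrier G" "\<iota> ` B = gen (\<iota> ` A)" using ex_preimage[OF genX] by blast
  have "sg (gen (\<iota> ` A))" using sg_gen[OF sgX] A by blast
  then have "subgroup B G" using subgroup_cayley[OF B(1)] B(2) by simp
  moreover have "A \<subseteq> B" using gen_incl[of "\<iota> ` A"] image_subset_cayley[OF A B(1)] B(2) by simp
  ultimately have "generate G A \<subseteq> B" by (rule generate_subgroup_incl[rotated])
  then show "\<iota> ` generate G A \<subseteq> gen (\<iota> ` A)" using B(2) by blast
qed

lemma commutator_cayley:
  assumes "A \<subseteq> carrier G" "B \<subseteq> carrier G"
  shows "\<iota> ` commutator_subgroup G A B = comm (\<iota> ` A) (\<iota> ` B)" "commutator_subgroup G A B \<subseteq> carrier G"
proof -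
  let ?S = "\<Union>a\<in>A. \<Union>b\<in>B. {a \<otimes> b \<otimes> inv a \<otimes> inv b}"
  have S: "?S \<subseteq> carrier G" using assms by (auto intro!: m_closed inv_closed)
  have "\<iota> ` ?S = (\<Union>a\<in>A. \<Union>b\<in>B. {cm (\<iota> a) (\<iota> b)})"
    unfolding image_UN using assms by (intro SUP_cong refl) (auto simp: cayley_cm subset_iff)
  also have "\<dots> = {cm a b |a b. a \<in> \<iota> ` A \<and> b \<in> \<iota> ` B}" by blast
  finally show "\<iota> ` commutator_subgroup G A B = comm (\<iota> ` A) (\<iota> ` B)"
    unfolding commutator_subgroup_def comm_def gen_cayley[OF S] by simp
  show "commutator_subgroup G A B \<subseteq> carrier G"
    unfolding commutator_subgroup_def using subgroup.subset[OF generate_is_subgroup[OF S]] .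
qed

lemma commutator_restrict:
  assumes Y: "subgroup Y G" and A: "A \<subseteq> Y"
  shows "commutator_subgroup (G\<lparr>carrier := Y\<rparr>) A Y = commutator_subgroup G A Y"
proof -
  let ?S = "\<Union>a\<in>A. \<Union>b\<in>Y. {a \<otimes> b \<otimes> inv a \<otimes> inv b}"
  have e: "(\<Union>a\<in>A. \<Union>b\<in>Y. {a \<otimes>\<^bsub>G\<lparr>carrier := Y\<rparr>\<^esub> b \<otimes>\<^bsub>G\<lparr>carrier := Y\<rparr>\<^esub> inv\<^bsub>G\<lparr>carrier := Y\<rparr>\<^esub> a
      \<otimes>\<^bsub>G\<lparr>carrier := Y\<rparr>\<^esub> inv\<^bsub>G\<lparr>carrier := Y\<rparr>\<^esub> b}) = ?S"
    using inv_restrict[OF Y] A by (intro SUP_cong refl) auto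
  have "?S \<subseteq> Y" using A subgroup.m_closed[OF Y] subgroup.m_inv_closed[OF Y] by auto
  then show ?thesis unfolding commutator_subgroup_def e using generate_consistent[OF _ Y] by simp
qed

lemma nilpotent_cayley: assumes Y: "subgroup Y G" shows "nilpotent_group (G\<lparr>carrier := Y\<rparr>) \<longleftrightarrow> nilp (\<iota> ` Y)"
proof -
  note YG = subgroup.subset[OF Y]
  have sY: "sg (\<iota> ` Y)" using subgroup_cayley[OF YG] Y by blast
  let ?L = "\<lambda>n. ((\<lambda>S. commutator_subgroup (G\<lparr>carrier := Y\<rparr>) S Y) ^^ n) Y"
  have L: "?L n \<subseteq> Y \<and> \<iota> ` ?L n = lcs (\<iota> ` Y) n" for n
  proof (induction n)
    case (Suc n)
    then have LG: "?L n \<subseteq> carrier G" using YG by blast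
    have e: "?L (Suc n) = commutator_subgroup G (?L n) Y" using commutator_restrict[OF Y] Suc by simp
    have i: "\<iota> ` ?L (Suc n) = lcs (\<iota> ` Y) (Suc n)"
      unfolding e commutator_cayley(1)[OF LG YG] using Suc by simp
    moreover have "?L (Suc n) \<subseteq> carrier G" unfolding e by (rule commutator_cayley(2)[OF LG YG])
    moreover have "lcs (\<iota> ` Y) (Suc n) \<subseteq> \<iota> ` Y" using nmlD(3)[OF nml_lcs[OF sY]] .
    ultimately show ?case using image_subset_cayley[OF _ YG] by metis
  qed simp
  have "?L n = {\<one>} \<longleftrightarrow> lcs (\<iota> ` Y) n = {1}" for n
  proof -
    have "?L n \<subseteq> carrier G" using L[of n] YG by blast
    then show ?thesis using image_eq_cayley[of "?L n" "{\<one>}"] L[of n] cayley_one by simp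
  qed
  then show ?thesis unfolding nilpotent_group_def nilp_def by simp
qed

lemma iso_cayley: assumes "S \<subseteq> carrier G" shows "\<iota> \<in> iso (G\<lparr>carrier := S\<rparr>) (rec (\<iota> ` S))"
  by (rule isoI) (use assms cayley_mult inj_on_subset[OF inj_cayley assms] in \<open>auto simp: hom_def bij_betw_def subset_iff\<close>)

lemma is_iso_cayley: assumes S: "subgroup S G" shows "G\<lparr>carrier := S\<rparr> \<cong> A \<longleftrightarrow> rec (\<iota> ` S) \<cong> A"
proof -
  have i: "G\<lparr>carrier := S\<rparr> \<cong> rec (\<iota> ` S)" using is_isoI[OF iso_cayley[OF subgroup.subset[OF S]]] .
  then have "rec (\<iota> ` S) \<cong> G\<lparr>carrier := S\<rparr>" using group.iso_sym[OF subgroup_imp_group[OF S]] by blast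
  then show ?thesis using iso_trans[OF i, of A] iso_trans[of "rec (\<iota> ` S)" "G\<lparr>carrier := S\<rparr>" A] by argo
qed

lemma cyclic_cayley: assumes S: "subgroup S G" shows "cyclic_group (G\<lparr>carrier := S\<rparr>) \<longleftrightarrow> cyclic_group (rec (\<iota> ` S))"
  using isomorphic_group_cyclicity[OF _ subgroup_imp_group[OF S] group_rec, of "\<iota> ` S"]
    is_isoI[OF iso_cayley[OF subgroup.subset[OF S]]] subgroup_cayley[OF subgroup.subset[OF S]] S by blast

lemma set_mult_cayley: assumes "A \<subseteq> carrier G" "B \<subseteq> carrier G"
  shows "\<iota> ` (A <#> B) = \<iota> ` A \<bullet> \<iota> ` B" "A <#> B \<subseteq> carrier G"
proof -
  show "\<iota> ` (A <#> B) = \<iota> ` A \<bullet> \<iota> ` B"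
  proof
    show "\<iota> ` (A <#> B) \<subseteq> \<iota> ` A \<bullet> \<iota> ` B" using assms
      by (auto simp: set_mult_def cayley_mult subset_iff intro!: setmulI)
    show "\<iota> ` A \<bullet> \<iota> ` B \<subseteq> \<iota> ` (A <#> B)"
    proof
      fix x assume "x \<in> \<iota> ` A \<bullet> \<iota> ` B"
      then obtain a b where ab: "a \<in> A" "b \<in> B" "x = \<iota> a * \<iota> b" by (auto elim!: setmulE)
      then have "x = \<iota> (a \<otimes> b)" using cayley_mult assms by (auto simp: subset_iff)
      then show "x \<in> \<iota> ` (A <#> B)" using ab by (auto simp: set_mult_def)
    qed
  qed
  show "A <#> B \<subseteq> carrier G" using assms by (rule set_mult_closed)
qed

lemma Int_cayley: assumes "A \<subseteq> carrier G" "B \<subseteq> carrier G" shows "A \<inter> B = {\<one>} \<longleftrightarrow> \<iota> ` A \<inter> \<iota> ` B = {1}"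
proof -
  have "A \<inter> B \<subseteq> carrier G" using assms by blast
  then show ?thesis
    using image_eq_cayley[of "A \<inter> B" "{\<one>}"] inj_on_image_Int[OF inj_cayley assms] cayley_one by simp
qed

lemma int_semidirect_cayley:
  assumes "N \<subseteq> carrier G" "A \<subseteq> carrier G" "Y \<subseteq> carrier G"
  shows "int_semidirect G N A Y \<longleftrightarrow> sg (\<iota> ` Y) \<and> sg (\<iota> ` A) \<and> nml (\<iota> ` N) (\<iota> ` Y) \<and> \<iota> ` A \<subseteq> \<iota> ` Y \<and>
    \<iota> ` N \<inter> \<iota> ` A = {1} \<and> \<iota> ` N \<bullet> \<iota> ` A = \<iota> ` Y"
  unfolding int_semidirect_def
  using subgroup_cayley[OF assms(3)] subgroup_cayley[OF assms(2)] normal_cayley[OF _ assms(1), of Y]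
    image_subset_cayley[OF assms(2,3)] Int_cayley[OF assms(1,2)] set_mult_cayley[OF assms(1,2)]
    image_eq_cayley[OF set_mult_cayley(2)[OF assms(1,2)] assms(3)] by auto

lemma int_direct_cayley:
  assumes "A \<subseteq> carrier G" "B \<subseteq> carrier G" "Y \<subseteq> carrier G"
  shows "int_direct G A B Y \<longleftrightarrow> sg (\<iota> ` Y) \<and> nml (\<iota> ` A) (\<iota> ` Y) \<and> nml (\<iota> ` B) (\<iota> ` Y) \<and>
    \<iota> ` A \<inter> \<iota> ` B = {1} \<and> \<iota> ` A \<bullet> \<iota> ` B = \<iota> ` Y"
  unfolding int_direct_def
  using subgroup_cayley[OF assms(3)] normal_cayley[OF _ assms(1), of Y] normal_cayley[OF _ assms(2), of Y]
    Int_cayley[OF assms(1,2)] set_mult_cayley[OF assms(1,2)]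
    image_eq_cayley[OF set_mult_cayley(2)[OF assms(1,2)] assms(3)] by auto

lemma conj_union_cayley: assumes C: "C \<subseteq> carrier G"
  shows "\<iota> ` (\<Union>g\<in>carrier G. conj_set G C g) = (\<Union>x\<in>X. cj x ` \<iota> ` C)"
proof -
  have "\<iota> ` (\<Union>g\<in>carrier G. conj_set G C g) = (\<Union>g\<in>carrier G. cj ((\<iota> g)\<^sup>-) ` \<iota> ` C)"
    unfolding image_UN using conj_set_cayley(1)[OF C] by (intro SUP_cong refl) blast
  also have "\<dots> = (\<Union>x\<in>(\<lambda>x. x\<^sup>-) ` X. cj x ` \<iota> ` C)" by simp
  also have "(\<lambda>x. x\<^sup>-) ` X = X"
  proof
    show "(\<lambda>x. x\<^sup>-) ` X \<subseteq> X" using sg_inv[OF sgX] by blast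
    show "X \<subseteq> (\<lambda>x. x\<^sup>-) ` X" using sg_inv[OF sgX] by (metis imageI inverse_inv subsetI)
  qed
  finally show ?thesis .
qed

lemma frobenius_cayley:
  assumes C: "C \<subseteq> carrier G" and K: "K \<subseteq> carrier G"
  shows "frobenius_group_with G K C \<longleftrightarrow> FP X (\<iota> ` C) \<and> \<iota> ` K = kern X (\<iota> ` C)"
proof -
  have conj: "(C \<inter> conj_set G C g = {\<one>}) \<longleftrightarrow> \<iota> ` C \<inter> cj ((\<iota> g)\<^sup>-) ` \<iota> ` C = {1}" if "g \<in> carrier G" for g
    using Int_cayley[OF C conj_set_cayley(2)[OF C that]] conj_set_cayley(1)[OF C that] by simp
  have "(\<forall>g\<in>carrier G - C. C \<inter> conj_set G C g = {\<one>}) \<longleftrightarrow> (\<forall>x\<in>X - \<iota> ` C. \<iota> ` C \<inter> cj x ` \<iota> ` C = {1})" if sC: "sg (\<iota> ` C)"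
  proof -
    have d: "X - \<iota> ` C = \<iota> ` (carrier G - C)" using inj_on_image_set_diff[OF inj_cayley _ C, of "carrier G"] by auto
    have "(\<forall>g\<in>carrier G - C. C \<inter> conj_set G C g = {\<one>}) \<longleftrightarrow> (\<forall>x\<in>X - \<iota> ` C. \<iota> ` C \<inter> cj (x\<^sup>-) ` \<iota> ` C = {1})"
      unfolding d using conj by auto
    also have "\<dots> \<longleftrightarrow> (\<forall>x\<in>X - \<iota> ` C. \<iota> ` C \<inter> cj x ` \<iota> ` C = {1})"
      using sg_inv_iff[OF sgX] sg_inv_iff[OF sC] by (metis Diff_iff inverse_inv)
    finally show ?thesis .
  qed
  moreover have "K = carrier G - (\<Union>g\<in>carrier G. conj_set G C g) \<union> {\<one>} \<longleftrightarrow> \<iota> ` K = kern X (\<iota> ` C)"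
  proof -
    let ?U = "\<Union>g\<in>carrier G. conj_set G C g"
    have U: "?U \<subseteq> carrier G" using conj_set_cayley(2)[OF C] by blast
    have "\<iota> ` (carrier G - ?U \<union> {\<one>}) = insert 1 (X - (\<Union>x\<in>X. cj x ` \<iota> ` C))"
      using inj_on_image_set_diff[OF inj_cayley _ U, of "carrier G"] conj_union_cayley[OF C] cayley_one by (simp add: image_Un)
    moreover have "carrier G - ?U \<union> {\<one>} \<subseteq> carrier G" by auto
    ultimately show ?thesis unfolding kern_def using image_eq_cayley[OF K] by metis
  qed
  moreover have "C = carrier G \<longleftrightarrow> \<iota> ` C = X" "C = {\<one>} \<longleftrightarrow> \<iota> ` C = {1}"
    using image_eq_cayley[OF C subset_refl] image_eq_cayley[OF C, of "{\<one>}"] cayley_one by auto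
  moreover have "\<iota> ` C \<subseteq> X" using C by blast
  ultimately show ?thesis
    unfolding frobenius_group_with_def FP_def using subgroup_cayley[OF C] sgX by argo
qed

lemma irreducible_cayley:
  assumes "P \<subseteq> carrier G" "K \<subseteq> carrier G" and sP: "sg (\<iota> ` P)"
  shows "acts_irreducibly G P K \<longleftrightarrow> \<iota> ` K \<noteq> {1} \<and>
    (\<forall>N. sg N \<longrightarrow> N \<subseteq> \<iota> ` K \<longrightarrow> (\<forall>a\<in>\<iota> ` P. cj a ` N = N) \<longrightarrow> N = {1} \<or> N = \<iota> ` K)"
proof -
  have inv: "(\<forall>a\<in>P. conj_set G N a = N) \<longleftrightarrow> (\<forall>a\<in>\<iota> ` P. cj a ` \<iota> ` N = \<iota> ` N)" if N: "N \<subseteq> carrier G" for N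
  proof -
    have "(\<forall>a\<in>P. conj_set G N a = N) \<longleftrightarrow> (\<forall>a\<in>P. cj ((\<iota> a)\<^sup>-) ` \<iota> ` N = \<iota> ` N)"
      using conj_set_cayley[OF N] image_eq_cayley[OF conj_set_cayley(2)[OF N] N] assms(1) by (metis subsetD)
    also have "\<dots> \<longleftrightarrow> (\<forall>a\<in>\<iota> ` P. cj (a\<^sup>-) ` \<iota> ` N = \<iota> ` N)" by simp
    also have "\<dots> \<longleftrightarrow> (\<forall>a\<in>\<iota> ` P. cj a ` \<iota> ` N = \<iota> ` N)" using sg_inv[OF sP] by (metis inverse_inv)
    finally show ?thesis .
  qed
  have "(\<forall>N. subgroup N G \<and> N \<subseteq> K \<and> (\<forall>a\<in>P. conj_set G N a = N) \<longrightarrow> N = {\<one>} \<or> N = K) \<longleftrightarrow>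
      (\<forall>N. sg N \<longrightarrow> N \<subseteq> \<iota> ` K \<longrightarrow> (\<forall>a\<in>\<iota> ` P. cj a ` N = N) \<longrightarrow> N = {1} \<or> N = \<iota> ` K)" (is "?L \<longleftrightarrow> ?R")
  proof
    assume L: ?L
    show ?R
    proof (intro allI impI)
      fix N assume N: "sg N" "N \<subseteq> \<iota> ` K" "\<forall>a\<in>\<iota> ` P. cj a ` N = N"
      obtain M where M: "M \<subseteq> K" "\<iota> ` M = N" using N(2) by (metis subset_imageE)
      have MG: "M \<subseteq> carrier G" using M(1) assms(2) by blast
      have "subgroup M G" "\<forall>a\<in>P. conj_set G M a = M"
        using subgroup_cayley[OF MG] inv[OF MG] N(1,3) unfolding M(2) by simp_all
      then have "M = {\<one>} \<or> M = K" using L[THEN spec, of M] M(1) by simp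
      then show "N = {1} \<or> N = \<iota> ` K" using M(2) cayley_one by auto
    qed
  next
    assume R: ?R
    show ?L
    proof (intro allI impI)
      fix N assume N: "subgroup N G \<and> N \<subseteq> K \<and> (\<forall>a\<in>P. conj_set G N a = N)"
      have NG: "N \<subseteq> carrier G" using N assms(2) by blast
      have "sg (\<iota> ` N)" "\<forall>a\<in>\<iota> ` P. cj a ` \<iota> ` N = \<iota> ` N" "\<iota> ` N \<subseteq> \<iota> ` K"
        using subgroup_cayley[OF NG] inv[OF NG] N by auto
      then have "\<iota> ` N = {1} \<or> \<iota> ` N = \<iota> ` K" using R[THEN spec, of "\<iota> ` N"] by simp
      then show "N = {\<one>} \<or> N = K"
        using image_eq_cayley[OF NG, of "{\<one>}"] image_eq_cayley[OF NG assms(2)] cayley_one by auto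
    qed
  qed
  moreover have "K = {\<one>} \<longleftrightarrow> \<iota> ` K = {1}" using image_eq_cayley[OF assms(2), of "{\<one>}"] cayley_one by auto
  ultimately show ?thesis unfolding acts_irreducibly_def by simp
qed

lemma sylow_cayley: "P \<subseteq> carrier G \<Longrightarrow> sylow_subgroup G p P \<longleftrightarrow> syl p X (\<iota> ` P)"
  unfolding sylow_subgroup_def syl_def using subgroup_cayley[of P] card_cayley[of P] card_cayley[of "carrier G"]
  by (auto simp: Coset.order_def)

lemma TI_or_sn_cayley:
  "TI_or_sn p X \<longleftrightarrow> (\<forall>S. subgroup S G \<and> \<not> nilpotent_group (G\<lparr>carrier := S\<rparr>) \<longrightarrow>
     TI_subgroup G S \<or> subnormal G S \<or> \<not> p dvd card S)"
proof -
  have eq: "(sg (\<iota> ` S) \<longrightarrow> \<not> nilp (\<iota> ` S) \<longrightarrow> p dvd card (\<iota> ` S) \<longrightarrow> TI X (\<iota> ` S) \<or> sn X (\<iota> ` S)) \<longleftrightarrow>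
      (subgroup S G \<and> \<not> nilpotent_group (G\<lparr>carrier := S\<rparr>) \<longrightarrow> TI_subgroup G S \<or> subnormal G S \<or> \<not> p dvd card S)"
    if "S \<subseteq> carrier G" for S
    using subgroup_cayley[OF that] nilpotent_cayley[of S] TI_cayley[of S] subnormal_cayley[of S] card_cayley[OF that] by metis
  have "TI_or_sn p X \<longleftrightarrow>
      (\<forall>S\<subseteq>carrier G. sg (\<iota> ` S) \<longrightarrow> \<not> nilp (\<iota> ` S) \<longrightarrow> p dvd card (\<iota> ` S) \<longrightarrow> TI X (\<iota> ` S) \<or> sn X (\<iota> ` S))"
    unfolding TI_or_sn_def using ex_preimage by (metis image_mono)
  then show ?thesis using eq subgroup.subset by metis
qed

lemma card_rec_iso: assumes "S \<subseteq> carrier G" "G\<lparr>carrier := S\<rparr> \<cong> integer_mod_group n" "n > 0" shows "card S = n"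
  using iso_same_card[OF assms(2)] assms(3) by (simp add: carrier_integer_mod_group)

section \<open>The two implications for an arbitrary finite group\<close>

lemma structure_of_TI_or_sn:
  assumes p: "Factorial_Ring.prime p" and hyp: "TI_or_sn p X"
    and S: "subgroup S G" "\<not> nilpotent_group (G\<lparr>carrier := S\<rparr>)" "p dvd card S" "\<not> subnormal G S"
  shows "p > 2 \<and>
           (\<exists>K P H C q r.
              Factorial_Ring.prime q \<and> q \<noteq> p \<and> r > 1 \<and>
              G\<lparr>carrier := K\<rparr> \<cong> elem_abelian_group q r \<and>
              G\<lparr>carrier := P\<rparr> \<cong> integer_mod_group p \<and>
              sylow_subgroup G p P \<and>
              subgroup H G \<and>
              int_semidirect G P H C \<and>
              int_semidirect G K C (carrier G) \<and>
              frobenius_group_with G K C \<and>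
              (cyclic_group (G\<lparr>carrier := H\<rparr>) \<or>
               (\<exists>Q Z. G\<lparr>carrier := Q\<rparr> \<cong> Q8_group \<and> cyclic_group (G\<lparr>carrier := Z\<rparr>) \<and>
                      odd (card Z) \<and> int_direct G Q Z H)) \<and>
              commutator_subgroup G P H \<noteq> {\<one>} \<and>
              acts_irreducibly G P K)"
proof -
  note SG = subgroup.subset[OF S(1)]
  have T: "sg (\<iota> ` S)" "\<iota> ` S \<subseteq> X" "\<not> nilp (\<iota> ` S)" "p dvd card (\<iota> ` S)" "\<not> sn X (\<iota> ` S)"
    using S subgroup_cayley[OF SG] nilpotent_cayley[OF S(1)] card_cayley[OF SG] subnormal_cayley[OF S(1)] SG by auto
  obtain M P H q where p2: "p > 2" and q: "Factorial_Ring.prime q" "q \<noteq> p"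
    and ker: "\<not> Factorial_Ring.prime (card (kern X M))" "kern X M \<noteq> {1}"
      "\<forall>x\<in>kern X M. x ^ q = 1 \<and> (\<forall>y\<in>kern X M. x * y = y * x)" "nml (kern X M) X"
    and M: "FP X M" "kern X M \<inter> M = {1}" "kern X M \<bullet> M = X"
    and P: "nml P M" "card P = p" "syl p X P"
    and H: "sg H" "H \<subseteq> M" "P \<inter> H = {1}" "P \<bullet> H = M" "\<exists>x\<in>P. \<exists>h\<in>H. x * h \<noteq> h * x"
    and alt: "(\<exists>g\<in>H. H = cyc g) \<or>
       (\<exists>u v g. u \<in> H \<and> v \<in> H \<and> g \<in> H \<and> u ^ 4 = 1 \<and> u ^ 2 \<noteq> 1 \<and> v ^ 2 = u ^ 2 \<and> v \<notin> cyc u \<and>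
          v * u = u ^ 2 * (u * v) \<and> nml (cyc u \<bullet> cyc v) H \<and> nml (cyc g) H \<and> odd (card (cyc g)) \<and>
          (cyc u \<bullet> cyc v) \<inter> cyc g = {1} \<and> (cyc u \<bullet> cyc v) \<bullet> cyc g = H)"
    and irr: "\<forall>N. sg N \<longrightarrow> N \<subseteq> kern X M \<longrightarrow> N \<noteq> {1} \<longrightarrow> (\<forall>a\<in>P. cj a ` N = N) \<longrightarrow> N = kern X M"
    using TI_or_sn_structure[OF sgX p hyp T] by (elim exE conjE) (rule that)
  have sub: "kern X M \<subseteq> X" "M \<subseteq> X" "P \<subseteq> X" "H \<subseteq> X"
    using kern_sub[OF sgX] FPD(3)[OF M(1)] sylD(2)[OF P(3)] H(2) by auto
  obtain K' where K': "K' \<subseteq> carrier G" "\<iota> ` K' = kern X M" using ex_preimage[OF sub(1)] by blast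
  obtain C' where C': "C' \<subseteq> carrier G" "\<iota> ` C' = M" using ex_preimage[OF sub(2)] by blast
  obtain P' where P': "P' \<subseteq> carrier G" "\<iota> ` P' = P" using ex_preimage[OF sub(3)] by blast
  obtain H' where H': "H' \<subseteq> carrier G" "\<iota> ` H' = H" using ex_preimage[OF sub(4)] by blast
  have sK: "subgroup K' G" using subgroup_cayley[OF K'(1)] K'(2) nmlD(1)[OF ker(4)] by simp
  have sP: "sg P" using sylD(1)[OF P(3)] .
  have sP': "subgroup P' G" using subgroup_cayley[OF P'(1)] P'(2) sP by simp
  have sH': "subgroup H' G" using subgroup_cayley[OF H'(1)] H'(2) H(1) by simp
  obtain r where r: "card (kern X M) = q ^ r" "rec (kern X M) \<cong> elem_abelian_group q r"
    using iso_rec_elem_abelian[OF nmlD(1)[OF ker(4)] q(1)] ker(3) by blast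
  \<comment> \<open>The rank exceeds 1 for two separate reasons: the kernel is non-trivial, and by
    \<open>K_not_prime\<close> its order is not a prime.\<close>
  have "r \<noteq> 0"
  proof
    assume "r = 0"
    then have "card (kern X M) = 1" using r(1) by simp
    then show False using ker(2) sg_one[OF nmlD(1)[OF ker(4)]] by (auto simp: card_1_singleton_iff)
  qed
  moreover have "r \<noteq> 1" using r(1) ker(1) q(1) by auto
  ultimately have r1: "r > 1" by simp
  have isoK: "G\<lparr>carrier := K'\<rparr> \<cong> elem_abelian_group q r" unfolding is_iso_cayley[OF sK] K'(2) by (rule r(2))
  have isoP: "G\<lparr>carrier := P'\<rparr> \<cong> integer_mod_group p"
  proof -
    obtain x where x: "x \<in> P" "x \<noteq> 1" using H(5) by (metis mult_1_left mult_1_right)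
    have "cyc x = P" using cyc_of_prime_card[OF sP p P(2) x] .
    then have "rec P \<cong> integer_mod_group p" using iso_rec_integer_mod_group[OF sP x(1)] P(2) by (simp add: od_def)
    then show ?thesis unfolding is_iso_cayley[OF sP'] P'(2) .
  qed
  have syl: "sylow_subgroup G p P'" using sylow_cayley[OF P'(1)] P'(2) P(3) by simp
  have sd: "int_semidirect G P' H' C'"
    using int_semidirect_cayley[OF P'(1) H'(1) C'(1)] FPD(2)[OF M(1)] H P(1) unfolding P'(2) H'(2) C'(2) by blast
  have sdK: "int_semidirect G K' C' (carrier G)"
    using int_semidirect_cayley[OF K'(1) C'(1) subset_refl] FPD(2)[OF M(1)] sgX M ker(4) sub(2) unfolding K'(2) C'(2) by blast
  have frob: "frobenius_group_with G K' C'" using frobenius_cayley[OF C'(1) K'(1)] M(1) unfolding K'(2) C'(2) by blast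
  \<comment> \<open>A trivial commutator subgroup would make all elements of \<open>P\<close> and
    \<open>H\<close> commute, against the pair supplied by the structure theorem.\<close>
  have cm: "commutator_subgroup G P' H' \<noteq> {\<one>}"
  proof
    assume "commutator_subgroup G P' H' = {\<one>}"
    then have one: "comm P H = {1}" using commutator_cayley(1)[OF P'(1) H'(1)] cayley_one unfolding P'(2) H'(2) by simp
    obtain x h where xh: "x \<in> P" "h \<in> H" "x * h \<noteq> h * x" using H(5) by blast
    have "cm x h \<in> comm P H" unfolding comm_def by (rule subsetD[OF gen_incl]) (use xh in blast)
    then show False using one xh(3) cm_eq_one_iff[of x h] by simp
  qed
  have irr': "acts_irreducibly G P' K'"
    using irreducible_cayley[OF P'(1) K'(1)] sP irr ker(2) unfolding P'(2) K'(2) by metis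
  have alt': "cyclic_group (G\<lparr>carrier := H'\<rparr>) \<or>
               (\<exists>Q Z. G\<lparr>carrier := Q\<rparr> \<cong> Q8_group \<and> cyclic_group (G\<lparr>carrier := Z\<rparr>) \<and>
                      odd (card Z) \<and> int_direct G Q Z H')"
    using alt
  proof
    assume "\<exists>g\<in>H. H = cyc g"
    then obtain g where g: "g \<in> H" "H = cyc g" by blast
    have "cyclic_group (rec H)" using cyclic_group_rec[OF H(1) g(1)] g(2) by simp
    then show ?thesis using cyclic_cayley[OF sH'] H'(2) by simp
  next
    assume "\<exists>u v g. u \<in> H \<and> v \<in> H \<and> g \<in> H \<and> u ^ 4 = 1 \<and> u ^ 2 \<noteq> 1 \<and> v ^ 2 = u ^ 2 \<and> v \<notin> cyc u \<and>
          v * u = u ^ 2 * (u * v) \<and> nml (cyc u \<bullet> cyc v) H \<and> nml (cyc g) H \<and> odd (card (cyc g)) \<and>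
          (cyc u \<bullet> cyc v) \<inter> cyc g = {1} \<and> (cyc u \<bullet> cyc v) \<bullet> cyc g = H"
    then obtain u v g where uvg: "u \<in> H" "v \<in> H" "g \<in> H" "u ^ 4 = 1" "u ^ 2 \<noteq> 1" "v ^ 2 = u ^ 2" "v \<notin> cyc u"
          "v * u = u ^ 2 * (u * v)" and n: "nml (cyc u \<bullet> cyc v) H" "nml (cyc g) H" "odd (card (cyc g))"
          "(cyc u \<bullet> cyc v) \<inter> cyc g = {1}" "(cyc u \<bullet> cyc v) \<bullet> cyc g = H" by blast
    have sub': "cyc u \<bullet> cyc v \<subseteq> X" "cyc g \<subseteq> X" using nmlD(3)[OF n(1)] nmlD(3)[OF n(2)] sub(4) by auto
    obtain Q where Q: "Q \<subseteq> carrier G" "\<iota> ` Q = cyc u \<bullet> cyc v" using ex_preimage[OF sub'(1)] by blast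
    obtain Z where Z: "Z \<subseteq> carrier G" "\<iota> ` Z = cyc g" using ex_preimage[OF sub'(2)] by blast
    have "subgroup Q G" using subgroup_cayley[OF Q(1)] Q(2) nmlD(1)[OF n(1)] by simp
    then have "G\<lparr>carrier := Q\<rparr> \<cong> Q8_group"
      unfolding is_iso_cayley[OF \<open>subgroup Q G\<close>] Q(2) by (intro iso_rec_Q8[OF H(1) uvg(1,2,4-8) nmlD(1)[OF n(1)]])
    moreover have "cyclic_group (G\<lparr>carrier := Z\<rparr>)"
      using cyclic_cayley[of Z] subgroup_cayley[OF Z(1)] Z(2) nmlD(1)[OF n(2)] cyclic_group_rec[OF H(1) uvg(3)] by simp
    moreover have "odd (card Z)" using n(3) card_cayley[OF Z(1)] Z(2) by simp
    moreover have "int_direct G Q Z H'"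
      using int_direct_cayley[OF Q(1) Z(1) H'(1)] n H(1) unfolding Q(2) Z(2) H'(2) by blast
    ultimately show ?thesis by blast
  qed
  have "Factorial_Ring.prime q \<and> q \<noteq> p \<and> r > 1 \<and> G\<lparr>carrier := K'\<rparr> \<cong> elem_abelian_group q r \<and>
      G\<lparr>carrier := P'\<rparr> \<cong> integer_mod_group p \<and> sylow_subgroup G p P' \<and> subgroup H' G \<and>
      int_semidirect G P' H' C' \<and> int_semidirect G K' C' (carrier G) \<and> frobenius_group_with G K' C' \<and>
      (cyclic_group (G\<lparr>carrier := H'\<rparr>) \<or>
        (\<exists>Q Z. G\<lparr>carrier := Q\<rparr> \<cong> Q8_group \<and> cyclic_group (G\<lparr>carrier := Z\<rparr>) \<and> odd (card Z) \<and> int_direct G Q Z H')) \<and>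
      commutator_subgroup G P' H' \<noteq> {\<one>} \<and> acts_irreducibly G P' K'"
    by (intro conjI q r1 isoK isoP syl sH' sd sdK frob alt' cm irr')
  with p2 show ?thesis by (intro conjI[OF p2] exI)
qed

lemma TI_or_sn_of_frobenius:
  assumes p: "Factorial_Ring.prime p" and isoP: "G\<lparr>carrier := P\<rparr> \<cong> integer_mod_group p"
    and syl: "sylow_subgroup G p P" and sd: "int_semidirect G P H C" and sdK: "int_semidirect G K C (carrier G)"
    and frob: "frobenius_group_with G K C"
    and alt: "cyclic_group (G\<lparr>carrier := H\<rparr>) \<or>
       (\<exists>Q Z. G\<lparr>carrier := Q\<rparr> \<cong> Q8_group \<and> cyclic_group (G\<lparr>carrier := Z\<rparr>) \<and>
              odd (card Z) \<and> int_direct G Q Z H)"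
    and irr: "acts_irreducibly G P K"
  shows "TI_or_sn p X"
proof -
  have cG: "P \<subseteq> carrier G" "C \<subseteq> carrier G" "H \<subseteq> carrier G"
    using sd subgroup.subset syl unfolding int_semidirect_def sylow_subgroup_def by blast+
  have "K \<lhd> G\<lparr>carrier := carrier G\<rparr>" using sdK by (simp add: int_semidirect_def)
  from subgroup.subset[OF normal_imp_subgroup[OF this]] have "K \<subseteq> carrier G" by simp
  note cG = cG this
  have sP: "subgroup P G" and sH: "subgroup H G"
    using syl sd by (auto simp: sylow_subgroup_def int_semidirect_def)
  have d: "sg (\<iota> ` C)" "sg (\<iota> ` H)" "nml (\<iota> ` P) (\<iota> ` C)" "\<iota> ` H \<subseteq> \<iota> ` C" "\<iota> ` P \<bullet> \<iota> ` H = \<iota> ` C"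
    using sd int_semidirect_cayley[OF cG(1,3,2)] by auto
  have dK: "nml (\<iota> ` K) X" "\<iota> ` C \<subseteq> X" "\<iota> ` K \<bullet> \<iota> ` C = X"
    using sdK int_semidirect_cayley[OF cG(4,2) subset_refl] by auto
  have cardP: "card (\<iota> ` P) = p"
    using card_rec_iso[OF cG(1) isoP] prime_gt_0_nat[OF p] card_cayley[OF cG(1)] by simp
  have FP: "FP X (\<iota> ` C)" using frob frobenius_cayley[OF cG(2,4)] by blast
  have abel: "x * y = y * x" if "cyclic_group (G\<lparr>carrier := Z\<rparr>)" "subgroup Z G" "x \<in> \<iota> ` Z" "y \<in> \<iota> ` Z" for Z x y
  proof -
    have "sg (\<iota> ` Z)" using subgroup_cayley[OF subgroup.subset[OF that(2)]] that(2) by blast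
    moreover have "cyclic_group (rec (\<iota> ` Z))" using cyclic_cayley[OF that(2)] that(1) by simp
    ultimately have "comm_group (rec (\<iota> ` Z))" using group.cyclic_imp_abelian_group[OF group_rec] by blast
    then show ?thesis using comm_groupE(4)[of "rec (\<iota> ` Z)" x y] that(3,4) by simp
  qed
  have ded: "cj h x \<in> cyc x" if xh: "x \<in> \<iota> ` H" "h \<in> \<iota> ` H" for x h
    using alt
  proof
    assume "cyclic_group (G\<lparr>carrier := H\<rparr>)"
    then have "h * x = x * h" using abel[OF _ sH xh(2,1)] by blast
    then have "cj h x = x" by (simp add: cj_def mult.assoc)
    then show ?thesis using sg_cyc[OF d(2) xh(1)] by simp
  next
    assume "\<exists>Q Z. G\<lparr>carrier := Q\<rparr> \<cong> Q8_group \<and> cyclic_group (G\<lparr>carrier := Z\<rparr>) \<and>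
              odd (card Z) \<and> int_direct G Q Z H"
    then obtain Q Z where QZ: "G\<lparr>carrier := Q\<rparr> \<cong> Q8_group" "cyclic_group (G\<lparr>carrier := Z\<rparr>)"
        "odd (card Z)" "int_direct G Q Z H" by blast
    have sub: "subgroup Q G" "subgroup Z G"
      using QZ(4) incl_subgroup[OF sH] normal_imp_subgroup unfolding int_direct_def by blast+
    note c = sub[THEN subgroup.subset]
    have n: "nml (\<iota> ` Q) (\<iota> ` H)" "nml (\<iota> ` Z) (\<iota> ` H)" "\<iota> ` Q \<inter> \<iota> ` Z = {1}" "\<iota> ` Q \<bullet> \<iota> ` Z = \<iota> ` H"
      using QZ(4) int_direct_cayley[OF c cG(3)] by auto
    show ?thesis
    proof (rule cyclic_or_quaternion_dedekind[OF n(1) _ n(2) _ _ n(3,4) xh])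
      show "rec (\<iota> ` Q) \<cong> Q8_group" using QZ(1) unfolding is_iso_cayley[OF sub(1)] .
      show "x * y = y * x" if "x \<in> \<iota> ` Z" "y \<in> \<iota> ` Z" for x y using abel[OF QZ(2) sub(2) that] .
      show "odd (card (\<iota> ` Z))" using QZ(3) card_cayley[OF c(2)] by simp
    qed
  qed
  have sP': "sg (\<iota> ` P)" using nmlD(1)[OF d(3)] .
  show ?thesis
  proof (rule TI_or_sn_of_structure[OF sgX p dK(1) d(1) dK(2,3) _ d(3) cardP _ d(2,4,5) ded])
    show "\<iota> ` C \<inter> cj g ` \<iota> ` C = {1}" if "g \<in> X - \<iota> ` C" for g using FP that by (simp add: FP_def)
    show "syl p X (\<iota> ` P)" using syl sylow_cayley[OF cG(1)] by simp
    show "N = {1} \<or> N = \<iota> ` K" if "sg N" "N \<subseteq> \<iota> ` K" "\<And>a. a \<in> \<iota> ` P \<Longrightarrow> cj a ` N = N" for N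
      using irr irreducible_cayley[OF cG(1,4) sP'] that by simp
  qed
qed

end

theorem theorem1p2:
  fixes G :: "('a, 'b) monoid_scheme" and p :: nat
  assumes "group G" and "finite (carrier G)"
    and "Factorial_Ring.prime p" and "p dvd order G"
  shows "(\<forall>S. subgroup S G \<and> \<not> nilpotent_group (G\<lparr>carrier := S\<rparr>) \<longrightarrow>
             TI_subgroup G S \<or> subnormal G S \<or> \<not> p dvd card S)
     \<longleftrightarrow>
         ((\<forall>S. subgroup S G \<and> \<not> nilpotent_group (G\<lparr>carrier := S\<rparr>) \<and> p dvd card S \<longrightarrow>
               subnormal G S)
        \<or> (p > 2 \<and>
           (\<exists>K P H C q r.
              Factorial_Ring.prime q \<and> q \<noteq> p \<and> r > 1 \<and>
              G\<lparr>carrier := K\<rparr> \<cong> elem_abelian_group q r \<and>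
              G\<lparr>carrier := P\<rparr> \<cong> integer_mod_group p \<and>
              sylow_subgroup G p P \<and>
              subgroup H G \<and>
              int_semidirect G P H C \<and>
              int_semidirect G K C (carrier G) \<and>
              frobenius_group_with G K C \<and>
              (cyclic_group (G\<lparr>carrier := H\<rparr>) \<or>
               (\<exists>Q Z. G\<lparr>carrier := Q\<rparr> \<cong> Q8_group \<and> cyclic_group (G\<lparr>carrier := Z\<rparr>) \<and>
                      odd (card Z) \<and> int_direct G Q Z H)) \<and>
              commutator_subgroup G P H \<noteq> {\<one>\<^bsub>G\<^esub>} \<and>
              acts_irreducibly G P K)))"
    (is "?L \<longleftrightarrow> ?A \<or> ?B")
proof -
  interpret cayley_embedding G
    using assms(1,2) by (simp add: cayley_embedding_def cayley_embedding_axioms_def)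
  show ?thesis
  proof
    assume L: ?L
    then have T: "TI_or_sn p X" unfolding TI_or_sn_cayley .
    show "?A \<or> ?B"
    proof (rule disjCI)
      assume nB: "\<not> ?B"
      show ?A
      proof (intro allI impI)
        fix S assume S: "subgroup S G \<and> \<not> nilpotent_group (G\<lparr>carrier := S\<rparr>) \<and> p dvd card S"
        show "subnormal G S"
        proof (rule ccontr)
          assume "\<not> subnormal G S"
          with S have "?B" by (intro structure_of_TI_or_sn[OF assms(3) T, of S]) simp_all
          with nB show False ..
        qed
      qed
    qed
  next
    assume "?A \<or> ?B"
    then show ?L
    proof
      assume ?A
      then show ?L by blast
    next
      assume B: ?B
      have "TI_or_sn p X" using B[THEN conjunct2] 
        by (elim exE conjE) (rule TI_or_sn_of_frobenius[OF assms(3)])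
      then show ?L unfolding TI_or_sn_cayley .
    qed
  qed
qed

end
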